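(* Let $n\ge 1$, let $d\ge 2$ be an even integer, let $P$ be a nonzero homogeneous harmonic polynomial of degree $d$ on $\mathbb{R}^n$, and let $T$ be the higher Riesz transform with kernel $P(x)/|x|^{n+d}$. Then there is a constant $C$ (depending only on $T$) such that $$T^{*}f(x)\le C\, M(Tf)(x),\qquad x\in\mathbb{R}^n,\quad f\in L^2(\mathbb{R}^n).$$
   Context: A smooth homogeneous convolution singular integral operator on $\mathbb{R}^n$ is an operator $Tf(x)=\lim_{\epsilon\to 0}T^{\epsilon}f(x)$, where $T^{\epsilon}f(x)=\int_{|y|>\epsilon} f(x-y)K(y)\,dy$ (the truncation at level $\epsilon$), with kernel $K(x)=\Omega(x)/|x|^n$, $\Omega$ real valued, homogeneous of degree $0$, with restriction to the unit sphere $S^{n-1}$ of class $C^\infty(S^{n-1})$ and $\int_{S^{n-1}}\Omega\,d\sigma=0$. The maximal singular integral is $T^{*}f(x)=\sup_{\epsilon>0}|T^{\epsilon}f(x)|$. A higher Riesz transform is such an operator with kernel $P(x)/|x|^{n+d}$, where $P$ is a homogeneous harmonic polynomial of degree $d\ge1$. $M$ denotes the Hardy–Littlewood maximal operator. *)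

theory Defs
  imports "HOL-Analysis.Analysis"
begin

definition partial_deriv :: "'n::finite \<Rightarrow> (real^'n \<Rightarrow> real) \<Rightarrow> real^'n \<Rightarrow> real" where
  "partial_deriv i f x = deriv (\<lambda>t. f (x + t *\<^sub>R axis i 1)) 0"

definition homogeneous_harmonic_poly :: "nat \<Rightarrow> (real^'n::finite \<Rightarrow> real) \<Rightarrow> bool" where
  "homogeneous_harmonic_poly d P \<longleftrightarrow>
     real_polynomial_function P \<and>
     (\<forall>t x. P (t *\<^sub>R x) = t ^ d * P x) \<and>
     (\<forall>x. (\<Sum>i\<in>UNIV. partial_deriv i (partial_deriv i P) x) = 0)"

definition riesz_kernel :: "nat \<Rightarrow> (real^'n::finite \<Rightarrow> real) \<Rightarrow> real^'n \<Rightarrow> real" where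
  "riesz_kernel d P y = P y / norm y ^ (CARD('n) + d)"

definition L2 :: "(real^'n::finite \<Rightarrow> complex) \<Rightarrow> bool" where
  "L2 f \<longleftrightarrow> f \<in> borel_measurable lebesgue \<and> integrable lebesgue (\<lambda>x. (norm (f x))\<^sup>2)"

definition trunc_op :: "(real^'n::finite \<Rightarrow> real) \<Rightarrow> real \<Rightarrow> (real^'n \<Rightarrow> complex) \<Rightarrow> real^'n \<Rightarrow> complex" where
  "trunc_op K e f x = (LINT y:{y. norm y > e}|lebesgue. complex_of_real (K y) * f (x - y))"

definition sing_op :: "(real^'n::finite \<Rightarrow> real) \<Rightarrow> (real^'n \<Rightarrow> complex) \<Rightarrow> real^'n \<Rightarrow> complex" where
  "sing_op K f x = Lim (at_right 0) (\<lambda>e. trunc_op K e f x)"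

definition max_sing_op :: "(real^'n::finite \<Rightarrow> real) \<Rightarrow> (real^'n \<Rightarrow> complex) \<Rightarrow> real^'n \<Rightarrow> ennreal" where
  "max_sing_op K f x = (SUP e\<in>{0<..}. ennreal (norm (trunc_op K e f x)))"

definition HL_max :: "(real^'n::finite \<Rightarrow> complex) \<Rightarrow> real^'n \<Rightarrow> ennreal" where
  "HL_max g x = (SUP r\<in>{0<..}. (\<integral>\<^sup>+ y \<in> ball x r. ennreal (norm (g y)) \<partial>lebesgue) / emeasure lebesgue (ball x r))"

end

theory Submission
  imports Defs
begin

text \<open>
  Write \<open>K = P / |y| ^ (n + d)\<close> with \<open>d = 2 N\<close>. There is a polynomial \<open>q\<close> of degree less than \<open>N\<close>
  such that \<open>b y = q (|y|\<^sup>2)\<close> on the closed unit ball, extended by zero, satisfies \<open>T b = K\<close> outside the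
  unit ball and \<open>T b = 0\<close> inside. Inside, the identity holds for every such \<open>q\<close>, because \<open>P\<close> is orthogonal
  on spheres to polynomials of degree less than \<open>d\<close>. Outside, the spherical means of \<open>K\<close> about \<open>x\<close> are
  polynomials of degree less than \<open>N\<close> in the squared radius, so it suffices to prescribe \<open>N\<close> moments of \<open>q\<close>;
  they also give \<open>b\<close> integral one.

  Since \<open>K\<close> is even, \<open>T\<close> is symmetric, and \<open>T b = K 1\<^bsub>|y| > 1\<^esub>\<close> turns the truncation into an average,
  \<open>T\<^sup>\<epsilon> f x = \<integral> b y * g (x - \<epsilon> y) dy\<close>, where \<open>g\<close> is the \<open>L\<^sup>2\<close> limit of the truncations of \<open>f\<close>. This limit exists by
  the Cotlar--Stein lemma. By Lebesgue's differentiation argument the averages converge to \<open>g\<close> almost everywhere,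
  whence \<open>T f = g\<close>, and as \<open>b\<close> is bounded with support in the unit ball they are dominated by the maximal function
  of \<open>g\<close>.
\<close>

section \<open>Polar coordinates\<close>

text \<open>Parity is what makes the potential work. On opposite rays the values of \<open>P\<close>
  agree, so the two radial integrals are added, and their logarithms combine into ln (1 - |x|^2),
  which is the same for all directions. For odd degree they would be subtracted, and the logarithms
  would stay. The identity for T b concerns a singular integral of a function that may jump across
  the unit sphere. It is approached through truncations of T at level \<delta>, which have the exact
  value wherever |x| differs from 1 by more than \<delta>. In the remaining shell they are O(log
  (1/\<delta>)), and the shell has measure O(\<delta>); so the identity holds in the sense of L^2
  limits, which is all that the duality argument uses. Pairing with a fixed function then gives the
  formula for the truncation of f at every x and \<epsilon>, not only almost everywhere. The
  exceptional set of T f is harmless because the maximal function only integrates T f. The L^2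
  theory avoids the Fourier transform: it rests on the mean value zero, the homogeneity and the L^1
  continuity of the dyadic pieces of K.\<close>

lemma nn_integral_lborel_affine:
  fixes f :: "'a::euclidean_space \<Rightarrow> ennreal"
  assumes [measurable]: "f \<in> borel_measurable borel" and c: "c \<noteq> 0"
  shows "(\<integral>\<^sup>+x. f x \<partial>lborel) = ennreal (\<bar>c\<bar> ^ DIM('a)) * (\<integral>\<^sup>+x. f (t + c *\<^sub>R x) \<partial>lborel)"
  by (subst lborel_affine[OF c, of t])
     (simp add: nn_integral_density nn_integral_distr nn_integral_cmult)

lemma integrable_lborel_affine:
  fixes f :: "'a::euclidean_space \<Rightarrow> 'b :: {banach, second_countable_topology}"
  assumes f: "integrable lborel f" and c: "c \<noteq> 0"
  shows "integrable lborel (\<lambda>x. f (t + c *\<^sub>R x))"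
  using f f[THEN borel_measurable_integrable] c unfolding integrable_iff_bounded
  by (subst (asm) nn_integral_lborel_affine[where c=c and t=t]) (auto simp: ennreal_mult_less_top)

lemma integrable_lborel_affine_iff:
  fixes f :: "'a::euclidean_space \<Rightarrow> 'b :: {banach, second_countable_topology}"
  assumes c: "c \<noteq> 0"
  shows "integrable lborel (\<lambda>x. f (t + c *\<^sub>R x)) \<longleftrightarrow> integrable lborel f"
  using assms integrable_lborel_affine[of f c t]
    integrable_lborel_affine[of "\<lambda>x. f (t + c *\<^sub>R x)" "1/c" "- (1/c) *\<^sub>R t"]
  by (auto simp: algebra_simps)

lemma integral_lborel_affine:
  fixes f :: "'a::euclidean_space \<Rightarrow> 'b :: {banach, second_countable_topology}"
  assumes c: "c \<noteq> 0"
  shows "(\<integral>x. f x \<partial>lborel) = \<bar>c\<bar> ^ DIM('a) *\<^sub>R (\<integral>x. f (t + c *\<^sub>R x) \<partial>lborel)"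
proof cases
  assume f[measurable]: "integrable lborel f"
  then show ?thesis
    using c f f[THEN borel_measurable_integrable] integrable_lborel_affine[OF f c, of t]
    by (subst lborel_affine[OF c, of t]) (simp add: integral_density integral_distr)
next
  assume "\<not> integrable lborel f"
  with c show ?thesis
    by (simp add: integrable_lborel_affine_iff not_integrable_integral_eq)
qed

lemma integral_lborel_reflect:
  fixes f :: "'a::euclidean_space \<Rightarrow> 'b :: {banach, second_countable_topology}"
  shows "(\<integral>y. f (x - y) \<partial>lborel) = (\<integral>y. f y \<partial>lborel)"
  using integral_lborel_affine[of "-1" f x] by simp

lemma integrable_lborel_reflect:
  fixes f :: "'a::euclidean_space \<Rightarrow> 'b :: {banach, second_countable_topology}"
  shows "integrable lborel (\<lambda>y. f (x - y)) \<longleftrightarrow> integrable lborel f"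
  using integrable_lborel_affine_iff[of "-1" f x] by simp

lemma nn_integral_lborel_reflect:
  fixes f :: "'a::euclidean_space \<Rightarrow> ennreal"
  assumes "f \<in> borel_measurable borel"
  shows "(\<integral>\<^sup>+y. f (x - y) \<partial>lborel) = (\<integral>\<^sup>+y. f y \<partial>lborel)"
  using nn_integral_lborel_affine[OF assms, of "-1" x] by simp

lemma integral_lborel_translate:
  fixes f :: "'a::euclidean_space \<Rightarrow> 'b :: {banach, second_countable_topology}"
  shows "(\<integral>y. f (x + y) \<partial>lborel) = (\<integral>y. f y \<partial>lborel)"
  using integral_lborel_affine[of 1 f x] by simp

lemma integrable_lborel_translate:
  fixes f :: "'a::euclidean_space \<Rightarrow> 'b :: {banach, second_countable_topology}"
  shows "integrable lborel (\<lambda>y. f (x + y)) \<longleftrightarrow> integrable lborel f"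
  using integrable_lborel_affine_iff[of 1 f x] by simp

lemma ball_borel_measurable [measurable]: "ball c r \<in> sets borel" "cball c r \<in> sets borel"
  for c :: "'a::euclidean_space"
  by auto

lemma AE_lborel_nonzero: "AE u in lborel. (u::'a::euclidean_space) \<noteq> 0"
  by (rule AE_I[where N="{0}"]) auto

text \<open>Multiplying by a^n turns this into a partition of unity over radii: the factor 1 that it
  provides introduces the radial variable in the polar formula.\<close>

lemma nn_integral_inverse_power_tail:
  assumes "n > 0" "0 < a"
  shows "(\<integral>\<^sup>+\<rho>. indicator {a<..} \<rho> * ennreal (real n / \<rho> ^ (n+1)) \<partial>lborel) = ennreal (1 / a ^ n)"
proof -
  have "(\<integral>\<^sup>+\<rho>. ennreal (real n / \<rho> ^ (n+1)) * indicator {a..} \<rho> \<partial>lborel) = ennreal (0 - (- 1 / a ^ n))"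
  proof (rule nn_integral_FTC_atLeast)
    fix x :: real assume "a \<le> x"
    then have x: "x > 0" using assms by simp
    show "((\<lambda>x. - 1 / x ^ n) has_real_derivative real n / x ^ (n+1)) (at x)"
    proof -
      obtain m where m: "n = Suc m" using assms(1) by (cases n) auto
      show ?thesis
        unfolding m using x power_minus_mult[of m x]
        by (cases "m = 0") (auto intro!: derivative_eq_intros simp: field_simps power_add)
    qed
    show "0 \<le> real n / x ^ (n+1)" using x by simp
  next
    show "((\<lambda>x::real. - 1 / x ^ n) \<longlongrightarrow> 0) at_top"
      using assms(1) by (intro tendsto_divide_0[OF tendsto_const] filterlim_at_top_imp_at_infinity
        filterlim_pow_at_top filterlim_ident)
  qed auto
  moreover have "(\<integral>\<^sup>+\<rho>. indicator {a<..} \<rho> * ennreal (real n / \<rho> ^ (n+1)) \<partial>lborel)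
     = (\<integral>\<^sup>+\<rho>. ennreal (real n / \<rho> ^ (n+1)) * indicator {a..} \<rho> \<partial>lborel)"
    by (rule nn_integral_cong_AE, rule AE_I[where N="{a}"]) (auto simp: indicator_def)
  ultimately show ?thesis by simp
qed

text \<open>Polar coordinates without surface measure: the direction is \<open>sgn u\<close> for \<open>u\<close> ranging over the unit ball.\<close>
definition polar_density :: "'a::euclidean_space itself \<Rightarrow> real \<Rightarrow> real" where
  "polar_density _ r = indicator {0<..} r * real DIM('a) * r ^ (DIM('a) - 1)"

lemma polar_density_nonneg [simp]: "0 \<le> polar_density TYPE('a::euclidean_space) r"
  by (auto simp: polar_density_def indicator_def)

lemma polar_density_measurable [measurable]: "polar_density TYPE('a::euclidean_space) \<in> borel_measurable borel"
  unfolding polar_density_def[abs_def] by measurable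

text \<open>Insert 1 = |y|^n times the integral of n / \<rho>^(n+1) over \<rho> > |y|, exchange the
  integrals and substitute y = \<rho> u; then u ranges over the unit ball, and rescaling \<rho> by
  |u| leaves only the direction of u. The proof runs through this backwards.\<close>

lemma nn_integral_polar:
  fixes f :: "'a::euclidean_space \<Rightarrow> ennreal"
  assumes [measurable]: "f \<in> borel_measurable borel"
  shows "(\<integral>\<^sup>+y. f y \<partial>lborel) =
    (\<integral>\<^sup>+u. indicator (ball 0 1) u * (\<integral>\<^sup>+r. ennreal (polar_density TYPE('a) r) * f (r *\<^sub>R sgn u) \<partial>lborel) \<partial>lborel)"
    (is "_ = ?R")
proof -
  let ?n = "DIM('a)"
  have n: "?n > 0" by simp
  define g where "g = (\<lambda>(u::'a) (\<rho>::real). indicator (ball 0 1) u *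
     (indicator {0<..} \<rho> * ennreal (real ?n * norm u ^ ?n * \<rho> ^ (?n - 1)) * f (\<rho> *\<^sub>R u)))"
  have [measurable]: "(\<lambda>x::'a\<times>real. f (snd x *\<^sub>R fst x)) \<in> borel_measurable (lborel \<Otimes>\<^sub>M lborel)"
    by measurable
  have gm[measurable]: "case_prod g \<in> borel_measurable (lborel \<Otimes>\<^sub>M lborel)"
    unfolding g_def split_beta' by measurable
  have "?R = (\<integral>\<^sup>+u. (\<integral>\<^sup>+\<rho>. g u \<rho> \<partial>lborel) \<partial>lborel)"
  proof (rule nn_integral_cong_AE, use AE_lborel_nonzero in eventually_elim)
    fix u :: 'a assume u: "u \<noteq> 0"
    have "(\<integral>\<^sup>+r. ennreal (polar_density TYPE('a) r) * f (r *\<^sub>R sgn u) \<partial>lborel)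
      = ennreal \<bar>norm u\<bar> * (\<integral>\<^sup>+r. ennreal (polar_density TYPE('a) (0 + norm u * r)) * f ((0 + norm u * r) *\<^sub>R sgn u) \<partial>lborel)"
      by (rule nn_integral_real_affine) (use u in auto)
    also have "\<dots> = (\<integral>\<^sup>+r. ennreal \<bar>norm u\<bar> * (ennreal (polar_density TYPE('a) (0 + norm u * r)) * f ((0 + norm u * r) *\<^sub>R sgn u)) \<partial>lborel)"
      by (rule nn_integral_cmult[symmetric]) simp
    also have "\<dots> = (\<integral>\<^sup>+\<rho>. indicator {0<..} \<rho> * ennreal (real ?n * norm u ^ ?n * \<rho> ^ (?n - 1)) * f (\<rho> *\<^sub>R u) \<partial>lborel)"
    proof (rule nn_integral_cong)
      fix r :: real
      have 1: "(norm u * r) *\<^sub>R sgn u = r *\<^sub>R u"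
        using u by (simp add: sgn_div_norm)
      have 2: "norm u * polar_density TYPE('a) (norm u * r) = indicator {0<..} r * (real ?n * norm u ^ ?n * r ^ (?n - 1))"
        using u by (auto simp: polar_density_def indicator_def zero_less_mult_iff power_mult_distrib power_eq_if[of "norm u" ?n])
      have "ennreal \<bar>norm u\<bar> * ennreal (polar_density TYPE('a) (norm u * r)) = ennreal (norm u * polar_density TYPE('a) (norm u * r))"
        by (simp add: ennreal_mult)
      also have "\<dots> = indicator {0<..} r * ennreal (real ?n * norm u ^ ?n * r ^ (?n - 1))"
        unfolding 2 by (auto simp: indicator_def)
      finally show "ennreal \<bar>norm u\<bar> * (ennreal (polar_density TYPE('a) (0 + norm u * r)) * f ((0 + norm u * r) *\<^sub>R sgn u))
        = indicator {0<..} r * ennreal (real ?n * norm u ^ ?n * r ^ (?n - 1)) * f (r *\<^sub>R u)"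
        by (simp add: 1 mult.assoc[symmetric])
    qed
    finally show "indicator (ball 0 1) u * (\<integral>\<^sup>+r. ennreal (polar_density TYPE('a) r) * f (r *\<^sub>R sgn u) \<partial>lborel) = (\<integral>\<^sup>+\<rho>. g u \<rho> \<partial>lborel)"
      unfolding g_def by (subst nn_integral_cmult) auto
  qed
  also have "\<dots> = (\<integral>\<^sup>+\<rho>. (\<integral>\<^sup>+u. g u \<rho> \<partial>lborel) \<partial>lborel)"
    by (rule lborel_pair.Fubini'[OF gm, symmetric])
  \<comment> \<open>The substitution u = y / \<rho> turns the condition |u| < 1 into |y| <
    \<rho>.\<close>
  also have "\<dots> = (\<integral>\<^sup>+\<rho>. (\<integral>\<^sup>+y. indicator {norm y<..} \<rho> * ennreal (real ?n / \<rho> ^ (?n+1)) * (ennreal (norm y ^ ?n) * f y) \<partial>lborel) \<partial>lborel)"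
  proof (rule nn_integral_cong)
    fix \<rho> :: real
    show "(\<integral>\<^sup>+u. g u \<rho> \<partial>lborel) = (\<integral>\<^sup>+y. indicator {norm y<..} \<rho> * ennreal (real ?n / \<rho> ^ (?n+1)) * (ennreal (norm y ^ ?n) * f y) \<partial>lborel)"
    proof (cases "\<rho> > 0")
      case False
      then have "\<not> norm y < \<rho>" for y :: 'a using norm_ge_zero[of y] by linarith
      then show ?thesis using False by (simp add: g_def)
    next
      case True
      have [measurable]: "g u \<in> borel_measurable borel" "(\<lambda>u. g u \<rho>) \<in> borel_measurable borel" for u
        unfolding g_def by auto
      have "(\<integral>\<^sup>+u. g u \<rho> \<partial>lborel) = ennreal (\<bar>1/\<rho>\<bar> ^ ?n) * (\<integral>\<^sup>+u. g (0 + (1/\<rho>) *\<^sub>R u) \<rho> \<partial>lborel)"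
        by (rule nn_integral_lborel_affine) (use True in auto)
      also have "\<dots> = (\<integral>\<^sup>+u. ennreal (\<bar>1/\<rho>\<bar> ^ ?n) * g (0 + (1/\<rho>) *\<^sub>R u) \<rho> \<partial>lborel)"
        by (rule nn_integral_cmult[symmetric]) measurable
      also have "\<dots> = (\<integral>\<^sup>+y. indicator {norm y<..} \<rho> * ennreal (real ?n / \<rho> ^ (?n+1)) * (ennreal (norm y ^ ?n) * f y) \<partial>lborel)"
      proof (rule nn_integral_cong)
        fix y :: 'a
        have e: "\<bar>1/\<rho>\<bar> ^ ?n * (real ?n * (norm y / \<rho>) ^ ?n * \<rho> ^ (?n - 1)) = real ?n / \<rho> ^ (?n+1) * norm y ^ ?n"
          using True n by (simp add: power_divide power_eq_if[of \<rho> ?n] field_simps)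
        have "ennreal (\<bar>1/\<rho>\<bar> ^ ?n) * ennreal (real ?n * (norm y / \<rho>) ^ ?n * \<rho> ^ (?n - 1)) = ennreal (real ?n / \<rho> ^ (?n+1)) * ennreal (norm y ^ ?n)"
          using True by (subst (1 2) ennreal_mult[symmetric]) (simp_all only: e, auto)
        then have e': "ennreal ((1/\<rho>) ^ ?n) * (ennreal (real ?n * (norm y / \<rho>) ^ ?n * \<rho> ^ (?n - 1)) * f y) = ennreal (real ?n / \<rho> ^ (?n+1)) * (ennreal (norm y ^ ?n) * f y)"
          using True by (simp add: mult.assoc[symmetric])
        show "ennreal (\<bar>1/\<rho>\<bar> ^ ?n) * g (0 + (1/\<rho>) *\<^sub>R y) \<rho> = indicator {norm y<..} \<rho> * ennreal (real ?n / \<rho> ^ (?n+1)) * (ennreal (norm y ^ ?n) * f y)"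
          using True e' unfolding g_def by (simp add: indicator_def field_simps split: if_splits)
      qed
      finally show ?thesis .
    qed
  qed
  also have "\<dots> = (\<integral>\<^sup>+y. (\<integral>\<^sup>+\<rho>. indicator {norm y<..} \<rho> * ennreal (real ?n / \<rho> ^ (?n+1)) * (ennreal (norm y ^ ?n) * f y) \<partial>lborel) \<partial>lborel)"
  proof (rule lborel_pair.Fubini'[symmetric])
    have [measurable]: "Measurable.pred (borel \<Otimes>\<^sub>M borel) (\<lambda>x::real\<times>'a. norm (snd x) < fst x)" by measurable
    have "(\<lambda>x::real\<times>'a. indicator {norm (snd x)<..} (fst x) :: ennreal) = (\<lambda>x. indicator {x. norm (snd x) < fst x} x)"
      by (auto simp: indicator_def fun_eq_iff)
    then have [measurable]: "(\<lambda>x::real\<times>'a. indicator {norm (snd x)<..} (fst x) :: ennreal) \<in> borel_measurable (borel \<Otimes>\<^sub>M borel)"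
      by (simp add: pred_def)
    show "(\<lambda>(\<rho>, y). indicator {norm y<..} \<rho> * ennreal (real ?n / \<rho> ^ (?n+1)) * (ennreal (norm y ^ ?n) * f y)) \<in> borel_measurable (lborel \<Otimes>\<^sub>M lborel)"
      unfolding split_beta' by measurable
  qed
  also have "\<dots> = (\<integral>\<^sup>+y. f y \<partial>lborel)"
  proof (rule nn_integral_cong_AE, use AE_lborel_nonzero in eventually_elim)
    fix y :: 'a assume y: "y \<noteq> 0"
    have "(\<integral>\<^sup>+\<rho>. indicator {norm y<..} \<rho> * ennreal (real ?n / \<rho> ^ (?n+1)) * (ennreal (norm y ^ ?n) * f y) \<partial>lborel)
      = (\<integral>\<^sup>+\<rho>. indicator {norm y<..} \<rho> * ennreal (real ?n / \<rho> ^ (?n+1)) \<partial>lborel) * (ennreal (norm y ^ ?n) * f y)"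
      by (rule nn_integral_multc) simp
    also have "\<dots> = f y"
      using y n by (subst nn_integral_inverse_power_tail) (simp_all add: ennreal_mult[symmetric] mult.assoc[symmetric])
    finally show "(\<integral>\<^sup>+\<rho>. indicator {norm y<..} \<rho> * ennreal (real ?n / \<rho> ^ (?n+1)) * (ennreal (norm y ^ ?n) * f y) \<partial>lborel) = f y" .
  qed
  finally show ?thesis by simp
qed

text \<open>Read as a push-forward of measures, the formula for nonnegative functions extends to
  signed integrands by change of variables and Fubini's theorem.\<close>

definition polar_measure :: "('a::euclidean_space \<times> real) measure" where
  "polar_measure = density (lborel \<Otimes>\<^sub>M lborel) (\<lambda>z. ennreal (indicator (ball 0 1) (fst z) * polar_density TYPE('a) (snd z)))"

lemma sgn_borel_measurable [measurable]: "(sgn :: 'a::euclidean_space \<Rightarrow> 'a) \<in> borel_measurable borel"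
  unfolding sgn_div_norm by measurable

lemma lborel_eq_distr_polar:
  "(lborel :: 'a::euclidean_space measure) = distr polar_measure borel (\<lambda>z. snd z *\<^sub>R sgn (fst z))"
proof (rule measure_eqI)
  fix A :: "'a set" assume "A \<in> sets lborel"
  then have A[measurable]: "A \<in> sets borel" by simp
  have sp: "sets (polar_measure :: ('a \<times> real) measure) = sets (lborel \<Otimes>\<^sub>M lborel)"
    by (simp add: polar_measure_def)
  have m[measurable]: "(\<lambda>z::'a\<times>real. snd z *\<^sub>R sgn (fst z)) \<in> (lborel \<Otimes>\<^sub>M lborel) \<rightarrow>\<^sub>M borel"
    by measurable
  then have m': "(\<lambda>z. snd z *\<^sub>R sgn (fst z)) \<in> (polar_measure :: ('a \<times> real) measure) \<rightarrow>\<^sub>M borel"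
    by (simp cong: measurable_cong_sets add: sp)
  have dm[measurable]: "(\<lambda>z::'a\<times>real. ennreal (indicator (ball 0 1) (fst z) * polar_density TYPE('a) (snd z))) \<in> borel_measurable (lborel \<Otimes>\<^sub>M lborel)"
    unfolding split_beta' by measurable
  have "emeasure lborel A = (\<integral>\<^sup>+y. indicator A y \<partial>lborel)"
    by simp
  also have "\<dots> = (\<integral>\<^sup>+u. indicator (ball 0 1) u * (\<integral>\<^sup>+r. ennreal (polar_density TYPE('a) r) * indicator A (r *\<^sub>R sgn u) \<partial>lborel) \<partial>lborel)"
    by (rule nn_integral_polar) simp
  also have "\<dots> = (\<integral>\<^sup>+u. (\<integral>\<^sup>+r. ennreal (indicator (ball 0 1) u * polar_density TYPE('a) r) * indicator A (r *\<^sub>R sgn u) \<partial>lborel) \<partial>lborel)"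
  proof (rule nn_integral_cong)
    fix u :: 'a
    show "indicator (ball 0 1) u * (\<integral>\<^sup>+r. ennreal (polar_density TYPE('a) r) * indicator A (r *\<^sub>R sgn u) \<partial>lborel)
      = (\<integral>\<^sup>+r. ennreal (indicator (ball 0 1) u * polar_density TYPE('a) r) * indicator A (r *\<^sub>R sgn u) \<partial>lborel)"
      by (cases "u \<in> ball 0 1") simp_all
  qed
  also have "\<dots> = (\<integral>\<^sup>+z. ennreal (indicator (ball 0 1) (fst z) * polar_density TYPE('a) (snd z)) * indicator A (snd z *\<^sub>R sgn (fst z)) \<partial>(lborel \<Otimes>\<^sub>M lborel))"
    by (subst lborel.nn_integral_fst[symmetric]) auto
  also have "\<dots> = (\<integral>\<^sup>+z. indicator A (snd z *\<^sub>R sgn (fst z)) \<partial>polar_measure)"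
    unfolding polar_measure_def by (subst nn_integral_density[OF dm]) (auto simp: split_beta')
  also have "\<dots> = (\<integral>\<^sup>+y. indicator A y \<partial>distr polar_measure borel (\<lambda>z. snd z *\<^sub>R sgn (fst z)))"
    by (subst nn_integral_distr[OF m']) auto
  finally show "emeasure lborel A = emeasure (distr polar_measure borel (\<lambda>z. snd z *\<^sub>R sgn (fst z))) A"
    by simp
qed simp

lemma
  fixes f :: "'a::euclidean_space \<Rightarrow> real"
  assumes f: "integrable lborel f"
  shows integrable_polar: "integrable (lborel \<Otimes>\<^sub>M lborel) (\<lambda>(u, r). indicator (ball 0 1) u * (polar_density TYPE('a) r * f (r *\<^sub>R sgn u)))"
    and integral_polar: "(\<integral>y. f y \<partial>lborel) =
      (\<integral>u. indicator (ball 0 1) u * (\<integral>r. polar_density TYPE('a) r * f (r *\<^sub>R sgn u) \<partial>lborel) \<partial>lborel)"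
proof -
  have [measurable]: "f \<in> borel_measurable borel" using borel_measurable_integrable[OF f] by simp
  have sp: "sets (polar_measure :: ('a \<times> real) measure) = sets (lborel \<Otimes>\<^sub>M lborel)"
    by (simp add: polar_measure_def)
  have m[measurable]: "(\<lambda>z::'a\<times>real. snd z *\<^sub>R sgn (fst z)) \<in> (lborel \<Otimes>\<^sub>M lborel) \<rightarrow>\<^sub>M borel"
    by measurable
  then have m': "(\<lambda>z. snd z *\<^sub>R sgn (fst z)) \<in> (polar_measure :: ('a \<times> real) measure) \<rightarrow>\<^sub>M borel"
    by (simp cong: measurable_cong_sets add: sp)
  have dm: "(\<lambda>z::'a\<times>real. indicator (ball 0 1) (fst z) * polar_density TYPE('a) (snd z)) \<in> borel_measurable (lborel \<Otimes>\<^sub>M lborel)"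
    unfolding split_beta' by measurable
  have fm: "(\<lambda>z::'a\<times>real. f (snd z *\<^sub>R sgn (fst z))) \<in> borel_measurable (lborel \<Otimes>\<^sub>M lborel)"
    by measurable
  have "integrable polar_measure (\<lambda>z. f (snd z *\<^sub>R sgn (fst z)))"
    by (rule integrable_distr[OF m']) (use f in \<open>simp add: lborel_eq_distr_polar[symmetric]\<close>)
  then have i: "integrable (lborel \<Otimes>\<^sub>M lborel) (\<lambda>z::'a\<times>real. (indicator (ball 0 1) (fst z) * polar_density TYPE('a) (snd z)) *\<^sub>R f (snd z *\<^sub>R sgn (fst z)))"
    unfolding polar_measure_def
    by (subst (asm) integrable_density) (use dm fm in auto)
  then show i': "integrable (lborel \<Otimes>\<^sub>M lborel) (\<lambda>(u, r). indicator (ball 0 1) u * (polar_density TYPE('a) r * f (r *\<^sub>R sgn u)))"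
    by (simp add: split_beta' mult.assoc)
  have "(\<integral>y. f y \<partial>lborel) = (\<integral>z. f (snd z *\<^sub>R sgn (fst z)) \<partial>polar_measure)"
    by (subst lborel_eq_distr_polar, rule integral_distr[OF m']) simp
  also have "\<dots> = (\<integral>z. (indicator (ball 0 1) (fst z) * polar_density TYPE('a) (snd z)) *\<^sub>R f (snd z *\<^sub>R sgn (fst z)) \<partial>(lborel \<Otimes>\<^sub>M lborel))"
    unfolding polar_measure_def
    by (subst integral_density) (use dm fm in auto)
  also have "\<dots> = (\<integral>z. (\<lambda>(u, r). indicator (ball 0 1) u * (polar_density TYPE('a) r * f (r *\<^sub>R sgn u))) z \<partial>(lborel \<Otimes>\<^sub>M lborel))"
    by (simp add: split_beta' mult.assoc)
  also have "\<dots> = (\<integral>u. (\<integral>r. indicator (ball 0 1) u * (polar_density TYPE('a) r * f (r *\<^sub>R sgn u)) \<partial>lborel) \<partial>lborel)"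
    using lborel_pair.integral_fst'[OF i'] by simp
  finally show "(\<integral>y. f y \<partial>lborel) =
      (\<integral>u. indicator (ball 0 1) u * (\<integral>r. polar_density TYPE('a) r * f (r *\<^sub>R sgn u) \<partial>lborel) \<partial>lborel)"
    by simp
qed

section \<open>Integration by parts on balls\<close>

lemma AE_lborel_norm_neq: "AE y in lborel. norm (y::'a::euclidean_space) \<noteq> R"
proof (rule AE_I[where N="sphere 0 R"])
  have "sphere (0::'a) R \<in> null_sets lebesgue"
    using negligible_sphere by (simp add: negligible_iff_null_sets)
  then show "emeasure lborel (sphere (0::'a) R) = 0"
    by (auto simp: null_sets_def)
qed auto

lemma integrable_continuous_on_compact_indicator:
  fixes f :: "'a::euclidean_space \<Rightarrow> real"
  assumes "compact S" "continuous_on S f"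
  shows "integrable lborel (\<lambda>y. indicator S y * f y)"
  using borel_integrable_compact[OF assms] by (simp add: indicator_def if_distrib if_distribR cong: if_cong)

text \<open>The weight \<open>R\<^sup>2 - (norm y)\<^sup>2\<close> vanishes on the boundary of the ball, so that integration by parts needs no surface integral.\<close>
lemma integral_partial_times_cap:
  fixes F F' :: "'a::euclidean_space \<Rightarrow> real" and e :: 'a
  assumes R: "0 < R" "R < R'"
    and D: "\<And>y. y \<in> ball 0 R' \<Longrightarrow> ((\<lambda>s. F (y + s *\<^sub>R e)) has_real_derivative F' y) (at 0)"
    and cF: "continuous_on (ball 0 R') F" and cF': "continuous_on (ball 0 R') F'"
  shows "(\<integral>y. indicator (cball 0 R) y * (F' y * (R\<^sup>2 - (norm y)\<^sup>2)) \<partial>lborel)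
       = 2 * (\<integral>y. indicator (cball 0 R) y * ((y \<bullet> e) * F y) \<partial>lborel)"
proof -
  define R1 where "R1 = (R + R') / 2"
  have R1: "R < R1" "R1 < R'" using R by (auto simp: R1_def)
  \<comment> \<open>Extended by zero, the weight is still locally Lipschitz, so its difference
    quotients stay bounded. This is where its vanishing on the sphere matters.\<close>
  define w :: "'a \<Rightarrow> real" where "w y = max 0 (R\<^sup>2 - (norm y)\<^sup>2)" for y
  define F0 where "F0 y = indicator (cball 0 R1) y * F y" for y
  \<comment> \<open>The steps tend to zero and are so short that points of the ball of radius
    \<open>R\<close> stay within radius \<open>R1\<close> when shifted; there \<open>F0\<close>
    coincides with \<open>F\<close>. Adding 1 to the norm covers e = 0.\<close>
  define s where "s k = min 1 ((R1 - R) / (norm e + 1)) / real (Suc k)" for k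
  have s_pos: "s k > 0" for k using R1 by (auto simp: s_def add_nonneg_pos)
  have s_le: "s k \<le> min 1 ((R1 - R) / (norm e + 1))" for k
  proof -
    have "0 \<le> min 1 ((R1 - R) / (norm e + 1))" using R1 by (simp add: add_nonneg_pos)
    then have "min 1 ((R1 - R) / (norm e + 1)) / real (Suc k) \<le> min 1 ((R1 - R) / (norm e + 1)) / 1"
      by (intro divide_left_mono) auto
    then show ?thesis unfolding s_def by simp
  qed
  then have s_le1: "s k \<le> 1" and s_e: "s k * norm e \<le> R1 - R" for k
  proof -
    show "s k \<le> 1" using s_le[of k] by simp
    have "s k * (norm e + 1) \<le> R1 - R" using s_le[of k] by (simp add: pos_le_divide_eq add_nonneg_pos)
    then show "s k * norm e \<le> R1 - R" using s_pos[of k] by (simp add: algebra_simps)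
  qed
  have s_lim: "s \<longlonglongrightarrow> 0"
    unfolding s_def using lim_const_over_n LIMSEQ_Suc by fastforce
  have sub1: "cball 0 R1 \<subseteq> ball 0 R'" using R1 by auto
  have sub0: "cball 0 R \<subseteq> ball 0 R'" using R by auto
  obtain M where M: "\<And>y. y \<in> cball 0 R1 \<Longrightarrow> \<bar>F' y\<bar> \<le> M"
    using compact_imp_bounded[OF compact_continuous_image[OF continuous_on_subset[OF cF' sub1] compact_cball]]
    unfolding bounded_iff by (metis imageI real_norm_def)
  have F0i: "integrable lborel F0"
    unfolding F0_def[abs_def]
    by (rule integrable_continuous_on_compact_indicator) (use continuous_on_subset[OF cF sub1] in auto)
  then have F0m[measurable]: "F0 \<in> borel_measurable borel" using borel_measurable_integrable by auto
  have wm[measurable]: "w \<in> borel_measurable borel" unfolding w_def[abs_def] by measurable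
  have w0: "0 \<le> w y" "w y \<le> R\<^sup>2" for y by (auto simp: w_def)
  have w_out: "w y = 0" if "norm y \<ge> R" for y
    using that R by (simp add: w_def power_mono)
  have w_in: "w y = R\<^sup>2 - (norm y)\<^sup>2" if "norm y \<le> R" for y
    using that by (simp add: w_def power_mono)
  have wbd: "\<bar>w y\<bar> \<le> R\<^sup>2" for y using w0[of y] by simp
  have F0w: "integrable lborel (\<lambda>y. F0 y * w (y - v))" for v
    by (rule Bochner_Integration.integrable_bound[where f="\<lambda>y. R\<^sup>2 * F0 y"])
       (use F0i wbd in \<open>auto intro!: AE_I2 mult_mono simp: abs_mult mult.commute\<close>)
  have F0w': "integrable lborel (\<lambda>y. F0 (y + v) * w y)" for v
    using integrable_lborel_translate[of "\<lambda>y. F0 (y + v) * w y" "-v"] F0w[of v] by simp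
  \<comment> \<open>\<open>A k\<close> has the difference quotient on \<open>F0\<close>,
    \<open>B k\<close> has it on the weight. Translation invariance makes them equal, and dominated
    convergence gives the two sides of the claim as their limits.\<close>
  define A where "A k = (\<integral>y. (F0 (y + s k *\<^sub>R e) - F0 y) / s k * w y \<partial>lborel)" for k
  define B where "B k = (\<integral>y. F0 y * ((w (y - s k *\<^sub>R e) - w y) / s k) \<partial>lborel)" for k
  have AB: "A k = B k" for k
  proof -
    have "(\<integral>y. F0 (y + s k *\<^sub>R e) * w y \<partial>lborel) = (\<integral>y. F0 y * w (y - s k *\<^sub>R e) \<partial>lborel)"
      using integral_lborel_translate[of "\<lambda>y. F0 (y + s k *\<^sub>R e) * w y" "- s k *\<^sub>R e"] by simp
    moreover have "A k = ((\<integral>y. F0 (y + s k *\<^sub>R e) * w y \<partial>lborel) - (\<integral>y. F0 y * w y \<partial>lborel)) / s k"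
    proof -
      have "A k = (\<integral>y. (F0 (y + s k *\<^sub>R e) * w y - F0 y * w y) / s k \<partial>lborel)"
        unfolding A_def by (rule Bochner_Integration.integral_cong) (auto simp: field_simps)
      then show ?thesis using F0w'[of "s k *\<^sub>R e"] F0w[of 0] by simp
    qed
    moreover have "B k = ((\<integral>y. F0 y * w (y - s k *\<^sub>R e) \<partial>lborel) - (\<integral>y. F0 y * w y \<partial>lborel)) / s k"
    proof -
      have "B k = (\<integral>y. (F0 y * w (y - s k *\<^sub>R e) - F0 y * w y) / s k \<partial>lborel)"
        unfolding B_def by (rule Bochner_Integration.integral_cong) (auto simp: field_simps)
      then show ?thesis using F0w[of "s k *\<^sub>R e"] F0w[of 0] by simp
    qed
    ultimately show ?thesis by simp
  qed
  have inball: "y + t *\<^sub>R e \<in> cball 0 R1" if "norm y \<le> R" "0 \<le> t" "t \<le> s k" for y t k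
  proof -
    have "norm (y + t *\<^sub>R e) \<le> norm y + t * norm e" using that by (metis norm_scaleR abs_of_nonneg norm_triangle_ineq)
    also have "t * norm e \<le> s k * norm e" using that by (simp add: mult_right_mono)
    finally show ?thesis using s_e[of k] that by simp
  qed
  have "A \<longlonglongrightarrow> (\<integral>y. indicator (cball 0 R) y * (F' y * w y) \<partial>lborel)"
    unfolding A_def
  proof (rule integral_dominated_convergence[where w="\<lambda>y. M * (indicator (cball 0 R) y * R\<^sup>2)"])
    have "(\<lambda>y. indicator (cball 0 R) y * (F' y * w y)) = (\<lambda>y. (indicator (cball 0 R) y * F' y) * w y)"
      by (auto simp: fun_eq_iff)
    moreover have "(\<lambda>y. indicator (cball 0 R) y * F' y) \<in> borel_measurable lborel"
      using borel_measurable_integrable[OF integrable_continuous_on_compact_indicator[OF compact_cball continuous_on_subset[OF cF' sub0]]] .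
    ultimately show "(\<lambda>y. indicator (cball 0 R) y * (F' y * w y)) \<in> borel_measurable lborel"
      by simp
    show "(\<lambda>y. (F0 (y + s k *\<^sub>R e) - F0 y) / s k * w y) \<in> borel_measurable lborel" for k
      by measurable
    show "integrable lborel (\<lambda>y. M * (indicator (cball (0::'a) R) y * R\<^sup>2))"
      using integrable_continuous_on_compact_indicator[of "cball (0::'a) R" "\<lambda>_. R\<^sup>2"] by (intro integrable_mult_right) auto
    show "AE y in lborel. (\<lambda>k. (F0 (y + s k *\<^sub>R e) - F0 y) / s k * w y) \<longlonglongrightarrow> indicator (cball 0 R) y * (F' y * w y)"
    proof (rule AE_I2)
      fix y :: 'a
      show "(\<lambda>k. (F0 (y + s k *\<^sub>R e) - F0 y) / s k * w y) \<longlonglongrightarrow> indicator (cball 0 R) y * (F' y * w y)"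
      proof (cases "norm y \<le> R")
        case False
        then show ?thesis using w_out[of y] by simp
      next
        case True
        have yk: "F0 (y + s k *\<^sub>R e) = F (y + s k *\<^sub>R e)" "F0 y = F y" for k
          using inball[OF True, of "s k" k] True R1 s_pos[of k] by (auto simp: F0_def)
        have "((\<lambda>h. (F (y + h *\<^sub>R e) - F y) / h) \<longlongrightarrow> F' y) (at 0)"
          using D[of y] True R unfolding DERIV_def by simp
        then have "(\<lambda>k. (F (y + s k *\<^sub>R e) - F y) / s k) \<longlonglongrightarrow> F' y"
          by (rule filterlim_compose) (use s_lim s_pos in \<open>auto simp: filterlim_at less_imp_neq[symmetric] intro!: always_eventually\<close>)
        from tendsto_mult_right[OF this, of "w y"] show ?thesis using True unfolding yk by simp
      qed
    qed
    show "AE y in lborel. norm ((F0 (y + s k *\<^sub>R e) - F0 y) / s k * w y) \<le> M * (indicator (cball 0 R) y * R\<^sup>2)" for k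
    proof (rule AE_I2)
      fix y :: 'a
      show "norm ((F0 (y + s k *\<^sub>R e) - F0 y) / s k * w y) \<le> M * (indicator (cball 0 R) y * R\<^sup>2)"
      proof (cases "norm y \<le> R")
        case False
        then show ?thesis using w_out[of y] by simp
      next
        case True
        have yk: "F0 (y + s k *\<^sub>R e) = F (y + s k *\<^sub>R e)" "F0 y = F y"
          using inball[OF True, of "s k" k] True R1 s_pos[of k] by (auto simp: F0_def)
        have der: "((\<lambda>t. F (y + t *\<^sub>R e)) has_real_derivative F' (y + t *\<^sub>R e)) (at t)" if "0 \<le> t" "t \<le> s k" for t
        proof -
          have "y + t *\<^sub>R e \<in> ball 0 R'" using inball[OF True that] sub1 by blast
          from D[OF this] have "((\<lambda>h. F (y + (t + h) *\<^sub>R e)) has_real_derivative F' (y + t *\<^sub>R e)) (at 0)"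
            by (simp add: algebra_simps)
          then show ?thesis using DERIV_shift[of "\<lambda>t. F (y + t *\<^sub>R e)" _ 0 t] by (simp add: add.commute)
        qed
        obtain z where z: "0 < z" "z < s k" "F (y + s k *\<^sub>R e) - F (y + 0 *\<^sub>R e) = (s k - 0) * F' (y + z *\<^sub>R e)"
          using MVT2[of 0 "s k" "\<lambda>t. F (y + t *\<^sub>R e)" "\<lambda>t. F' (y + t *\<^sub>R e)"] der s_pos[of k] by auto
        have "\<bar>F' (y + z *\<^sub>R e)\<bar> \<le> M" using M inball[OF True, of z k] z by simp
        moreover have "(F0 (y + s k *\<^sub>R e) - F0 y) / s k = F' (y + z *\<^sub>R e)"
          using z s_pos[of k] by (simp add: yk)
        ultimately show ?thesis using True wbd[of y] by (simp add: abs_mult mult_mono')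
      qed
    qed
  qed
  moreover have "B \<longlonglongrightarrow> (\<integral>y. F0 y * (indicator (cball 0 R) y * (2 * (y \<bullet> e))) \<partial>lborel)"
    unfolding B_def
  proof (rule integral_dominated_convergence[where w="\<lambda>y. \<bar>F0 y\<bar> * (2 * R1 * norm e + (norm e)\<^sup>2)"])
    show "(\<lambda>y. F0 y * (indicator (cball 0 R) y * (2 * (y \<bullet> e)))) \<in> borel_measurable lborel"
      "(\<lambda>y. F0 y * ((w (y - s k *\<^sub>R e) - w y) / s k)) \<in> borel_measurable lborel" for k
      by measurable
    show "integrable lborel (\<lambda>y. \<bar>F0 y\<bar> * (2 * R1 * norm e + (norm e)\<^sup>2))"
      using F0i by auto
    have expand: "(norm (y - t *\<^sub>R e))\<^sup>2 = (norm y)\<^sup>2 - 2 * t * (y \<bullet> e) + t\<^sup>2 * (norm e)\<^sup>2" for y t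
      unfolding power2_norm_eq_inner by (simp add: inner_simps inner_commute algebra_simps power2_eq_square)
    \<comment> \<open>Off the sphere of radius \<open>R\<close>, which is a null set, the weight is
      differentiable; on the sphere it has a kink.\<close>
    show "AE y in lborel. (\<lambda>k. F0 y * ((w (y - s k *\<^sub>R e) - w y) / s k)) \<longlonglongrightarrow> F0 y * (indicator (cball 0 R) y * (2 * (y \<bullet> e)))"
      using AE_lborel_norm_neq[of R]
    proof eventually_elim
      fix y :: 'a assume yR: "norm y \<noteq> R"
      have lim: "(\<lambda>k. norm (y - s k *\<^sub>R e)) \<longlonglongrightarrow> norm y"
        using s_lim by (auto intro!: tendsto_eq_intros)
      have "(\<lambda>k. (w (y - s k *\<^sub>R e) - w y) / s k) \<longlonglongrightarrow> indicator (cball 0 R) y * (2 * (y \<bullet> e))"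
      proof (cases "norm y < R")
        case True
        have "\<forall>\<^sub>F k in sequentially. norm (y - s k *\<^sub>R e) < R"
          using order_tendstoD(2)[OF lim True] .
        then have "\<forall>\<^sub>F k in sequentially. 2 * (y \<bullet> e) - s k * (norm e)\<^sup>2 = (w (y - s k *\<^sub>R e) - w y) / s k"
        proof eventually_elim
          case (elim k)
          have "w (y - s k *\<^sub>R e) - w y = s k * (2 * (y \<bullet> e) - s k * (norm e)\<^sup>2)"
            using w_in[of y] w_in[of "y - s k *\<^sub>R e"] True elim expand[of y "s k"]
            by (simp add: algebra_simps power2_eq_square)
          then show ?case using s_pos[of k] by simp
        qed
        moreover have "(\<lambda>k. 2 * (y \<bullet> e) - s k * (norm e)\<^sup>2) \<longlonglongrightarrow> 2 * (y \<bullet> e)"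
          using s_lim by (auto intro!: tendsto_eq_intros)
        ultimately show ?thesis using True by (auto intro: Lim_transform_eventually)
      next
        case False
        then have "R < norm y" using yR by simp
        from order_tendstoD(1)[OF lim this]
        have "\<forall>\<^sub>F k in sequentially. 0 = (w (y - s k *\<^sub>R e) - w y) / s k"
          by eventually_elim (use w_out[of y] w_out \<open>R < norm y\<close> in auto)
        then show ?thesis using \<open>R < norm y\<close> by (auto intro: Lim_transform_eventually)
      qed
      then show "(\<lambda>k. F0 y * ((w (y - s k *\<^sub>R e) - w y) / s k)) \<longlonglongrightarrow> F0 y * (indicator (cball 0 R) y * (2 * (y \<bullet> e)))"
        by (intro tendsto_mult) auto
    qed
    show "AE y in lborel. norm (F0 y * ((w (y - s k *\<^sub>R e) - w y) / s k)) \<le> \<bar>F0 y\<bar> * (2 * R1 * norm e + (norm e)\<^sup>2)" for k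
    proof (rule AE_I2)
      fix y :: 'a
      show "norm (F0 y * ((w (y - s k *\<^sub>R e) - w y) / s k)) \<le> \<bar>F0 y\<bar> * (2 * R1 * norm e + (norm e)\<^sup>2)"
      proof (cases "norm y \<le> R1")
        case False
        then show ?thesis by (simp add: F0_def)
      next
        case True
        have "\<bar>w (y - s k *\<^sub>R e) - w y\<bar> \<le> \<bar>(norm y)\<^sup>2 - (norm (y - s k *\<^sub>R e))\<^sup>2\<bar>"
          unfolding w_def by linarith
        also have "\<dots> = \<bar>s k * (2 * (y \<bullet> e) - s k * (norm e)\<^sup>2)\<bar>"
          unfolding expand by (simp add: algebra_simps power2_eq_square)
        also have "\<dots> = s k * \<bar>2 * (y \<bullet> e) - s k * (norm e)\<^sup>2\<bar>"
          using s_pos[of k] by (simp add: abs_mult)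
        also have "\<bar>2 * (y \<bullet> e) - s k * (norm e)\<^sup>2\<bar> \<le> 2 * \<bar>y \<bullet> e\<bar> + s k * (norm e)\<^sup>2"
          using abs_triangle_ineq4[of "2 * (y \<bullet> e)" "s k * (norm e)\<^sup>2"] s_pos[of k] by (simp add: abs_mult)
        also have "\<bar>y \<bullet> e\<bar> \<le> R1 * norm e"
          using Cauchy_Schwarz_ineq2[of y e] mult_right_mono[OF True, of "norm e"] by simp
        also have "s k * (norm e)\<^sup>2 \<le> (norm e)\<^sup>2" using s_le1[of k] mult_right_mono[of "s k" 1 "(norm e)\<^sup>2"] by simp
        finally have "\<bar>w (y - s k *\<^sub>R e) - w y\<bar> \<le> s k * (2 * (R1 * norm e) + (norm e)\<^sup>2)"
          using s_pos[of k] by simp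
        then have "\<bar>(w (y - s k *\<^sub>R e) - w y) / s k\<bar> \<le> 2 * R1 * norm e + (norm e)\<^sup>2"
          using s_pos[of k] by (simp add: pos_divide_le_eq mult.commute mult.left_commute)
        from mult_left_mono[OF this, of "\<bar>F0 y\<bar>"] show ?thesis by (simp add: abs_mult)
      qed
    qed
  qed
  ultimately have "(\<integral>y. indicator (cball 0 R) y * (F' y * w y) \<partial>lborel) = (\<integral>y. F0 y * (indicator (cball 0 R) y * (2 * (y \<bullet> e))) \<partial>lborel)"
    using LIMSEQ_unique[of B] unfolding ext[of A B, OF AB] by blast
  moreover have "(\<integral>y. indicator (cball 0 R) y * (F' y * w y) \<partial>lborel) = (\<integral>y. indicator (cball 0 R) y * (F' y * (R\<^sup>2 - (norm y)\<^sup>2)) \<partial>lborel)"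
    by (rule Bochner_Integration.integral_cong) (auto simp: w_in indicator_def)
  moreover have "(\<integral>y. F0 y * (indicator (cball 0 R) y * (2 * (y \<bullet> e))) \<partial>lborel) = (\<integral>y. 2 * (indicator (cball 0 R) y * ((y \<bullet> e) * F y)) \<partial>lborel)"
    by (rule Bochner_Integration.integral_cong) (use R1 in \<open>auto simp: F0_def indicator_def\<close>)
  ultimately show ?thesis by simp
qed

section \<open>Orthogonality of harmonic polynomials to polynomials of lower degree\<close>

text \<open>The partial derivatives are first obtained as unnamed polynomials, because
  \<open>partial_deriv\<close> is defined by \<open>deriv\<close>, whose value can be computed only
  after differentiability is known.\<close>

lemma polynomial_function_gradient:
  fixes p :: "real^'n::finite \<Rightarrow> real"
  assumes "real_polynomial_function p"
  shows "\<exists>D. (\<forall>i. real_polynomial_function (D i)) \<and> (\<forall>x. (p has_derivative (\<lambda>h. \<Sum>i\<in>UNIV. h $ i * D i x)) (at x))"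
  using assms
proof (induction p rule: real_polynomial_function.induct)
  case (linear f)
  have "f h = (\<Sum>i\<in>UNIV. h $ i * f (axis i 1))" for h
  proof -
    have "f h = f (\<Sum>i\<in>UNIV. (h $ i) *\<^sub>R axis i 1)"
      using basis_expansion[of h] by (simp add: scalar_mult_eq_scaleR)
    also have "\<dots> = (\<Sum>i\<in>UNIV. h $ i * f (axis i 1))"
      using bounded_linear.linear[OF linear] by (simp add: linear_sum linear_cmul)
    finally show ?thesis .
  qed
  then have eq: "f = (\<lambda>h. \<Sum>i\<in>UNIV. h $ i * f (axis i 1))" by (rule ext)
  have "(f has_derivative (\<lambda>h. \<Sum>i\<in>UNIV. h $ i * f (axis i 1))) (at x)" for x
    by (rule has_derivative_eq_rhs[OF bounded_linear_imp_has_derivative[OF linear] eq])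
  then show ?case by (intro exI[of _ "\<lambda>i x. f (axis i 1)"]) auto
next
  case (const c)
  show ?case by (intro exI[of _ "\<lambda>i x. 0"]) auto
next
  case (add f g)
  then obtain D E where "\<forall>i. real_polynomial_function (D i)" "\<forall>i. real_polynomial_function (E i)"
    "\<And>x. (f has_derivative (\<lambda>h. \<Sum>i\<in>UNIV. h $ i * D i x)) (at x)"
    "\<And>x. (g has_derivative (\<lambda>h. \<Sum>i\<in>UNIV. h $ i * E i x)) (at x)" by blast
  then show ?case
    by (intro exI[of _ "\<lambda>i x. D i x + E i x"])
       (auto intro!: derivative_eq_intros simp: sum.distrib algebra_simps fun_eq_iff)
next
  case (mult f g)
  then obtain D E where D: "\<forall>i. real_polynomial_function (D i)" "\<forall>i. real_polynomial_function (E i)"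
    and fg: "\<And>x. (f has_derivative (\<lambda>h. \<Sum>i\<in>UNIV. h $ i * D i x)) (at x)"
    "\<And>x. (g has_derivative (\<lambda>h. \<Sum>i\<in>UNIV. h $ i * E i x)) (at x)" by blast
  have "((\<lambda>x. f x * g x) has_derivative (\<lambda>h. \<Sum>i\<in>UNIV. h $ i * (f x * E i x + D i x * g x))) (at x)" for x
    using has_derivative_mult[OF fg(1)[of x] fg(2)[of x]]
    by (simp add: sum.distrib sum_distrib_left sum_distrib_right algebra_simps)
  moreover have "real_polynomial_function (\<lambda>x. f x * E i x + D i x * g x)" for i
    by (intro real_polynomial_function.intros(3,4)) (use D mult in auto)
  ultimately show ?case by (intro exI[of _ "\<lambda>i x. f x * E i x + D i x * g x"]) blast
qed

lemma has_derivative_line: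
  fixes p :: "'a::real_normed_vector \<Rightarrow> real"
  assumes "(p has_derivative L) (at y)"
  shows "((\<lambda>s. p (y + s *\<^sub>R e)) has_real_derivative L e) (at 0)"
proof -
  have l: "((\<lambda>s. y + s *\<^sub>R e) has_derivative (\<lambda>s. s *\<^sub>R e)) (at 0)"
    by (auto intro!: derivative_eq_intros)
  have "((p \<circ> (\<lambda>s. y + s *\<^sub>R e)) has_derivative (L \<circ> (\<lambda>s. s *\<^sub>R e))) (at 0)"
    by (rule diff_chain_at[OF l]) (use assms in simp)
  moreover have "L \<circ> (\<lambda>s. s *\<^sub>R e) = (*) (L e)"
    using has_derivative_linear[OF assms] by (auto simp: fun_eq_iff linear_cmul)
  ultimately show ?thesis by (simp add: has_field_derivative_def o_def)
qed

lemma partial_deriv_eqI: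
  fixes p :: "real^'n::finite \<Rightarrow> real"
  assumes "(p has_derivative L) (at x)"
  shows "partial_deriv i p x = L (axis i 1)"
  unfolding partial_deriv_def by (rule DERIV_imp_deriv[OF has_derivative_line[OF assms]])

lemma
  fixes p :: "real^'n::finite \<Rightarrow> real"
  assumes "real_polynomial_function p"
  shows polynomial_function_partial_deriv: "real_polynomial_function (partial_deriv i p)"
    and polynomial_function_has_derivative: "(p has_derivative (\<lambda>h. \<Sum>i\<in>UNIV. h $ i * partial_deriv i p x)) (at x)"
    and polynomial_function_line: "((\<lambda>s. p (x + s *\<^sub>R axis i 1)) has_real_derivative partial_deriv i p x) (at 0)"
proof -
  obtain D where D: "\<forall>i. real_polynomial_function (D i)"
     "\<And>x. (p has_derivative (\<lambda>h. \<Sum>i\<in>UNIV. h $ i * D i x)) (at x)"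
    using polynomial_function_gradient[OF assms] by blast
  have ax: "(\<Sum>j\<in>UNIV. axis i 1 $ j * D j x) = D i x" for i x
  proof -
    have "(\<Sum>j\<in>UNIV. axis i 1 $ j * D j x) = (\<Sum>j\<in>UNIV. if j = i then D j x else 0)"
      by (rule sum.cong) (auto simp: axis_def)
    then show ?thesis by simp
  qed
  have eq: "partial_deriv i p = D i" for i
    using partial_deriv_eqI[OF D(2)] by (auto simp: fun_eq_iff ax)
  show "real_polynomial_function (partial_deriv i p)" using D by (simp add: eq)
  show "(p has_derivative (\<lambda>h. \<Sum>i\<in>UNIV. h $ i * partial_deriv i p x)) (at x)" using D by (simp add: eq)
  show "((\<lambda>s. p (x + s *\<^sub>R axis i 1)) has_real_derivative partial_deriv i p x) (at 0)"
    using has_derivative_line[OF D(2), of x "axis i 1"] by (simp add: eq ax)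
qed

lemma polynomial_function_continuous_on:
  "real_polynomial_function p \<Longrightarrow> continuous_on S p" for p :: "'a::real_normed_vector \<Rightarrow> real"
  using continuous_on_polymonial_function real_polynomial_function_eq by blast

text \<open>The direction enters only through the first factor. If that factor is seen to vanish
  with one radial weight whose radial integral is nonzero, the integral vanishes for all admissible
  weights.\<close>

lemma integral_homogeneous_radial:
  fixes h :: "'a::euclidean_space \<Rightarrow> real"
  assumes i: "integrable lborel (\<lambda>y. \<phi> (norm y) * h y)"
    and h: "\<And>r z. r > 0 \<Longrightarrow> h (r *\<^sub>R z) = r ^ l * h z"
    and [measurable]: "h \<in> borel_measurable borel"
  shows "(\<integral>y. \<phi> (norm y) * h y \<partial>lborel)
    = (\<integral>u. indicator (ball 0 1) u * h (sgn u) \<partial>lborel) * (\<integral>r. polar_density TYPE('a) r * (\<phi> r * r ^ l) \<partial>lborel)"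
proof -
  have "(\<integral>y. \<phi> (norm y) * h y \<partial>lborel) = (\<integral>u. indicator (ball 0 1) u * (\<integral>r. polar_density TYPE('a) r * (\<phi> (norm (r *\<^sub>R sgn u)) * h (r *\<^sub>R sgn u)) \<partial>lborel) \<partial>lborel)"
    by (rule integral_polar[OF i])
  also have "\<dots> = (\<integral>u. indicator (ball 0 1) u * (h (sgn u) * (\<integral>r. polar_density TYPE('a) r * (\<phi> r * r ^ l) \<partial>lborel)) \<partial>lborel)"
  proof (rule integral_cong_AE)
    have "(\<integral>r. polar_density TYPE('a) r * (\<phi> (norm (r *\<^sub>R sgn u)) * h (r *\<^sub>R sgn u)) \<partial>lborel) = h (sgn u) * (\<integral>r. polar_density TYPE('a) r * (\<phi> r * r ^ l) \<partial>lborel)" if u: "u \<noteq> 0" for u :: 'a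
    proof -
      have "(\<integral>r. polar_density TYPE('a) r * (\<phi> (norm (r *\<^sub>R sgn u)) * h (r *\<^sub>R sgn u)) \<partial>lborel)
         = (\<integral>r. h (sgn u) * (polar_density TYPE('a) r * (\<phi> r * r ^ l)) \<partial>lborel)"
        using u h by (intro Bochner_Integration.integral_cong refl) (auto simp: polar_density_def indicator_def norm_sgn)
      then show ?thesis by simp
    qed
    note inner = this
    \<comment> \<open>At u = 0 the vector r \<open>sgn u\<close> has norm 0 and not r, so the
      equality is claimed only almost everywhere.\<close>
    show "AE u in lborel. indicator (ball 0 1) u * (\<integral>r. polar_density TYPE('a) r * (\<phi> (norm (r *\<^sub>R sgn u)) * h (r *\<^sub>R sgn u)) \<partial>lborel)
       = indicator (ball 0 1) u * (h (sgn u) * (\<integral>r. polar_density TYPE('a) r * (\<phi> r * r ^ l) \<partial>lborel))"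
      using AE_lborel_nonzero by eventually_elim (use inner in simp)
    show "(\<lambda>u. indicator (ball 0 1) u * (\<integral>r. polar_density TYPE('a) r * (\<phi> (norm (r *\<^sub>R sgn u)) * h (r *\<^sub>R sgn u)) \<partial>lborel)) \<in> borel_measurable lborel"
      using borel_measurable_integrable[OF lborel_pair.integrable_fst'[OF integrable_polar[OF i]]] by simp
  qed measurable
  also have "\<dots> = (\<integral>u. indicator (ball 0 1) u * h (sgn u) \<partial>lborel) * (\<integral>r. polar_density TYPE('a) r * (\<phi> r * r ^ l) \<partial>lborel)"
    unfolding mult.assoc[symmetric] by simp
  finally show ?thesis .
qed

lemma
  fixes f :: "real \<Rightarrow> real"
  assumes R: "0 \<le> R" and c: "continuous_on {0..R} f"
  shows integrable_polar_density_continuous: "integrable lborel (\<lambda>r. polar_density TYPE('a::euclidean_space) r * (indicator {..R} r * f r))"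
    and integral_polar_density_continuous: "(\<integral>r. polar_density TYPE('a) r * (indicator {..R} r * f r) \<partial>lborel) =
      (\<integral>r. indicator {0..R} r * (real DIM('a) * r ^ (DIM('a) - 1) * f r) \<partial>lborel)"
proof -
  have i: "integrable lborel (\<lambda>r. indicator {0..R} r * (real DIM('a) * r ^ (DIM('a) - 1) * f r))"
    by (rule integrable_continuous_on_compact_indicator) (auto intro!: continuous_intros c)
  have eq: "polar_density TYPE('a) r * (indicator {..R} r * f r) = indicator {0<..} r * (indicator {0..R} r * (real DIM('a) * r ^ (DIM('a) - 1) * f r))" for r
    by (auto simp: polar_density_def indicator_def)
  have ae: "AE r in lborel. indicator {0..R} r * (real DIM('a) * r ^ (DIM('a) - 1) * f r) = polar_density TYPE('a) r * (indicator {..R} r * f r)"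
    unfolding eq by (rule AE_I[where N="{0::real}"]) (auto simp: indicator_def)
  have m: "(\<lambda>r. polar_density TYPE('a) r * (indicator {..R} r * f r)) \<in> borel_measurable lborel"
    unfolding eq using borel_measurable_integrable[OF i] by measurable
  show "integrable lborel (\<lambda>r. polar_density TYPE('a) r * (indicator {..R} r * f r))"
    using integrable_cong_AE[OF borel_measurable_integrable[OF i] m ae] i by simp
  show "(\<integral>r. polar_density TYPE('a) r * (indicator {..R} r * f r) \<partial>lborel) =
      (\<integral>r. indicator {0..R} r * (real DIM('a) * r ^ (DIM('a) - 1) * f r) \<partial>lborel)"
    by (rule integral_cong_AE[OF m borel_measurable_integrable[OF i]]) (use ae in \<open>auto elim: eventually_mono\<close>)
qed

lemma integral_polar_density_power_upto:
  assumes "0 \<le> R"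
  shows "(\<integral>r. polar_density TYPE('a::euclidean_space) r * (indicator {..R} r * r ^ k) \<partial>lborel) = real DIM('a) * R ^ (DIM('a) + k) / real (DIM('a) + k)"
proof -
  let ?n = "DIM('a)"
  have n: "?n > 0" by simp
  have "(\<integral>r. polar_density TYPE('a) r * (indicator {..R} r * r ^ k) \<partial>lborel) = (\<integral>r. indicator {0..R} r * (real ?n * r ^ (?n - 1) * r ^ k) \<partial>lborel)"
    by (rule integral_polar_density_continuous[OF assms]) (auto intro!: continuous_intros)
  also have "\<dots> = (\<integral>r. real ?n * (r ^ (?n - 1 + k) * indicator {0..R} r) \<partial>lborel)"
    by (simp only: power_add mult_ac)
  also have "\<dots> = real ?n * (R ^ (?n - 1 + k + 1) / real (?n - 1 + k + 1))"
    using integral_power[of 0 R "?n - 1 + k"] assms by simp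
  also have "?n - 1 + k + 1 = ?n + k" using n by simp
  finally show ?thesis by simp
qed

section \<open>Moments of harmonic polynomials on spheres\<close>

locale harmonic_poly =
  fixes P :: "real^'n::finite \<Rightarrow> real" and d :: nat
  assumes hhp: "homogeneous_harmonic_poly d P"
begin

lemma P_poly: "real_polynomial_function P"
  using hhp by (simp add: homogeneous_harmonic_poly_def)

lemma P_scale: "P (t *\<^sub>R x) = t ^ d * P x"
  using hhp by (simp add: homogeneous_harmonic_poly_def)

lemma P_harmonic: "(\<Sum>i\<in>UNIV. partial_deriv i (partial_deriv i P) x) = 0"
  using hhp by (simp add: homogeneous_harmonic_poly_def)

lemma P_cont [continuous_intros]: "continuous_on S P"
  by (rule polynomial_function_continuous_on[OF P_poly])

lemma P_borel [measurable]: "P \<in> borel_measurable borel"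
  using P_cont[of UNIV] by (simp add: borel_measurable_continuous_onI)

lemma P_euler: "(\<Sum>i\<in>UNIV. y $ i * partial_deriv i P y) = real d * P y"
proof -
  have "((\<lambda>s. P (y + s *\<^sub>R y)) has_real_derivative (\<Sum>i\<in>UNIV. y $ i * partial_deriv i P y)) (at 0)"
    by (rule has_derivative_line[OF polynomial_function_has_derivative[OF P_poly]])
  moreover have "P (y + s *\<^sub>R y) = (1 + s) ^ d * P y" for s
    using P_scale[of "1 + s" y] by (simp add: scaleR_left_distrib)
  moreover have "((\<lambda>s. (1 + s) ^ d * P y) has_real_derivative real d * P y) (at 0)"
    by (auto intro!: derivative_eq_intros)
  ultimately show ?thesis using DERIV_unique by simp blast
qed

text \<open>The integrand depends on u only through its direction, so this is a positive multiple of
  the integral of P(\<theta>) (x . \<theta>)^m over the unit sphere.\<close>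

definition sphere_moment :: "nat \<Rightarrow> real^'n \<Rightarrow> real" where
  "sphere_moment m x = (\<integral>u. indicator (ball 0 1) u * (P (sgn u) * (x \<bullet> sgn u) ^ m) \<partial>lborel)"

lemma integral_radial_moment:
  assumes "integrable lborel (\<lambda>y. \<phi> (norm y) * (P y * (x \<bullet> y) ^ m))"
  shows "(\<integral>y. \<phi> (norm y) * (P y * (x \<bullet> y) ^ m) \<partial>lborel) =
    sphere_moment m x * (\<integral>r. polar_density TYPE(real^'n) r * (\<phi> r * r ^ (d + m)) \<partial>lborel)"
  unfolding sphere_moment_def
  by (rule integral_homogeneous_radial[OF assms]) (simp_all add: P_scale power_mult_distrib power_add)

text \<open>Green's formula for \<open>P y\<close> and \<open>(x \<bullet> y) ^ m\<close> with the weight \<open>1 - (norm y)\<^sup>2\<close>.\<close>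
lemma moment_recursion:
  "2 * (real m - real d) * (\<integral>y. indicator (cball 0 1) y * (P y * (x \<bullet> y) ^ m) \<partial>lborel)
   = real m * (real m - 1) * (norm x)\<^sup>2 *
     (\<integral>y. indicator (cball 0 1) y * (1 - (norm y)\<^sup>2) * (P y * (x \<bullet> y) ^ (m - 2)) \<partial>lborel)"
proof -
  let ?p = "\<lambda>i. partial_deriv i P" and ?q = "\<lambda>i. partial_deriv i (partial_deriv i P)"
  have pp: "real_polynomial_function (?p i)" "real_polynomial_function (?q i)" for i
    using polynomial_function_partial_deriv P_poly by auto
  note cont = polynomial_function_continuous_on[OF pp(1)] polynomial_function_continuous_on[OF pp(2)]
  have dG: "((\<lambda>s. (x \<bullet> (y + s *\<^sub>R axis i 1)) ^ k) has_real_derivative real k * (x \<bullet> y) ^ (k - 1) * x $ i) (at 0)" for i y k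
    by (auto intro!: derivative_eq_intros simp: inner_simps inner_axis)
  let ?I = "\<lambda>f. (\<integral>y. indicator (cball 0 1) y * f y \<partial>lborel)"
  let ?w = "\<lambda>y::real^'n. 1\<^sup>2 - (norm y)\<^sup>2"
  have int: "integrable lborel (\<lambda>y. indicator (cball 0 1) y * f y)" if "continuous_on (cball 0 1) f" for f :: "real^'n \<Rightarrow> real"
    by (rule integrable_continuous_on_compact_indicator) (use that in auto)
  \<comment> \<open>Integration by parts for G times the i-th derivative of P, where G y = (x .
    y)^m. In the sum over i the Laplacian of P drops out.\<close>
  have A: "?I (\<lambda>y. (real m * (x \<bullet> y) ^ (m - 1) * x $ i * ?p i y + (x \<bullet> y) ^ m * ?q i y) * ?w y)
     = 2 * ?I (\<lambda>y. (y \<bullet> axis i 1) * ((x \<bullet> y) ^ m * ?p i y))" for i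
  proof (rule integral_partial_times_cap[where R'=2])
    fix y
    show "((\<lambda>s. (x \<bullet> (y + s *\<^sub>R axis i 1)) ^ m * ?p i (y + s *\<^sub>R axis i 1)) has_real_derivative
      real m * (x \<bullet> y) ^ (m - 1) * x $ i * ?p i y + (x \<bullet> y) ^ m * ?q i y) (at 0)"
      using DERIV_mult[OF dG[of y i m] polynomial_function_line[OF pp(1), of i y i]] by (simp add: algebra_simps)
  qed (auto intro!: continuous_intros cont)
  \<comment> \<open>The same for P times the i-th derivative of G. Here the Laplacian of G survives
    and produces the moment of order m - 2.\<close>
  have B: "?I (\<lambda>y. (real m * x $ i * (real (m - 1) * (x \<bullet> y) ^ (m - 1 - 1) * x $ i * P y + (x \<bullet> y) ^ (m - 1) * ?p i y)) * ?w y)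
     = 2 * ?I (\<lambda>y. (y \<bullet> axis i 1) * (real m * x $ i * ((x \<bullet> y) ^ (m - 1) * P y)))" for i
  proof (rule integral_partial_times_cap[where R'=2])
    fix y
    show "((\<lambda>s. real m * x $ i * ((x \<bullet> (y + s *\<^sub>R axis i 1)) ^ (m - 1) * P (y + s *\<^sub>R axis i 1))) has_real_derivative
       real m * x $ i * (real (m - 1) * (x \<bullet> y) ^ (m - 1 - 1) * x $ i * P y + (x \<bullet> y) ^ (m - 1) * ?p i y)) (at 0)"
      using DERIV_cmult[OF DERIV_mult[OF dG[of y i "m - 1"] polynomial_function_line[OF P_poly, of y i]], of "real m * x $ i"] by (simp add: algebra_simps)
  qed (auto intro!: continuous_intros cont)
  \<comment> \<open>\<open>S\<close> is the weighted integral of grad P . grad G, which occurs in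
    both sums. By Euler's identity the right-hand sides are 2 d and 2 m times the moment;
    eliminating \<open>S\<close> leaves the recursion.\<close>
  define S where "S = ?I (\<lambda>y. real m * (x \<bullet> y) ^ (m - 1) * (\<Sum>i\<in>UNIV. x $ i * ?p i y) * ?w y)"
  have sumI: "(\<Sum>i\<in>UNIV. ?I (f i)) = ?I (\<lambda>y. \<Sum>i\<in>UNIV. f i y)" if "\<And>i. continuous_on (cball 0 1) (f i)" for f :: "'n \<Rightarrow> real^'n \<Rightarrow> real"
    using int[OF that] by (subst Bochner_Integration.integral_sum[symmetric]) (auto simp: sum_distrib_left simp del: sum_mult_indicator)
  have addI: "?I f + ?I g = ?I (\<lambda>y. f y + g y)" if "continuous_on (cball 0 1) f" "continuous_on (cball 0 1) g" for f g :: "real^'n \<Rightarrow> real"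
    using int[OF that(1)] int[OF that(2)] by (simp add: distrib_left)
  have "S = (\<Sum>i\<in>UNIV. ?I (\<lambda>y. (real m * (x \<bullet> y) ^ (m - 1) * x $ i * ?p i y + (x \<bullet> y) ^ m * ?q i y) * ?w y))"
  proof (subst sumI)
    show "S = ?I (\<lambda>y. \<Sum>i\<in>UNIV. (real m * (x \<bullet> y) ^ (m - 1) * x $ i * ?p i y + (x \<bullet> y) ^ m * ?q i y) * ?w y)"
      unfolding S_def
    proof (rule Bochner_Integration.integral_cong[OF refl])
      fix y
      have "(\<Sum>i\<in>UNIV. (real m * (x \<bullet> y) ^ (m - 1) * x $ i * ?p i y + (x \<bullet> y) ^ m * ?q i y) * ?w y)
        = (real m * (x \<bullet> y) ^ (m - 1) * (\<Sum>i\<in>UNIV. x $ i * ?p i y) + (x \<bullet> y) ^ m * (\<Sum>i\<in>UNIV. ?q i y)) * ?w y"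
        unfolding sum_distrib_right[symmetric] sum.distrib sum_distrib_left by (simp add: mult.assoc)
      then show "indicator (cball 0 1) y * (real m * (x \<bullet> y) ^ (m - 1) * (\<Sum>i\<in>UNIV. x $ i * ?p i y) * ?w y)
        = indicator (cball 0 1) y * (\<Sum>i\<in>UNIV. (real m * (x \<bullet> y) ^ (m - 1) * x $ i * ?p i y + (x \<bullet> y) ^ m * ?q i y) * ?w y)"
        by (simp add: P_harmonic)
    qed
  qed (auto intro!: continuous_intros cont)
  also have "\<dots> = 2 * (\<Sum>i\<in>UNIV. ?I (\<lambda>y. (y \<bullet> axis i 1) * ((x \<bullet> y) ^ m * ?p i y)))"
    unfolding A sum_distrib_left ..
  also have "\<dots> = 2 * ?I (\<lambda>y. real d * (P y * (x \<bullet> y) ^ m))"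
  proof (subst sumI)
    have "(\<Sum>i\<in>UNIV. (y \<bullet> axis i 1) * ((x \<bullet> y) ^ m * ?p i y)) = real d * (P y * (x \<bullet> y) ^ m)" for y
    proof -
      have "(\<Sum>i\<in>UNIV. (y \<bullet> axis i 1) * ((x \<bullet> y) ^ m * ?p i y)) = (x \<bullet> y) ^ m * (\<Sum>i\<in>UNIV. y $ i * ?p i y)"
        by (simp add: inner_axis sum_distrib_left algebra_simps)
      then show ?thesis by (simp add: P_euler)
    qed
    then show "2 * ?I (\<lambda>y. \<Sum>i\<in>UNIV. (y \<bullet> axis i 1) * ((x \<bullet> y) ^ m * ?p i y)) = 2 * ?I (\<lambda>y. real d * (P y * (x \<bullet> y) ^ m))"
      by simp
  qed (auto intro!: continuous_intros cont)
  finally have S1: "S = 2 * ?I (\<lambda>y. real d * (P y * (x \<bullet> y) ^ m))" .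
  define Q where "Q = ?I (\<lambda>y. real m * (real m - 1) * (norm x)\<^sup>2 * ((1 - (norm y)\<^sup>2) * (P y * (x \<bullet> y) ^ (m - 2))))"
  have "S + Q = ?I (\<lambda>y. real m * (x \<bullet> y) ^ (m - 1) * (\<Sum>i\<in>UNIV. x $ i * ?p i y) * ?w y + real m * (real m - 1) * (norm x)\<^sup>2 * ((1 - (norm y)\<^sup>2) * (P y * (x \<bullet> y) ^ (m - 2))))"
    unfolding S_def Q_def by (rule addI) (auto intro!: continuous_intros cont)
  also have "\<dots> = (\<Sum>i\<in>UNIV. ?I (\<lambda>y. (real m * x $ i * (real (m - 1) * (x \<bullet> y) ^ (m - 1 - 1) * x $ i * P y + (x \<bullet> y) ^ (m - 1) * ?p i y)) * ?w y))"
  proof (subst sumI)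
    have "real m * (x \<bullet> y) ^ (m - 1) * (\<Sum>i\<in>UNIV. x $ i * ?p i y) * ?w y + real m * (real m - 1) * (norm x)\<^sup>2 * ((1 - (norm y)\<^sup>2) * (P y * (x \<bullet> y) ^ (m - 2)))
       = (\<Sum>i\<in>UNIV. (real m * x $ i * (real (m - 1) * (x \<bullet> y) ^ (m - 1 - 1) * x $ i * P y + (x \<bullet> y) ^ (m - 1) * ?p i y)) * ?w y)" for y
    proof -
      have nx: "(norm x)\<^sup>2 = (\<Sum>i\<in>UNIV. x $ i * x $ i)"
        by (simp add: power2_norm_eq_inner inner_vec_def)
      \<comment> \<open>Truncated subtraction does no harm: for m = 0 both sides have the factor 0.
        For the same reason the exponent m - 2 may be cut off at m < 2.\<close>
      have m1: "real m * (real m - 1) = real m * real (m - 1)" by (cases m) auto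
      have m2: "m - 2 = m - 1 - 1" by simp
      have *: "(\<Sum>i\<in>UNIV. (a * x $ i * (b * x $ i * p + g * q i)) * W) = a * g * (\<Sum>i\<in>UNIV. x $ i * q i) * W + a * b * (\<Sum>i\<in>UNIV. x $ i * x $ i) * (W * p)"
        for a b p g W and q :: "'n \<Rightarrow> real"
        unfolding sum_distrib_right[symmetric] distrib_left sum.distrib sum_distrib_left by (simp add: algebra_simps sum_distrib_left)
      show ?thesis unfolding nx m1 m2 *[of "real m" "real (m - 1) * (x \<bullet> y) ^ (m - 1 - 1)"] by (simp add: algebra_simps)
    qed
    then show "?I (\<lambda>y. real m * (x \<bullet> y) ^ (m - 1) * (\<Sum>i\<in>UNIV. x $ i * ?p i y) * ?w y + real m * (real m - 1) * (norm x)\<^sup>2 * ((1 - (norm y)\<^sup>2) * (P y * (x \<bullet> y) ^ (m - 2))))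
      = ?I (\<lambda>y. \<Sum>i\<in>UNIV. (real m * x $ i * (real (m - 1) * (x \<bullet> y) ^ (m - 1 - 1) * x $ i * P y + (x \<bullet> y) ^ (m - 1) * ?p i y)) * ?w y)"
      by simp
  qed (auto intro!: continuous_intros cont)
  also have "\<dots> = 2 * (\<Sum>i\<in>UNIV. ?I (\<lambda>y. (y \<bullet> axis i 1) * (real m * x $ i * ((x \<bullet> y) ^ (m - 1) * P y))))"
    unfolding B sum_distrib_left ..
  also have "\<dots> = 2 * ?I (\<lambda>y. real m * (P y * (x \<bullet> y) ^ m))"
  proof (subst sumI)
    have "(\<Sum>i\<in>UNIV. (y \<bullet> axis i 1) * (real m * x $ i * ((x \<bullet> y) ^ (m - 1) * P y))) = real m * (P y * (x \<bullet> y) ^ m)" for y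
    proof -
      have "(\<Sum>i\<in>UNIV. (y \<bullet> axis i 1) * (real m * x $ i * ((x \<bullet> y) ^ (m - 1) * P y))) = real m * P y * (x \<bullet> y) ^ (m - 1) * (\<Sum>i\<in>UNIV. x $ i * y $ i)"
        by (simp add: inner_axis sum_distrib_left algebra_simps)
      also have "(\<Sum>i\<in>UNIV. x $ i * y $ i) = x \<bullet> y" by (simp add: inner_vec_def)
      finally show ?thesis by (cases m) auto
    qed
    then show "2 * ?I (\<lambda>y. \<Sum>i\<in>UNIV. (y \<bullet> axis i 1) * (real m * x $ i * ((x \<bullet> y) ^ (m - 1) * P y))) = 2 * ?I (\<lambda>y. real m * (P y * (x \<bullet> y) ^ m))"
      by simp
  qed (auto intro!: continuous_intros cont)
  finally have S2: "S + Q = 2 * ?I (\<lambda>y. real m * (P y * (x \<bullet> y) ^ m))" .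
  have Q: "Q = real m * (real m - 1) * (norm x)\<^sup>2 * ?I (\<lambda>y. (1 - (norm y)\<^sup>2) * (P y * (x \<bullet> y) ^ (m - 2)))"
    unfolding Q_def mult.left_commute[of "indicator _ _"] by simp
  have c: "?I (\<lambda>y. a * (P y * (x \<bullet> y) ^ m)) = a * ?I (\<lambda>y. P y * (x \<bullet> y) ^ m)" for a
    unfolding mult.left_commute[of "indicator _ _"] by simp
  show ?thesis using S1 S2 unfolding c Q by (simp add: algebra_simps)
qed

text \<open>For m < d the factor m - d in the recursion is nonzero, and its right-hand side vanishes
  for m < 2 because of the coefficient and otherwise by induction. The weight 1 - |y|^2 there causes
  no trouble, since every radial weight multiplies the same spherical moment.\<close>

lemma sphere_moment_zero: "m < d \<Longrightarrow> sphere_moment m x = 0"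
proof (induction m rule: less_induct)
  case (less m)
  have i: "integrable lborel (\<lambda>y. indicator (cball 0 1) y * f y)" if "continuous_on (cball 0 1) f" for f :: "real^'n \<Rightarrow> real"
    by (rule integrable_continuous_on_compact_indicator) (use that in auto)
  have ind: "indicator (cball 0 1) (y::real^'n) = (indicator {..1} (norm y) :: real)" for y
    by (auto simp: indicator_def)
  have "real m * (real m - 1) * (\<integral>y. indicator (cball 0 1) y * (1 - (norm y)\<^sup>2) * (P y * (x \<bullet> y) ^ (m - 2)) \<partial>lborel) = 0"
  proof (cases "m < 2")
    case True
    then have "m = 0 \<or> m = 1" by auto
    then show ?thesis by auto
  next
    case False
    have "(\<integral>y. (indicator {..1} (norm y) * (1 - (norm y)\<^sup>2)) * (P y * (x \<bullet> y) ^ (m - 2)) \<partial>lborel) = 0"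
      by (subst integral_radial_moment[where \<phi>="\<lambda>r. indicator {..1} r * (1 - r\<^sup>2)"])
         (use less.IH[of "m - 2"] less.prems False in \<open>auto simp: ind[symmetric] mult.assoc intro!: i continuous_intros\<close>)
    then show ?thesis by (simp add: ind)
  qed
  then have "2 * (real m - real d) * (\<integral>y. indicator (cball 0 1) y * (P y * (x \<bullet> y) ^ m) \<partial>lborel) = 0"
    unfolding moment_recursion by (simp only: mult_eq_0_iff) blast
  then have "(\<integral>y. indicator {..1} (norm y) * (P y * (x \<bullet> y) ^ m) \<partial>lborel) = 0"
    using less.prems by (simp add: ind)
  moreover have "(\<integral>y. indicator {..1} (norm y) * (P y * (x \<bullet> y) ^ m) \<partial>lborel) = sphere_moment m x * (real CARD('n) / real (CARD('n) + (d + m)))"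
    using integral_polar_density_power_upto[where 'a="real^'n", of 1 "d + m"]
    by (subst integral_radial_moment) (auto simp: ind[symmetric] intro!: i continuous_intros)
  ultimately have "sphere_moment m x * (real CARD('n) / real (CARD('n) + (d + m))) = 0" by simp
  moreover have "real CARD('n) / real (CARD('n) + (d + m)) > 0"
    by (intro divide_pos_pos) (auto simp: add_pos_nonneg)
  ultimately show ?case by (metis mult_eq_0_iff less_irrefl)
qed

end

section \<open>Spherical means of the kernel\<close>

text \<open>Without the origin, \<open>sgn u\<close> is a unit vector throughout, so identities on
  spheres hold pointwise.\<close>

abbreviation "pball \<equiv> ball 0 1 - {0}"

text \<open>With the directions integrated first, the inner integral is a spherical mean of fixed
  radius up to a factor, which is the quantity that Darboux's equation governs.\<close>

lemma integral_polar_swap: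
  fixes f :: "'a::euclidean_space \<Rightarrow> real"
  assumes f: "integrable lborel f"
  shows "(\<integral>y. f y \<partial>lborel) =
      (\<integral>r. polar_density TYPE('a) r * (\<integral>u. indicator pball u * f (r *\<^sub>R sgn u) \<partial>lborel) \<partial>lborel)"
proof -
  have fm[measurable]: "f \<in> borel_measurable borel" using borel_measurable_integrable[OF f] by simp
  have "(\<integral>y. f y \<partial>lborel) = (\<integral>u. (\<integral>r. indicator (ball 0 1) u * (polar_density TYPE('a) r * f (r *\<^sub>R sgn u)) \<partial>lborel) \<partial>lborel)"
    unfolding integral_polar[OF f] by simp
  also have "\<dots> = (\<integral>r. (\<integral>u. indicator (ball 0 1) u * (polar_density TYPE('a) r * f (r *\<^sub>R sgn u)) \<partial>lborel) \<partial>lborel)"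
    by (rule lborel_pair.Fubini_integral[symmetric]) (use integrable_polar[OF f] in simp)
  also have "\<dots> = (\<integral>r. polar_density TYPE('a) r * (\<integral>u. indicator pball u * f (r *\<^sub>R sgn u) \<partial>lborel) \<partial>lborel)"
  proof (rule Bochner_Integration.integral_cong[OF refl])
    fix r
    have "(\<integral>u. indicator (ball 0 1) u * (polar_density TYPE('a) r * f (r *\<^sub>R sgn u)) \<partial>lborel)
      = (\<integral>u. polar_density TYPE('a) r * (indicator pball u * f (r *\<^sub>R sgn u)) \<partial>lborel)"
    proof (rule integral_cong_AE)
      show "AE u in lborel. indicator (ball 0 1) u * (polar_density TYPE('a) r * f (r *\<^sub>R sgn u)) = polar_density TYPE('a) r * (indicator pball u * f (r *\<^sub>R sgn u))"
        using AE_lborel_nonzero by eventually_elim (auto simp: indicator_def)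
    qed measurable
    then show "(\<integral>u. indicator (ball 0 1) u * (polar_density TYPE('a) r * f (r *\<^sub>R sgn u)) \<partial>lborel)
      = polar_density TYPE('a) r * (\<integral>u. indicator pball u * f (r *\<^sub>R sgn u) \<partial>lborel)" by simp
  qed
  finally show ?thesis .
qed

lemma integral_radial_swap:
  fixes g :: "'a::euclidean_space \<Rightarrow> real"
  assumes f: "integrable lborel (\<lambda>y. \<phi> (norm y) * g y)"
  shows "(\<integral>y. \<phi> (norm y) * g y \<partial>lborel) =
      (\<integral>r. polar_density TYPE('a) r * (\<phi> r * (\<integral>u. indicator pball u * g (r *\<^sub>R sgn u) \<partial>lborel)) \<partial>lborel)"
  unfolding integral_polar_swap[OF f]
proof (rule Bochner_Integration.integral_cong[OF refl])
  fix r :: real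
  show "polar_density TYPE('a) r * (\<integral>u. indicator pball u * (\<phi> (norm (r *\<^sub>R sgn u)) * g (r *\<^sub>R sgn u)) \<partial>lborel)
     = polar_density TYPE('a) r * (\<phi> r * (\<integral>u. indicator pball u * g (r *\<^sub>R sgn u) \<partial>lborel))"
  proof (cases "r > 0")
    case True
    then have "(\<integral>u. indicator pball (u::'a) * (\<phi> (norm (r *\<^sub>R sgn u)) * g (r *\<^sub>R sgn u)) \<partial>lborel) = (\<integral>u. \<phi> r * (indicator pball u * g (r *\<^sub>R sgn u)) \<partial>lborel)"
      by (intro Bochner_Integration.integral_cong) (auto simp: indicator_def norm_sgn)
    then show ?thesis by simp
  next
    case False
    then show ?thesis by (simp add: polar_density_def)
  qed
qed

section \<open>Continuity and differentiation under the integral sign\<close>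

lemma continuous_on_integral_dominated:
  fixes f :: "'b::metric_space \<Rightarrow> 'a \<Rightarrow> real"
  assumes m: "\<And>t. t \<in> S \<Longrightarrow> f t \<in> borel_measurable M"
    and c: "\<And>x. continuous_on S (\<lambda>t. f t x)"
    and b: "\<And>t x. t \<in> S \<Longrightarrow> \<bar>f t x\<bar> \<le> w x" and w: "integrable M w"
  shows "continuous_on S (\<lambda>t. \<integral>x. f t x \<partial>M)"
  unfolding continuous_on_sequentially comp_def
proof (intro allI ballI impI)
  fix s a assume a: "a \<in> S" and s: "(\<forall>n. s n \<in> S) \<and> s \<longlonglongrightarrow> a"
  show "(\<lambda>n. \<integral>x. f (s n) x \<partial>M) \<longlonglongrightarrow> (\<integral>x. f a x \<partial>M)"
  proof (rule integral_dominated_convergence[OF _ _ w])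
    show "AE x in M. (\<lambda>n. f (s n) x) \<longlonglongrightarrow> f a x"
      using c s a unfolding continuous_on_sequentially comp_def by (intro AE_I2) blast
    show "AE x in M. norm (f (s n) x) \<le> w x" for n using b s by auto
  qed (use m a s in auto)
qed

text \<open>The mean value theorem turns the bound on \<open>f'\<close> into a bound for the
  difference quotients that does not depend on the step, as dominated convergence requires.\<close>

lemma has_real_derivative_integral:
  fixes f f' :: "real \<Rightarrow> 'a \<Rightarrow> real"
  assumes e: "e > 0"
    and i: "\<And>t. \<bar>t - t0\<bar> < e \<Longrightarrow> integrable M (f t)"
    and D: "\<And>t x. \<bar>t - t0\<bar> < e \<Longrightarrow> ((\<lambda>t. f t x) has_real_derivative f' t x) (at t)"
    and b: "\<And>t x. \<bar>t - t0\<bar> < e \<Longrightarrow> \<bar>f' t x\<bar> \<le> w x" and w: "integrable M w"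
    and m: "f' t0 \<in> borel_measurable M"
  shows "((\<lambda>t. \<integral>x. f t x \<partial>M) has_real_derivative (\<integral>x. f' t0 x \<partial>M)) (at t0)"
  unfolding DERIV_def tendsto_at_iff_sequentially comp_def
proof (intro allI impI)
  fix h :: "nat \<Rightarrow> real" assume h0: "\<forall>i. h i \<in> UNIV - {0}" and h: "h \<longlonglongrightarrow> 0"
  obtain N where N: "\<And>k. k \<ge> N \<Longrightarrow> \<bar>h k\<bar> < e"
    using LIMSEQ_D[OF h e] by auto
  have hN: "\<bar>h (k + N)\<bar> < e" "h (k + N) \<noteq> 0" for k using N[of "k + N"] h0 by auto
  have hl: "(\<lambda>k. h (k + N)) \<longlonglongrightarrow> 0" using h by (rule LIMSEQ_ignore_initial_segment)
  have "(\<lambda>k. \<integral>x. (f (t0 + h (k + N)) x - f t0 x) / h (k + N) \<partial>M) \<longlonglongrightarrow> (\<integral>x. f' t0 x \<partial>M)"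
  proof (rule integral_dominated_convergence[OF m _ w])
    show "(\<lambda>x. (f (t0 + h (k + N)) x - f t0 x) / h (k + N)) \<in> borel_measurable M" for k
      using i[of "t0 + h (k + N)"] i[of t0] hN[of k] e by (auto intro!: borel_measurable_divide borel_measurable_diff borel_measurable_integrable)
    show "AE x in M. (\<lambda>k. (f (t0 + h (k + N)) x - f t0 x) / h (k + N)) \<longlonglongrightarrow> f' t0 x"
    proof (rule AE_I2)
      fix x
      have "((\<lambda>h. (f (t0 + h) x - f t0 x) / h) \<longlongrightarrow> f' t0 x) (at 0)"
        using D[of t0 x] e unfolding DERIV_def by simp
      then show "(\<lambda>k. (f (t0 + h (k + N)) x - f t0 x) / h (k + N)) \<longlonglongrightarrow> f' t0 x"
        by (rule filterlim_compose) (use hl hN in \<open>auto simp: filterlim_at intro!: always_eventually\<close>)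
    qed
    show "AE x in M. norm ((f (t0 + h (k + N)) x - f t0 x) / h (k + N)) \<le> w x" for k
    proof (rule AE_I2)
      fix x
      let ?h = "h (k + N)"
      obtain z where z: "\<bar>z - t0\<bar> < e" "f (t0 + ?h) x - f t0 x = ?h * f' z x"
      proof (cases "?h > 0")
        case True
        have "\<exists>z. t0 < z \<and> z < t0 + ?h \<and> f (t0 + ?h) x - f t0 x = (t0 + ?h - t0) * f' z x"
          by (rule MVT2) (use True hN[of k] D in auto)
        then obtain z where "t0 < z" "z < t0 + ?h" "f (t0 + ?h) x - f t0 x = (t0 + ?h - t0) * f' z x" by blast
        then show ?thesis using that[of z] hN[of k] by auto
      next
        case False
        have "\<exists>z. t0 + ?h < z \<and> z < t0 \<and> f t0 x - f (t0 + ?h) x = (t0 - (t0 + ?h)) * f' z x"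
          by (rule MVT2) (use False hN[of k] D in auto)
        then obtain z where "t0 + ?h < z" "z < t0" "f t0 x - f (t0 + ?h) x = (t0 - (t0 + ?h)) * f' z x" by blast
        then show ?thesis using that[of z] hN[of k] by (auto simp: algebra_simps)
      qed
      have "(f (t0 + ?h) x - f t0 x) / ?h = f' z x" using z(2) hN[of k] by simp
      then show "norm ((f (t0 + ?h) x - f t0 x) / ?h) \<le> w x" using b[OF z(1)] by simp
    qed
  qed
  moreover have "(\<integral>x. (f (t0 + h (k + N)) x - f t0 x) / h (k + N) \<partial>M) = ((\<integral>x. f (t0 + h (k + N)) x \<partial>M) - (\<integral>x. f t0 x \<partial>M)) / h (k + N)" for k
    using i[of "t0 + h (k + N)"] i[of t0] hN[of k] e
    by (subst Bochner_Integration.integral_diff[symmetric]) (auto simp: integral_divide_zero)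
  ultimately have "(\<lambda>k. ((\<integral>x. f (t0 + h (k + N)) x \<partial>M) - (\<integral>x. f t0 x \<partial>M)) / h (k + N)) \<longlonglongrightarrow> (\<integral>x. f' t0 x \<partial>M)"
    by (simp only:)
  then show "(\<lambda>k. ((\<integral>x. f (t0 + h k) x \<partial>M) - (\<integral>x. f t0 x \<partial>M)) / h k) \<longlonglongrightarrow> (\<integral>x. f' t0 x \<partial>M)"
    by (rule LIMSEQ_offset)
qed

text \<open>\<open>h\<close> is the derivative of a primitive that vanishes identically. At R = b
  this derivative is one-sided, hence the derivative within the interval.\<close>

lemma continuous_eq_zero_if_integrals_zero:
  fixes h :: "real \<Rightarrow> real"
  assumes c: "continuous_on {0..b} h"
    and z: "\<And>R. 0 < R \<Longrightarrow> R \<le> b \<Longrightarrow> (\<integral>r. indicator {0..R} r * h r \<partial>lborel) = 0"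
    and R: "0 < R" "R \<le> b"
  shows "h R = 0"
proof -
  have eq: "integral {0..s} h = 0" if "0 \<le> s" "s \<le> b" for s
  proof (cases "s = 0")
    case False
    have c': "continuous_on {0..s} h" using c by (rule continuous_on_subset) (use that in auto)
    have "set_integrable lborel {0..s} h"
      using borel_integrable_compact[OF _ c'] unfolding set_integrable_def by (simp add: indicator_def if_distrib if_distribR cong: if_cong)
    from set_borel_integral_eq_integral(2)[OF this] show ?thesis
      using z[of s] that False by (simp add: set_lebesgue_integral_def)
  qed simp
  have "((\<lambda>s. integral {0..s} h) has_real_derivative h R) (at R within {0..b})"
    by (rule integral_has_real_derivative[OF c]) (use R in auto)
  moreover have "((\<lambda>s. integral {0..s} h) has_real_derivative 0) (at R within {0..b})"
    by (rule has_field_derivative_transform_within[where f="\<lambda>_. 0" and d=1]) (use eq R in auto)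
  moreover have "R \<in> {0..b} \<and> (0::real) < b" using R by auto
  ultimately show ?thesis
    using has_real_derivative_iff_has_vector_derivative vector_derivative_unique_within_closed_interval[of 0 b R "\<lambda>s. integral {0..s} h"]
    by (metis box_real(2) cbox_interval)
qed

section \<open>Derivatives of the homogeneous kernels\<close>

context harmonic_poly
begin

text \<open>The exponent is kept free because the Laplacian raises it by two: the spherical means
  are computed along the chain a, a + 2, a + 4, ... that starts at the kernel exponent n +
  d.\<close>

definition pker :: "nat \<Rightarrow> real^'n \<Rightarrow> real" where
  "pker a z = P z / norm z ^ a"

text \<open>\<open>gker a i\<close> and \<open>hker a i\<close> are the first and second partial derivatives of \<open>pker a\<close> in direction \<open>i\<close>.\<close>
definition gker :: "nat \<Rightarrow> 'n \<Rightarrow> real^'n \<Rightarrow> real" where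
  "gker a i z = partial_deriv i P z / norm z ^ a - real a * z $ i * P z / norm z ^ (a + 2)"

definition hker :: "nat \<Rightarrow> 'n \<Rightarrow> real^'n \<Rightarrow> real" where
  "hker a i z = partial_deriv i (partial_deriv i P) z / norm z ^ a - 2 * real a * (z $ i * partial_deriv i P z) / norm z ^ (a + 2)
     - real a * P z / norm z ^ (a + 2) + real a * (real a + 2) * (z $ i)\<^sup>2 * P z / norm z ^ (a + 4)"

lemma has_derivative_norm_power:
  assumes "z \<noteq> (0::real^'n)"
  shows "((\<lambda>z. 1 / norm z ^ a) has_derivative (\<lambda>h. - real a * (z \<bullet> h) / norm z ^ (a + 2))) (at z)"
proof -
  have nz: "norm z > 0" using assms by simp
  have "((\<lambda>z. 1 / norm z ^ a) has_derivative (\<lambda>h. - (real a * norm z ^ (a - 1) * (h \<bullet> sgn z)) / (norm z ^ a * norm z ^ a))) (at z)"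
    using has_derivative_norm[OF assms] assms by (auto intro!: derivative_eq_intros has_derivative_norm simp: fun_eq_iff field_simps inner_commute)
  moreover have "- (real a * norm z ^ (a - 1) * (h \<bullet> sgn z)) / (norm z ^ a * norm z ^ a) = - real a * (z \<bullet> h) / norm z ^ (a + 2)" for h
  proof (cases a)
    case (Suc b)
    have "h \<bullet> sgn z = (z \<bullet> h) / norm z" by (simp add: sgn_div_norm inner_commute divide_inverse)
    then show ?thesis unfolding Suc using nz by (simp add: divide_simps power_add) (simp add: algebra_simps)
  qed simp
  ultimately show ?thesis by simp
qed

lemma pker_has_derivative:
  assumes "z \<noteq> 0"
  shows "(pker a has_derivative (\<lambda>h. \<Sum>i\<in>UNIV. h $ i * gker a i z)) (at z)"
proof -
  have "((\<lambda>z. P z * (1 / norm z ^ a)) has_derivative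
     (\<lambda>h. P z * (- real a * (z \<bullet> h) / norm z ^ (a + 2)) + (\<Sum>i\<in>UNIV. h $ i * partial_deriv i P z) * (1 / norm z ^ a))) (at z)"
    by (rule has_derivative_mult[OF polynomial_function_has_derivative[OF P_poly] has_derivative_norm_power[OF assms]])
  moreover have "P z * (- real a * (z \<bullet> h) / norm z ^ (a + 2)) + (\<Sum>i\<in>UNIV. h $ i * partial_deriv i P z) * (1 / norm z ^ a) = (\<Sum>i\<in>UNIV. h $ i * gker a i z)" for h
  proof -
    have "z \<bullet> h = (\<Sum>i\<in>UNIV. h $ i * z $ i)" by (simp add: inner_vec_def mult.commute)
    then have "P z * (- real a * (z \<bullet> h) / norm z ^ (a + 2)) = (\<Sum>i\<in>UNIV. h $ i * (- (real a * z $ i * P z / norm z ^ (a + 2))))"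
      by (simp add: sum_distrib_left sum_distrib_right sum_divide_distrib sum_negf algebra_simps)
    moreover have "(\<Sum>i\<in>UNIV. h $ i * partial_deriv i P z) * (1 / norm z ^ a) = (\<Sum>i\<in>UNIV. h $ i * (partial_deriv i P z / norm z ^ a))"
      by (simp add: sum_divide_distrib)
    ultimately show ?thesis unfolding gker_def
      by (simp only: sum.distrib[symmetric] distrib_left[symmetric]) (simp add: algebra_simps)
  qed
  ultimately show ?thesis unfolding pker_def[abs_def] by simp
qed

lemma gker_line:
  assumes "z \<noteq> 0"
  shows "((\<lambda>s. gker a i (z + s *\<^sub>R axis i 1)) has_real_derivative hker a i z) (at 0)"
proof -
  have nz: "norm z > 0" using assms by simp
  have N: "((\<lambda>s. 1 / norm (z + s *\<^sub>R axis i 1) ^ b) has_real_derivative - real b * z $ i / norm z ^ (b + 2)) (at 0)" for b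
    using has_derivative_line[OF has_derivative_norm_power[OF assms, of b], of "axis i 1"] by (simp add: inner_axis)
  have p: "((\<lambda>s. P (z + s *\<^sub>R axis i 1)) has_real_derivative partial_deriv i P z) (at 0)"
    "((\<lambda>s. partial_deriv i P (z + s *\<^sub>R axis i 1)) has_real_derivative partial_deriv i (partial_deriv i P) z) (at 0)"
    using polynomial_function_line P_poly polynomial_function_partial_deriv by blast+
  have zi: "((\<lambda>s. (z + s *\<^sub>R axis i 1) $ i) has_real_derivative 1) (at 0)"
    by (auto intro!: derivative_eq_intros)
  have "((\<lambda>s. partial_deriv i P (z + s *\<^sub>R axis i 1) * (1 / norm (z + s *\<^sub>R axis i 1) ^ a)
        - real a * ((z + s *\<^sub>R axis i 1) $ i * P (z + s *\<^sub>R axis i 1)) * (1 / norm (z + s *\<^sub>R axis i 1) ^ (a + 2)))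
     has_real_derivative (partial_deriv i (partial_deriv i P) z * (1 / norm z ^ a) + (- real a * z $ i / norm z ^ (a + 2)) * partial_deriv i P z)
       - ((real a * (1 * P z + partial_deriv i P z * z $ i)) * (1 / norm z ^ (a + 2)) + (- real (a + 2) * z $ i / norm z ^ (a + 2 + 2)) * (real a * (z $ i * P z)))) (at 0)"
    by (intro DERIV_diff DERIV_cong[OF DERIV_mult[OF p(2) N[of a]]] DERIV_cong[OF DERIV_mult[OF DERIV_cmult[OF DERIV_mult[OF zi p(1)]] N[of "a + 2"]]]) simp_all
  moreover have "(partial_deriv i (partial_deriv i P) z * (1 / norm z ^ a) + (- real a * z $ i / norm z ^ (a + 2)) * partial_deriv i P z)
       - ((real a * (1 * P z + partial_deriv i P z * z $ i)) * (1 / norm z ^ (a + 2)) + (- real (a + 2) * z $ i / norm z ^ (a + 2 + 2)) * (real a * (z $ i * P z))) = hker a i z"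
  proof -
    have e: "a + 2 + 2 = a + 4" by simp
    show ?thesis unfolding hker_def e
      by (simp add: diff_divide_distrib add_divide_distrib algebra_simps power2_eq_square)
  qed
  ultimately show ?thesis unfolding gker_def by (simp add: mult.assoc)
qed

text \<open>The Laplacian of P drops out and Euler's identity evaluates the cross term, so three
  multiples of P / |z|^(a+2) remain, with coefficients - 2 a d, - n a and a (a + 2).\<close>

lemma sum_hker:
  assumes "z \<noteq> 0"
  shows "(\<Sum>i\<in>UNIV. hker a i z) = real a * (real a + 2 - real CARD('n) - 2 * real d) * pker (a + 2) z"
proof -
  have nz: "norm z > 0" using assms by simp
  have n2: "(\<Sum>i\<in>UNIV. (z $ i)\<^sup>2) = (norm z)\<^sup>2"
    unfolding power2_norm_eq_inner inner_vec_def by (simp add: power2_eq_square)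
  have "(\<Sum>i\<in>UNIV. hker a i z) = (\<Sum>i\<in>UNIV. partial_deriv i (partial_deriv i P) z) / norm z ^ a
     - 2 * real a * (\<Sum>i\<in>UNIV. z $ i * partial_deriv i P z) / norm z ^ (a + 2)
     - real CARD('n) * (real a * P z / norm z ^ (a + 2)) + real a * (real a + 2) * (\<Sum>i\<in>UNIV. (z $ i)\<^sup>2) * P z / norm z ^ (a + 4)"
    unfolding hker_def by (simp add: sum.distrib sum_subtractf sum_divide_distrib sum_distrib_left sum_distrib_right)
  also have "\<dots> = - 2 * real a * (real d * P z) / norm z ^ (a + 2) - real CARD('n) * (real a * P z / norm z ^ (a + 2))
      + real a * (real a + 2) * P z * ((norm z)\<^sup>2 / norm z ^ (a + 4))"
    unfolding P_harmonic P_euler n2 by simp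
  also have "(norm z)\<^sup>2 / norm z ^ (a + 4) = 1 / norm z ^ (a + 2)"
  proof -
    have "norm z ^ (a + 4) = (norm z)\<^sup>2 * norm z ^ (a + 2)"
      by (simp add: power_add[symmetric] numeral_eq_Suc)
    then show ?thesis using nz by simp
  qed
  finally show ?thesis unfolding pker_def by (simp add: algebra_simps add_divide_distrib diff_divide_distrib)
qed

lemma kers_continuous:
  assumes "0 \<notin> S"
  shows "continuous_on S (pker a)" "continuous_on S (gker a i)" "continuous_on S (hker a i)"
  using assms unfolding pker_def[abs_def] gker_def[abs_def] hker_def[abs_def]
  by (auto intro!: continuous_intros polynomial_function_continuous_on[OF polynomial_function_partial_deriv[OF P_poly]]
    polynomial_function_continuous_on[OF polynomial_function_partial_deriv[OF polynomial_function_partial_deriv[OF P_poly]]])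

lemma kers_borel [measurable]:
  "pker a \<in> borel_measurable borel" "gker a i \<in> borel_measurable borel"
proof -
  have [measurable]: "partial_deriv i P \<in> borel_measurable borel" for i
    using polynomial_function_continuous_on[OF polynomial_function_partial_deriv[OF P_poly], of UNIV i]
    by (simp add: borel_measurable_continuous_onI)
  show "pker a \<in> borel_measurable borel" "gker a i \<in> borel_measurable borel"
    unfolding pker_def[abs_def] gker_def[abs_def] by measurable
qed

end

lemma continuous_on_compact_abs_bound:
  fixes f :: "'a::topological_space \<Rightarrow> real"
  assumes "compact S" "continuous_on S f"
  obtains M where "M \<ge> 0" "\<And>z. z \<in> S \<Longrightarrow> \<bar>f z\<bar> \<le> M"
proof -
  obtain M where "\<forall>z\<in>S. \<bar>f z\<bar> \<le> M"
    using compact_imp_bounded[OF compact_continuous_image[OF assms(2,1)]]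
    unfolding bounded_iff by (metis imageI real_norm_def)
  then show ?thesis using that[of "max 0 M"] by force
qed

lemma integral_polar_density_sum:
  assumes "0 \<le> R" "\<And>i. i < M \<Longrightarrow> continuous_on {0..R} (f i)"
  shows "(\<integral>r. polar_density TYPE('a::euclidean_space) r * (indicator {..R} r * (\<Sum>i<M. f i r)) \<partial>lborel)
    = (\<Sum>i<(M::nat). \<integral>r. polar_density TYPE('a) r * (indicator {..R} r * f i r) \<partial>lborel)"
proof -
  have "(\<Sum>i<M. \<integral>r. polar_density TYPE('a) r * (indicator {..R} r * f i r) \<partial>lborel)
    = (\<integral>r. (\<Sum>i<M. polar_density TYPE('a) r * (indicator {..R} r * f i r)) \<partial>lborel)"
    by (rule Bochner_Integration.integral_sum[symmetric]) (use assms in \<open>auto intro!: integrable_polar_density_continuous\<close>)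
  then show ?thesis by (simp only: sum_distrib_left)
qed

text \<open>The Laplacian of \<open>P z / norm z ^ a\<close> is \<open>lapc n d a * P z / norm z ^ (a + 2)\<close>; it vanishes for \<open>a = n + 2 * d - 2\<close>.\<close>
definition lapc :: "nat \<Rightarrow> nat \<Rightarrow> nat \<Rightarrow> real" where
  "lapc n d a = real a * (real a + 2 - real n - 2 * real d)"

section \<open>Spherical means and Darboux's equation\<close>

context harmonic_poly
begin

text \<open>A spherical mean about x without normalisation: at r = 0 its value is the volume of the
  unit ball times \<open>pker a x\<close>.\<close>

definition sphA :: "nat \<Rightarrow> real^'n \<Rightarrow> real \<Rightarrow> real" where
  "sphA a x r = (\<integral>u. indicator pball u * pker a (x - r *\<^sub>R sgn u) \<partial>lborel)"

text \<open>The derivative of \<open>sphA a x\<close>.\<close>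
definition sphD :: "nat \<Rightarrow> real^'n \<Rightarrow> real \<Rightarrow> real" where
  "sphD a x r = (\<integral>u. indicator pball u * (- (\<Sum>i\<in>UNIV. sgn u $ i * gker a i (x - r *\<^sub>R sgn u))) \<partial>lborel)"

lemma norm_scale_sgn_le: "norm (r *\<^sub>R sgn (u::real^'n)) \<le> \<bar>r\<bar>"
  by (simp add: norm_sgn)

lemma shift_in_cball: "\<bar>r\<bar> \<le> b \<Longrightarrow> x - r *\<^sub>R sgn (u::real^'n) \<in> cball x b"
  using norm_scale_sgn_le[of r u] by (simp add: dist_norm)

lemma zero_notin_cball: "b < norm x \<Longrightarrow> 0 \<notin> cball (x::real^'n) b"
  by (simp add: dist_norm)

lemma integrable_pball_bounded:
  fixes f :: "real^'n \<Rightarrow> real"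
  assumes [measurable]: "f \<in> borel_measurable borel" and "\<And>u. \<bar>f u\<bar> \<le> M"
  shows "integrable lborel (\<lambda>u. indicator pball u * f u)"
proof (rule Bochner_Integration.integrable_bound[where f="\<lambda>u. M * indicator (ball 0 1) u"])
  show "integrable lborel (\<lambda>u::real^'n. M * indicator (ball 0 1) u)"
    using emeasure_lborel_ball_finite[of "0::real^'n" 1] by (intro integrable_mult_right) (simp add: top.not_eq_extremum)
  show "AE u in lborel. norm (indicator pball u * f u) \<le> norm (M * indicator (ball 0 1) u)"
    using assms(2) by (intro AE_I2) (auto simp: indicator_def intro: order_trans[OF _ abs_ge_self])
qed measurable

lemma vec_nth_borel [measurable]: "(\<lambda>u::real^'n. u $ i) \<in> borel_measurable borel"
  by (intro borel_measurable_continuous_onI continuous_intros)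

lemma dker_bound:
  assumes "0 < b" "b < norm x"
  obtains M where "M \<ge> 0" "\<And>r u. \<bar>r\<bar> \<le> b \<Longrightarrow> \<bar>- (\<Sum>i\<in>UNIV. sgn (u::real^'n) $ i * gker a i (x - r *\<^sub>R sgn u))\<bar> \<le> M"
proof -
  have "\<exists>M. M \<ge> 0 \<and> (\<forall>z\<in>cball x b. \<bar>gker a i z\<bar> \<le> M)" for i
    using continuous_on_compact_abs_bound[OF compact_cball kers_continuous(2)[OF zero_notin_cball[OF assms(2)]], of a i] by metis
  then obtain M where M: "\<And>i. M i \<ge> 0" "\<And>i z. z \<in> cball x b \<Longrightarrow> \<bar>gker a i z\<bar> \<le> M i" by metis
  show ?thesis
  proof
    show "(\<Sum>i\<in>UNIV. M i) \<ge> 0" using M by (simp add: sum_nonneg)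
    fix r u assume r: "\<bar>r\<bar> \<le> b"
    have "\<bar>sgn u $ i * gker a i (x - r *\<^sub>R sgn u)\<bar> \<le> M i" for i
    proof -
      have "\<bar>sgn u $ i\<bar> \<le> 1" using component_le_norm_cart[of "sgn u" i] by (simp add: norm_sgn split: if_splits)
      then have "\<bar>sgn u $ i\<bar> * \<bar>gker a i (x - r *\<^sub>R sgn u)\<bar> \<le> 1 * M i"
        using M shift_in_cball[OF r] by (intro mult_mono) auto
      then show ?thesis by (simp add: abs_mult)
    qed
    then show "\<bar>- (\<Sum>i\<in>UNIV. sgn u $ i * gker a i (x - r *\<^sub>R sgn u))\<bar> \<le> (\<Sum>i\<in>UNIV. M i)"
      by (simp add: order_trans[OF sum_abs] sum_mono)
  qed
qed

lemma sphA_has_derivative: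
  assumes t0: "\<bar>t0\<bar> < norm x"
  shows "(sphA a x has_real_derivative sphD a x t0) (at t0)"
proof -
  define e where "e = (norm x - \<bar>t0\<bar>) / 2"
  define b where "b = \<bar>t0\<bar> + e"
  have e: "e > 0" and b: "0 < b" "b < norm x" using t0 by (auto simp: e_def b_def field_simps)
  have tb: "\<bar>t\<bar> \<le> b" if "\<bar>t - t0\<bar> < e" for t using that unfolding b_def by linarith
  obtain M where M: "M \<ge> 0" "\<And>r u. \<bar>r\<bar> \<le> b \<Longrightarrow> \<bar>- (\<Sum>i\<in>UNIV. sgn (u::real^'n) $ i * gker a i (x - r *\<^sub>R sgn u))\<bar> \<le> M"
    using dker_bound[OF b] by blast
  obtain M' where M': "\<And>z. z \<in> cball x b \<Longrightarrow> \<bar>pker a z\<bar> \<le> M'"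
    using continuous_on_compact_abs_bound[OF compact_cball kers_continuous(1)[OF zero_notin_cball[OF b(2)]], of a] by metis
  show ?thesis unfolding sphA_def[abs_def] sphD_def
  proof (rule has_real_derivative_integral[OF e])
    fix t assume t: "\<bar>t - t0\<bar> < e"
    show "integrable lborel (\<lambda>u. indicator pball u * pker a (x - t *\<^sub>R sgn u))"
      by (rule integrable_pball_bounded[of _ M']) (use M' shift_in_cball[OF tb[OF t]] in auto)
    fix u :: "real^'n"
    let ?z = "x - t *\<^sub>R sgn u"
    have z: "?z \<noteq> 0" using shift_in_cball[OF tb[OF t], of x u] zero_notin_cball[OF b(2)] by metis
    have "((\<lambda>s. pker a (?z + s *\<^sub>R (- sgn u))) has_real_derivative (\<Sum>i\<in>UNIV. (- sgn u) $ i * gker a i ?z)) (at 0)"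
      by (rule has_derivative_line[OF pker_has_derivative[OF z]])
    then have "((\<lambda>s. pker a (x - (s + t) *\<^sub>R sgn u)) has_real_derivative - (\<Sum>i\<in>UNIV. sgn u $ i * gker a i ?z)) (at 0)"
      by (simp add: algebra_simps sum_negf)
    then have "((\<lambda>t. pker a (x - t *\<^sub>R sgn u)) has_real_derivative - (\<Sum>i\<in>UNIV. sgn u $ i * gker a i ?z)) (at t)"
      using DERIV_shift[of "\<lambda>t. pker a (x - t *\<^sub>R sgn u)" _ 0 t] by simp
    then show "((\<lambda>t. indicator pball u * pker a (x - t *\<^sub>R sgn u)) has_real_derivative
       indicator pball u * (- (\<Sum>i\<in>UNIV. sgn u $ i * gker a i (x - t *\<^sub>R sgn u)))) (at t)"
      by (rule DERIV_cmult)
    show "\<bar>indicator pball u * (- (\<Sum>i\<in>UNIV. sgn u $ i * gker a i (x - t *\<^sub>R sgn u)))\<bar> \<le> indicator pball u * M"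
      using M(2)[OF tb[OF t], of u] by (auto simp: indicator_def)
  next
    show "integrable lborel (\<lambda>u::real^'n. indicator pball u * M)"
      by (rule integrable_pball_bounded[of _ M]) (use M in auto)
  qed measurable
qed

lemma sphD_continuous:
  assumes b: "0 < b" "b < norm x"
  shows "continuous_on {0..b} (sphD a x)"
proof -
  obtain M where M: "M \<ge> 0" "\<And>r u. \<bar>r\<bar> \<le> b \<Longrightarrow> \<bar>- (\<Sum>i\<in>UNIV. sgn (u::real^'n) $ i * gker a i (x - r *\<^sub>R sgn u))\<bar> \<le> M"
    using dker_bound[OF b] by blast
  show ?thesis unfolding sphD_def[abs_def]
  proof (rule continuous_on_integral_dominated)
    show "continuous_on {0..b} (\<lambda>t. indicator pball u * (- (\<Sum>i\<in>UNIV. sgn u $ i * gker a i (x - t *\<^sub>R sgn u))))" for u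
      by (intro continuous_intros continuous_on_compose2[OF kers_continuous(2)[OF zero_notin_cball[OF b(2)]]])
         (auto simp: norm_sgn)
    show "\<bar>indicator pball u * (- (\<Sum>i\<in>UNIV. sgn u $ i * gker a i (x - t *\<^sub>R sgn u)))\<bar> \<le> indicator pball u * M" if "t \<in> {0..b}" for t u
      using M(2)[of t u] that by (auto simp: indicator_def)
    show "integrable lborel (\<lambda>u::real^'n. indicator pball u * M)"
      by (rule integrable_pball_bounded[of _ M]) (use M in auto)
  qed measurable
qed

text \<open>An integrated form of Darboux's equation for the spherical means of \<open>pker a\<close>, again with a weight vanishing on the boundary.\<close>
lemma darboux:
  assumes R: "0 < R" "R < norm x"
  shows "(\<integral>r. polar_density TYPE(real^'n) r * (indicator {..R} r * ((R\<^sup>2 - r\<^sup>2) * (lapc CARD('n) d a * sphA (a + 2) x r))) \<partial>lborel)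
     = 2 * (\<integral>r. polar_density TYPE(real^'n) r * (indicator {..R} r * (r * sphD a x r)) \<partial>lborel)"
proof -
  let ?I = "\<lambda>f. (\<integral>y. indicator (cball 0 R) (y::real^'n) * f y \<partial>lborel)"
  have ind: "indicator (cball 0 R) (y::real^'n) = (indicator {..R} (norm y) :: real)" for y
    by (auto simp: indicator_def)
  have int: "integrable lborel (\<lambda>y. indicator (cball 0 R) y * f y)" if "continuous_on (cball 0 R) f" for f :: "real^'n \<Rightarrow> real"
    by (rule integrable_continuous_on_compact_indicator) (use that in auto)
  have sumI: "(\<Sum>i\<in>UNIV. ?I (f i)) = ?I (\<lambda>y. \<Sum>i\<in>UNIV. f i y)" if "\<And>i. continuous_on (cball 0 R) (f i)" for f :: "'n \<Rightarrow> real^'n \<Rightarrow> real"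
    using int[OF that] by (subst Bochner_Integration.integral_sum[symmetric]) (auto simp: sum_distrib_left simp del: sum_mult_indicator)
  have sub: "(\<lambda>y. x - y) ` cball 0 R \<subseteq> - {0}" "(\<lambda>y. x - y) ` ball 0 (norm x) \<subseteq> - {0}" using R by auto
  note cont = continuous_on_compose2[OF kers_continuous(1)[of "- {0}"] _ sub(1)]
     continuous_on_compose2[OF kers_continuous(2)[of "- {0}"] _ sub(1)]
     continuous_on_compose2[OF kers_continuous(3)[of "- {0}"] _ sub(1)]
     continuous_on_compose2[OF kers_continuous(2)[of "- {0}"] _ sub(2)]
     continuous_on_compose2[OF kers_continuous(3)[of "- {0}"] _ sub(2)]
  \<comment> \<open>Integration by parts is applied to minus the i-th derivative of the kernel at x
    - y; differentiating once more in y restores the sign.\<close>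
  have A: "?I (\<lambda>y. hker a i (x - y) * (R\<^sup>2 - (norm y)\<^sup>2)) = 2 * ?I (\<lambda>y. (y \<bullet> axis i 1) * (- gker a i (x - y)))" for i
  proof (rule integral_partial_times_cap[OF R])
    fix y :: "real^'n" assume "y \<in> ball 0 (norm x)"
    then have "x - y \<noteq> 0" by auto
    from gker_line[OF this, of a i]
    have "((\<lambda>s. gker a i (x - y + (- s) *\<^sub>R axis i 1)) has_real_derivative - hker a i (x - y)) (at 0)"
      using DERIV_mirror[of "\<lambda>s. gker a i (x - y + s *\<^sub>R axis i 1)" "hker a i (x - y)" 0] by simp
    from DERIV_minus[OF this] show "((\<lambda>s. - gker a i (x - (y + s *\<^sub>R axis i 1))) has_real_derivative hker a i (x - y)) (at 0)"
      by (simp add: algebra_simps)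
  qed (auto intro!: continuous_intros cont)
  have "(\<Sum>i\<in>UNIV. ?I (\<lambda>y. hker a i (x - y) * (R\<^sup>2 - (norm y)\<^sup>2))) = ?I (\<lambda>y. (R\<^sup>2 - (norm y)\<^sup>2) * (lapc CARD('n) d a * pker (a + 2) (x - y)))"
  proof (subst sumI)
    show "?I (\<lambda>y. \<Sum>i\<in>UNIV. hker a i (x - y) * (R\<^sup>2 - (norm y)\<^sup>2)) = ?I (\<lambda>y. (R\<^sup>2 - (norm y)\<^sup>2) * (lapc CARD('n) d a * pker (a + 2) (x - y)))"
    proof (rule Bochner_Integration.integral_cong[OF refl])
      fix y
      show "indicator (cball 0 R) y * (\<Sum>i\<in>UNIV. hker a i (x - y) * (R\<^sup>2 - (norm y)\<^sup>2)) = indicator (cball 0 R) y * ((R\<^sup>2 - (norm y)\<^sup>2) * (lapc CARD('n) d a * pker (a + 2) (x - y)))"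
      proof (cases "y \<in> cball 0 R")
        case True
        then have "x - y \<noteq> 0" using R by auto
        then show ?thesis unfolding sum_distrib_right[symmetric] sum_hker[OF \<open>x - y \<noteq> 0\<close>] lapc_def by simp
      qed simp
    qed
  qed (auto intro!: continuous_intros cont)
  also have "\<dots> = (\<integral>y. (indicator {..R} (norm y) * (R\<^sup>2 - (norm y)\<^sup>2)) * (lapc CARD('n) d a * pker (a + 2) (x - y)) \<partial>lborel)"
    by (simp add: ind mult.assoc)
  also have "\<dots> = (\<integral>r. polar_density TYPE(real^'n) r * ((indicator {..R} r * (R\<^sup>2 - r\<^sup>2)) * (\<integral>u. indicator pball u * (lapc CARD('n) d a * pker (a + 2) (x - r *\<^sub>R sgn u)) \<partial>lborel)) \<partial>lborel)"
    by (rule integral_radial_swap[where \<phi>="\<lambda>r. indicator {..R} r * (R\<^sup>2 - r\<^sup>2)"])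
       (auto simp: ind[symmetric] mult.assoc intro!: int continuous_intros cont)
  also have "\<dots> = (\<integral>r. polar_density TYPE(real^'n) r * (indicator {..R} r * ((R\<^sup>2 - r\<^sup>2) * (lapc CARD('n) d a * sphA (a + 2) x r))) \<partial>lborel)"
    unfolding sphA_def by (simp add: mult.left_commute[of _ "lapc CARD('n) d a"] mult.assoc)
  finally have L: "(\<Sum>i\<in>UNIV. ?I (\<lambda>y. hker a i (x - y) * (R\<^sup>2 - (norm y)\<^sup>2))) = \<dots>" .
  have "(\<Sum>i\<in>UNIV. ?I (\<lambda>y. (y \<bullet> axis i 1) * (- gker a i (x - y)))) = (\<integral>y. indicator {..R} (norm y) * (- (\<Sum>i\<in>UNIV. y $ i * gker a i (x - y))) \<partial>lborel)"
    by (subst sumI) (auto intro!: continuous_intros cont simp: ind inner_axis sum_negf)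
  also have "\<dots> = (\<integral>r. polar_density TYPE(real^'n) r * (indicator {..R} r * (\<integral>u. indicator pball u * (- (\<Sum>i\<in>UNIV. (r *\<^sub>R sgn u) $ i * gker a i (x - r *\<^sub>R sgn u))) \<partial>lborel)) \<partial>lborel)"
    by (rule integral_radial_swap) (unfold ind[symmetric], auto intro!: int continuous_intros cont)
  also have "\<dots> = (\<integral>r. polar_density TYPE(real^'n) r * (indicator {..R} r * (r * sphD a x r)) \<partial>lborel)"
  proof -
    have "(\<integral>u. indicator pball u * (- (\<Sum>i\<in>UNIV. (r *\<^sub>R sgn u) $ i * gker a i (x - r *\<^sub>R sgn u))) \<partial>lborel) = r * sphD a x r" for r
    proof -
      have "(\<Sum>i\<in>UNIV. (r *\<^sub>R sgn u) $ i * gker a i (x - r *\<^sub>R sgn u)) = r * (\<Sum>i\<in>UNIV. sgn u $ i * gker a i (x - r *\<^sub>R sgn u))" for u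
        by (simp add: sum_distrib_left mult.assoc)
      then show ?thesis unfolding sphD_def integral_mult_right_zero[symmetric]
        by (intro Bochner_Integration.integral_cong) (auto simp: algebra_simps)
    qed
    then show ?thesis by simp
  qed
  finally have RR: "(\<Sum>i\<in>UNIV. ?I (\<lambda>y. (y \<bullet> axis i 1) * (- gker a i (x - y)))) = \<dots>" .
  show ?thesis using L unfolding A sum_distrib_left[symmetric] RR by simp
qed

text \<open>The Laplacian of \<open>pker a\<close> is a multiple of \<open>pker (a + 2)\<close>. If
  the means of that multiple are even polynomials in the radius, the integrated equation of
  \<open>darboux\<close> determines the derivative of \<open>sphA a x\<close>, and one more
  integration raises the degree by two.\<close>

lemma sphA_step:
  assumes h: "\<And>r. 0 \<le> r \<Longrightarrow> r < norm x \<Longrightarrow> lapc CARD('n) d a * sphA (a + 2) x r = (\<Sum>i<M. \<alpha> i * r ^ (2 * i))"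
    and r: "0 \<le> R" "R < norm x"
  shows "sphA a x R = sphA a x 0 + (\<Sum>i<M. \<alpha> i / (real CARD('n) + 2 * real i) / (2 * real i + 2) * R ^ (2 * i + 2))"
proof -
  let ?n = "CARD('n)"
  \<comment> \<open>\<open>E\<close> is the solution of (r^(n-1) E)' = r^(n-1) (\<Sum> \<alpha> i
    r^(2i)) that vanishes at 0, that is, the flux form of the radial Poisson equation. This is the
    origin of the divisor n + 2 i.\<close>
  define E where "E r = (\<Sum>i<M. \<alpha> i / (real ?n + 2 * real i) * r ^ (2 * i + 1))" for r
  have n: "?n > 0" by simp
  have nz: "real ?n + 2 * real i \<noteq> 0" for i using n by (metis add_pos_nonneg less_irrefl mult_nonneg_nonneg of_nat_0_le_iff of_nat_0_less_iff zero_le_numeral)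
  \<comment> \<open>\<open>E\<close> satisfies the same weighted identity as \<open>sphD\<close>.
    For a single power it reads S^2 / (n + 2i) - S^2 / (n + 2i + 2) = 2 S^2 / ((n + 2i) (n + 2i +
    2)), up to common factors.\<close>
  have key: "(\<integral>r. polar_density TYPE(real^'n) r * (indicator {..S} r * (r * sphD a x r)) \<partial>lborel)
     = (\<integral>r. polar_density TYPE(real^'n) r * (indicator {..S} r * (r * E r)) \<partial>lborel)" if S: "0 < S" "S < norm x" for S
  proof -
    have "2 * (\<integral>r. polar_density TYPE(real^'n) r * (indicator {..S} r * (r * sphD a x r)) \<partial>lborel)
      = (\<integral>r. polar_density TYPE(real^'n) r * (indicator {..S} r * (\<Sum>i<M. \<alpha> i * S\<^sup>2 * r ^ (2 * i) - \<alpha> i * r ^ (2 * i + 2))) \<partial>lborel)"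
      unfolding darboux[OF S, symmetric]
    proof (rule Bochner_Integration.integral_cong[OF refl])
      fix r
      show "polar_density TYPE(real^'n) r * (indicator {..S} r * ((S\<^sup>2 - r\<^sup>2) * (lapc CARD('n) d a * sphA (a + 2) x r))) =
        polar_density TYPE(real^'n) r * (indicator {..S} r * (\<Sum>i<M. \<alpha> i * S\<^sup>2 * r ^ (2 * i) - \<alpha> i * r ^ (2 * i + 2)))"
      proof (cases "0 < r \<and> r \<le> S")
        case True
        then have "lapc CARD('n) d a * sphA (a + 2) x r = (\<Sum>i<M. \<alpha> i * r ^ (2 * i))" using h[of r] S by simp
        then show ?thesis by (simp add: sum_distrib_left algebra_simps power2_eq_square)
      qed (auto simp: polar_density_def indicator_def)
    qed
    also have "\<dots> = (\<Sum>i<M. \<integral>r. polar_density TYPE(real^'n) r * (indicator {..S} r * (\<alpha> i * S\<^sup>2 * r ^ (2 * i) - \<alpha> i * r ^ (2 * i + 2))) \<partial>lborel)"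
      by (rule integral_polar_density_sum) (use S in \<open>auto intro!: continuous_intros\<close>)
    also have "\<dots> = (\<Sum>i<M. \<alpha> i * S\<^sup>2 * (real ?n * S ^ (?n + 2 * i) / real (?n + 2 * i)) - \<alpha> i * (real ?n * S ^ (?n + (2 * i + 2)) / real (?n + (2 * i + 2))))"
    proof (rule sum.cong[OF refl])
      fix i
      have "(\<integral>r. polar_density TYPE(real^'n) r * (indicator {..S} r * (\<alpha> i * S\<^sup>2 * r ^ (2 * i) - \<alpha> i * r ^ (2 * i + 2))) \<partial>lborel)
        = (\<integral>r. \<alpha> i * S\<^sup>2 * (polar_density TYPE(real^'n) r * (indicator {..S} r * r ^ (2 * i))) - \<alpha> i * (polar_density TYPE(real^'n) r * (indicator {..S} r * r ^ (2 * i + 2))) \<partial>lborel)"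
        by (rule Bochner_Integration.integral_cong) (auto simp: algebra_simps)
      also have "\<dots> = \<alpha> i * S\<^sup>2 * (\<integral>r. polar_density TYPE(real^'n) r * (indicator {..S} r * r ^ (2 * i)) \<partial>lborel) - \<alpha> i * (\<integral>r. polar_density TYPE(real^'n) r * (indicator {..S} r * r ^ (2 * i + 2)) \<partial>lborel)"
        using S by (subst Bochner_Integration.integral_diff) (auto intro!: integrable_mult_right integrable_polar_density_continuous continuous_intros simp del: power_Suc)
      finally show "(\<integral>r. polar_density TYPE(real^'n) r * (indicator {..S} r * (\<alpha> i * S\<^sup>2 * r ^ (2 * i) - \<alpha> i * r ^ (2 * i + 2))) \<partial>lborel)
        = \<alpha> i * S\<^sup>2 * (real ?n * S ^ (?n + 2 * i) / real (?n + 2 * i)) - \<alpha> i * (real ?n * S ^ (?n + (2 * i + 2)) / real (?n + (2 * i + 2)))"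
        using S integral_polar_density_power_upto[where 'a="real^'n" and R=S] by (simp only: less_imp_le DIM_cart DIM_real mult_1_right)
    qed
    also have "\<dots> = (\<Sum>i<M. 2 * (\<alpha> i / (real ?n + 2 * real i) * (real ?n * S ^ (?n + (2 * i + 2)) / real (?n + (2 * i + 2)))))"
    proof (rule sum.cong[OF refl])
      fix i
      define A B where "A = real ?n + 2 * real i" and "B = S ^ (?n + 2 * i)"
      have A: "A > 0" "A + 2 > 0" using n by (auto simp: A_def add_pos_nonneg)
      have e: "S ^ (?n + (2 * i + 2)) = S\<^sup>2 * B" "real (?n + 2 * i) = A" "real (?n + (2 * i + 2)) = A + 2"
        unfolding A_def B_def by (simp_all add: power_add power2_eq_square)
      show "\<alpha> i * S\<^sup>2 * (real ?n * S ^ (?n + 2 * i) / real (?n + 2 * i)) - \<alpha> i * (real ?n * S ^ (?n + (2 * i + 2)) / real (?n + (2 * i + 2))) =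
        2 * (\<alpha> i / (real ?n + 2 * real i) * (real ?n * S ^ (?n + (2 * i + 2)) / real (?n + (2 * i + 2))))"
        unfolding e B_def[symmetric] A_def[symmetric] using A by (simp add: divide_simps) (simp add: algebra_simps)
    qed
    also have "\<dots> = 2 * (\<Sum>i<M. \<integral>r. polar_density TYPE(real^'n) r * (indicator {..S} r * (\<alpha> i / (real ?n + 2 * real i) * r ^ (2 * i + 2))) \<partial>lborel)"
    proof -
      have *: "(\<integral>r. polar_density TYPE(real^'n) r * (indicator {..S} r * (c * r ^ k)) \<partial>lborel) = c * (real ?n * S ^ (?n + k) / real (?n + k))" for c k
        using S integral_polar_density_power_upto[where 'a="real^'n" and R=S and k=k]
        unfolding mult.left_commute[of _ c] by simp
      show ?thesis unfolding * sum_distrib_left ..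
    qed
    also have "\<dots> = 2 * (\<integral>r. polar_density TYPE(real^'n) r * (indicator {..S} r * (\<Sum>i<M. \<alpha> i / (real ?n + 2 * real i) * r ^ (2 * i + 2))) \<partial>lborel)"
      by (subst integral_polar_density_sum) (use S in \<open>auto intro!: continuous_intros simp: nz simp del: power_Suc\<close>)
    finally show ?thesis unfolding E_def by (simp add: sum_distrib_left mult.left_commute)
  qed
  have Ec: "continuous_on T E" for T unfolding E_def by (intro continuous_intros) (use nz in auto)
  \<comment> \<open>The integrals over [0, T] agree for all T up to S, so the continuous integrands
    agree; the factor r^n can be cancelled at r = S > 0.\<close>
  have DE: "sphD a x S = E S" if S: "0 < S" "S < norm x" for S
  proof -
    have Dc: "continuous_on {0..S'} (sphD a x)" if "0 < S'" "S' \<le> S" for S'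
      using sphD_continuous[of S' x a] that S by simp
    have "real ?n * S ^ (?n - 1) * (S * (sphD a x S - E S)) = 0"
    proof (rule continuous_eq_zero_if_integrals_zero[where b=S and R=S and h="\<lambda>S. real ?n * S ^ (?n - 1) * (S * (sphD a x S - E S))"])
      show "continuous_on {0..S} (\<lambda>S. real ?n * S ^ (?n - 1) * (S * (sphD a x S - E S)))"
        using S by (intro continuous_intros Ec Dc) auto
      fix T assume T: "0 < T" "T \<le> S"
      have "(\<integral>r. indicator {0..T} r * (real ?n * r ^ (?n - 1) * (r * (sphD a x r - E r))) \<partial>lborel)
        = (\<integral>r. polar_density TYPE(real^'n) r * (indicator {..T} r * (r * (sphD a x r - E r))) \<partial>lborel)"
        using T by (subst integral_polar_density_continuous) (auto intro!: continuous_intros Ec Dc)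
      also have "\<dots> = (\<integral>r. polar_density TYPE(real^'n) r * (indicator {..T} r * (r * sphD a x r)) - polar_density TYPE(real^'n) r * (indicator {..T} r * (r * E r)) \<partial>lborel)"
        by (rule Bochner_Integration.integral_cong) (auto simp: algebra_simps)
      also have "\<dots> = (\<integral>r. polar_density TYPE(real^'n) r * (indicator {..T} r * (r * sphD a x r)) \<partial>lborel) - (\<integral>r. polar_density TYPE(real^'n) r * (indicator {..T} r * (r * E r)) \<partial>lborel)"
        using T by (intro Bochner_Integration.integral_diff integrable_polar_density_continuous continuous_intros Ec Dc) auto
      also have "\<dots> = 0" using key[of T] T S by simp
      finally show "(\<integral>r. indicator {0..T} r * (real ?n * r ^ (?n - 1) * (r * (sphD a x r - E r))) \<partial>lborel) = 0" .
    qed (use S in auto)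
    then show ?thesis using S by simp
  qed
  define G where "G r = sphA a x r - (\<Sum>i<M. \<alpha> i / (real ?n + 2 * real i) / (2 * real i + 2) * r ^ (2 * i + 2))" for r
  have dG: "(G has_real_derivative sphD a x s - E s) (at s)" if "\<bar>s\<bar> < norm x" for s
  proof -
    have "((\<lambda>r. \<Sum>i<M. \<alpha> i / (real ?n + 2 * real i) / (2 * real i + 2) * r ^ (2 * i + 2)) has_real_derivative E s) (at s)"
      unfolding E_def
    proof (rule DERIV_sum)
      fix i
      have "((\<lambda>r. r ^ (2 * i + 2)) has_real_derivative real (2 * i + 2) * s ^ (2 * i + 2 - Suc 0)) (at s)"
        using DERIV_pow[of "2 * i + 2" s UNIV] by simp
      moreover have "\<alpha> i / (real ?n + 2 * real i) / (2 * real i + 2) * (real (2 * i + 2) * s ^ (2 * i + 2 - Suc 0)) = \<alpha> i / (real ?n + 2 * real i) * s ^ (2 * i + 1)"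
      proof -
        have *: "A / (2 * real i + 2) * (real (2 * i + 2) * B) = A * B" for A B :: real
          by (simp add: field_simps)
        have e: "2 * i + 2 - Suc 0 = 2 * i + 1" by simp
        show ?thesis unfolding e by (rule *)
      qed
      ultimately show "((\<lambda>r. \<alpha> i / (real ?n + 2 * real i) / (2 * real i + 2) * r ^ (2 * i + 2)) has_real_derivative \<alpha> i / (real ?n + 2 * real i) * s ^ (2 * i + 1)) (at s)"
        by (metis DERIV_cmult)
    qed
    from DERIV_diff[OF sphA_has_derivative[OF that] this] show ?thesis unfolding G_def[abs_def] .
  qed
  have "G R = G 0"
  proof (cases "R = 0")
    case False
    show ?thesis
    proof (rule DERIV_isconst_end[where f=G])
      show "continuous_on {0..R} G"
        by (intro continuous_at_imp_continuous_on ballI DERIV_isCont[OF dG]) (use r in auto)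
      show "(G has_real_derivative 0) (at s)" if "0 < s" "s < R" for s
        using dG[of s] DE[of s] that r by simp
    qed (use False r in auto)
  qed simp
  then show ?thesis unfolding G_def by (simp add: power_add)
qed

text \<open>At \<open>j = 0\<close> the exponent is \<open>n + 2 * d - 2\<close>, for which the kernel is harmonic and its spherical means are constant; every further step integrates Darboux's equation once.\<close>
lemma sphA_polynomial:
  assumes d: "d = 2 * N" and j: "j < N" and x: "x \<noteq> 0"
  shows "\<exists>\<alpha>. \<forall>r. 0 \<le> r \<longrightarrow> r < norm x \<longrightarrow> sphA (CARD('n) + d + 2 * (N - 1 - j)) x r = (\<Sum>i<Suc j. \<alpha> i * r ^ (2 * i))"
  using j
proof (induction j)
  case 0
  let ?a = "CARD('n) + d + 2 * (N - 1 - 0)"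
  have "lapc CARD('n) d ?a = 0" unfolding lapc_def d using 0 by (simp add: of_nat_diff algebra_simps)
  then have "sphA ?a x r = sphA ?a x 0" if "0 \<le> r" "r < norm x" for r
    using sphA_step[of x ?a "\<lambda>_. 0" 0 r] that by simp
  then show ?case by (intro exI[of _ "\<lambda>_. sphA ?a x 0"]) auto
next
  case (Suc j)
  let ?a = "CARD('n) + d + 2 * (N - 1 - Suc j)"
  have a: "CARD('n) + d + 2 * (N - 1 - j) = ?a + 2" using Suc.prems by simp
  from Suc.IH Suc.prems obtain \<alpha> where al: "\<And>r. 0 \<le> r \<Longrightarrow> r < norm x \<Longrightarrow> sphA (?a + 2) x r = (\<Sum>i<Suc j. \<alpha> i * r ^ (2 * i))"
    unfolding a by auto
  \<comment> \<open>The integration constant is the value at the centre; all other coefficients move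
    up by one power of r^2.\<close>
  define \<beta> where "\<beta> i = (case i of 0 \<Rightarrow> sphA ?a x 0 | Suc k \<Rightarrow> lapc CARD('n) d ?a * \<alpha> k / (real CARD('n) + 2 * real k) / (2 * real k + 2))" for i
  have "sphA ?a x r = (\<Sum>i<Suc (Suc j). \<beta> i * r ^ (2 * i))" if r: "0 \<le> r" "r < norm x" for r
  proof -
    have "sphA ?a x r = sphA ?a x 0 + (\<Sum>i<Suc j. (lapc CARD('n) d ?a * \<alpha> i) / (real CARD('n) + 2 * real i) / (2 * real i + 2) * r ^ (2 * i + 2))"
      by (rule sphA_step[OF _ r]) (simp only: al sum_distrib_left mult.assoc)
    also have "\<dots> = (\<Sum>i<Suc (Suc j). \<beta> i * r ^ (2 * i))"
      unfolding sum.lessThan_Suc_shift[of _ "Suc j"] \<beta>_def by simp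
    finally show ?thesis .
  qed
  then show ?case by blast
qed

text \<open>The zeroth moment is 1 over the volume of the unit ball because \<open>sphA\<close> is
  not normalised: its constant term is that volume times the kernel at x. The higher moments remove
  the other terms. For |x| > 1 the singularity lies outside the domain of integration.\<close>

lemma convolution_exterior:
  assumes d: "d = 2 * N" and N: "N > 0" and x: "norm x > 1"
    and q: "\<And>i. i < N \<Longrightarrow> (\<integral>r. polar_density TYPE(real^'n) r * (indicator {..1} r * (r ^ (2 * i) * poly q (r\<^sup>2))) \<partial>lborel)
       = (if i = 0 then 1 / measure lborel (ball (0::real^'n) 1) else 0)"
  shows "(\<integral>y. indicator (cball 0 1) y * poly q ((norm y)\<^sup>2) * pker (CARD('n) + d) (x - y) \<partial>lborel) = pker (CARD('n) + d) x"
proof -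
  let ?a = "CARD('n) + d"
  let ?om = "measure lborel (ball (0::real^'n) 1)"
  have om: "?om > 0" using content_ball_pos[of 1 "0::real^'n"] by simp
  have ind: "indicator (cball 0 1) (y::real^'n) = (indicator {..1} (norm y) :: real)" for y
    by (auto simp: indicator_def)
  have x0: "x \<noteq> 0" using x by auto
  obtain \<alpha> where al: "\<And>r. 0 \<le> r \<Longrightarrow> r < norm x \<Longrightarrow> sphA ?a x r = (\<Sum>i<N. \<alpha> i * r ^ (2 * i))"
    using sphA_polynomial[OF d, of "N - 1", OF _ x0] N by auto
  have "sphA ?a x 0 = (\<Sum>i<N. \<alpha> i * 0 ^ (2 * i))" using al[of 0] x0 by simp
  also have "\<dots> = (\<Sum>i<N. if i = 0 then \<alpha> i else 0)"
    by (rule sum.cong) (auto simp: power_0_left)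
  finally have "sphA ?a x 0 = (\<Sum>i<N. if i = 0 then \<alpha> i else 0)" .
  then have a0: "\<alpha> 0 = sphA ?a x 0" using N by (simp add: sum.delta)
  have "sphA ?a x 0 = (\<integral>u. indicator pball (u::real^'n) * pker ?a x \<partial>lborel)" by (simp add: sphA_def)
  also have "\<dots> = (\<integral>u. indicator (ball 0 1) (u::real^'n) * pker ?a x \<partial>lborel)"
  proof (rule integral_cong_AE)
    show "AE u in lborel. indicator pball (u::real^'n) * pker ?a x = indicator (ball 0 1) u * pker ?a x"
      using AE_lborel_nonzero by eventually_elim (auto simp: indicator_def)
  qed measurable
  also have "\<dots> = ?om * pker ?a x" by simp
  finally have a0': "\<alpha> 0 = ?om * pker ?a x" using a0 by simp
  have sub: "(\<lambda>y. x - y) ` cball 0 1 \<subseteq> - {0}" using x by auto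
  have "(\<integral>y. indicator (cball 0 1) y * poly q ((norm y)\<^sup>2) * pker ?a (x - y) \<partial>lborel) = (\<integral>y. (indicator {..1} (norm y) * poly q ((norm y)\<^sup>2)) * pker ?a (x - y) \<partial>lborel)"
    by (simp add: ind)
  also have "\<dots> = (\<integral>r. polar_density TYPE(real^'n) r * ((indicator {..1} r * poly q (r\<^sup>2)) * (\<integral>u. indicator pball u * pker ?a (x - r *\<^sub>R sgn u) \<partial>lborel)) \<partial>lborel)"
    by (rule integral_radial_swap[where \<phi>="\<lambda>r. indicator {..1} r * poly q (r\<^sup>2)"])
       (auto simp: ind[symmetric] mult.assoc intro!: integrable_continuous_on_compact_indicator continuous_intros
          continuous_on_compose2[OF kers_continuous(1)[of "- {0}"] _ sub])
  also have "\<dots> = (\<integral>r. polar_density TYPE(real^'n) r * (indicator {..1} r * (\<Sum>i<N. \<alpha> i * (r ^ (2 * i) * poly q (r\<^sup>2)))) \<partial>lborel)"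
  proof (rule Bochner_Integration.integral_cong[OF refl])
    fix r
    show "polar_density TYPE(real^'n) r * ((indicator {..1} r * poly q (r\<^sup>2)) * (\<integral>u. indicator pball u * pker ?a (x - r *\<^sub>R sgn u) \<partial>lborel))
      = polar_density TYPE(real^'n) r * (indicator {..1} r * (\<Sum>i<N. \<alpha> i * (r ^ (2 * i) * poly q (r\<^sup>2))))"
    proof (cases "0 < r \<and> r \<le> 1")
      case True
      then have "(\<integral>u. indicator pball u * pker ?a (x - r *\<^sub>R sgn u) \<partial>lborel) = (\<Sum>i<N. \<alpha> i * r ^ (2 * i))"
        using al[of r] x by (simp add: sphA_def)
      then show ?thesis by (simp add: sum_distrib_left mult_ac)
    qed (auto simp: polar_density_def indicator_def)
  qed
  also have "\<dots> = (\<Sum>i<N. \<integral>r. polar_density TYPE(real^'n) r * (indicator {..1} r * (\<alpha> i * (r ^ (2 * i) * poly q (r\<^sup>2)))) \<partial>lborel)"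
    by (rule integral_polar_density_sum) (auto intro!: continuous_intros)
  also have "\<dots> = (\<Sum>i<N. if i = 0 then \<alpha> i / ?om else 0)"
  proof (rule sum.cong[OF refl])
    fix i assume "i \<in> {..<N}"
    then show "(\<integral>r. polar_density TYPE(real^'n) r * (indicator {..1} r * (\<alpha> i * (r ^ (2 * i) * poly q (r\<^sup>2)))) \<partial>lborel) = (if i = 0 then \<alpha> i / ?om else 0)"
      using q[of i] unfolding mult.left_commute[of _ "\<alpha> i"] by simp
  qed
  also have "\<dots> = \<alpha> 0 / ?om" using N by (simp add: sum.delta)
  finally show ?thesis using om a0' by simp
qed

end

section \<open>The radial potential of the truncated kernel\<close>

text \<open>The system has a Cauchy matrix. It is solved without determinants: the coefficients are
  those of the partial fraction expansion of a multiple of Q(X) / \<Prod>(X + z l), where Q has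
  degree N - 1 and vanishes at X = 2, 4, ..., 2 (N - 1).\<close>

lemma partial_fraction_coefficients:
  fixes z :: "nat \<Rightarrow> real"
  assumes z: "inj_on z {..<N}" "\<And>j. j < N \<Longrightarrow> z j > 0" and N: "N > 0"
  shows "\<exists>\<beta>. \<forall>i<N. (\<Sum>j<N. \<beta> j / (2 * real i + z j)) = (if i = 0 then c else 0)"
proof -
  define Q :: "real poly" where "Q = (\<Prod>l=1..<N. [:- 2 * real l, 1:])"
  \<comment> \<open>\<open>L j\<close> / \<open>D j\<close> are the Lagrange basis polynomials for
    the nodes - z k, and \<open>W\<close> is the interpolation of \<open>Q\<close> at these
    nodes.\<close>
  define L where "L j = (\<Prod>l\<in>{..<N}-{j}. [:z l, 1:])" for j
  define D where "D j = (\<Prod>l\<in>{..<N}-{j}. z l - z j)" for j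
  define W where "W = (\<Sum>j<N. smult (poly Q (- z j) / D j) (L j))"
  have D0: "D j \<noteq> 0" if "j < N" for j
    unfolding D_def using z(1) that by (auto simp: inj_on_def)
  have degL: "degree (L j) < N" if "j < N" for j
  proof -
    have "degree (L j) \<le> (\<Sum>l\<in>{..<N}-{j}. degree [:z l, 1:])"
      unfolding L_def using degree_prod_sum_le[of "{..<N}-{j}" "\<lambda>l. [:z l, 1:]"] by (simp add: o_def)
    also have "\<dots> \<le> (\<Sum>l\<in>{..<N}-{j}. 1)" by (intro sum_mono) simp
    also have "\<dots> = card ({..<N}-{j})" by simp
    also have "\<dots> < N" using that N by simp
    finally show ?thesis .
  qed
  have degQ: "degree Q < N"
  proof -
    have "degree Q \<le> (\<Sum>l=1..<N. degree [:- 2 * real l, 1:])"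
      unfolding Q_def using degree_prod_sum_le[of "{1..<N}" "\<lambda>l. [:- 2 * real l, 1:]"] by (simp add: o_def)
    also have "\<dots> \<le> (\<Sum>l=1..<N. 1)" by (intro sum_mono) simp
    finally show ?thesis using N by simp
  qed
  have degW: "degree W < N"
    unfolding W_def
    by (rule degree_sum_less) (use degL N in \<open>auto intro: le_less_trans[OF degree_smult_le]\<close>)
  have Leval: "poly (L j) (- z k) = (if j = k then D j else 0)" if "j < N" "k < N" for j k
  proof (cases "j = k")
    case True
    then show ?thesis unfolding L_def D_def poly_prod by simp
  next
    case False
    then have "k \<in> {..<N} - {j}" using that by simp
    then have "poly (L j) (- z k) = 0" unfolding L_def poly_prod by (intro prod_zero) auto
    then show ?thesis using False by simp
  qed
  \<comment> \<open>Both polynomials have degree less than N and agree at N distinct nodes.\<close>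
  have "W = Q"
  proof (rule poly_eqI_degree[where A="(\<lambda>k. - z k) ` {..<N}"])
    fix y assume "y \<in> (\<lambda>k. - z k) ` {..<N}"
    then obtain k where k: "k < N" "y = - z k" by auto
    have "poly W y = (\<Sum>j<N. poly Q (- z j) / D j * (if j = k then D j else 0))"
      unfolding W_def poly_sum k(2) using Leval k(1) by (intro sum.cong) auto
    also have "\<dots> = (\<Sum>j<N. if j = k then poly Q (- z k) else 0)"
      using D0 by (intro sum.cong) auto
    also have "\<dots> = poly Q y" using k by (simp add: sum.delta)
    finally show "poly W y = poly Q y" .
  next
    have "card ((\<lambda>k. - z k) ` {..<N}) = N"
      using z(1) by (subst card_image) (auto simp: inj_on_def)
    then show "degree W < card ((\<lambda>k. - z k) ` {..<N})" "degree Q < card ((\<lambda>k. - z k) ` {..<N})"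
      using degW degQ by auto
  qed
  define E where "E X = (\<Prod>l<N. X + z l)" for X
  have E: "E (2 * real i) > 0" for i unfolding E_def using z(2) by (intro prod_pos) (auto simp: add_nonneg_pos)
  have sum: "(\<Sum>j<N. poly Q (- z j) / D j / (2 * real i + z j)) = poly Q (2 * real i) / E (2 * real i)" for i
  proof -
    have "poly (L j) (2 * real i) / E (2 * real i) = 1 / (2 * real i + z j)" if "j < N" for j
    proof -
      have "E (2 * real i) = (2 * real i + z j) * poly (L j) (2 * real i)"
        unfolding E_def L_def poly_prod using that by (subst prod.remove[of _ j]) (auto simp: add.commute)
      then show ?thesis using E[of i] by (auto simp: divide_simps)
    qed
    then have "(\<Sum>j<N. poly Q (- z j) / D j / (2 * real i + z j)) = (\<Sum>j<N. poly Q (- z j) / D j * (poly (L j) (2 * real i) / E (2 * real i)))"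
      by (intro sum.cong) auto
    also have "\<dots> = poly W (2 * real i) / E (2 * real i)"
      unfolding W_def poly_sum by (simp add: sum_divide_distrib)
    finally show ?thesis using \<open>W = Q\<close> by simp
  qed
  have Q0: "poly Q 0 \<noteq> 0" unfolding Q_def poly_prod by (simp add: prod_zero_iff)
  have Qi: "poly Q (2 * real i) = 0" if "0 < i" "i < N" for i
    unfolding Q_def poly_prod using that by (intro prod_zero bexI[of _ i]) auto
  \<comment> \<open>The scaling that gives the value c at X = 0, where \<open>Q\<close> does not
    vanish.\<close>
  define k where "k = c * E 0 / poly Q 0"
  show ?thesis
  proof (intro exI allI impI)
    fix i assume i: "i < N"
    have "(\<Sum>j<N. k * (poly Q (- z j) / D j) / (2 * real i + z j)) = k * (poly Q (2 * real i) / E (2 * real i))"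
      unfolding sum[symmetric] sum_distrib_left by simp
    also have "\<dots> = (if i = 0 then c else 0)"
      using Q0 Qi[of i] i E[of 0] by (auto simp: k_def)
    finally show "(\<Sum>j<N. k * (poly Q (- z j) / D j) / (2 * real i + z j)) = (if i = 0 then c else 0)" .
  qed
qed

text \<open>The polar density pairs r^(2i) with r^(2j) to n / (n + 2i + 2j), so the coefficients of
  q solve a Cauchy system with z j = n + 2j.\<close>

lemma exists_radial_moment_poly:
  assumes N: "N > 0"
  shows "\<exists>q. degree q < N \<and> (\<forall>i<N. (\<integral>r. polar_density TYPE('a::euclidean_space) r * (indicator {..1} r * (r ^ (2 * i) * poly q (r\<^sup>2))) \<partial>lborel) = (if i = 0 then c else 0))"
proof -
  let ?n = "DIM('a)"
  have n: "real ?n > 0" by simp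
  have "\<exists>\<beta>. \<forall>i<N. (\<Sum>j<N. \<beta> j / (2 * real i + (real ?n + 2 * real j))) = (if i = 0 then c / real ?n else 0)"
    using N by (intro partial_fraction_coefficients) (auto simp: inj_on_def add_pos_nonneg)
  then obtain \<beta> where \<beta>: "\<And>i. i < N \<Longrightarrow> (\<Sum>j<N. \<beta> j / (2 * real i + (real ?n + 2 * real j))) = (if i = 0 then c / real ?n else 0)"
    by blast
  define q where "q = (\<Sum>j<N. monom (\<beta> j) j)"
  have "degree q < N" unfolding q_def
    by (rule degree_sum_less) (use N in \<open>auto intro: le_less_trans[OF degree_monom_le]\<close>)
  moreover have "(\<integral>r. polar_density TYPE('a) r * (indicator {..1} r * (r ^ (2 * i) * poly q (r\<^sup>2))) \<partial>lborel) = (if i = 0 then c else 0)" if "i < N" for i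
  proof -
    have pq: "r ^ (2 * i) * poly q (r\<^sup>2) = (\<Sum>j<N. \<beta> j * r ^ (2 * i + 2 * j))" for r
      unfolding q_def poly_sum poly_monom sum_distrib_left power_mult[of r 2, symmetric] by (simp add: power_add mult_ac)
    have "(\<integral>r. polar_density TYPE('a) r * (indicator {..1} r * (r ^ (2 * i) * poly q (r\<^sup>2))) \<partial>lborel)
      = (\<Sum>j<N. \<integral>r. polar_density TYPE('a) r * (indicator {..1} r * (\<beta> j * r ^ (2 * i + 2 * j))) \<partial>lborel)"
      unfolding pq by (rule integral_polar_density_sum) (auto intro!: continuous_intros)
    also have "\<dots> = (\<Sum>j<N. real ?n * (\<beta> j / (2 * real i + (real ?n + 2 * real j))))"
    proof (rule sum.cong[OF refl])
      fix j
      show "(\<integral>r. polar_density TYPE('a) r * (indicator {..1} r * (\<beta> j * r ^ (2 * i + 2 * j))) \<partial>lborel) = real ?n * (\<beta> j / (2 * real i + (real ?n + 2 * real j)))"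
        unfolding mult.left_commute[of _ "\<beta> j"] using integral_polar_density_power_upto[where 'a='a and R=1 and k="2 * i + 2 * j"]
        by (simp add: algebra_simps)
    qed
    also have "\<dots> = (if i = 0 then c else 0)"
      unfolding sum_distrib_left[symmetric] \<beta>[OF that] using n by simp
    finally show ?thesis .
  qed
  ultimately show ?thesis by blast
qed

section \<open>Integrals along rays through the unit ball\<close>

text \<open>Coefficient of \<open>r ^ j\<close> in \<open>(c - 2 * r * t + r\<^sup>2) ^ i\<close>, as a polynomial in \<open>t\<close>.\<close>
fun quad_coeff :: "real \<Rightarrow> nat \<Rightarrow> nat \<Rightarrow> real poly" where
  "quad_coeff c 0 j = (if j = 0 then 1 else 0)"
| "quad_coeff c (Suc i) j = smult c (quad_coeff c i j) + (if j \<ge> 1 then [:0, -2:] * quad_coeff c i (j - 1) else 0)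
     + (if j \<ge> 2 then quad_coeff c i (j - 2) else 0)"

lemma quad_coeff_eq_0: "2 * i < j \<Longrightarrow> quad_coeff c i j = 0"
  by (induction i arbitrary: j) auto

text \<open>If r and t both get weight one, the quadratic has weight at most two; hence its i-th
  power pairs r^j with degree at most 2 i - j in t. The second alternative is there because the zero
  polynomial has degree 0, so that the inequality fails for j > 2 i.\<close>

lemma degree_quad_coeff: "degree (quad_coeff c i j) + j \<le> 2 * i \<or> quad_coeff c i j = 0"
proof (induction i arbitrary: j)
  case (Suc i)
  show ?case
  proof (cases "j > 2 * Suc i")
    case True
    then show ?thesis using quad_coeff_eq_0 by blast
  next
    case False
    then have j: "j \<le> 2 * i + 2" by simp
    have 1: "degree (smult c (quad_coeff c i j)) \<le> 2 * i + 2 - j"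
      using Suc.IH[of j] degree_smult_le[of c "quad_coeff c i j"] by auto
    have 2: "degree (if j \<ge> 1 then [:0, -2:] * quad_coeff c i (j - 1) else 0) \<le> 2 * i + 2 - j"
      using Suc.IH[of "j - 1"] degree_mult_le[of "[:0, -2:]" "quad_coeff c i (j - 1)"] j by auto
    have 3: "degree (if j \<ge> 2 then quad_coeff c i (j - 2) else 0) \<le> 2 * i + 2 - j"
      using Suc.IH[of "j - 2"] j by auto
    have "degree (quad_coeff c (Suc i) j) \<le> 2 * i + 2 - j"
      using 1 2 3 by (simp only: quad_coeff.simps) (intro degree_add_le)
    then show ?thesis using j by auto
  qed
qed simp

lemma quad_coeff_0: "quad_coeff c i 0 = [:c ^ i:]"
  by (induction i) (auto simp: one_pCons)

text \<open>Changing the sign of t in the quadratic amounts to changing the sign of r.\<close>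

lemma poly_quad_coeff_minus: "poly (quad_coeff c i j) (- t) = (-1) ^ j * poly (quad_coeff c i j) t"
proof (induction i arbitrary: j)
  case (Suc i)
  show ?case
  proof (cases "j \<ge> 2")
    case True
    define k where "k = j - 2"
    have k: "j = Suc (Suc k)" using True by (simp add: k_def)
    show ?thesis using Suc.IH[of k] Suc.IH[of "Suc k"] Suc.IH[of "Suc (Suc k)"] unfolding k by (simp add: algebra_simps)
  next
    case False
    then have "j = 0 \<or> j = 1" by auto
    then show ?thesis using Suc.IH[of 0] Suc.IH[of 1] by (auto simp: algebra_simps)
  qed
qed simp

lemma sum_quad_coeff: "2 * i \<le> M \<Longrightarrow> (\<Sum>j\<le>M. poly (quad_coeff c i j) t * r ^ j) = (c - 2 * r * t + r\<^sup>2) ^ i"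
proof (induction i arbitrary: M)
  case 0
  have "(\<Sum>j\<le>M. poly (quad_coeff c 0 j) t * r ^ j) = (\<Sum>j\<le>M. if j = 0 then 1 else 0)"
    by (rule sum.cong) auto
  then show ?case by simp
next
  case (Suc i)
  define M' where "M' = M - 2"
  have M: "M = Suc (Suc M')" "2 * i \<le> M'" using Suc.prems by (auto simp: M'_def)
  let ?p = "\<lambda>j. poly (quad_coeff c i j) t"
  have "(\<Sum>j\<le>M. poly (quad_coeff c (Suc i) j) t * r ^ j)
     = c * (\<Sum>j\<le>M. ?p j * r ^ j) + (\<Sum>j\<le>M. (if j \<ge> 1 then - 2 * t * ?p (j - 1) else 0) * r ^ j) + (\<Sum>j\<le>M. (if j \<ge> 2 then ?p (j - 2) else 0) * r ^ j)"
    unfolding sum_distrib_left sum.distrib[symmetric] by (rule sum.cong) (auto simp: algebra_simps)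
  also have "(\<Sum>j\<le>M. (if j \<ge> 1 then - 2 * t * ?p (j - 1) else 0) * r ^ j) = - 2 * t * r * (\<Sum>j\<le>Suc M'. ?p j * r ^ j)"
    unfolding M(1) sum.atMost_Suc_shift[of _ "Suc M'"] sum_distrib_left by (simp add: mult_ac del: sum.atMost_Suc)
  also have "(\<Sum>j\<le>M. (if j \<ge> 2 then ?p (j - 2) else 0) * r ^ j) = r\<^sup>2 * (\<Sum>j\<le>M'. ?p j * r ^ j)"
    unfolding M(1) sum.atMost_Suc_shift[of _ "Suc M'"] sum.atMost_Suc_shift[of _ M'] sum_distrib_left by (simp add: mult_ac power2_eq_square del: sum.atMost_Suc)
  finally show ?case using Suc.IH[of M] Suc.IH[of M'] Suc.IH[of "Suc M'"] M by (simp add: algebra_simps del: sum.atMost_Suc)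
qed

text \<open>Power sums of the two roots of \<open>r\<^sup>2 = 2 * t * r + a\<close>, as polynomials in \<open>t\<close>.\<close>
fun root_power_sum :: "real \<Rightarrow> nat \<Rightarrow> real poly" where
  "root_power_sum a 0 = [:2:]"
| "root_power_sum a (Suc 0) = [:0, 2:]"
| "root_power_sum a (Suc (Suc j)) = [:0, 2:] * root_power_sum a (Suc j) + smult a (root_power_sum a j)"

lemma degree_root_power_sum: "degree (root_power_sum a j) \<le> j"
proof (induction a j rule: root_power_sum.induct)
  case (3 a j)
  have "degree ([:0, 2:] * root_power_sum a (Suc j)) \<le> Suc (Suc j)"
    using degree_mult_le[of "[:0, 2:]" "root_power_sum a (Suc j)"] 3 by simp
  moreover have "degree (smult a (root_power_sum a j)) \<le> Suc (Suc j)"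
    using degree_smult_le[of a "root_power_sum a j"] 3 by simp
  ultimately show ?case by (simp only: root_power_sum.simps) (intro degree_add_le)
qed auto

lemma poly_root_power_sum:
  assumes "r1 + r2 = 2 * t" "r1 * r2 = - a"
  shows "poly (root_power_sum a j) t = r1 ^ j + r2 ^ j"
proof -
  have r: "r1\<^sup>2 = 2 * t * r1 + a" "r2\<^sup>2 = 2 * t * r2 + a"
    using assms unfolding power2_eq_square by algebra+
  have "poly (root_power_sum a j) t = r1 ^ j + r2 ^ j \<and> poly (root_power_sum a (Suc j)) t = r1 ^ Suc j + r2 ^ Suc j"
  proof (induction j)
    case 0
    then show ?case using assms by simp
  next
    case (Suc j)
    have "r1 ^ Suc (Suc j) + r2 ^ Suc (Suc j) = r1 ^ j * r1\<^sup>2 + r2 ^ j * r2\<^sup>2"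
      by (simp add: power2_eq_square)
    also have "\<dots> = 2 * t * (r1 ^ Suc j + r2 ^ Suc j) + a * (r1 ^ j + r2 ^ j)"
      unfolding r by (simp add: algebra_simps)
    finally show ?case using Suc by simp
  qed
  then show ?thesis by blast
qed

text \<open>The two upper limits have product \<open>1 - c\<close>, so the logarithms produced by \<open>1 / r\<close> add up to a constant, while the remaining terms are power sums of the roots of a quadratic.\<close>
lemma ray_integral_symmetric:
  fixes q :: "real poly"
  assumes c: "0 \<le> c" and \<delta>: "0 < \<delta>" "sqrt c + \<delta> < 1"
  shows "\<exists>p. degree p \<le> 2 * degree q \<and> (\<forall>t. t\<^sup>2 \<le> c \<longrightarrow>
     (\<integral>r. indicator {\<delta><..t + sqrt (t\<^sup>2 + (1 - c))} r * (poly q (c - 2 * r * t + r\<^sup>2) / r) \<partial>lborel)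
   + (\<integral>r. indicator {\<delta><..- t + sqrt (t\<^sup>2 + (1 - c))} r * (poly q (c - 2 * r * (- t) + r\<^sup>2) / r) \<partial>lborel) = poly p t)"
proof -
  define m where "m = degree q"
  define M where "M = 2 * m"
  define a where "a = 1 - c"
  \<comment> \<open>In the application c = |x|^2 and t = x . \<theta> for a unit vector \<theta>;
    then \<open>R t\<close> is the value of r at which x - r \<theta> leaves the unit ball.\<close>
  define R where "R t = t + sqrt (t\<^sup>2 + a)" for t
  have sc: "sqrt c < 1" using \<delta> by linarith
  have c1: "c < 1" using sc by (metis real_sqrt_lt_1_iff)
  have a: "a > 0" using c1 by (simp add: a_def)
  define H where "H j = (\<Sum>i\<le>m. smult (coeff q i) (quad_coeff c i j))" for j
  have H_sum: "poly q (c - 2 * r * t + r\<^sup>2) = (\<Sum>j\<le>M. poly (H j) t * r ^ j)" for r t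
  proof -
    have "(\<Sum>j\<le>M. poly (H j) t * r ^ j) = (\<Sum>j\<le>M. \<Sum>i\<le>m. coeff q i * (poly (quad_coeff c i j) t * r ^ j))"
      unfolding H_def poly_sum sum_distrib_right by (simp add: mult.assoc)
    also have "\<dots> = (\<Sum>i\<le>m. coeff q i * (\<Sum>j\<le>M. poly (quad_coeff c i j) t * r ^ j))"
      by (subst sum.swap) (simp add: sum_distrib_left)
    also have "\<dots> = (\<Sum>i\<le>m. coeff q i * (c - 2 * r * t + r\<^sup>2) ^ i)"
      by (intro sum.cong) (auto simp: sum_quad_coeff M_def)
    finally show ?thesis by (simp add: poly_altdef m_def)
  qed
  have H_deg: "degree (H j) \<le> M - j" for j
    unfolding H_def
  proof (rule degree_sum_le)
    fix i assume "i \<in> {..m}"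
    then have "degree (quad_coeff c i j) \<le> M - j" using degree_quad_coeff[of c i j] by (auto simp: M_def)
    then show "degree (smult (coeff q i) (quad_coeff c i j)) \<le> M - j" using degree_smult_le order_trans by blast
  qed simp
  have H_par: "poly (H j) (- t) = (-1) ^ j * poly (H j) t" for j t
    unfolding H_def poly_sum sum_distrib_left by (simp add: poly_quad_coeff_minus mult_ac)
  have H_0: "poly (H 0) t = poly q c" for t
    unfolding H_def poly_sum quad_coeff_0 by (simp add: poly_altdef m_def)
  \<comment> \<open>A primitive in r. The logarithm belongs to j = 0 alone, and its coefficient is
    the constant q(c), independent of t.\<close>
  define \<Lambda> where "\<Lambda> t r = poly (H 0) t * ln r + (\<Sum>j=1..M. poly (H j) t * (r ^ j / real j))" for t r
  \<comment> \<open>The ball of radius \<delta> about x lies inside the unit ball, because |x| +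
    \<delta> < 1.\<close>
  have R: "\<delta> < R t" if t: "t\<^sup>2 \<le> c" for t
  proof -
    have "\<bar>t\<bar> \<le> sqrt c" using t by (metis real_sqrt_abs real_sqrt_le_mono)
    then have "- 2 * \<delta> * t \<le> 2 * \<delta> * sqrt c" using \<delta> mult_left_mono[of "- t" "sqrt c" "2 * \<delta>"] by (simp add: abs_le_iff)
    then have "\<delta>\<^sup>2 - 2 * \<delta> * t + c \<le> (sqrt c + \<delta>)\<^sup>2"
      using c by (simp add: power2_sum)
    also have "\<dots> < 1\<^sup>2" using \<delta> c by (intro power_strict_mono) auto
    finally have "(\<delta> - t)\<^sup>2 < t\<^sup>2 + a" by (simp add: a_def power2_diff algebra_simps)
    then have "\<delta> - t < sqrt (t\<^sup>2 + a)" using real_less_rsqrt by blast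
    then show ?thesis by (simp add: R_def)
  qed
  have I: "(\<integral>r. indicator {\<delta><..R t} r * (poly q (c - 2 * r * t + r\<^sup>2) / r) \<partial>lborel) = \<Lambda> t (R t) - \<Lambda> t \<delta>" if t: "t\<^sup>2 \<le> c" for t
  proof -
    have cont: "continuous_on {\<delta>..R t} (\<lambda>r. poly q (c - 2 * r * t + r\<^sup>2) / r)"
      using \<delta> by (intro continuous_intros) auto
    have i: "integrable lborel (\<lambda>r. indicator {\<delta>..R t} r * (poly q (c - 2 * r * t + r\<^sup>2) / r))"
      by (rule integrable_continuous_on_compact_indicator[OF _ cont]) auto
    have [measurable]: "poly q \<in> borel_measurable borel"
      by (intro borel_measurable_continuous_onI continuous_intros)
    have "(\<integral>r. indicator {\<delta><..R t} r * (poly q (c - 2 * r * t + r\<^sup>2) / r) \<partial>lborel)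
      = (\<integral>r. indicator {\<delta>..R t} r * (poly q (c - 2 * r * t + r\<^sup>2) / r) \<partial>lborel)"
    proof (rule integral_cong_AE)
      show "AE r in lborel. indicator {\<delta><..R t} r * (poly q (c - 2 * r * t + r\<^sup>2) / r) = indicator {\<delta>..R t} r * (poly q (c - 2 * r * t + r\<^sup>2) / r)"
        by (rule AE_I[where N="{\<delta>}"]) (auto simp: indicator_def)
    qed measurable
    also have "\<dots> = (\<integral>r. (poly q (c - 2 * r * t + r\<^sup>2) / r) * indicator {\<delta>..R t} r \<partial>lborel)"
      by (simp add: mult.commute)
    also have "\<dots> = \<Lambda> t (R t) - \<Lambda> t \<delta>"
    proof (rule integral_FTC_Icc_real)
      show "\<delta> \<le> R t" using R[OF t] by simp
      fix r assume "\<delta> \<le> r" "r \<le> R t"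
      then have r: "r > 0" using \<delta> by simp
      have "((\<lambda>r. poly (H 0) t * ln r) has_real_derivative poly (H 0) t * (1 / r)) (at r)"
        using r by (intro DERIV_cmult) (auto intro!: derivative_eq_intros)
      moreover have "((\<lambda>r. \<Sum>j=1..M. poly (H j) t * (r ^ j / real j)) has_real_derivative (\<Sum>j=1..M. poly (H j) t * (r ^ j / r))) (at r)"
      proof (intro DERIV_sum DERIV_cmult)
        fix j assume "j \<in> {1..M}"
        then obtain k where k: "j = Suc k" by (cases j) auto
        have "((\<lambda>r. r ^ Suc k / real (Suc k)) has_real_derivative (real (Suc k) * r ^ k) / real (Suc k)) (at r)"
          using DERIV_cdivide[OF DERIV_pow[of "Suc k" r UNIV], of "real (Suc k)"] by simp
        then show "((\<lambda>r. r ^ j / real j) has_real_derivative r ^ j / r) (at r)"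
          using r k by (simp del: of_nat_Suc)
      qed
      ultimately have "(\<Lambda> t has_real_derivative poly (H 0) t * (1 / r) + (\<Sum>j=1..M. poly (H j) t * (r ^ j / r))) (at r)"
        unfolding \<Lambda>_def[abs_def] by (rule DERIV_add)
      moreover have "poly (H 0) t * (1 / r) + (\<Sum>j=1..M. poly (H j) t * (r ^ j / r)) = poly q (c - 2 * r * t + r\<^sup>2) / r"
        unfolding H_sum atMost_atLeast0 sum.atLeast_Suc_atMost[of 0 M, simplified] by (simp add: sum_divide_distrib add_divide_distrib)
      ultimately show "(\<Lambda> t has_real_derivative poly q (c - 2 * r * t + r\<^sup>2) / r) (at r)" by simp
      show "isCont (\<lambda>r. poly q (c - 2 * r * t + r\<^sup>2) / r) r"
        using r by (intro continuous_intros) auto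
    qed
    finally show ?thesis .
  qed
  \<comment> \<open>The terms for t and - t are added. The logarithms at the upper limits give ln a.
    By the parity of \<open>H j\<close> the remaining upper terms contain R(t)^j + (- R(- t))^j, and
    the lower ones leave \<delta>^j for even j only. Degrees M - j from \<open>H j\<close> and j
    from the power sum add up to M.\<close>
  define p where "p = [:poly q c * (ln a - 2 * ln \<delta>):] + (\<Sum>j=1..M. smult (1 / real j) (H j * (root_power_sum a j - [:\<delta> ^ j * (1 + (-1) ^ j):])))"
  have "degree p \<le> M"
    unfolding p_def
  proof (intro degree_add_le degree_sum_le)
    fix j assume j: "j \<in> {1..M}"
    have "degree (root_power_sum a j - [:\<delta> ^ j * (1 + (-1) ^ j):]) \<le> j"
      by (intro degree_diff_le degree_root_power_sum) auto
    then have "degree (H j * (root_power_sum a j - [:\<delta> ^ j * (1 + (-1) ^ j):])) \<le> (M - j) + j"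
      using H_deg[of j] degree_mult_le[of "H j"] by (meson add_mono order_trans)
    then show "degree (smult (1 / real j) (H j * (root_power_sum a j - [:\<delta> ^ j * (1 + (-1) ^ j):]))) \<le> M"
      using j degree_smult_le order_trans by fastforce
  qed auto
  moreover have key: "\<Lambda> t (R t) - \<Lambda> t \<delta> + (\<Lambda> (- t) (R (- t)) - \<Lambda> (- t) \<delta>) = poly p t" if t: "t\<^sup>2 \<le> c" for t
  proof -
    have t': "(- t)\<^sup>2 \<le> c" using t by simp
    have Rp: "R t > 0" "R (- t) > 0" using R[OF t] R[OF t'] \<delta> by auto
    have sq: "(sqrt (t\<^sup>2 + a))\<^sup>2 = t\<^sup>2 + a" using a by (intro real_sqrt_pow2) (auto simp: add_nonneg_nonneg)
    have RR: "R t * R (- t) = a" unfolding R_def using sq by (simp add: algebra_simps power2_eq_square)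
    \<comment> \<open>\<open>R t\<close> and - \<open>R (- t)\<close> are the two roots of r^2 = 2 t
      r + a.\<close>
    have rs: "R t + (- R (- t)) = 2 * t" "R t * (- R (- t)) = - a"
      using arg_cong[OF RR, of uminus] by (simp add: R_def, simp only: mult_minus_right)
    have l: "ln (R t) + ln (R (- t)) = ln a" using RR Rp by (metis ln_mult_pos)
    have "\<Lambda> t (R t) - \<Lambda> t \<delta> + (\<Lambda> (- t) (R (- t)) - \<Lambda> (- t) \<delta>)
      = poly q c * (ln (R t) + ln (R (- t)) - 2 * ln \<delta>) +
        ((\<Sum>j=1..M. poly (H j) t * (R t ^ j / real j)) - (\<Sum>j=1..M. poly (H j) t * (\<delta> ^ j / real j))
         + ((\<Sum>j=1..M. poly (H j) (- t) * (R (- t) ^ j / real j)) - (\<Sum>j=1..M. poly (H j) (- t) * (\<delta> ^ j / real j))))"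
      unfolding \<Lambda>_def H_0 by (simp add: algebra_simps)
    also have "\<dots> = poly q c * (ln a - 2 * ln \<delta>) + (\<Sum>j=1..M. 1 / real j * (poly (H j) t * ((R t ^ j + (- R (- t)) ^ j) - \<delta> ^ j * (1 + (-1) ^ j))))"
      unfolding l sum_subtractf[symmetric] sum.distrib[symmetric] H_par power_minus[of "R (- t)"]
      by (intro arg_cong2[where f="(+)"] sum.cong refl) (simp add: field_simps)
    also have "\<dots> = poly p t"
      unfolding p_def poly_add poly_sum poly_root_power_sum[OF rs, symmetric] by simp
    finally show ?thesis .
  qed
  ultimately show ?thesis
  proof (intro exI[of _ p] conjI allI impI)
    fix t :: real assume t: "t\<^sup>2 \<le> c"
    show "(\<integral>r. indicator {\<delta><..t + sqrt (t\<^sup>2 + (1 - c))} r * (poly q (c - 2 * r * t + r\<^sup>2) / r) \<partial>lborel)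
      + (\<integral>r. indicator {\<delta><..- t + sqrt (t\<^sup>2 + (1 - c))} r * (poly q (c - 2 * r * (- t) + r\<^sup>2) / r) \<partial>lborel) = poly p t"
      using I[of t] I[of "- t"] key[OF t] t by (simp add: R_def a_def)
  qed (simp add: M_def m_def)
qed

lemma integrable_bounded_support:
  fixes f :: "'a::euclidean_space \<Rightarrow> real"
  assumes "f \<in> borel_measurable borel" and M: "\<And>y. \<bar>f y\<bar> \<le> M" and R: "\<And>y. norm y > R \<Longrightarrow> f y = 0"
  shows "integrable lborel f"
proof (rule Bochner_Integration.integrable_bound[where f="\<lambda>y. M * indicator (cball 0 R) y"])
  show "integrable lborel (\<lambda>y::'a. M * indicator (cball 0 R) y)"
    using emeasure_lborel_cball_finite[of "0::'a" R] by (intro integrable_mult_right) (simp add: top.not_eq_extremum)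
  show "AE y in lborel. norm (f y) \<le> norm (M * indicator (cball 0 R) y)"
    using M R by (intro AE_I2) (auto simp: indicator_def intro: order_trans[OF _ abs_ge_self])
qed (use assms in auto)

section \<open>The kernel, and its pairing with radial polynomials inside the ball\<close>

context harmonic_poly
begin

definition ker :: "real^'n \<Rightarrow> real" where
  "ker = pker (CARD('n) + d)"

lemma ker_eq: "ker y = P y / norm y ^ (CARD('n) + d)"
  by (simp add: ker_def pker_def)

lemma ker_borel [measurable]: "ker \<in> borel_measurable borel"
  unfolding ker_def by measurable

definition CP :: real where
  "CP = (SOME M. M \<ge> 0 \<and> (\<forall>z\<in>cball 0 1. \<bar>P z\<bar> \<le> M))"

lemma CP: "CP \<ge> 0" "norm z \<le> 1 \<Longrightarrow> \<bar>P z\<bar> \<le> CP"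
proof -
  have "\<exists>M. M \<ge> 0 \<and> (\<forall>z\<in>cball 0 1. \<bar>P z\<bar> \<le> M)"
    using continuous_on_compact_abs_bound[OF compact_cball P_cont, of 0 1] by metis
  then have "CP \<ge> 0 \<and> (\<forall>z\<in>cball 0 1. \<bar>P z\<bar> \<le> CP)" unfolding CP_def by (rule someI_ex)
  then show "CP \<ge> 0" "norm z \<le> 1 \<Longrightarrow> \<bar>P z\<bar> \<le> CP" by auto
qed

lemma ker_scale: "r > 0 \<Longrightarrow> ker (r *\<^sub>R y) = ker y / r ^ CARD('n)"
  unfolding ker_eq by (simp add: P_scale power_mult_distrib power_add)

lemma ker_bound: "\<bar>ker y\<bar> \<le> CP / norm y ^ CARD('n)"
proof (cases "y = 0")
  case False
  then have "ker y = ker (norm y *\<^sub>R sgn y)" by (simp add: sgn_div_norm)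
  also have "\<dots> = P (sgn y) / norm y ^ CARD('n)"
    using False by (subst ker_scale) (auto simp: ker_eq norm_sgn)
  finally show ?thesis using CP(2)[of "sgn y"] by (simp add: norm_sgn divide_right_mono split: if_splits)
qed (simp add: ker_eq power_0_left)

lemma P_even: "even d \<Longrightarrow> P (- y) = P y"
  using P_scale[of "-1" y] by simp

lemma ker_even: "even d \<Longrightarrow> ker (- y) = ker y"
  by (simp add: ker_eq P_even)

lemma ker_bound_away: "\<delta> > 0 \<Longrightarrow> norm y > \<delta> \<Longrightarrow> \<bar>ker y\<bar> \<le> CP / \<delta> ^ CARD('n)"
  using CP(1) by (intro order_trans[OF ker_bound] divide_left_mono power_mono mult_pos_pos zero_less_power) auto

lemma bounded_indicator_poly:
  fixes q :: "real poly"
  obtains M where "M \<ge> 0" "\<And>y::real^'n. \<bar>indicator (cball 0 1) y * poly q ((norm y)\<^sup>2)\<bar> \<le> M"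
proof -
  have "continuous_on (cball (0::real^'n) 1) (\<lambda>y. poly q ((norm y)\<^sup>2))" by (intro continuous_intros)
  from continuous_on_compact_abs_bound[OF compact_cball this]
  obtain M where "M \<ge> 0" "\<And>y::real^'n. y \<in> cball 0 1 \<Longrightarrow> \<bar>poly q ((norm y)\<^sup>2)\<bar> \<le> M" by metis
  then show ?thesis using that[of M] by (auto simp: indicator_def)
qed

lemma poly_norm_borel [measurable]: "(\<lambda>y::real^'n. poly q ((norm y)\<^sup>2)) \<in> borel_measurable borel"
  by (intro borel_measurable_continuous_onI continuous_intros)

text \<open>In polar coordinates the radial integral, symmetrised in the direction, is a polynomial of degree less than \<open>d\<close> in \<open>x \<bullet> sgn u\<close>, to which \<open>P\<close> is orthogonal.\<close>
lemma convolution_interior: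
  assumes d: "d = 2 * N" and N: "N > 0" and q: "degree q < N" and \<delta>: "0 < \<delta>" "norm x + \<delta> < 1"
  shows "(\<integral>y. (indicator {y. norm y > \<delta>} y * ker y) * (indicator (cball 0 1) (x - y) * poly q ((norm (x - y))\<^sup>2)) \<partial>lborel) = 0"
proof -
  let ?n = "CARD('n)"
  define f where "f y = (indicator {y. norm y > \<delta>} y * ker y) * (indicator (cball 0 1) (x - y) * poly q ((norm (x - y))\<^sup>2))" for y
  define c where "c = (norm x)\<^sup>2"
  define I where "I t = (\<integral>r. indicator {\<delta><..t + sqrt (t\<^sup>2 + (1 - c))} r * (poly q (c - 2 * r * t + r\<^sup>2) / r) \<partial>lborel)" for t
  have c: "0 \<le> c" "sqrt c + \<delta> < 1" "c < 1"
  proof -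
    have "norm x < 1" using \<delta> by linarith
    then show "c < 1" unfolding c_def by (simp add: power_less_one_iff)
  qed (use \<delta> in \<open>auto simp: c_def\<close>)
  obtain p where p: "degree p \<le> 2 * degree q" "\<And>t. t\<^sup>2 \<le> c \<Longrightarrow> I t + I (- t) = poly p t"
    using ray_integral_symmetric[OF c(1) \<delta>(1) c(2), of q] unfolding I_def by auto
  have [measurable]: "Measurable.pred borel (\<lambda>y::real^'n. \<delta> < norm y)" by measurable
  have fm: "f \<in> borel_measurable borel"
    unfolding f_def by measurable
  obtain M where M: "M \<ge> 0" "\<And>y::real^'n. \<bar>indicator (cball 0 1) y * poly q ((norm y)\<^sup>2)\<bar> \<le> M"
    using bounded_indicator_poly by blast
  have fi: "integrable lborel f"
  proof (rule integrable_bounded_support[OF fm])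
    show "\<bar>f y\<bar> \<le> CP / \<delta> ^ ?n * M" for y
      unfolding f_def abs_mult[of "_ * ker y"]
      by (rule mult_mono) (use ker_bound_away[OF \<delta>(1), of y] M(2)[of "x - y"] CP(1) \<delta> in \<open>auto simp: indicator_def\<close>)
    show "f y = 0" if "norm y > 2" for y
    proof -
      have "norm (x - y) > 1" using norm_triangle_ineq2[of y x] that \<delta> by (simp add: norm_minus_commute)
      then show ?thesis by (simp add: f_def)
    qed
  qed
  define G where "G u = indicator (ball 0 1) u * (real ?n * P (sgn u) * I (x \<bullet> sgn u))" for u
  have inner: "(\<integral>r. polar_density TYPE(real^'n) r * f (r *\<^sub>R sgn u) \<partial>lborel) = real ?n * P (sgn u) * I (x \<bullet> sgn u)" for u
  proof (cases "u = 0")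
    case True
    have "P 0 = 0" using P_scale[of 0 0] d N by (simp add: power_0_left)
    then show ?thesis using True \<delta> by (simp add: f_def)
  next
    case False
    define \<theta> where "\<theta> = sgn u"
    have th: "norm \<theta> = 1" using False by (simp add: \<theta>_def norm_sgn)
    define t where "t = x \<bullet> \<theta>"
    have "polar_density TYPE(real^'n) r * f (r *\<^sub>R \<theta>) = real ?n * P \<theta> * (indicator {\<delta><..t + sqrt (t\<^sup>2 + (1 - c))} r * (poly q (c - 2 * r * t + r\<^sup>2) / r))" for r
    proof (cases "r > \<delta>")
      case False
      then have "f (r *\<^sub>R \<theta>) = 0 \<or> r \<le> 0" using th by (auto simp: f_def indicator_def)
      then show ?thesis using False by (auto simp: polar_density_def)
    next
      case True
      then have r: "r > 0" using \<delta> by simp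
      have nx: "(norm (x - r *\<^sub>R \<theta>))\<^sup>2 = c - 2 * r * t + r\<^sup>2"
      proof -
        have "(norm (x - r *\<^sub>R \<theta>))\<^sup>2 = x \<bullet> x - 2 * r * (x \<bullet> \<theta>) + r\<^sup>2 * (\<theta> \<bullet> \<theta>)"
          unfolding power2_norm_eq_inner by (simp add: inner_simps inner_commute algebra_simps power2_eq_square)
        also have "\<theta> \<bullet> \<theta> = 1" using th by (simp add: norm_eq_1)
        finally show ?thesis by (simp add: c_def t_def power2_norm_eq_inner)
      qed
      \<comment> \<open>For |x| < 1 the smaller root t - sqrt (...) is not positive, so for r > 0
        only the larger root limits r.\<close>
      have iff: "norm (x - r *\<^sub>R \<theta>) \<le> 1 \<longleftrightarrow> r \<le> t + sqrt (t\<^sup>2 + (1 - c))"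
      proof -
        have "norm (x - r *\<^sub>R \<theta>) \<le> 1 \<longleftrightarrow> (norm (x - r *\<^sub>R \<theta>))\<^sup>2 \<le> 1" by (simp add: abs_square_le_1)
        also have "\<dots> \<longleftrightarrow> (r - t)\<^sup>2 \<le> t\<^sup>2 + (1 - c)" unfolding nx by (simp add: power2_eq_square algebra_simps)
        also have "\<dots> \<longleftrightarrow> \<bar>r - t\<bar> \<le> sqrt (t\<^sup>2 + (1 - c))" unfolding real_sqrt_abs[of "r - t", symmetric] real_sqrt_le_iff ..
        also have "\<dots> \<longleftrightarrow> r \<le> t + sqrt (t\<^sup>2 + (1 - c))"
        proof -
          have "\<bar>t\<bar> \<le> sqrt (t\<^sup>2 + (1 - c))" using c real_sqrt_le_mono[of "t\<^sup>2" "t\<^sup>2 + (1 - c)"] by simp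
          then show ?thesis using r by (auto simp: abs_le_iff)
        qed
        finally show ?thesis .
      qed
      have k: "ker (r *\<^sub>R \<theta>) = P \<theta> / r ^ ?n" using r th by (subst ker_scale) (auto simp: ker_eq)
      have "polar_density TYPE(real^'n) r * f (r *\<^sub>R \<theta>) = real ?n * P \<theta> * (r ^ (?n - 1) * (1 / r ^ ?n)) * (indicator {\<delta><..t + sqrt (t\<^sup>2 + (1 - c))} r * poly q (c - 2 * r * t + r\<^sup>2))"
        using r True th iff unfolding f_def k nx by (auto simp: polar_density_def indicator_def)
      \<comment> \<open>The volume factor r^(n-1) meets the decay r^(-n) of the kernel: this is the
        1 / r of the ray integrals.\<close>
      moreover have "r ^ (?n - 1) * (1 / r ^ ?n) = 1 / r"
        using r power_minus_mult[of ?n r] by (simp add: field_simps)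
      ultimately show ?thesis by (simp only:) simp
    qed
    then have "(\<integral>r. polar_density TYPE(real^'n) r * f (r *\<^sub>R \<theta>) \<partial>lborel) = real ?n * P \<theta> * I t"
      unfolding I_def integral_mult_right_zero[symmetric] by (simp only:)
    then show ?thesis by (simp add: \<theta>_def t_def)
  qed
  have Gi: "integrable lborel G"
    using lborel_pair.integrable_fst'[OF integrable_polar[OF fi]] by (simp add: inner G_def[abs_def])
  have fG: "(\<integral>y. f y \<partial>lborel) = (\<integral>u. G u \<partial>lborel)"
    unfolding integral_polar[OF fi] inner G_def ..
  \<comment> \<open>Averaging over u and - u replaces I(t) by I(t) + I(- t), because P is even. Only
    this sum is a polynomial in t.\<close>
  have "(\<integral>u. G (0 - u) \<partial>lborel) = (\<integral>u. G u \<partial>lborel)" by (rule integral_lborel_reflect)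
  moreover have "integrable lborel (\<lambda>u. G (0 - u))" using Gi by (subst integrable_lborel_reflect)
  ultimately have "2 * (\<integral>u. G u \<partial>lborel) = (\<integral>u. G u + G (0 - u) \<partial>lborel)"
    using Gi by simp
  also have "\<dots> = (\<integral>u. (\<Sum>k\<le>degree p. real ?n * coeff p k * (indicator (ball 0 1) u * (P (sgn u) * (x \<bullet> sgn u) ^ k))) \<partial>lborel)"
  proof (rule Bochner_Integration.integral_cong[OF refl])
    fix u :: "real^'n"
    have "\<bar>x \<bullet> sgn u\<bar> \<le> norm x * norm (sgn u)" by (rule Cauchy_Schwarz_ineq2)
    also have "\<dots> \<le> norm x" by (simp add: norm_sgn)
    finally have t: "(x \<bullet> sgn u)\<^sup>2 \<le> c" unfolding c_def by (simp add: abs_le_square_iff[symmetric])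
    have "G u + G (0 - u) = indicator (ball 0 1) u * (real ?n * P (sgn u) * (I (x \<bullet> sgn u) + I (- (x \<bullet> sgn u))))"
      using P_even[of "sgn u"] d unfolding G_def by (simp add: sgn_minus indicator_def algebra_simps)
    also have "\<dots> = indicator (ball 0 1) u * (real ?n * P (sgn u) * (\<Sum>k\<le>degree p. coeff p k * (x \<bullet> sgn u) ^ k))"
      unfolding p(2)[OF t] by (simp add: poly_altdef)
    finally show "G u + G (0 - u) = (\<Sum>k\<le>degree p. real ?n * coeff p k * (indicator (ball 0 1) u * (P (sgn u) * (x \<bullet> sgn u) ^ k)))"
      by (simp only: sum_distrib_left mult_ac)
  qed
  also have "\<dots> = (\<Sum>k\<le>degree p. real ?n * coeff p k * sphere_moment k x)"
  proof -
    have "integrable lborel (\<lambda>u. indicator (ball 0 1) u * (P (sgn u) * (x \<bullet> sgn u) ^ k))" for k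
    proof (rule integrable_bounded_support[where R=1])
      fix u :: "real^'n"
      have ns: "norm (sgn u) \<le> 1" by (simp add: norm_sgn)
      have "\<bar>x \<bullet> sgn u\<bar> \<le> norm x"
        using Cauchy_Schwarz_ineq2[of x "sgn u"] mult_left_mono[OF ns, of "norm x"] by simp
      then have "\<bar>P (sgn u)\<bar> * \<bar>x \<bullet> sgn u\<bar> ^ k \<le> CP * norm x ^ k"
        using CP ns by (intro mult_mono power_mono) auto
      moreover have "0 \<le> CP * norm x ^ k" using CP by simp
      ultimately show "\<bar>indicator (ball 0 1) u * (P (sgn u) * (x \<bullet> sgn u) ^ k)\<bar> \<le> CP * norm x ^ k"
        by (auto simp: indicator_def abs_mult power_abs)
    qed (auto simp: indicator_def)
    then have "(\<integral>u. (\<Sum>k\<le>degree p. real ?n * coeff p k * (indicator (ball 0 1) u * (P (sgn u) * (x \<bullet> sgn u) ^ k))) \<partial>lborel)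
      = (\<Sum>k\<le>degree p. \<integral>u. real ?n * coeff p k * (indicator (ball 0 1) u * (P (sgn u) * (x \<bullet> sgn u) ^ k)) \<partial>lborel)"
      by (intro Bochner_Integration.integral_sum integrable_mult_right)
    then show ?thesis unfolding sphere_moment_def integral_mult_right_zero .
  qed
  \<comment> \<open>From \<open>degree q < N\<close> it follows that 2 \<open>degree q\<close> < d,
    so every moment that occurs has order less than d.\<close>
  also have "\<dots> = 0"
    using p(1) q d by (intro sum.neutral ballI) (simp add: sphere_moment_zero)
  finally have "(\<integral>u. G u \<partial>lborel) = 0" by simp
  then show ?thesis using fG unfolding f_def by simp
qed

end

section \<open>Convolution and almost orthogonality\<close>

text \<open>Borel functions instead of Lebesgue measurable ones or classes: joint measurability in
  product spaces is then immediate, and the averages below have definite values at every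
  point.\<close>

definition l2fun :: "('a::euclidean_space \<Rightarrow> real) \<Rightarrow> bool" where
  "l2fun f \<longleftrightarrow> f \<in> borel_measurable borel \<and> integrable lborel (\<lambda>x. (f x)\<^sup>2)"

definition l2norm :: "('a::euclidean_space \<Rightarrow> real) \<Rightarrow> real" where
  "l2norm f = sqrt (\<integral>x. (f x)\<^sup>2 \<partial>lborel)"

definition l1norm :: "('a::euclidean_space \<Rightarrow> real) \<Rightarrow> real" where
  "l1norm f = (\<integral>x. \<bar>f x\<bar> \<partial>lborel)"

lemma l2fun_measurable [measurable_dest]: "l2fun f \<Longrightarrow> f \<in> borel_measurable borel"
  by (simp add: l2fun_def)

lemma l2norm_nonneg [simp]: "0 \<le> l2norm f"
  by (simp add: l2norm_def)

lemma l1norm_nonneg [simp]: "0 \<le> l1norm f"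
  by (simp add: l1norm_def)

lemma l2norm_square: "(l2norm f)\<^sup>2 = (\<integral>x. (f x)\<^sup>2 \<partial>lborel)"
  by (simp add: l2norm_def)

lemma l2fun_mult_integrable:
  assumes "l2fun f" "l2fun g"
  shows "integrable lborel (\<lambda>x. f x * g x)"
proof (rule Bochner_Integration.integrable_bound[where f="\<lambda>x. (f x)\<^sup>2 + (g x)\<^sup>2"])
  show "integrable lborel (\<lambda>x. (f x)\<^sup>2 + (g x)\<^sup>2)" using assms by (auto simp: l2fun_def)
  show "AE x in lborel. norm (f x * g x) \<le> norm ((f x)\<^sup>2 + (g x)\<^sup>2)"
  proof (rule AE_I2)
    fix x
    have "2 * \<bar>f x\<bar> * \<bar>g x\<bar> \<le> \<bar>f x\<bar>\<^sup>2 + \<bar>g x\<bar>\<^sup>2" by (rule sum_squares_bound)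
    moreover have "0 \<le> \<bar>f x\<bar> * \<bar>g x\<bar>" by simp
    ultimately have "\<bar>f x\<bar> * \<bar>g x\<bar> \<le> (f x)\<^sup>2 + (g x)\<^sup>2" unfolding power2_abs mult.assoc by linarith
    then show "norm (f x * g x) \<le> norm ((f x)\<^sup>2 + (g x)\<^sup>2)"
      by (simp add: abs_mult)
  qed
qed (use assms in \<open>auto simp: l2fun_def\<close>)

lemma l2fun_add: "l2fun f \<Longrightarrow> l2fun g \<Longrightarrow> l2fun (\<lambda>x. f x + g x)"
  using l2fun_mult_integrable[of f g] by (auto simp: l2fun_def power2_sum mult.assoc)

lemma l2fun_cmult: "l2fun f \<Longrightarrow> l2fun (\<lambda>x. c * f x)"
  by (auto simp: l2fun_def power_mult_distrib)

lemma l2fun_diff: "l2fun f \<Longrightarrow> l2fun g \<Longrightarrow> l2fun (\<lambda>x. f x - g x)"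
  using l2fun_add[of f "\<lambda>x. (-1) * g x"] l2fun_cmult[of g "-1"] by simp

lemma l2fun_abs: "l2fun f \<Longrightarrow> l2fun (\<lambda>x. \<bar>f x\<bar>)"
  by (auto simp: l2fun_def)

lemma l2norm_cauchy_schwarz:
  assumes f: "l2fun f" and g: "l2fun g"
  shows "\<bar>\<integral>x. f x * g x \<partial>lborel\<bar> \<le> l2norm f * l2norm g"
proof -
  let ?F = "\<integral>x. (f x)\<^sup>2 \<partial>lborel" and ?G = "\<integral>x. (g x)\<^sup>2 \<partial>lborel" and ?H = "\<integral>x. f x * g x \<partial>lborel"
  have fg: "integrable lborel (\<lambda>x. f x * g x)" by (rule l2fun_mult_integrable[OF f g])
  have quad: "0 \<le> s\<^sup>2 * ?F - 2 * (s * t) * ?H + t\<^sup>2 * ?G" for s t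
  proof -
    have "0 \<le> (\<integral>x. (s * f x - t * g x)\<^sup>2 \<partial>lborel)" by simp
    also have "\<dots> = (\<integral>x. s\<^sup>2 * (f x)\<^sup>2 - 2 * (s * t) * (f x * g x) + t\<^sup>2 * (g x)\<^sup>2 \<partial>lborel)"
      by (rule Bochner_Integration.integral_cong) (auto simp: power2_diff power_mult_distrib algebra_simps)
    also have "\<dots> = s\<^sup>2 * ?F - 2 * (s * t) * ?H + t\<^sup>2 * ?G"
      using f g fg by (simp add: l2fun_def)
    finally show ?thesis .
  qed
  have "?H\<^sup>2 \<le> ?F * ?G"
  proof (cases "?G = 0")
    case False
    then have G: "?G > 0" by (simp add: order_less_le)
    have "0 \<le> ?G\<^sup>2 * ?F - 2 * (?G * ?H) * ?H + ?H\<^sup>2 * ?G" by (rule quad)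
    then have "0 \<le> ?G * (?G * ?F - ?H\<^sup>2)" by (simp add: algebra_simps power2_eq_square)
    then show ?thesis using G by (simp add: zero_le_mult_iff mult.commute)
  next
    case True
    have "?H = 0"
    proof (rule ccontr)
      assume H: "?H \<noteq> 0"
      \<comment> \<open>If g has norm zero, the form is linear in t; this choice of t makes it equal
        to - ?F - 2, which is negative.\<close>
      have "0 \<le> 1\<^sup>2 * ?F - 2 * (1 * ((?F + 1) / ?H)) * ?H + ((?F + 1) / ?H)\<^sup>2 * ?G" by (rule quad)
      then have "0 \<le> - ?F - 2" using H True by simp
      moreover have "0 \<le> ?F" by simp
      ultimately show False by linarith
    qed
    then show ?thesis by simp
  qed
  then have "sqrt (?H\<^sup>2) \<le> sqrt (?F * ?G)" by (rule real_sqrt_le_mono)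
  then show ?thesis by (simp add: l2norm_def real_sqrt_mult)
qed

lemma l2norm_triangle:
  assumes f: "l2fun f" and g: "l2fun g"
  shows "l2norm (\<lambda>x. f x + g x) \<le> l2norm f + l2norm g"
proof -
  have "(l2norm (\<lambda>x. f x + g x))\<^sup>2 = (l2norm f)\<^sup>2 + (l2norm g)\<^sup>2 + 2 * (\<integral>x. f x * g x \<partial>lborel)"
    unfolding l2norm_square using f g l2fun_mult_integrable[OF f g] by (simp add: power2_sum mult.assoc l2fun_def)
  also have "\<dots> \<le> (l2norm f)\<^sup>2 + (l2norm g)\<^sup>2 + 2 * (l2norm f * l2norm g)"
    using l2norm_cauchy_schwarz[OF f g] by simp
  also have "\<dots> = (l2norm f + l2norm g)\<^sup>2" by (simp add: power2_sum)
  finally show ?thesis by (rule power2_le_imp_le) simp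
qed

lemma l2fun_sum: "finite I \<Longrightarrow> (\<And>i. i \<in> I \<Longrightarrow> l2fun (f i)) \<Longrightarrow> l2fun (\<lambda>x. \<Sum>i\<in>I. f i x)"
proof (induction I rule: finite_induct)
  case empty
  then show ?case by (simp add: l2fun_def)
next
  case (insert i I)
  then show ?case using l2fun_add[of "f i" "\<lambda>x. \<Sum>i\<in>I. f i x"] by simp
qed

lemma l2norm_sum: "finite I \<Longrightarrow> (\<And>i. i \<in> I \<Longrightarrow> l2fun (f i)) \<Longrightarrow> l2norm (\<lambda>x. \<Sum>i\<in>I. f i x) \<le> (\<Sum>i\<in>I. l2norm (f i))"
proof (induction I rule: finite_induct)
  case empty
  then show ?case by (simp add: l2norm_def)
next
  case (insert i I)
  have "l2fun (\<lambda>x. \<Sum>i\<in>I. f i x)" by (rule l2fun_sum) (use insert in auto)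
  then have "l2norm (\<lambda>x. f i x + (\<Sum>i\<in>I. f i x)) \<le> l2norm (f i) + l2norm (\<lambda>x. \<Sum>i\<in>I. f i x)"
    by (intro l2norm_triangle) (use insert in auto)
  moreover have "l2norm (\<lambda>x. \<Sum>i\<in>I. f i x) \<le> (\<Sum>i\<in>I. l2norm (f i))" using insert by blast
  ultimately show ?case using insert.hyps by simp
qed

text \<open>Bounded Borel functions of bounded support form a class stable under products, shifts
  and convolution, on which all exchanges of integrals are justified at once. General functions of
  \<open>l2fun\<close> are reached from it by cutting off and by Fatou's lemma.\<close>

definition bcs :: "('a::euclidean_space \<Rightarrow> real) \<Rightarrow> bool" where
  "bcs f \<longleftrightarrow> f \<in> borel_measurable borel \<and> (\<exists>M. \<forall>x. \<bar>f x\<bar> \<le> M) \<and> (\<exists>R. \<forall>x. norm x > R \<longrightarrow> f x = 0)"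

lemma bcsI: "f \<in> borel_measurable borel \<Longrightarrow> (\<And>x. \<bar>f x\<bar> \<le> M) \<Longrightarrow> (\<And>x. norm x > R \<Longrightarrow> f x = 0) \<Longrightarrow> bcs f"
  unfolding bcs_def by blast

lemma bcsE:
  assumes "bcs f"
  obtains M R where "f \<in> borel_measurable borel" "M \<ge> 0" "R \<ge> 0" "\<And>x. \<bar>f x\<bar> \<le> M" "\<And>x. norm x > R \<Longrightarrow> f x = 0"
proof -
  obtain M R where 1: "f \<in> borel_measurable borel" "\<And>x. \<bar>f x\<bar> \<le> M" "\<And>x. norm x > R \<Longrightarrow> f x = 0"
    using assms unfolding bcs_def by blast
  moreover have "M \<ge> 0" using 1(2)[of 0] by linarith
  ultimately show ?thesis using that[of M "max 0 R"] by simp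
qed

lemma bcs_measurable [measurable_dest]: "bcs f \<Longrightarrow> f \<in> borel_measurable borel"
  by (simp add: bcs_def)

lemma bcs_integrable: "bcs f \<Longrightarrow> integrable lborel f"
  by (erule bcsE) (rule integrable_bounded_support)

lemma bcs_mult: "bcs f \<Longrightarrow> bcs g \<Longrightarrow> bcs (\<lambda>x. f x * g x)"
proof -
  assume f: "bcs f" and g: "bcs g"
  obtain M R where 1: "f \<in> borel_measurable borel" "M \<ge> 0" "\<And>x. \<bar>f x\<bar> \<le> M" "\<And>x. norm x > R \<Longrightarrow> f x = 0"
    using bcsE[OF f] by metis
  obtain M' R' where 2: "g \<in> borel_measurable borel" "\<And>x. \<bar>g x\<bar> \<le> M'" "\<And>x. norm x > R' \<Longrightarrow> g x = 0"
    using bcsE[OF g] by metis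
  show ?thesis
    by (rule bcsI[of _ "M * M'" R]) (use 1 2 in \<open>auto simp: abs_mult intro!: mult_mono\<close>)
qed

lemma bcs_abs: "bcs f \<Longrightarrow> bcs (\<lambda>x. \<bar>f x\<bar>)"
  unfolding bcs_def by force

lemma bcs_add: "bcs f \<Longrightarrow> bcs g \<Longrightarrow> bcs (\<lambda>x. f x + g x)"
proof -
  assume f: "bcs f" and g: "bcs g"
  obtain M R where 1: "f \<in> borel_measurable borel" "\<And>x. \<bar>f x\<bar> \<le> M" "\<And>x. norm x > R \<Longrightarrow> f x = 0"
    using bcsE[OF f] by metis
  obtain M' R' where 2: "g \<in> borel_measurable borel" "\<And>x. \<bar>g x\<bar> \<le> M'" "\<And>x. norm x > R' \<Longrightarrow> g x = 0"
    using bcsE[OF g] by metis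
  show ?thesis
    by (rule bcsI[of _ "M + M'" "max R R'"])
       (use 1 2 in \<open>auto intro!: order_trans[OF abs_triangle_ineq] add_mono\<close>)
qed

lemma bcs_sum: "finite I \<Longrightarrow> (\<And>i. i \<in> I \<Longrightarrow> bcs (f i)) \<Longrightarrow> bcs (\<lambda>x. \<Sum>i\<in>I. f i x)"
proof (induction I rule: finite_induct)
  case empty
  then show ?case using bcsI[of "\<lambda>_. 0" 0 0] by simp
next
  case (insert i I)
  then show ?case using bcs_add[of "f i" "\<lambda>x. \<Sum>i\<in>I. f i x"] by simp
qed

lemma bcs_l2fun: "bcs f \<Longrightarrow> l2fun f"
  using bcs_integrable[OF bcs_mult[of f f]] by (simp add: l2fun_def power2_eq_square bcs_measurable)

lemma bcs_shift: "bcs f \<Longrightarrow> bcs (\<lambda>y. f (x - y))"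
proof -
  assume f: "bcs f"
  obtain M R where 1: "f \<in> borel_measurable borel" "\<And>x. \<bar>f x\<bar> \<le> M" "\<And>x. norm x > R \<Longrightarrow> f x = 0"
    using bcsE[OF f] by metis
  show ?thesis
  proof (rule bcsI[of _ M "norm x + R"])
    show "f (x - y) = 0" if "norm y > norm x + R" for y
      using norm_triangle_ineq2[of y x] that by (intro 1(3)) (simp add: norm_minus_commute)
  qed (use 1 in auto)
qed

section \<open>Convolution\<close>

definition conv :: "('a::euclidean_space \<Rightarrow> real) \<Rightarrow> ('a \<Rightarrow> real) \<Rightarrow> 'a \<Rightarrow> real" where
  "conv f g x = (\<integral>y. f y * g (x - y) \<partial>lborel)"

lemma conv_integrable: "bcs f \<Longrightarrow> bcs g \<Longrightarrow> integrable lborel (\<lambda>y. f y * g (x - y))"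
  by (intro bcs_integrable bcs_mult bcs_shift)

lemma conv_measurable [measurable]:
  assumes [measurable]: "f \<in> borel_measurable borel" "g \<in> borel_measurable borel"
  shows "conv f g \<in> borel_measurable borel"
proof -
  have "(\<lambda>x. \<integral>y. f y * g (x - y) \<partial>lborel) \<in> borel_measurable borel"
    by (rule lborel.borel_measurable_lebesgue_integral) (simp add: split_beta')
  then show ?thesis unfolding conv_def[abs_def] .
qed

lemma bcs_conv:
  assumes f: "bcs f" and g: "bcs g"
  shows "bcs (conv f g)"
proof -
  obtain M R where 1: "f \<in> borel_measurable borel" "\<And>x. norm x > R \<Longrightarrow> f x = 0"
    using bcsE[OF f] by metis
  obtain M' R' where 2: "g \<in> borel_measurable borel" "M' \<ge> 0" "\<And>x. \<bar>g x\<bar> \<le> M'" "\<And>x. norm x > R' \<Longrightarrow> g x = 0"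
    using bcsE[OF g] by metis
  show ?thesis
  proof (rule bcsI[of _ "M' * l1norm f" "R + R'"])
    show "conv f g \<in> borel_measurable borel" using 1 2 by measurable
    fix x
    have "\<bar>conv f g x\<bar> \<le> (\<integral>y. \<bar>f y * g (x - y)\<bar> \<partial>lborel)"
      unfolding conv_def by (rule integral_abs_bound)
    also have "\<dots> \<le> (\<integral>y. M' * \<bar>f y\<bar> \<partial>lborel)"
    proof (rule integral_mono)
      show "integrable lborel (\<lambda>y. \<bar>f y * g (x - y)\<bar>)" using conv_integrable[OF f g] by (rule integrable_abs)
      show "integrable lborel (\<lambda>y. M' * \<bar>f y\<bar>)" using bcs_integrable[OF bcs_abs[OF f]] by simp
      show "\<bar>f y * g (x - y)\<bar> \<le> M' * \<bar>f y\<bar>" for y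
        unfolding abs_mult mult.commute[of M'] by (intro mult_left_mono 2(3)) simp
    qed
    finally show "\<bar>conv f g x\<bar> \<le> M' * l1norm f" by (simp add: l1norm_def)
    assume x: "norm x > R + R'"
    have fg0: "f y * g (x - y) = 0" for y
    proof (cases "norm y > R")
      case False
      then have "norm (x - y) > R'" using norm_triangle_ineq2[of x y] x by simp
      then show ?thesis using 2 by simp
    qed (use 1 in simp)
    show "conv f g x = 0" unfolding conv_def fg0 by simp
  qed
qed

lemma conv_commute: "conv f g x = conv g f x"
proof -
  have "conv f g x = (\<integral>y. f (x - y) * g (x - (x - y)) \<partial>lborel)"
    unfolding conv_def by (rule integral_lborel_reflect[of "\<lambda>y. f y * g (x - y)", symmetric])
  then show ?thesis by (simp add: conv_def mult.commute)
qed

lemma conv_triple_integrable: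
  assumes f: "bcs f" and g: "bcs g" and h: "bcs h"
  shows "integrable (lborel \<Otimes>\<^sub>M lborel) (\<lambda>(y, z). f y * g (z - y) * h (x - z))"
proof -
  obtain M1 R1 where 1: "f \<in> borel_measurable borel" "M1 \<ge> 0" "\<And>x. \<bar>f x\<bar> \<le> M1" "\<And>x. norm x > R1 \<Longrightarrow> f x = 0"
    using bcsE[OF f] by metis
  obtain M2 R2 where 2: "g \<in> borel_measurable borel" "M2 \<ge> 0" "\<And>x. \<bar>g x\<bar> \<le> M2"
    using bcsE[OF g] by metis
  obtain M3 R3 where 3: "(\<lambda>z. h (x - z)) \<in> borel_measurable borel" "M3 \<ge> 0" "\<And>z. \<bar>h (x - z)\<bar> \<le> M3" "\<And>z. norm z > R3 \<Longrightarrow> h (x - z) = 0"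
    using bcsE[OF bcs_shift[OF h, of x]] by metis
  have [measurable]: "h \<in> borel_measurable borel" using h by measurable
  note [measurable] = 1(1) 2(1) 3(1)
  have "integrable lborel (\<lambda>(y, z). f y * g (z - y) * h (x - z))"
  proof (rule integrable_bounded_support[of _ "M1 * M2 * M3" "\<bar>R1\<bar> + \<bar>R3\<bar>"])
    show "(\<lambda>(y, z). f y * g (z - y) * h (x - z)) \<in> borel_measurable borel"
      unfolding borel_prod[symmetric] by measurable
    show "\<bar>case yz of (y, z) \<Rightarrow> f y * g (z - y) * h (x - z)\<bar> \<le> M1 * M2 * M3" for yz
      using 1 2 3 by (auto simp: abs_mult split: prod.split intro!: mult_mono)
    show "(case yz of (y, z) \<Rightarrow> f y * g (z - y) * h (x - z)) = 0" if "norm yz > \<bar>R1\<bar> + \<bar>R3\<bar>" for yz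
    proof -
      obtain y z where yz: "yz = (y, z)" by (cases yz)
      have "norm yz \<le> norm y + norm z" unfolding yz by (rule norm_Pair_le)
      then have "norm y > R1 \<or> norm z > R3" using that by linarith
      then show ?thesis unfolding yz using 1 3 by auto
    qed
  qed
  then show ?thesis unfolding lborel_prod .
qed

lemma conv_assoc:
  assumes f: "bcs f" and g: "bcs g" and h: "bcs h"
  shows "conv (conv f g) h x = conv f (conv g h) x"
proof -
  have "conv (conv f g) h x = (\<integral>z. (\<integral>y. f y * g (z - y) * h (x - z) \<partial>lborel) \<partial>lborel)"
    unfolding conv_def by simp
  also have "\<dots> = (\<integral>y. (\<integral>z. f y * g (z - y) * h (x - z) \<partial>lborel) \<partial>lborel)"
    by (rule lborel_pair.Fubini_integral[OF conv_triple_integrable[OF f g h]])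
  also have "\<dots> = (\<integral>y. f y * conv g h (x - y) \<partial>lborel)"
  proof (rule Bochner_Integration.integral_cong[OF refl])
    fix y
    have "(\<integral>z. f y * g (z - y) * h (x - z) \<partial>lborel) = (\<integral>w. f y * g (y + w - y) * h (x - (y + w)) \<partial>lborel)"
      by (rule integral_lborel_translate[symmetric])
    also have "\<dots> = f y * conv g h (x - y)"
      by (simp add: conv_def mult.assoc diff_diff_eq)
    finally show "(\<integral>z. f y * g (z - y) * h (x - z) \<partial>lborel) = f y * conv g h (x - y)" .
  qed
  finally show ?thesis by (simp add: conv_def)
qed

text \<open>The case of three factors is applied with the indicator of a ball outside which the
  product of the other two is zero anyway.\<close>

lemma conv_pair_integrable:
  assumes f: "bcs f" and g: "bcs g"
  shows "integrable (lborel \<Otimes>\<^sub>M lborel) (\<lambda>(y, z). f y * g (z - y))"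
proof -
  obtain R where R: "\<And>x. norm x > R \<Longrightarrow> f x = 0" using bcsE[OF f] by metis
  obtain R' where R': "\<And>x. norm x > R' \<Longrightarrow> g x = 0" using bcsE[OF g] by metis
  define h :: "'a \<Rightarrow> real" where "h = indicator (cball 0 (R + R'))"
  have "bcs h" unfolding h_def by (rule bcsI[of _ 1 "R + R'"]) (auto simp: indicator_def)
  from conv_triple_integrable[OF f g this, of 0]
  have "integrable (lborel \<Otimes>\<^sub>M lborel) (\<lambda>(y, z). f y * g (z - y) * h (0 - z))" .
  moreover have "(\<lambda>(y, z). f y * g (z - y) * h (0 - z)) = (\<lambda>(y, z). f y * g (z - y))"
  proof (intro ext, clarify)
    fix y z :: 'a
    show "f y * g (z - y) * h (0 - z) = f y * g (z - y)"
    proof (cases "norm z \<le> R + R'")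
      case False
      then have "norm y > R \<or> norm (z - y) > R'" using norm_triangle_ineq2[of z y] by linarith
      then show ?thesis using R R' by auto
    qed (simp add: h_def)
  qed
  ultimately show ?thesis by simp
qed

lemma l1norm_conv:
  assumes f: "bcs f" and g: "bcs g"
  shows "l1norm (conv f g) \<le> l1norm f * l1norm g"
proof -
  have i: "integrable (lborel \<Otimes>\<^sub>M lborel) (\<lambda>(y, z). \<bar>f y\<bar> * \<bar>g (z - y)\<bar>)"
    by (rule conv_pair_integrable[OF bcs_abs[OF f] bcs_abs[OF g]])
  have "l1norm (conv f g) \<le> (\<integral>z. (\<integral>y. \<bar>f y\<bar> * \<bar>g (z - y)\<bar> \<partial>lborel) \<partial>lborel)"
    unfolding l1norm_def
  proof (rule integral_mono)
    show "integrable lborel (\<lambda>z. \<bar>conv f g z\<bar>)" using bcs_integrable[OF bcs_abs[OF bcs_conv[OF f g]]] .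
    show "integrable lborel (\<lambda>z. \<integral>y. \<bar>f y\<bar> * \<bar>g (z - y)\<bar> \<partial>lborel)"
      using bcs_integrable[OF bcs_conv[OF bcs_abs[OF f] bcs_abs[OF g]]] unfolding conv_def[abs_def] .
    show "\<bar>conv f g z\<bar> \<le> (\<integral>y. \<bar>f y\<bar> * \<bar>g (z - y)\<bar> \<partial>lborel)" for z
      unfolding conv_def abs_mult[symmetric] by (rule integral_abs_bound)
  qed
  also have "\<dots> = (\<integral>y. (\<integral>z. \<bar>f y\<bar> * \<bar>g (z - y)\<bar> \<partial>lborel) \<partial>lborel)"
    by (rule lborel_pair.Fubini_integral[OF i])
  also have "\<dots> = (\<integral>y. \<bar>f y\<bar> * l1norm g \<partial>lborel)"
    using integral_lborel_translate[of "\<lambda>z. \<bar>g z\<bar>" "- _"] by (simp add: l1norm_def)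
  finally show ?thesis by (simp add: l1norm_def)
qed

lemma conv_sum_left:
  "finite I \<Longrightarrow> (\<And>i. i \<in> I \<Longrightarrow> bcs (f i)) \<Longrightarrow> bcs g \<Longrightarrow> conv (\<lambda>x. \<Sum>i\<in>I. f i x) g x = (\<Sum>i\<in>I. conv (f i) g x)"
  unfolding conv_def by (simp add: sum_distrib_right conv_integrable)

lemma conv_sum_right:
  "finite I \<Longrightarrow> (\<And>i. i \<in> I \<Longrightarrow> bcs (f i)) \<Longrightarrow> bcs g \<Longrightarrow> conv g (\<lambda>x. \<Sum>i\<in>I. f i x) x = (\<Sum>i\<in>I. conv g (f i) x)"
  unfolding conv_def by (simp add: sum_distrib_left conv_integrable)

text \<open>The inner product with h is the value at 0 of the convolution with the reflection of h.
  Symmetry is then commutativity and associativity, and evenness of f lets the reflection pass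
  through.\<close>

lemma inner_conv_even:
  assumes f: "bcs f" and g: "bcs g" and h: "bcs h" and ev: "\<And>x. f (- x) = f x"
  shows "(\<integral>x. conv f g x * h x \<partial>lborel) = (\<integral>x. g x * conv f h x \<partial>lborel)"
proof -
  define r where "r k = (\<lambda>x::'a. k (0 - x) :: real)" for k
  have ip: "(\<integral>x. a x * k x \<partial>lborel) = conv a (r k) 0" for a k :: "'a \<Rightarrow> real"
    by (simp add: conv_def r_def)
  have rb: "bcs (r h)" unfolding r_def by (rule bcs_shift[OF h])
  have rc: "r (conv f h) = conv f (r h)"
  proof
    fix x
    have "r (conv f h) x = (\<integral>y. f (0 - y) * h (0 - x - (0 - y)) \<partial>lborel)"
      unfolding r_def conv_def by (rule integral_lborel_reflect[symmetric])
    also have "\<dots> = conv f (r h) x"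
      unfolding conv_def r_def by (rule Bochner_Integration.integral_cong) (auto simp: ev algebra_simps)
    finally show "r (conv f h) x = conv f (r h) x" .
  qed
  have "(\<integral>x. conv f g x * h x \<partial>lborel) = conv (conv f g) (r h) 0" by (rule ip)
  also have "\<dots> = conv (conv g f) (r h) 0"
    using ext[of "conv f g" "conv g f", OF conv_commute] by simp
  also have "\<dots> = conv g (conv f (r h)) 0" by (rule conv_assoc[OF g f rb])
  also have "\<dots> = (\<integral>x. g x * conv f h x \<partial>lborel)" unfolding rc[symmetric] ip[symmetric] ..
  finally show ?thesis .
qed

text \<open>Young's inequality: write |f| as the square of its root, apply the Cauchy--Schwarz
  inequality with one root on each side, and use the L^1 bound for |f| and g^2.\<close>

lemma l2norm_conv:
  assumes f: "bcs f" and g: "bcs g"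
  shows "l2norm (conv f g) \<le> l1norm f * l2norm g"
proof -
  have sf: "bcs (\<lambda>y. sqrt \<bar>f y\<bar>)"
  proof -
    obtain M R where 1: "f \<in> borel_measurable borel" "\<And>x. \<bar>f x\<bar> \<le> M" "\<And>x. norm x > R \<Longrightarrow> f x = 0"
      using bcsE[OF f] by metis
    show ?thesis by (rule bcsI[of _ "sqrt M" R]) (use 1 in \<open>auto simp: real_sqrt_abs2\<close>)
  qed
  have g2: "bcs (\<lambda>x. (g x)\<^sup>2)" using bcs_mult[OF g g] by (simp add: power2_eq_square)
  have pt: "(conv f g x)\<^sup>2 \<le> l1norm f * conv (\<lambda>y. \<bar>f y\<bar>) (\<lambda>x. (g x)\<^sup>2) x" for x
  proof -
    have "\<bar>conv f g x\<bar> \<le> (\<integral>y. \<bar>f y * g (x - y)\<bar> \<partial>lborel)"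
      unfolding conv_def by (rule integral_abs_bound)
    also have "\<dots> = (\<integral>y. sqrt \<bar>f y\<bar> * (sqrt \<bar>f y\<bar> * \<bar>g (x - y)\<bar>) \<partial>lborel)"
      by (simp add: abs_mult mult.assoc[symmetric])
    also have "\<dots> \<le> l2norm (\<lambda>y. sqrt \<bar>f y\<bar>) * l2norm (\<lambda>y. sqrt \<bar>f y\<bar> * \<bar>g (x - y)\<bar>)"
      by (rule order_trans[OF abs_ge_self l2norm_cauchy_schwarz])
         (intro bcs_l2fun bcs_mult sf bcs_abs bcs_shift g)+
    finally have "(conv f g x)\<^sup>2 \<le> (l2norm (\<lambda>y. sqrt \<bar>f y\<bar>) * l2norm (\<lambda>y. sqrt \<bar>f y\<bar> * \<bar>g (x - y)\<bar>))\<^sup>2"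
      by (simp add: abs_le_square_iff[symmetric] abs_mult)
    also have "\<dots> = l1norm f * conv (\<lambda>y. \<bar>f y\<bar>) (\<lambda>x. (g x)\<^sup>2) x"
      unfolding power_mult_distrib l2norm_square l1norm_def conv_def by simp
    finally show ?thesis .
  qed
  have cb: "bcs (conv (\<lambda>y. \<bar>f y\<bar>) (\<lambda>x. (g x)\<^sup>2))" by (rule bcs_conv[OF bcs_abs[OF f] g2])
  have "(l2norm (conv f g))\<^sup>2 \<le> (\<integral>x. l1norm f * conv (\<lambda>y. \<bar>f y\<bar>) (\<lambda>x. (g x)\<^sup>2) x \<partial>lborel)"
    unfolding l2norm_square
    using pt bcs_l2fun[OF bcs_conv[OF f g]] bcs_integrable[OF cb] by (intro integral_mono) (auto simp: l2fun_def)
  also have "\<dots> \<le> l1norm f * l1norm (conv (\<lambda>y. \<bar>f y\<bar>) (\<lambda>x. (g x)\<^sup>2))"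
    unfolding integral_mult_right_zero l1norm_def[of "conv _ _"]
    by (intro mult_left_mono integral_mono integrable_abs bcs_integrable[OF cb]) auto
  also have "\<dots> \<le> l1norm f * (l1norm (\<lambda>y. \<bar>f y\<bar>) * l1norm (\<lambda>x. (g x)\<^sup>2))"
    by (intro mult_left_mono l1norm_conv bcs_abs f g2) simp
  also have "\<dots> = (l1norm f * l2norm g)\<^sup>2"
    by (simp add: power_mult_distrib l2norm_square) (simp add: l1norm_def power2_eq_square)
  finally show ?thesis by (rule power2_le_imp_le) simp
qed

text \<open>By log-convexity the quotients of consecutive terms increase. Had the first one exceeded
  B, the sequence would outgrow C B^k. Applied to the norms of iterates of a symmetric operator,
  this replaces taking k-th roots of operator norms, and the constant C is lost without
  trace.\<close>

lemma log_convex_bound: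
  fixes a :: "nat \<Rightarrow> real"
  assumes a0: "\<And>k. a k \<ge> 0" and lc: "\<And>k. (a (Suc k))\<^sup>2 \<le> a k * a (Suc (Suc k))"
    and ub: "\<And>k. a k \<le> C * B ^ k" and B: "B \<ge> 0"
  shows "a 1 \<le> B * a 0"
proof (rule ccontr)
  assume "\<not> a 1 \<le> B * a 0"
  then have gt: "a 1 > B * a 0" by simp
  have a1: "a 1 > 0" using gt B a0[of 0] by (smt (verit) mult_nonneg_nonneg)
  have a00: "a 0 > 0"
  proof (rule ccontr)
    assume "\<not> a 0 > 0"
    then have "a 0 = 0" using a0[of 0] by simp
    then show False using lc[of 0] a1 by simp
  qed
  define \<rho> where "\<rho> = a 1 / a 0"
  have rho: "\<rho> > B" "\<rho> > 0" using gt a00 a1 by (auto simp: \<rho>_def pos_less_divide_eq)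
  have step: "a k > 0 \<and> a (Suc k) \<ge> \<rho> * a k" for k
  proof (induction k)
    case 0
    then show ?case using a00 by (simp add: \<rho>_def)
  next
    case (Suc k)
    then have pos: "a (Suc k) > 0" using rho by (smt (verit) mult_pos_pos)
    have "\<rho> * a k * a (Suc k) \<le> a (Suc k) * a (Suc k)" using Suc pos by (intro mult_right_mono) auto
    also have "\<dots> \<le> a k * a (Suc (Suc k))" using lc[of k] by (simp add: power2_eq_square)
    finally have "a k * (\<rho> * a (Suc k)) \<le> a k * a (Suc (Suc k))" by (simp add: algebra_simps)
    then show ?case using pos Suc by simp
  qed
  have lower: "\<rho> ^ k * a 0 \<le> a k" for k
  proof (induction k)
    case (Suc k)
    have "\<rho> ^ Suc k * a 0 = \<rho> * (\<rho> ^ k * a 0)" by simp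
    also have "\<dots> \<le> \<rho> * a k" using Suc rho by (intro mult_left_mono) auto
    also have "\<dots> \<le> a (Suc k)" using step by blast
    finally show ?case .
  qed simp
  have le: "\<rho> ^ k * a 0 \<le> C * B ^ k" for k using lower[of k] ub[of k] by linarith
  show False
  proof (cases "B = 0")
    case True
    then show ?thesis using le[of 1] rho a00 by simp (smt (verit) mult_pos_pos)
  next
    case False
    then have B: "B > 0" using B by simp
    then have "\<rho> / B > 1" using rho by simp
    then obtain k where "(\<rho> / B) ^ k > C / a 0" using real_arch_pow by blast
    then have "\<rho> ^ k * a 0 > C * B ^ k" using B a00 by (simp add: power_divide field_simps)
    then show ?thesis using le[of k] by simp
  qed
qed

text \<open>The setting of the Cotlar--Stein lemma. The norm of the composition along a word of indices is bounded by grouping its factors into consecutive pairs, starting at the first or at the second letter.\<close>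
locale almost_orthogonal =
  fixes K :: "nat \<Rightarrow> 'a::euclidean_space \<Rightarrow> real" and m :: nat and A B :: real and w :: "nat \<Rightarrow> nat \<Rightarrow> real"
  assumes K: "\<And>j. j < m \<Longrightarrow> bcs (K j)" and ev: "\<And>j x. j < m \<Longrightarrow> K j (- x) = K j x"
    and A: "\<And>j. j < m \<Longrightarrow> l1norm (K j) \<le> A" "A \<ge> 0"
    and W: "\<And>j k. j < m \<Longrightarrow> k < m \<Longrightarrow> l1norm (conv (K j) (K k)) \<le> (w j k)\<^sup>2"
    and w: "\<And>j k. w j k \<ge> 0"
    and B: "\<And>j. j < m \<Longrightarrow> (\<Sum>k<m. w j k) \<le> B" "B > 0"
begin

fun opl :: "nat list \<Rightarrow> ('a \<Rightarrow> real) \<Rightarrow> 'a \<Rightarrow> real" where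
  "opl [] f = f"
| "opl (j # L) f = conv (K j) (opl L f)"

fun pairs :: "nat list \<Rightarrow> real" where
  "pairs [] = 1"
| "pairs [j] = A"
| "pairs (j # k # L) = (w j k)\<^sup>2 * pairs L"

fun chain :: "nat list \<Rightarrow> real" where
  "chain [] = 1"
| "chain [j] = 1"
| "chain (j # k # L) = w j k * chain (k # L)"

fun words :: "nat \<Rightarrow> nat list set" where
  "words 0 = {[]}"
| "words (Suc N) = (\<lambda>(j, L). j # L) ` ({..<m} \<times> words N)"

lemma words_finite: "finite (words N)"
  by (induction N) auto

lemma words_set: "L \<in> words N \<Longrightarrow> set L \<subseteq> {..<m}"
proof (induction N arbitrary: L)
  case (Suc N)
  then obtain j L' where "L = j # L'" "j < m" "L' \<in> words N" by auto
  then show ?case using Suc.IH[of L'] by auto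
qed simp

lemma sum_words_Suc: "(\<Sum>L\<in>words (Suc N). F L) = (\<Sum>j<m. \<Sum>L\<in>words N. F (j # L))"
  unfolding words.simps by (subst sum.reindex) (auto simp: inj_on_def sum.cartesian_product split_beta')

lemma chain_nonneg: "chain L \<ge> 0"
  by (induction L rule: chain.induct) (auto simp: w)

lemma pairs_nonneg: "pairs L \<ge> 0"
  by (induction L rule: pairs.induct) (auto simp: A)

text \<open>The pairing that starts at the first letter and the one that starts at the second
  together use every pair of neighbours once. Of the two words exactly one has odd length, and its
  unpaired letter gives the factor A.\<close>

lemma pairs_chain: "pairs (j # L) * pairs L = A * (chain (j # L))\<^sup>2"
proof (induction L arbitrary: j)
  case (Cons k L)
  have "pairs (j # k # L) * pairs (k # L) = (w j k)\<^sup>2 * (pairs (k # L) * pairs L)" by (simp add: mult_ac)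
  then show ?case unfolding Cons by (simp add: power_mult_distrib mult_ac)
qed simp

lemma opl_bcs: "set L \<subseteq> {..<m} \<Longrightarrow> bcs f \<Longrightarrow> bcs (opl L f)"
  by (induction L) (auto intro: bcs_conv K)

lemma opl_pairs: "set L \<subseteq> {..<m} \<Longrightarrow> bcs f \<Longrightarrow> l2norm (opl L f) \<le> pairs L * l2norm f"
proof (induction L rule: pairs.induct)
  case (2 j)
  then have j: "j < m" by simp
  have "l2norm (conv (K j) f) \<le> l1norm (K j) * l2norm f" by (rule l2norm_conv[OF K[OF j] 2(2)])
  also have "\<dots> \<le> A * l2norm f" using A(1)[OF j] by (intro mult_right_mono) auto
  finally show ?case by simp
next
  case (3 j k L)
  then have jk: "j < m" "k < m" and L: "set L \<subseteq> {..<m}" by auto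
  have b: "bcs (opl L f)" using opl_bcs[OF L 3(3)] .
  have "opl (j # k # L) f = conv (conv (K j) (K k)) (opl L f)"
    by (rule ext) (simp add: conv_assoc[OF K[OF jk(1)] K[OF jk(2)] b])
  then have "l2norm (opl (j # k # L) f) \<le> l1norm (conv (K j) (K k)) * l2norm (opl L f)"
    using l2norm_conv[OF bcs_conv[OF K[OF jk(1)] K[OF jk(2)]] b] by simp
  also have "\<dots> \<le> (w j k)\<^sup>2 * (pairs L * l2norm f)"
    using W[OF jk] 3(1)[OF L 3(3)] by (intro mult_mono) auto
  finally show ?case by (simp add: mult.assoc)
qed simp

text \<open>The geometric mean of two bounds: one from pairing all letters, the other from splitting
  off the first letter and pairing the rest. It contains \<open>w\<close> and no longer its
  square.\<close>

lemma opl_chain: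
  assumes j: "j < m" and L: "set L \<subseteq> {..<m}" and f: "bcs f"
  shows "l2norm (opl (j # L) f) \<le> A * chain (j # L) * l2norm f"
proof -
  have 1: "l2norm (opl (j # L) f) \<le> pairs (j # L) * l2norm f" using opl_pairs[of "j # L" f] assms by auto
  have "l2norm (opl (j # L) f) \<le> l1norm (K j) * l2norm (opl L f)"
    using l2norm_conv[OF K[OF j] opl_bcs[OF L f]] by simp
  also have "\<dots> \<le> A * (pairs L * l2norm f)" using A j opl_pairs[OF L f] by (intro mult_mono) auto
  finally have 2: "l2norm (opl (j # L) f) \<le> A * (pairs L * l2norm f)" .
  have "(l2norm (opl (j # L) f))\<^sup>2 \<le> (pairs (j # L) * l2norm f) * (A * (pairs L * l2norm f))"
    unfolding power2_eq_square using 1 2 pairs_nonneg A by (intro mult_mono) auto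
  also have "\<dots> = A * (pairs (j # L) * pairs L) * (l2norm f)\<^sup>2" by (simp add: power2_eq_square mult_ac)
  also have "\<dots> = (A * chain (j # L) * l2norm f)\<^sup>2" unfolding pairs_chain by (simp add: power2_eq_square mult_ac)
  finally show ?thesis
    by (rule power2_le_imp_le) (intro mult_nonneg_nonneg A(2) chain_nonneg l2norm_nonneg)
qed

text \<open>Summing over the last letter of a word costs one row sum of \<open>w\<close>, hence one
  factor B; repeat this for each further letter. The first letter stays fixed.\<close>

lemma sum_chain: "j < m \<Longrightarrow> (\<Sum>L\<in>words N. chain (j # L)) \<le> B ^ N"
proof (induction N arbitrary: j)
  case (Suc N)
  have "(\<Sum>L\<in>words (Suc N). chain (j # L)) = (\<Sum>k<m. w j k * (\<Sum>L\<in>words N. chain (k # L)))"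
    unfolding sum_words_Suc by (simp add: sum_distrib_left)
  also have "\<dots> \<le> (\<Sum>k<m. w j k * B ^ N)" using Suc.IH w by (intro sum_mono mult_left_mono) auto
  also have "\<dots> = (\<Sum>k<m. w j k) * B ^ N" by (simp add: sum_distrib_right)
  also have "\<dots> \<le> B * B ^ N" using B Suc.prems by (intro mult_right_mono) auto
  finally show ?case by simp
qed simp

definition total :: "'a \<Rightarrow> real" where
  "total x = (\<Sum>j<m. K j x)"

fun iter :: "nat \<Rightarrow> ('a \<Rightarrow> real) \<Rightarrow> 'a \<Rightarrow> real" where
  "iter 0 f = f"
| "iter (Suc k) f = conv total (iter k f)"

lemma total_bcs: "bcs total"
  unfolding total_def[abs_def] by (rule bcs_sum) (auto intro: K)

lemma iter_bcs: "bcs f \<Longrightarrow> bcs (iter k f)"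
  by (induction k) (auto intro: bcs_conv total_bcs)

lemma iter_words: "bcs f \<Longrightarrow> iter N f x = (\<Sum>L\<in>words N. opl L f x)"
proof (induction N arbitrary: x)
  case (Suc N)
  have "iter N f = (\<lambda>x. \<Sum>L\<in>words N. opl L f x)" by (rule ext) (rule Suc.IH[OF Suc.prems])
  then have "iter (Suc N) f x = conv total (\<lambda>x. \<Sum>L\<in>words N. opl L f x) x" by (simp only: iter.simps)
  also have "\<dots> = (\<Sum>L\<in>words N. conv total (opl L f) x)"
    by (rule conv_sum_right) (use words_finite opl_bcs words_set Suc.prems total_bcs in auto)
  also have "\<dots> = (\<Sum>L\<in>words N. \<Sum>j<m. conv (K j) (opl L f) x)"
    unfolding total_def[abs_def]
    by (intro sum.cong refl conv_sum_left) (use opl_bcs words_set Suc.prems K in auto)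
  also have "\<dots> = (\<Sum>L\<in>words (Suc N). opl L f x)"
    unfolding sum_words_Suc by (subst sum.swap) simp
  finally show ?case .
qed simp

text \<open>Expanding the iterates into words gives a bound with the factor m, the number of pieces.
  That factor is the same for all powers, so \<open>log_convex_bound\<close> removes it, and B alone
  remains.\<close>

theorem cotlar_bound:
  assumes f: "bcs f"
  shows "l2norm (conv total f) \<le> B * l2norm f"
proof -
  define a where "a k = l2norm (iter k f)" for k
  have evt: "total (- x) = total x" for x unfolding total_def by (simp add: ev)
  have "a 1 \<le> B * a 0"
  proof (rule log_convex_bound)
    fix k
    show "a k \<ge> 0" by (simp add: a_def)
    have "(a (Suc k))\<^sup>2 = (\<integral>x. conv total (iter k f) x * iter (Suc k) f x \<partial>lborel)"
      unfolding a_def l2norm_square by (simp add: power2_eq_square)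
    also have "\<dots> = (\<integral>x. iter k f x * iter (Suc (Suc k)) f x \<partial>lborel)"
      using inner_conv_even[OF total_bcs iter_bcs[OF f] iter_bcs[OF f], of k "Suc k"] evt by simp
    also have "\<dots> \<le> a k * a (Suc (Suc k))"
      unfolding a_def by (rule order_trans[OF abs_ge_self l2norm_cauchy_schwarz]) (intro bcs_l2fun iter_bcs f)+
    finally show "(a (Suc k))\<^sup>2 \<le> a k * a (Suc (Suc k))" .
    \<comment> \<open>The first summand covers k = 0. For k > 0 the first letter has m choices, and
      the others are summed by \<open>sum_chain\<close>.\<close>
    show "a k \<le> (l2norm f + A * real m * l2norm f / B) * B ^ k"
    proof (cases k)
      case 0
      then show ?thesis using A B by (simp add: a_def)
    next
      case (Suc N)
      have it: "iter k f = (\<lambda>x. \<Sum>L\<in>words (Suc N). opl L f x)" unfolding Suc by (rule ext) (rule iter_words[OF f])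
      have "a k \<le> (\<Sum>L\<in>words (Suc N). l2norm (opl L f))"
        unfolding a_def it by (rule l2norm_sum[OF words_finite]) (use opl_bcs words_set f bcs_l2fun in blast)
      also have "\<dots> = (\<Sum>j<m. \<Sum>L\<in>words N. l2norm (opl (j # L) f))" by (rule sum_words_Suc)
      also have "\<dots> \<le> (\<Sum>j<m. \<Sum>L\<in>words N. A * chain (j # L) * l2norm f)"
        using opl_chain words_set f by (intro sum_mono) auto
      also have "\<dots> = (\<Sum>j<m. A * (\<Sum>L\<in>words N. chain (j # L)) * l2norm f)"
        by (simp add: sum_distrib_left sum_distrib_right)
      also have "\<dots> \<le> (\<Sum>j<m. A * B ^ N * l2norm f)"
        using sum_chain A by (intro sum_mono mult_right_mono mult_left_mono) auto
      also have "\<dots> = (A * real m * l2norm f / B) * B ^ k" using B Suc by simp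
      also have "\<dots> \<le> (l2norm f + A * real m * l2norm f / B) * B ^ k" using B by (intro mult_right_mono) auto
      finally show ?thesis .
    qed
  qed (use B in simp)
  then show ?thesis by (simp add: a_def)
qed

end

section \<open>Estimates for shells and Lipschitz functions\<close>

lemma sum_geometric_two_sided:
  fixes \<rho> :: real
  assumes "0 \<le> \<rho>" "\<rho> < 1"
  shows "(\<Sum>k<m. \<rho> ^ (if j \<le> k then k - j else j - k)) \<le> 2 / (1 - \<rho>)"
proof -
  have geo: "(\<Sum>i\<in>I. \<rho> ^ i) \<le> 1 / (1 - \<rho>)" if "finite I" for I
    using sum_le_suminf[of "\<lambda>i. \<rho> ^ i" I] that assms summable_geometric[of \<rho>] suminf_geometric[of \<rho>] by simp
  have "(\<Sum>k<m. \<rho> ^ (if j \<le> k then k - j else j - k)) = (\<Sum>k\<in>{..<m} \<inter> {k. j \<le> k}. \<rho> ^ (k - j)) + (\<Sum>k\<in>{..<m} \<inter> - {k. j \<le> k}. \<rho> ^ (j - k))"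
    by (simp add: if_distrib sum.If_cases)
  also have "(\<Sum>k\<in>{..<m} \<inter> {k. j \<le> k}. \<rho> ^ (k - j)) = (\<Sum>i\<in>(\<lambda>k. k - j) ` ({..<m} \<inter> {k. j \<le> k}). \<rho> ^ i)"
    by (subst sum.reindex) (auto simp: inj_on_def)
  also have "\<dots> \<le> 1 / (1 - \<rho>)" by (rule geo) simp
  also have "(\<Sum>k\<in>{..<m} \<inter> - {k. j \<le> k}. \<rho> ^ (j - k)) = (\<Sum>i\<in>(\<lambda>k. j - k) ` ({..<m} \<inter> - {k. j \<le> k}). \<rho> ^ i)"
    by (subst sum.reindex) (auto simp: inj_on_def)
  also have "\<dots> \<le> 1 / (1 - \<rho>)" by (rule geo) simp
  finally show ?thesis by (simp add: add_divide_distrib[symmetric])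
qed

lemma power_diff_le:
  fixes x y :: real
  assumes "0 \<le> y" "y \<le> x" "x \<le> 3"
  shows "x ^ n - y ^ n \<le> real n * 3 ^ n * (x - y)"
proof (induction n)
  case (Suc n)
  have "x ^ Suc n - y ^ Suc n = x * (x ^ n - y ^ n) + y ^ n * (x - y)" by (simp add: algebra_simps)
  also have "\<dots> \<le> 3 * (real n * 3 ^ n * (x - y)) + 3 ^ n * (x - y)"
  proof (intro add_mono mult_right_mono)
    have "x * (x ^ n - y ^ n) \<le> 3 * (x ^ n - y ^ n)" using assms by (intro mult_right_mono) (auto simp: power_mono)
    then show "x * (x ^ n - y ^ n) \<le> 3 * (real n * 3 ^ n * (x - y))" using Suc by simp
    show "y ^ n \<le> 3 ^ n" using assms by (intro power_mono) auto
  qed (use assms in auto)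
  also have "\<dots> \<le> 3 * (real n * 3 ^ n * (x - y)) + 3 * (3 ^ n * (x - y))"
    using assms by simp
  also have "\<dots> = real (Suc n) * 3 ^ Suc n * (x - y)" by (simp add: algebra_simps)
  finally show ?case .
qed simp

text \<open>Radii from 1 to 2 include the spheres at which \<open>ann 1\<close> is cut off and the
  one at which the potential is; in both places the error sits in a thin shell.\<close>

lemma shell_measure:
  obtains C where "C \<ge> 0" "\<And>a h. 0 \<le> h \<Longrightarrow> h \<le> 1 \<Longrightarrow> 1 \<le> a \<Longrightarrow> a \<le> 2 \<Longrightarrow> measure lborel {x::'a::euclidean_space. \<bar>norm x - a\<bar> \<le> h} \<le> C * h"
proof
  let ?om = "measure lborel (ball (0::'a) 1)" and ?n = "DIM('a)"
  show "0 \<le> ?om * (real ?n * 3 ^ ?n * 2)" by simp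
  fix a h :: real assume h: "0 \<le> h" "h \<le> 1" "1 \<le> a" "a \<le> 2"
  have eq: "{x::'a. \<bar>norm x - a\<bar> \<le> h} = cball 0 (a + h) - ball 0 (a - h)" by auto
  have "measure lborel {x::'a. \<bar>norm x - a\<bar> \<le> h} = measure lborel (cball (0::'a) (a + h)) - measure lborel (ball (0::'a) (a - h))"
    unfolding eq using h emeasure_lborel_cball_finite[of "0::'a" "a + h"]
    by (intro measure_Diff) (auto simp: ball_subset_cball_iff top.not_eq_extremum)
  also have "measure lborel (cball (0::'a) (a + h)) = (a + h) ^ ?n * ?om"
    using content_cball_conv_ball[of "0::'a" "a + h"] content_ball_conv_unit_ball[of "a + h" "0::'a"] h by simp
  also have "measure lborel (ball (0::'a) (a - h)) = (a - h) ^ ?n * ?om"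
    using content_ball_conv_unit_ball[of "a - h" "0::'a"] h by simp
  also have "(a + h) ^ ?n * ?om - (a - h) ^ ?n * ?om = ?om * ((a + h) ^ ?n - (a - h) ^ ?n)" by (simp add: algebra_simps)
  \<comment> \<open>Both radii lie between 0 and 3, because 1 \<le> a \<le> 2 and h \<le> 1.\<close>
  also have "\<dots> \<le> ?om * (real ?n * 3 ^ ?n * ((a + h) - (a - h)))"
    using h by (intro mult_left_mono power_diff_le) auto
  finally show "measure lborel {x::'a. \<bar>norm x - a\<bar> \<le> h} \<le> ?om * (real ?n * 3 ^ ?n * 2) * h"
    by (simp add: mult_ac)
qed

text \<open>Boundedness is part of the notion because it makes the class closed under
  products.\<close>

definition lip_on :: "'a::real_normed_vector set \<Rightarrow> ('a \<Rightarrow> real) \<Rightarrow> bool" where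
  "lip_on S f \<longleftrightarrow> (\<exists>L M. L \<ge> 0 \<and> M \<ge> 0 \<and> (\<forall>x\<in>S. \<forall>y\<in>S. \<bar>f x - f y\<bar> \<le> L * norm (x - y)) \<and> (\<forall>x\<in>S. \<bar>f x\<bar> \<le> M))"

lemma lip_onI: "L \<ge> 0 \<Longrightarrow> M \<ge> 0 \<Longrightarrow> (\<And>x y. x \<in> S \<Longrightarrow> y \<in> S \<Longrightarrow> \<bar>f x - f y\<bar> \<le> L * norm (x - y)) \<Longrightarrow> (\<And>x. x \<in> S \<Longrightarrow> \<bar>f x\<bar> \<le> M) \<Longrightarrow> lip_on S f"
  unfolding lip_on_def by blast

lemma lip_on_mult:
  assumes "lip_on S f" "lip_on S g"
  shows "lip_on S (\<lambda>x. f x * g x)"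
proof -
  obtain L M where f: "L \<ge> 0" "M \<ge> 0" "\<And>x y. x \<in> S \<Longrightarrow> y \<in> S \<Longrightarrow> \<bar>f x - f y\<bar> \<le> L * norm (x - y)" "\<And>x. x \<in> S \<Longrightarrow> \<bar>f x\<bar> \<le> M"
    using assms(1) unfolding lip_on_def by blast
  obtain L' M' where g: "L' \<ge> 0" "M' \<ge> 0" "\<And>x y. x \<in> S \<Longrightarrow> y \<in> S \<Longrightarrow> \<bar>g x - g y\<bar> \<le> L' * norm (x - y)" "\<And>x. x \<in> S \<Longrightarrow> \<bar>g x\<bar> \<le> M'"
    using assms(2) unfolding lip_on_def by blast
  show ?thesis
  proof (rule lip_onI[of "M * L' + M' * L" "M * M'"])
    fix x y assume xy: "x \<in> S" "y \<in> S"
    have "f x * g x - f y * g y = f x * (g x - g y) + g y * (f x - f y)" by (simp add: algebra_simps)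
    then have "\<bar>f x * g x - f y * g y\<bar> \<le> \<bar>f x\<bar> * \<bar>g x - g y\<bar> + \<bar>g y\<bar> * \<bar>f x - f y\<bar>"
      by (metis abs_mult abs_triangle_ineq)
    also have "\<dots> \<le> M * (L' * norm (x - y)) + M' * (L * norm (x - y))"
      using f g xy by (intro add_mono mult_mono) auto
    finally show "\<bar>f x * g x - f y * g y\<bar> \<le> (M * L' + M' * L) * norm (x - y)" by (simp add: algebra_simps)
  next
    fix x assume "x \<in> S"
    then show "\<bar>f x * g x\<bar> \<le> M * M'" unfolding abs_mult using f g by (intro mult_mono) auto
  qed (use f g in auto)
qed

lemma lip_on_add:
  assumes "lip_on S f" "lip_on S g"
  shows "lip_on S (\<lambda>x. f x + g x)"
proof -
  obtain L M where f: "L \<ge> 0" "M \<ge> 0" "\<And>x y. x \<in> S \<Longrightarrow> y \<in> S \<Longrightarrow> \<bar>f x - f y\<bar> \<le> L * norm (x - y)" "\<And>x. x \<in> S \<Longrightarrow> \<bar>f x\<bar> \<le> M"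
    using assms(1) unfolding lip_on_def by blast
  obtain L' M' where g: "L' \<ge> 0" "M' \<ge> 0" "\<And>x y. x \<in> S \<Longrightarrow> y \<in> S \<Longrightarrow> \<bar>g x - g y\<bar> \<le> L' * norm (x - y)" "\<And>x. x \<in> S \<Longrightarrow> \<bar>g x\<bar> \<le> M'"
    using assms(2) unfolding lip_on_def by blast
  show ?thesis
  proof (rule lip_onI[of "L + L'" "M + M'"])
    fix x y assume xy: "x \<in> S" "y \<in> S"
    show "\<bar>f x + g x - (f y + g y)\<bar> \<le> (L + L') * norm (x - y)"
      using f(3)[OF xy] g(3)[OF xy] unfolding distrib_right by linarith
  next
    fix x assume "x \<in> S"
    then show "\<bar>f x + g x\<bar> \<le> M + M'" using f(4)[of x] g(4)[of x] by linarith
  qed (use f g in auto)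
qed

lemma lip_on_const: "lip_on S (\<lambda>x. c)"
  by (rule lip_onI[of 0 "\<bar>c\<bar>"]) auto

lemma lip_on_power: "lip_on S f \<Longrightarrow> lip_on S (\<lambda>x. f x ^ k)"
  by (induction k) (auto intro: lip_on_const lip_on_mult)

lemma polynomial_function_lip_on:
  fixes p :: "'a::real_normed_vector \<Rightarrow> real"
  assumes "real_polynomial_function p"
  shows "lip_on (cball 0 R) p"
  using assms
proof (induction p rule: real_polynomial_function.induct)
  case (linear f)
  obtain C where C: "\<And>x. norm (f x) \<le> norm x * C" "C \<ge> 0" using bounded_linear.nonneg_bounded[OF linear] by blast
  show ?case
  proof (rule lip_onI[of C "\<bar>R\<bar> * C"])
    fix x y
    show "\<bar>f x - f y\<bar> \<le> C * norm (x - y)"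
      using C(1)[of "x - y"] linear_diff[OF bounded_linear.linear[OF linear]] by (simp add: mult.commute)
  next
    fix x :: 'a assume "x \<in> cball 0 R"
    then have "norm x * C \<le> \<bar>R\<bar> * C" using C by (intro mult_right_mono) auto
    then show "\<bar>f x\<bar> \<le> \<bar>R\<bar> * C" using C(1)[of x] by simp
  qed (use C in auto)
qed (auto intro: lip_on_const lip_on_add lip_on_mult)

section \<open>Uniform bounds for the truncated operators\<close>

text \<open>It serves twice: to carry operator bounds from bounded functions of bounded support to
  all of \<open>l2fun\<close>, and to compare an L^2 Cauchy family with its pointwise limit.\<close>

lemma l2_fatou:
  fixes g :: "nat \<Rightarrow> 'a::euclidean_space \<Rightarrow> real"
  assumes gk: "\<And>k. l2fun (g k)" and c: "\<And>k. l2norm (g k) \<le> c"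
    and lim: "AE x in lborel. (\<lambda>k. g k x) \<longlonglongrightarrow> h x" and [measurable]: "h \<in> borel_measurable borel"
  shows "l2fun h" "l2norm h \<le> c"
proof -
  have [measurable]: "g k \<in> borel_measurable borel" for k using gk by (rule l2fun_measurable)
  have c0: "c \<ge> 0" using c[of 0] l2norm_nonneg[of "g 0"] by linarith
  have nn: "(\<integral>\<^sup>+x. ennreal ((g k x)\<^sup>2) \<partial>lborel) \<le> ennreal (c\<^sup>2)" for k
  proof -
    have "(\<integral>\<^sup>+x. ennreal ((g k x)\<^sup>2) \<partial>lborel) = ennreal ((l2norm (g k))\<^sup>2)"
      using gk[of k] unfolding l2norm_square l2fun_def by (intro nn_integral_eq_integral) auto
    also have "\<dots> \<le> ennreal (c\<^sup>2)" using c[of k] by (intro ennreal_leI power_mono) auto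
    finally show ?thesis .
  qed
  have "(\<integral>\<^sup>+x. ennreal ((h x)\<^sup>2) \<partial>lborel) = (\<integral>\<^sup>+x. liminf (\<lambda>k. ennreal ((g k x)\<^sup>2)) \<partial>lborel)"
  proof (rule nn_integral_cong_AE)
    show "AE x in lborel. ennreal ((h x)\<^sup>2) = liminf (\<lambda>k. ennreal ((g k x)\<^sup>2))"
      using lim
    proof eventually_elim
      fix x assume "(\<lambda>k. g k x) \<longlonglongrightarrow> h x"
      then have "(\<lambda>k. ennreal ((g k x)\<^sup>2)) \<longlonglongrightarrow> ennreal ((h x)\<^sup>2)"
        by (intro tendsto_ennrealI tendsto_power)
      then show "ennreal ((h x)\<^sup>2) = liminf (\<lambda>k. ennreal ((g k x)\<^sup>2))"
        by (metis lim_imp_Liminf trivial_limit_sequentially)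
    qed
  qed
  also have "\<dots> \<le> liminf (\<lambda>k. \<integral>\<^sup>+x. ennreal ((g k x)\<^sup>2) \<partial>lborel)"
    by (rule nn_integral_liminf) simp
  also have "\<dots> \<le> ennreal (c\<^sup>2)"
    using nn by (intro Liminf_le) (auto intro!: always_eventually)
  finally have le: "(\<integral>\<^sup>+x. ennreal ((h x)\<^sup>2) \<partial>lborel) \<le> ennreal (c\<^sup>2)" .
  have i: "integrable lborel (\<lambda>x. (h x)\<^sup>2)"
    by (rule integrableI_bounded) (use le in \<open>auto simp: top.not_eq_extremum intro: le_less_trans\<close>)
  then show "l2fun h" by (simp add: l2fun_def)
  have "ennreal ((l2norm h)\<^sup>2) \<le> ennreal (c\<^sup>2)"
    using le nn_integral_eq_integral[OF i] unfolding l2norm_square by simp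
  then have "(l2norm h)\<^sup>2 \<le> c\<^sup>2" by (simp add: ennreal_le_iff)
  then show "l2norm h \<le> c" using c0 by (rule power2_le_imp_le)
qed

lemma l2fun_affine:
  fixes f :: "'a::euclidean_space \<Rightarrow> real"
  assumes f: "l2fun f" and c: "c \<noteq> 0"
  shows "l2fun (\<lambda>y. f (x + c *\<^sub>R y))"
  using f integrable_lborel_affine[of "\<lambda>x. (f x)\<^sup>2" c x] c unfolding l2fun_def by auto

lemma l2fun_shift: "l2fun f \<Longrightarrow> l2fun (\<lambda>y. f (x - y))"
  using l2fun_affine[of f "-1" x] by simp

lemma l2norm_shift: "l2norm (\<lambda>y. f (x - y)) = l2norm f"
  unfolding l2norm_def integral_lborel_reflect[of "\<lambda>x. (f x)\<^sup>2"] ..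

section \<open>Dyadic pieces of the kernel\<close>

locale even_harmonic_poly = harmonic_poly P d for P :: "real^'n::finite \<Rightarrow> real" and d +
  assumes d_even: "even d" and d_pos: "d > 0"
begin

lemma integral_radial_ker:
  assumes "integrable lborel (\<lambda>y. \<phi> (norm y) * ker y)"
  shows "(\<integral>y. \<phi> (norm y) * ker y \<partial>lborel) = 0"
proof -
  \<comment> \<open>The power 0^0 is 1, so this is the moment of order zero, which vanishes because
    d > 0.\<close>
  have eq: "\<phi> (norm y) * ker y = (\<phi> (norm y) / norm y ^ (CARD('n) + d)) * (P y * (0 \<bullet> y) ^ 0)" for y
    by (simp add: ker_eq)
  show ?thesis unfolding eq
    by (subst integral_radial_moment[where \<phi>="\<lambda>r. \<phi> r / r ^ (CARD('n) + d)"])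
       (use assms in \<open>simp_all add: eq sphere_moment_zero[OF d_pos]\<close>)
qed

definition ann :: "real \<Rightarrow> real^'n \<Rightarrow> real" where
  "ann s y = indicator {y. s < norm y \<and> norm y \<le> 2 * s} y * ker y"

lemma annulus_measurable [measurable]: "{y::real^'n. s < norm y \<and> norm y \<le> t} \<in> sets borel" "{y::real^'n. s < norm y} \<in> sets borel"
  by measurable

lemma ker_annulus_bcs:
  assumes "s > 0"
  shows "bcs (\<lambda>y. indicator {y. s < norm y \<and> norm y \<le> t} y * ker y)"
proof (rule bcsI[of _ "CP / s ^ CARD('n)" t])
  show "\<bar>indicator {y. s < norm y \<and> norm y \<le> t} y * ker y\<bar> \<le> CP / s ^ CARD('n)" for y
    using ker_bound_away[OF assms, of y] CP(1) assms by (auto simp: indicator_def)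
qed auto

lemma ann_bcs: "s > 0 \<Longrightarrow> bcs (ann s)"
  unfolding ann_def[abs_def] by (rule ker_annulus_bcs)

lemma ann_even: "ann s (- y) = ann s y"
  by (simp add: ann_def indicator_def ker_even[OF d_even])

lemma integral_ker_annulus:
  assumes "s > 0"
  shows "(\<integral>y. indicator {y. s < norm y \<and> norm y \<le> t} y * ker y \<partial>lborel) = 0"
proof -
  have "(\<lambda>y. indicator {y. s < norm y \<and> norm y \<le> t} y * ker y) = (\<lambda>y. indicator {s<..t} (norm y) * ker y)"
    by (auto simp: indicator_def fun_eq_iff)
  then show ?thesis using integral_radial_ker[of "indicator {s<..t}"] bcs_integrable[OF ker_annulus_bcs[OF assms, of t]] by simp
qed

lemma ann_scale:
  assumes "s > 0"
  shows "ann s y = ann 1 ((1 / s) *\<^sub>R y) / s ^ CARD('n)"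
proof -
  have "ker ((1 / s) *\<^sub>R y) = ker y * s ^ CARD('n)"
    using assms by (subst ker_scale) (auto simp: field_simps)
  moreover have "s < norm y \<longleftrightarrow> 1 < norm y / s" "norm y \<le> 2 * s \<longleftrightarrow> norm y / s \<le> 2"
    using assms by (auto simp: field_simps)
  ultimately show ?thesis using assms unfolding ann_def by (simp add: indicator_def)
qed

text \<open>Homogeneity of degree - n makes the L^1 norm invariant under dilations, so one constant
  serves all dyadic pieces.\<close>

lemma l1norm_ann: "s > 0 \<Longrightarrow> l1norm (ann s) = l1norm (ann 1)"
  unfolding l1norm_def ann_scale[of s]
  using integral_lborel_affine[of "1/s" "\<lambda>y. \<bar>ann 1 y\<bar>" 0]
  by (simp add: abs_divide power_divide)

text \<open>The smoothness of the kernel is used only through this \<open>L\<^sup>1\<close> modulus of continuity.\<close>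
lemma ann_modulus:
  obtains L where "L \<ge> 0" "\<And>h. (\<integral>x. \<bar>ann 1 (x - h) - ann 1 x\<bar> \<partial>lborel) \<le> L * norm h"
proof -
  let ?e = "CARD('n) + d"
  \<comment> \<open>On the annulus this is the kernel. Replacing |x| by max 1 |x| removes the
    singularity and gives a Lipschitz function on the whole ball.\<close>
  define a where "a x = P x * (1 / max 1 (norm x)) ^ ?e" for x
  have lip_inv: "lip_on (cball 0 3) (\<lambda>x::real^'n. 1 / max 1 (norm x))"
  proof (rule lip_onI[of 1 1])
    fix x y :: "real^'n"
    have pos: "max 1 (norm x) \<ge> 1" "max 1 (norm y) \<ge> 1" by auto
    have "1 / max 1 (norm x) - 1 / max 1 (norm y) = (max 1 (norm y) - max 1 (norm x)) / (max 1 (norm x) * max 1 (norm y))"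
      using pos by (simp add: field_simps)
    then have "\<bar>1 / max 1 (norm x) - 1 / max 1 (norm y)\<bar> = \<bar>max 1 (norm y) - max 1 (norm x)\<bar> / (max 1 (norm x) * max 1 (norm y))"
      using pos by (simp add: abs_divide abs_mult)
    also have "\<dots> \<le> \<bar>max 1 (norm y) - max 1 (norm x)\<bar> / 1"
      using pos mult_mono[OF pos] by (intro divide_left_mono) auto
    also have "\<dots> \<le> \<bar>norm x - norm y\<bar>" by (simp add: max_def abs_minus_commute)
    also have "\<dots> \<le> norm (x - y)" by (rule norm_triangle_ineq3)
    finally show "\<bar>1 / max 1 (norm x) - 1 / max 1 (norm y)\<bar> \<le> 1 * norm (x - y)" by simp
    show "\<bar>1 / max 1 (norm x)\<bar> \<le> 1" using pos by simp
  qed auto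
  have "lip_on (cball 0 3) a"
    unfolding a_def[abs_def] by (intro lip_on_mult lip_on_power lip_inv polynomial_function_lip_on P_poly)
  then obtain LA MA where LA: "LA \<ge> 0" "MA \<ge> 0" "\<And>x y. x \<in> cball 0 3 \<Longrightarrow> y \<in> cball 0 3 \<Longrightarrow> \<bar>a x - a y\<bar> \<le> LA * norm (x - y)"
    "\<And>x. x \<in> cball 0 3 \<Longrightarrow> \<bar>a x\<bar> \<le> MA" unfolding lip_on_def by blast
  have ann_a: "ann 1 x = (if 1 < norm x \<and> norm x \<le> 2 then a x else 0)" for x
    by (simp add: ann_def a_def ker_eq max_def power_divide)
  obtain C where C: "C \<ge> 0" "\<And>a h. 0 \<le> h \<Longrightarrow> h \<le> 1 \<Longrightarrow> 1 \<le> a \<Longrightarrow> a \<le> 2 \<Longrightarrow> measure lborel {x::real^'n. \<bar>norm x - a\<bar> \<le> h} \<le> C * h"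
    using shell_measure by metis
  define V where "V = measure lborel (cball (0::real^'n) 3)"
  define L where "L = LA * V + MA * (C + C) + 2 * l1norm (ann 1)"
  have L0: "L \<ge> 0" unfolding L_def V_def using LA C by auto
  have b1: "bcs (ann 1)" by (rule ann_bcs) simp
  have b1s: "bcs (\<lambda>x. ann 1 (x - h))" for h
    using bcs_shift[OF bcs_shift[OF b1, of "- h"], of 0] by (simp add: algebra_simps)
  have iabs: "integrable lborel (\<lambda>x. \<bar>ann 1 (x - h) - ann 1 x\<bar>)" for h
    using bcs_integrable[OF b1] bcs_integrable[OF b1s] by (intro integrable_abs Bochner_Integration.integrable_diff)
  have "(\<integral>x. \<bar>ann 1 (x - h) - ann 1 x\<bar> \<partial>lborel) \<le> L * norm h" for h
  proof (cases "norm h \<le> 1")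
    case False
    have "(\<integral>x. \<bar>ann 1 (x - h) - ann 1 x\<bar> \<partial>lborel) \<le> (\<integral>x. \<bar>ann 1 (x - h)\<bar> + \<bar>ann 1 x\<bar> \<partial>lborel)"
      using iabs bcs_integrable[OF bcs_abs[OF b1]] bcs_integrable[OF bcs_abs[OF b1s]]
      by (intro integral_mono Bochner_Integration.integrable_add) (auto intro: abs_triangle_ineq4)
    also have "\<dots> = (\<integral>x. \<bar>ann 1 (x - h)\<bar> \<partial>lborel) + (\<integral>x. \<bar>ann 1 x\<bar> \<partial>lborel)"
      by (intro Bochner_Integration.integral_add bcs_integrable bcs_abs b1 b1s)
    also have "(\<integral>x. \<bar>ann 1 (x - h)\<bar> \<partial>lborel) = l1norm (ann 1)"
      using integral_lborel_translate[of "\<lambda>x. \<bar>ann 1 x\<bar>" "- h"] by (simp add: l1norm_def)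
    also have "l1norm (ann 1) + (\<integral>x. \<bar>ann 1 x\<bar> \<partial>lborel) = 2 * l1norm (ann 1) * 1" by (simp add: l1norm_def)
    also have "\<dots> \<le> 2 * l1norm (ann 1) * norm h" using False by (intro mult_left_mono) auto
    also have "\<dots> \<le> L * norm h" unfolding L_def V_def using LA C by (intro mult_right_mono) auto
    finally show ?thesis .
  next
    case True
    let ?S = "\<lambda>a. {x::real^'n. \<bar>norm x - a\<bar> \<le> norm h}"
    have Sm[measurable]: "?S a \<in> sets borel" for a by measurable
    have Sfin: "emeasure lborel (?S a) < \<infinity>" for a
    proof -
      have "emeasure lborel (?S a) \<le> emeasure lborel (cball (0::real^'n) (a + norm h))"
        by (rule emeasure_mono) auto
      then show ?thesis using emeasure_lborel_cball_finite[of "0::real^'n" "a + norm h"] by (rule le_less_trans)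
    qed
    \<comment> \<open>If x and x - h both lie in the annulus, the Lipschitz bound applies. If just
      one does, |x| is within |h| of 1 or 2, and only the size of the kernel counts.\<close>
    have pt: "\<bar>ann 1 (x - h) - ann 1 x\<bar> \<le> LA * norm h * indicator (cball 0 3) x + MA * (indicator (?S 1) x + indicator (?S 2) x)" for x
    proof -
      have nd: "\<bar>norm x - norm (x - h)\<bar> \<le> norm h" using norm_triangle_ineq3[of x "x - h"] by simp
      have nn0: "0 \<le> LA * norm h * indicator (cball 0 3) x" using LA by simp
      consider (both) "1 < norm x \<and> norm x \<le> 2" "1 < norm (x - h) \<and> norm (x - h) \<le> 2"
        | (one) "1 < norm x \<and> norm x \<le> 2" "\<not> (1 < norm (x - h) \<and> norm (x - h) \<le> 2)"
        | (two) "\<not> (1 < norm x \<and> norm x \<le> 2)" "1 < norm (x - h) \<and> norm (x - h) \<le> 2"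
        | (none) "\<not> (1 < norm x \<and> norm x \<le> 2)" "\<not> (1 < norm (x - h) \<and> norm (x - h) \<le> 2)" by blast
      then show ?thesis
      proof cases
        case both
        have "\<bar>ann 1 (x - h) - ann 1 x\<bar> \<le> LA * norm h"
          unfolding ann_a using both LA(3)[of "x - h" x] by simp
        moreover have "x \<in> cball 0 3" using both by simp
        moreover have "0 \<le> MA * (indicator (?S 1) x + indicator (?S 2) x)" using LA by simp
        ultimately show ?thesis by simp
      next
        case one
        then have "x \<in> ?S 1 \<or> x \<in> ?S 2" using nd by auto
        then have s: "(1::real) \<le> indicator (?S 1) x + indicator (?S 2) x" by (auto simp: indicator_def)
        have "\<bar>ann 1 (x - h) - ann 1 x\<bar> \<le> MA * 1" unfolding ann_a using one LA(4)[of x] by auto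
        also have "\<dots> \<le> MA * (indicator (?S 1) x + indicator (?S 2) x)" using s LA by (intro mult_left_mono) auto
        finally show ?thesis using nn0 by linarith
      next
        case two
        then have "x \<in> ?S 1 \<or> x \<in> ?S 2" using nd by auto
        then have s: "(1::real) \<le> indicator (?S 1) x + indicator (?S 2) x" by (auto simp: indicator_def)
        have "\<bar>ann 1 (x - h) - ann 1 x\<bar> \<le> MA * 1" unfolding ann_a using two LA(4)[of "x - h"] by auto
        also have "\<dots> \<le> MA * (indicator (?S 1) x + indicator (?S 2) x)" using s LA by (intro mult_left_mono) auto
        finally show ?thesis using nn0 by linarith
      next
        case none
        then have "ann 1 (x - h) - ann 1 x = 0" unfolding ann_a by auto
        then show ?thesis using LA by simp
      qed
    qed
    have iS: "integrable lborel (indicator (?S a) :: _ \<Rightarrow> real)" for a using Sfin[of a] by simp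
    have iB: "integrable lborel (indicator (cball (0::real^'n) 3) :: _ \<Rightarrow> real)" using emeasure_lborel_cball_finite[of "0::real^'n" 3] by simp
    have "(\<integral>x. \<bar>ann 1 (x - h) - ann 1 x\<bar> \<partial>lborel) \<le> (\<integral>x. LA * norm h * indicator (cball 0 3) x + MA * (indicator (?S 1) x + indicator (?S 2) x) \<partial>lborel)"
      using iabs iS iB pt by (intro integral_mono) auto
    also have "\<dots> = LA * norm h * V + MA * (measure lborel (?S 1) + measure lborel (?S 2))"
      using iS iB unfolding V_def by simp
    also have "\<dots> \<le> LA * norm h * V + MA * (C * norm h + C * norm h)"
      using C(2)[of "norm h" 1] C(2)[of "norm h" 2] True LA by (intro add_mono mult_left_mono) auto
    also have "\<dots> = (LA * V + MA * (C + C)) * norm h" by (simp add: algebra_simps)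
    also have "\<dots> \<le> L * norm h" unfolding L_def by (intro mult_right_mono) auto
    finally show ?thesis .
  qed
  then show ?thesis using that L0 by blast
qed

text \<open>\<open>ann s\<close> has integral zero, so \<open>ann t x\<close> may be subtracted from
  \<open>ann t (x - y)\<close>. As |y| \<le> 2 s on the support of \<open>ann s\<close>, the modulus
  of continuity at scale t gives the factor s / t, which is a gain when s is the smaller
  scale.\<close>

lemma l1norm_conv_ann:
  assumes L: "\<And>h. (\<integral>x. \<bar>ann 1 (x - h) - ann 1 x\<bar> \<partial>lborel) \<le> L * norm h" "L \<ge> 0"
    and s: "0 < s" "0 < t"
  shows "l1norm (conv (ann s) (ann t)) \<le> l1norm (ann 1) * L * 2 * (s / t)"
proof -
  let ?n = "CARD('n)"
  have bs: "bcs (ann s)" and bt: "bcs (ann t)" using s by (auto intro: ann_bcs)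
  have [measurable]: "ann s \<in> borel_measurable borel" "ann t \<in> borel_measurable borel" using bs bt by measurable
  have bts: "bcs (\<lambda>x. ann t (x - y))" for y
    using bcs_shift[OF bcs_shift[OF bt, of "- y"], of 0] by (simp add: algebra_simps)
  have mod: "(\<integral>x. \<bar>ann t (x - y) - ann t x\<bar> \<partial>lborel) \<le> L * (norm y / t)" for y
  proof -
    have "(\<integral>x. \<bar>ann t (x - y) - ann t x\<bar> \<partial>lborel) = (\<integral>x. \<bar>ann 1 (0 + (1/t) *\<^sub>R x - (1/t) *\<^sub>R y) - ann 1 (0 + (1/t) *\<^sub>R x)\<bar> / t ^ ?n \<partial>lborel)"
      using s by (intro Bochner_Integration.integral_cong refl)
        (simp add: ann_scale[of t] scaleR_diff_right diff_divide_distrib[symmetric] abs_divide)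
    also have "\<dots> = (\<integral>x. \<bar>ann 1 (x - (1/t) *\<^sub>R y) - ann 1 x\<bar> \<partial>lborel)"
      using integral_lborel_affine[of "1/t" "\<lambda>x. \<bar>ann 1 (x - (1/t) *\<^sub>R y) - ann 1 x\<bar>" 0] s
      by (simp add: power_divide)
    also have "\<dots> \<le> L * norm ((1/t) *\<^sub>R y)" by (rule L)
    finally show ?thesis using s by simp
  qed
  obtain M1 where M1: "M1 \<ge> 0" "\<And>y. \<bar>ann s y\<bar> \<le> M1" using bcsE[OF bs] by metis
  obtain M2 where M2: "M2 \<ge> 0" "\<And>y. \<bar>ann t y\<bar> \<le> M2" using bcsE[OF bt] by metis
  have int: "integrable (lborel \<Otimes>\<^sub>M lborel) (\<lambda>(y, x). \<bar>ann s y\<bar> * \<bar>ann t (x - y) - ann t x\<bar>)"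
    unfolding lborel_prod
  proof (rule integrable_bounded_support[of _ "M1 * (M2 + M2)" "2 * s + (2 * s + 2 * t)"])
    show "(\<lambda>(y, x). \<bar>ann s y\<bar> * \<bar>ann t (x - y) - ann t x\<bar>) \<in> borel_measurable borel"
      unfolding borel_prod[symmetric] by measurable
    show "\<bar>case z of (y, x) \<Rightarrow> \<bar>ann s y\<bar> * \<bar>ann t (x - y) - ann t x\<bar>\<bar> \<le> M1 * (M2 + M2)" for z
    proof -
      have "\<bar>ann t (x - y) - ann t x\<bar> \<le> M2 + M2" for x y using M2(2)[of "x - y"] M2(2)[of x] by linarith
      then have "\<bar>ann s y\<bar> * \<bar>ann t (x - y) - ann t x\<bar> \<le> M1 * (M2 + M2)" for x y
        using M1 M2 by (intro mult_mono) auto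
      then show ?thesis by (cases z) (simp only: prod.case abs_mult abs_abs)
    qed
    show "(case z of (y, x) \<Rightarrow> \<bar>ann s y\<bar> * \<bar>ann t (x - y) - ann t x\<bar>) = 0" if "norm z > 2 * s + (2 * s + 2 * t)" for z
    proof -
      obtain y x where z: "z = (y, x)" by (cases z)
      have "norm y + norm x > 2 * s + (2 * s + 2 * t)" using that norm_Pair_le[of y x] z by simp
      then consider "norm y > 2 * s" | "norm y \<le> 2 * s" "norm x > 2 * s + 2 * t" by linarith
      then show ?thesis
      proof cases
        case 1
        then show ?thesis by (simp add: z ann_def)
      next
        case 2
        then have "norm (x - y) > 2 * t" "norm x > 2 * t" using norm_triangle_ineq2[of x y] s by linarith+
        then show ?thesis by (simp add: z ann_def)
      qed
    qed
  qed
  have pt: "\<bar>conv (ann s) (ann t) x\<bar> \<le> (\<integral>y. \<bar>ann s y\<bar> * \<bar>ann t (x - y) - ann t x\<bar> \<partial>lborel)" for x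
  proof -
    have "(\<integral>y. ann s y * ann t x \<partial>lborel) = 0"
      using integral_ker_annulus[OF s(1), of "2 * s"] by (simp add: ann_def)
    then have "conv (ann s) (ann t) x = (\<integral>y. ann s y * ann t (x - y) \<partial>lborel) - (\<integral>y. ann s y * ann t x \<partial>lborel)"
      by (simp add: conv_def)
    also have "\<dots> = (\<integral>y. ann s y * (ann t (x - y) - ann t x) \<partial>lborel)"
      using conv_integrable[OF bs bt, of x] bcs_integrable[OF bs]
      by (subst Bochner_Integration.integral_diff[symmetric]) (auto simp: right_diff_distrib)
    finally show ?thesis unfolding abs_mult[symmetric] using integral_abs_bound[of lborel "\<lambda>y. ann s y * (ann t (x - y) - ann t x)"] by simp
  qed
  have "l1norm (conv (ann s) (ann t)) \<le> (\<integral>x. (\<integral>y. \<bar>ann s y\<bar> * \<bar>ann t (x - y) - ann t x\<bar> \<partial>lborel) \<partial>lborel)"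
    unfolding l1norm_def
    using pt bcs_integrable[OF bcs_abs[OF bcs_conv[OF bs bt]]] lborel_pair.integrable_snd[OF int]
    by (intro integral_mono) auto
  also have "\<dots> = (\<integral>y. (\<integral>x. \<bar>ann s y\<bar> * \<bar>ann t (x - y) - ann t x\<bar> \<partial>lborel) \<partial>lborel)"
    by (rule lborel_pair.Fubini_integral[OF int])
  also have "\<dots> \<le> (\<integral>y. L * (2 * (s / t)) * \<bar>ann s y\<bar> \<partial>lborel)"
  proof (rule integral_mono)
    show "integrable lborel (\<lambda>y. \<integral>x. \<bar>ann s y\<bar> * \<bar>ann t (x - y) - ann t x\<bar> \<partial>lborel)"
      using lborel_pair.integrable_fst'[OF int] by simp
    show "integrable lborel (\<lambda>y. L * (2 * (s / t)) * \<bar>ann s y\<bar>)" using bcs_integrable[OF bcs_abs[OF bs]] by simp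
    fix y
    show "(\<integral>x. \<bar>ann s y\<bar> * \<bar>ann t (x - y) - ann t x\<bar> \<partial>lborel) \<le> L * (2 * (s / t)) * \<bar>ann s y\<bar>"
    proof (cases "norm y \<le> 2 * s")
      case True
      have "(\<integral>x. \<bar>ann t (x - y) - ann t x\<bar> \<partial>lborel) \<le> L * (norm y / t)" by (rule mod)
      also have "\<dots> \<le> L * (2 * (s / t))" using True s L(2) by (intro mult_left_mono) (auto simp: divide_right_mono)
      finally have "(\<integral>x. \<bar>ann t (x - y) - ann t x\<bar> \<partial>lborel) \<le> L * (2 * (s / t))" .
      from mult_left_mono[OF this, of "\<bar>ann s y\<bar>"] show ?thesis by (simp add: mult.commute)
    qed (simp add: ann_def)
  qed
  also have "\<dots> = l1norm (ann 1) * L * 2 * (s / t)"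
    using l1norm_ann[OF s(1)] by (simp add: l1norm_def)
  finally show ?thesis .
qed

text \<open>The essential point is that B depends neither on \<delta> nor on the number m of dyadic
  annuli.\<close>

lemma truncated_l2_bound:
  obtains B where "B > 0" "\<And>\<delta> m f. \<delta> > 0 \<Longrightarrow> bcs f \<Longrightarrow>
    l2norm (conv (\<lambda>y. indicator {y. \<delta> < norm y \<and> norm y \<le> \<delta> * 2 ^ m} y * ker y) f) \<le> B * l2norm f"
proof -
  obtain L where L: "L \<ge> 0" "\<And>h. (\<integral>x. \<bar>ann 1 (x - h) - ann 1 x\<bar> \<partial>lborel) \<le> L * norm h"
    using ann_modulus by blast
  define C where "C = l1norm (ann 1) * L * 2"
  have C: "C \<ge> 0" using L by (simp add: C_def)
  \<comment> \<open>The convolutions of two pieces decay like 2^(-|j-k|), and \<open>w\<close> has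
    to bound them by its square, hence the root.\<close>
  define \<rho> where "\<rho> = sqrt (1 / 2)"
  have rho: "0 \<le> \<rho>" "\<rho> < 1" "\<rho>\<^sup>2 = 1 / 2" by (auto simp: \<rho>_def)
  define w where "w j k = sqrt C * \<rho> ^ (if j \<le> k then k - j else j - k)" for j k :: nat
  \<comment> \<open>The summand 1 makes B positive even if C = 0.\<close>
  define B where "B = sqrt C * (2 / (1 - \<rho>)) + 1"
  have B: "B > 0" using C rho by (auto simp: B_def intro!: add_nonneg_pos)
  have w2: "(w j k)\<^sup>2 = C * (1 / 2) ^ (if j \<le> k then k - j else j - k)" for j k
  proof -
    have "(\<rho> ^ i)\<^sup>2 = (1 / 2) ^ i" for i by (metis rho(3) power_mult mult.commute)
    then show ?thesis unfolding w_def power_mult_distrib using C by simp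
  qed
  have "l2norm (conv (\<lambda>y. indicator {y. \<delta> < norm y \<and> norm y \<le> \<delta> * 2 ^ m} y * ker y) f) \<le> B * l2norm f" if \<delta>: "\<delta> > 0" and f: "bcs f" for \<delta> m f
  proof -
    have step: "l1norm (conv (ann (\<delta> * 2 ^ j)) (ann (\<delta> * 2 ^ k))) \<le> C * (1 / 2) ^ (k - j)" if "j \<le> k" for j k :: nat
    proof -
      have "(\<delta> * 2 ^ j) / (\<delta> * 2 ^ k) = (1 / 2) ^ (k - j)"
        using \<delta> that by (simp add: power_diff power_divide)
      then show ?thesis using l1norm_conv_ann[OF L(2,1), of "\<delta> * 2 ^ j" "\<delta> * 2 ^ k"] \<delta> by (simp add: C_def)
    qed
    interpret almost_orthogonal "\<lambda>j. ann (\<delta> * 2 ^ j)" m "l1norm (ann 1)" B w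
    proof
      fix j k :: nat
      show "bcs (ann (\<delta> * 2 ^ j))" using \<delta> by (simp add: ann_bcs)
      show "ann (\<delta> * 2 ^ j) (- x) = ann (\<delta> * 2 ^ j) x" for x by (rule ann_even)
      show "l1norm (ann (\<delta> * 2 ^ j)) \<le> l1norm (ann 1)" using l1norm_ann[of "\<delta> * 2 ^ j"] \<delta> by simp
      show "w j k \<ge> 0" using C rho by (simp add: w_def)
      show "l1norm (conv (ann (\<delta> * 2 ^ j)) (ann (\<delta> * 2 ^ k))) \<le> (w j k)\<^sup>2"
      proof (cases "j \<le> k")
        case False
        have "conv (ann (\<delta> * 2 ^ j)) (ann (\<delta> * 2 ^ k)) = conv (ann (\<delta> * 2 ^ k)) (ann (\<delta> * 2 ^ j))"
          by (rule ext) (rule conv_commute)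
        then show ?thesis using step[of k j] False by (simp add: w2)
      qed (use step w2 in simp)
      show "(\<Sum>k<m. w j k) \<le> B"
        unfolding w_def B_def sum_distrib_left[symmetric]
        using mult_left_mono[OF sum_geometric_two_sided[OF rho(1,2), of j m], of "sqrt C"] C by simp
    qed (use B in auto)
    have "total y = indicator {y. \<delta> < norm y \<and> norm y \<le> \<delta> * 2 ^ m} y * ker y" for y
    proof -
      have "(\<Sum>j<m. ann (\<delta> * 2 ^ j) y) = indicator {y. \<delta> < norm y \<and> norm y \<le> \<delta> * 2 ^ m} y * ker y"
      proof (induction m)
        case (Suc m)
        have "\<delta> \<le> \<delta> * 2 ^ m" "\<delta> * 2 ^ Suc m = 2 * (\<delta> * 2 ^ m)" "0 < \<delta> * 2 ^ m" using \<delta> by simp_all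
        then show ?case unfolding sum.lessThan_Suc Suc.IH unfolding ann_def by (auto simp: indicator_def simp del: power_Suc mult_le_cancel_left1 mult_less_cancel_left1)
      qed (simp add: indicator_def)
      then show ?thesis by (simp add: total_def)
    qed
    then have "total = (\<lambda>y. indicator {y. \<delta> < norm y \<and> norm y \<le> \<delta> * 2 ^ m} y * ker y)" by (rule ext)
    then show ?thesis using cotlar_bound[OF f] by simp
  qed
  then show ?thesis using that B by blast
qed

end

section \<open>Convergence of the truncations in the mean\<close>

lemma nn_integral_radial:
  fixes g :: "real \<Rightarrow> ennreal"
  assumes [measurable]: "g \<in> borel_measurable borel"
  shows "(\<integral>\<^sup>+y. g (norm (y::'a::euclidean_space)) \<partial>lborel) = emeasure lborel (ball (0::'a) 1) * (\<integral>\<^sup>+r. ennreal (polar_density TYPE('a) r) * g r \<partial>lborel)"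
proof -
  have "(\<integral>\<^sup>+y. g (norm (y::'a)) \<partial>lborel) = (\<integral>\<^sup>+u. indicator (ball 0 1) (u::'a) * (\<integral>\<^sup>+r. ennreal (polar_density TYPE('a) r) * g (norm (r *\<^sub>R sgn u)) \<partial>lborel) \<partial>lborel)"
    by (rule nn_integral_polar) simp
  also have "\<dots> = (\<integral>\<^sup>+u. (\<integral>\<^sup>+r. ennreal (polar_density TYPE('a) r) * g r \<partial>lborel) * indicator (ball 0 1) (u::'a) \<partial>lborel)"
  proof (rule nn_integral_cong_AE, use AE_lborel_nonzero in eventually_elim)
    fix u :: 'a assume u: "u \<noteq> 0"
    have "(\<integral>\<^sup>+r. ennreal (polar_density TYPE('a) r) * g (norm (r *\<^sub>R sgn u)) \<partial>lborel) = (\<integral>\<^sup>+r. ennreal (polar_density TYPE('a) r) * g r \<partial>lborel)"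
      using u by (intro nn_integral_cong) (auto simp: polar_density_def indicator_def norm_sgn)
    then show "indicator (ball 0 1) u * (\<integral>\<^sup>+r. ennreal (polar_density TYPE('a) r) * g (norm (r *\<^sub>R sgn u)) \<partial>lborel)
      = (\<integral>\<^sup>+r. ennreal (polar_density TYPE('a) r) * g r \<partial>lborel) * indicator (ball 0 1) u"
      by (simp add: mult.commute)
  qed
  also have "\<dots> = (\<integral>\<^sup>+r. ennreal (polar_density TYPE('a) r) * g r \<partial>lborel) * emeasure lborel (ball (0::'a) 1)"
    by (subst nn_integral_cmult_indicator) auto
  finally show ?thesis by (simp add: mult.commute)
qed

section \<open>Density of Lipschitz functions of bounded support\<close>

definition lcs :: "('a::euclidean_space \<Rightarrow> real) \<Rightarrow> bool" where
  "lcs \<phi> \<longleftrightarrow> (\<exists>L R. L \<ge> 0 \<and> (\<forall>x y. \<bar>\<phi> x - \<phi> y\<bar> \<le> L * norm (x - y)) \<and> (\<forall>x. norm x > R \<longrightarrow> \<phi> x = 0))"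

lemma lcsI: "L \<ge> 0 \<Longrightarrow> (\<And>x y. \<bar>\<phi> x - \<phi> y\<bar> \<le> L * norm (x - y)) \<Longrightarrow> (\<And>x. norm x > R \<Longrightarrow> \<phi> x = 0) \<Longrightarrow> lcs \<phi>"
  unfolding lcs_def by blast

lemma lcsE:
  assumes "lcs \<phi>"
  obtains L R where "L \<ge> 0" "R \<ge> 0" "\<And>x y. \<bar>\<phi> x - \<phi> y\<bar> \<le> L * norm (x - y)" "\<And>x. norm x > R \<Longrightarrow> \<phi> x = 0"
proof -
  obtain L R where "L \<ge> 0" "\<And>x y. \<bar>\<phi> x - \<phi> y\<bar> \<le> L * norm (x - y)" "\<And>x. norm x > R \<Longrightarrow> \<phi> x = 0"
    using assms unfolding lcs_def by blast
  then show ?thesis using that[of L "max 0 R"] by simp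
qed

lemma lcs_continuous: "lcs \<phi> \<Longrightarrow> continuous_on UNIV \<phi>"
proof (elim lcsE)
  fix L R assume L: "L \<ge> 0" "\<And>x y. \<bar>\<phi> x - \<phi> y\<bar> \<le> L * norm (x - y)"
  have "L-lipschitz_on UNIV \<phi>" by (rule lipschitz_onI) (use L in \<open>auto simp: dist_norm\<close>)
  then show ?thesis by (rule lipschitz_on_continuous_on)
qed

lemma lcs_bcs: "lcs \<phi> \<Longrightarrow> bcs \<phi>"
proof -
  assume l: "lcs \<phi>"
  obtain L R where L: "L \<ge> 0" "R \<ge> 0" "\<And>x y. \<bar>\<phi> x - \<phi> y\<bar> \<le> L * norm (x - y)" "\<And>x. norm x > R \<Longrightarrow> \<phi> x = 0"
    using lcsE[OF l] by metis
  have "continuous_on (cball 0 R) \<phi>" using lcs_continuous[OF l] by (rule continuous_on_subset) simp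
  from continuous_on_compact_abs_bound[OF compact_cball this]
  obtain M where M: "M \<ge> 0" "\<And>z. z \<in> cball 0 R \<Longrightarrow> \<bar>\<phi> z\<bar> \<le> M" by metis
  show "bcs \<phi>"
  proof (rule bcsI[of _ M R])
    show "\<phi> \<in> borel_measurable borel" using lcs_continuous[OF l] by (rule borel_measurable_continuous_onI)
    show "\<bar>\<phi> x\<bar> \<le> M" for x using M L(4)[of x] by (cases "norm x \<le> R") auto
  qed (use L in auto)
qed

lemma lcs_add: "lcs f \<Longrightarrow> lcs g \<Longrightarrow> lcs (\<lambda>x. f x + g x)"
proof -
  assume f: "lcs f" and g: "lcs g"
  obtain L R where 1: "L \<ge> 0" "\<And>x y. \<bar>f x - f y\<bar> \<le> L * norm (x - y)" "\<And>x. norm x > R \<Longrightarrow> f x = 0" using lcsE[OF f] by metis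
  obtain L' R' where 2: "L' \<ge> 0" "\<And>x y. \<bar>g x - g y\<bar> \<le> L' * norm (x - y)" "\<And>x. norm x > R' \<Longrightarrow> g x = 0" using lcsE[OF g] by metis
  show ?thesis
  proof (rule lcsI[of "L + L'" _ "max R R'"])
    show "\<bar>f x + g x - (f y + g y)\<bar> \<le> (L + L') * norm (x - y)" for x y
      using 1(2)[of x y] 2(2)[of x y] unfolding distrib_right by linarith
  qed (use 1 2 in auto)
qed

lemma lcs_cmult: "lcs f \<Longrightarrow> lcs (\<lambda>x. c * f x)"
proof -
  assume f: "lcs f"
  obtain L R where 1: "L \<ge> 0" "\<And>x y. \<bar>f x - f y\<bar> \<le> L * norm (x - y)" "\<And>x. norm x > R \<Longrightarrow> f x = 0" using lcsE[OF f] by metis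
  show ?thesis
  proof (rule lcsI[of "\<bar>c\<bar> * L" _ R])
    show "\<bar>c * f x - c * f y\<bar> \<le> \<bar>c\<bar> * L * norm (x - y)" for x y
      using mult_left_mono[OF 1(2)[of x y], of "\<bar>c\<bar>"] by (simp add: abs_mult[symmetric] right_diff_distrib mult.assoc)
  qed (use 1 in auto)
qed

lemma lcs_clamp: "lcs f \<Longrightarrow> M \<ge> 0 \<Longrightarrow> lcs (\<lambda>x. max (- M) (min M (f x)))"
proof -
  assume f: "lcs f" and M: "M \<ge> 0"
  obtain L R where 1: "L \<ge> 0" "\<And>x y. \<bar>f x - f y\<bar> \<le> L * norm (x - y)" "\<And>x. norm x > R \<Longrightarrow> f x = 0" using lcsE[OF f] by metis
  show ?thesis
  proof (rule lcsI[OF 1(1), of _ R])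
    fix x y
    have "\<bar>max (- M) (min M (f x)) - max (- M) (min M (f y))\<bar> \<le> \<bar>f x - f y\<bar>" by (auto simp: max_def min_def)
    then show "\<bar>max (- M) (min M (f x)) - max (- M) (min M (f y))\<bar> \<le> L * norm (x - y)" using 1(2)[of x y] by linarith
  qed (use 1(3) M in auto)
qed

text \<open>A multiple of the distance to the complement, cut off at 1, tends to the indicator of U
  from below; a second factor cuts off at infinity.\<close>

lemma open_indicator_lcs_approx:
  fixes U :: "'a::euclidean_space set"
  assumes U: "open U" "emeasure lborel U < \<infinity>" and e: "e > 0"
  shows "\<exists>\<phi>. lcs \<phi> \<and> (\<integral>x. \<bar>indicator U x - \<phi> x\<bar> \<partial>lborel) < e"
proof -
  define D where "D = - U"
  have D: "closed D" "D \<noteq> {}"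
  proof -
    show "closed D" using U by (simp add: D_def closed_Compl)
    \<comment> \<open>The whole space has infinite measure. A nonempty complement is required
      because the distance to the empty set is 0 by convention.\<close>
    have "U \<noteq> UNIV" using U by auto
    then show "D \<noteq> {}" by (auto simp: D_def)
  qed
  define a where "a k x = min 1 (real k * infdist x D)" for k x
  define c where "c k x = max 0 (min 1 (real k + 1 - norm x))" for k and x :: 'a
  define \<phi> where "\<phi> k x = a k x * c k x" for k x
  have a01: "0 \<le> a k x" "a k x \<le> 1" and c01: "0 \<le> c k x" "c k x \<le> 1" for k x
    by (auto simp: a_def c_def infdist_nonneg)
  have la: "\<bar>a k x - a k y\<bar> \<le> real k * norm (x - y)" for k x y
  proof -
    have "\<bar>infdist x D - infdist y D\<bar> \<le> norm (x - y)"
      using infdist_triangle[of x D y] infdist_triangle[of y D x] by (simp add: dist_norm norm_minus_commute abs_le_iff)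
    from mult_left_mono[OF this, of "real k"]
    have "\<bar>real k * infdist x D - real k * infdist y D\<bar> \<le> real k * norm (x - y)"
      unfolding right_diff_distrib[symmetric] abs_mult by simp
    then show ?thesis unfolding a_def by (auto simp: min_def)
  qed
  have lc: "\<bar>c k x - c k y\<bar> \<le> norm (x - y)" for k x y
  proof -
    have "\<bar>c k x - c k y\<bar> \<le> \<bar>norm x - norm y\<bar>" unfolding c_def by (auto simp: max_def min_def)
    then show ?thesis using norm_triangle_ineq3[of x y] by linarith
  qed
  have l: "lcs (\<phi> k)" for k
  proof (rule lcsI[of "real k + 1" _ "real k + 1"])
    fix x y
    have "\<phi> k x - \<phi> k y = (a k x - a k y) * c k x + a k y * (c k x - c k y)" by (simp add: \<phi>_def algebra_simps)
    then have "\<bar>\<phi> k x - \<phi> k y\<bar> \<le> \<bar>a k x - a k y\<bar> * \<bar>c k x\<bar> + \<bar>a k y\<bar> * \<bar>c k x - c k y\<bar>"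
      by (metis abs_mult abs_triangle_ineq)
    also have "\<dots> \<le> (real k * norm (x - y)) * 1 + 1 * norm (x - y)"
      using la lc a01 c01 by (intro add_mono mult_mono) auto
    finally show "\<bar>\<phi> k x - \<phi> k y\<bar> \<le> (real k + 1) * norm (x - y)" by (simp add: algebra_simps)
  qed (auto simp: \<phi>_def c_def)
  have [measurable]: "\<phi> k \<in> borel_measurable borel" for k using lcs_bcs[OF l] by measurable
  have [measurable]: "U \<in> sets borel" using U by simp
  have "(\<lambda>k. \<integral>x. \<bar>indicator U x - \<phi> k x\<bar> \<partial>lborel) \<longlonglongrightarrow> (\<integral>x. 0 \<partial>(lborel :: 'a measure))"
  proof (rule integral_dominated_convergence[where w="indicator U"])
    show "integrable lborel (indicator U :: 'a \<Rightarrow> real)" using U by simp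
    show "AE x in lborel. (\<lambda>k. \<bar>indicator U x - \<phi> k x\<bar>) \<longlonglongrightarrow> (0::real)"
    proof (rule AE_I2)
      fix x :: 'a
      have "\<forall>\<^sub>F k in sequentially. \<bar>indicator U x - \<phi> k x\<bar> = (0::real)"
      proof (cases "x \<in> U")
        case True
        then have "infdist x D > 0" using D by (simp add: D_def infdist_pos_not_in_closed)
        then obtain k0 :: nat where k0: "1 < real k0 * infdist x D" using reals_Archimedean3 by blast
        obtain k1 :: nat where k1: "norm x \<le> real k1" using real_arch_simple by blast
        have "\<bar>indicator U x - \<phi> k x\<bar> = (0::real)" if k: "k \<ge> max k0 k1" for k
        proof -
          have "real k0 * infdist x D \<le> real k * infdist x D" using k by (intro mult_right_mono) (auto simp: infdist_nonneg)
          then have "a k x = 1" using k0 by (simp add: a_def)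
          moreover have "c k x = 1" using k k1 by (simp add: c_def)
          ultimately show ?thesis using True by (simp add: \<phi>_def)
        qed
        then show ?thesis unfolding eventually_sequentially by blast
      next
        case False
        then have "infdist x D = 0" by (simp add: D_def)
        then show ?thesis using False by (simp add: \<phi>_def a_def)
      qed
      then show "(\<lambda>k. \<bar>indicator U x - \<phi> k x\<bar>) \<longlonglongrightarrow> (0::real)" by (rule tendsto_eventually)
    qed
    show "AE x in lborel. norm \<bar>indicator U x - \<phi> k x\<bar> \<le> indicator U x" for k
    proof (rule AE_I2)
      fix x :: 'a
      have "0 \<le> \<phi> k x" "\<phi> k x \<le> 1" unfolding \<phi>_def using a01 c01 by (auto simp: mult_le_one)
      moreover have "\<phi> k x = 0" if "x \<notin> U" using that by (simp add: \<phi>_def a_def D_def)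
      ultimately show "norm \<bar>indicator U x - \<phi> k x\<bar> \<le> indicator U x" by (auto simp: indicator_def)
    qed
  qed measurable
  then have "(\<lambda>k. \<integral>x. \<bar>indicator U x - \<phi> k x\<bar> \<partial>lborel) \<longlonglongrightarrow> 0" by simp
  from order_tendstoD(2)[OF this e] obtain k where "(\<integral>x. \<bar>indicator U x - \<phi> k x\<bar> \<partial>lborel) < e"
    unfolding eventually_sequentially by blast
  then show ?thesis using l by blast
qed

text \<open>Induction over integrable functions; an indicator is first replaced by that of an open
  superset, by outer regularity of Lebesgue measure.\<close>

lemma integrable_lcs_approx:
  fixes f :: "'a::euclidean_space \<Rightarrow> real"
  assumes "integrable lborel f"
  shows "\<forall>e>0. \<exists>\<phi>. lcs \<phi> \<and> (\<integral>x. \<bar>f x - \<phi> x\<bar> \<partial>lborel) < e"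
  using assms
proof (induction f rule: integrable_induct)
  case (base A c)
  show ?case
  proof (intro allI impI)
    fix e :: real assume e: "e > 0"
    define e' where "e' = e / (2 * (\<bar>c\<bar> + 1))"
    have e': "e' > 0" using e by (simp add: e'_def add_nonneg_pos)
    have Ab: "A \<in> sets borel" using base by simp
    obtain T where T: "open T" "A \<subseteq> T" "emeasure lborel (T - A) < ennreal e'"
      using outer_regular_lborel[OF Ab e'] by metis
    have TA: "T - A \<in> sets borel" "T \<in> sets borel" using T(1) Ab by auto
    have TAfin: "emeasure lborel (T - A) < \<infinity>" using T(3) by (auto intro: less_trans)
    have "emeasure lborel T \<le> emeasure lborel A + emeasure lborel (T - A)"
    proof -
      have "A \<union> (T - A) = T" using T(2) by auto
      then show ?thesis using emeasure_subadditive[of A lborel "T - A"] Ab TA by simp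
    qed
    also have "\<dots> < \<infinity>" using base TAfin by (simp add: ennreal_add_less_top)
    finally have Tfin: "emeasure lborel T < \<infinity>" .
    obtain \<phi> where \<phi>: "lcs \<phi>" "(\<integral>x. \<bar>indicator T x - \<phi> x\<bar> \<partial>lborel) < e'"
      using open_indicator_lcs_approx[OF T(1) Tfin e'] by blast
    have iA: "integrable lborel (indicator A :: 'a \<Rightarrow> real)" using base by simp
    have iT: "integrable lborel (indicator T :: 'a \<Rightarrow> real)" using Tfin TA by simp
    have ip: "integrable lborel \<phi>" by (rule bcs_integrable[OF lcs_bcs[OF \<phi>(1)]])
    have "(\<integral>x. \<bar>indicator A x - indicator T x :: real\<bar> \<partial>lborel) = (\<integral>x. indicator (T - A) x \<partial>lborel)"
      using T(2) by (intro Bochner_Integration.integral_cong) (auto split: split_indicator)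
    also have "\<dots> = measure lborel (T - A)" using TA by simp
    also have "\<dots> < e'"
    proof -
      have "ennreal (measure lborel (T - A)) < ennreal e'"
        using T(3) TAfin by (simp add: emeasure_eq_ennreal_measure)
      then show ?thesis by (simp add: ennreal_less_iff)
    qed
    finally have 1: "(\<integral>x. \<bar>indicator A x - indicator T x :: real\<bar> \<partial>lborel) < e'" .
    have "(\<integral>x. \<bar>indicator A x *\<^sub>R c - c * \<phi> x\<bar> \<partial>lborel) \<le> (\<integral>x. \<bar>c\<bar> * (\<bar>indicator A x - indicator T x\<bar> + \<bar>indicator T x - \<phi> x\<bar>) \<partial>lborel)"
    proof (rule integral_mono)
      show "integrable lborel (\<lambda>x. \<bar>indicator A x *\<^sub>R c - c * \<phi> x\<bar>)" using iA ip by auto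
      show "integrable lborel (\<lambda>x. \<bar>c\<bar> * (\<bar>indicator A x - indicator T x\<bar> + \<bar>indicator T x - \<phi> x\<bar>))"
        using iA iT ip by (intro integrable_mult_right Bochner_Integration.integrable_add integrable_abs Bochner_Integration.integrable_diff) auto
      fix x
      have "\<bar>indicator A x *\<^sub>R c - c * \<phi> x\<bar> = \<bar>c\<bar> * \<bar>indicator A x - \<phi> x\<bar>"
        by (simp add: abs_mult[symmetric] right_diff_distrib mult.commute)
      also have "\<dots> \<le> \<bar>c\<bar> * (\<bar>indicator A x - indicator T x\<bar> + \<bar>indicator T x - \<phi> x\<bar>)"
        by (intro mult_left_mono) auto
      finally show "\<bar>indicator A x *\<^sub>R c - c * \<phi> x\<bar> \<le> \<bar>c\<bar> * (\<bar>indicator A x - indicator T x\<bar> + \<bar>indicator T x - \<phi> x\<bar>)" .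
    qed
    also have "\<dots> = \<bar>c\<bar> * ((\<integral>x. \<bar>indicator A x - indicator T x\<bar> \<partial>lborel) + (\<integral>x. \<bar>indicator T x - \<phi> x\<bar> \<partial>lborel))"
      using iA iT ip by simp
    also have "\<dots> \<le> \<bar>c\<bar> * (e' + e')" using 1 \<phi>(2) by (intro mult_left_mono) auto
    also have "\<dots> < (\<bar>c\<bar> + 1) * (e' + e')" using e' by simp
    also have "\<dots> = e" by (simp add: e'_def field_simps add_nonneg_eq_0_iff)
    finally show "\<exists>\<phi>. lcs \<phi> \<and> (\<integral>x. \<bar>indicator A x *\<^sub>R c - \<phi> x\<bar> \<partial>lborel) < e" using lcs_cmult[OF \<phi>(1), of c] by blast
  qed
next
  case (add f g)
  show ?case
  proof (intro allI impI)
    fix e :: real assume "e > 0"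
    then have e: "e / 2 > 0" by simp
    obtain \<phi> \<psi> where \<phi>: "lcs \<phi>" "(\<integral>x. \<bar>f x - \<phi> x\<bar> \<partial>lborel) < e / 2" and \<psi>: "lcs \<psi>" "(\<integral>x. \<bar>g x - \<psi> x\<bar> \<partial>lborel) < e / 2"
      using add.IH e by blast
    have i: "integrable lborel f" "integrable lborel g" "integrable lborel \<phi>" "integrable lborel \<psi>"
      using add.hyps \<phi> \<psi> by (auto intro: bcs_integrable lcs_bcs)
    have "(\<integral>x. \<bar>f x + g x - (\<phi> x + \<psi> x)\<bar> \<partial>lborel) \<le> (\<integral>x. \<bar>f x - \<phi> x\<bar> + \<bar>g x - \<psi> x\<bar> \<partial>lborel)"
      using i by (intro integral_mono) auto
    also have "\<dots> = (\<integral>x. \<bar>f x - \<phi> x\<bar> \<partial>lborel) + (\<integral>x. \<bar>g x - \<psi> x\<bar> \<partial>lborel)" using i by simp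
    also have "\<dots> < e" using \<phi>(2) \<psi>(2) by simp
    finally show "\<exists>\<phi>. lcs \<phi> \<and> (\<integral>x. \<bar>f x + g x - \<phi> x\<bar> \<partial>lborel) < e" using lcs_add[OF \<phi>(1) \<psi>(1)] by blast
  qed
next
  case (lim f s)
  show ?case
  proof (intro allI impI)
    fix e :: real assume "e > 0"
    then have e: "e / 2 > 0" by simp
    have [measurable]: "f \<in> borel_measurable borel" "s i \<in> borel_measurable borel" for i
      using lim.hyps by (auto dest!: borel_measurable_integrable)
    have "(\<lambda>i. \<integral>x. \<bar>f x - s i x\<bar> \<partial>lborel) \<longlonglongrightarrow> (\<integral>x. 0 \<partial>(lborel :: 'a measure))"
    proof (rule integral_dominated_convergence[where w="\<lambda>x. 3 * \<bar>f x\<bar>"])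
      show "integrable lborel (\<lambda>x. 3 * \<bar>f x\<bar>)" using lim.hyps by simp
      show "AE x in lborel. (\<lambda>i. \<bar>f x - s i x\<bar>) \<longlonglongrightarrow> 0"
      proof (rule AE_I2)
        fix x
        have "(\<lambda>i. s i x) \<longlonglongrightarrow> f x" using lim.hyps by simp
        then have "(\<lambda>i. \<bar>f x - s i x\<bar>) \<longlonglongrightarrow> \<bar>f x - f x\<bar>" by (intro tendsto_intros)
        then show "(\<lambda>i. \<bar>f x - s i x\<bar>) \<longlonglongrightarrow> 0" by simp
      qed
      show "AE x in lborel. norm \<bar>f x - s i x\<bar> \<le> 3 * \<bar>f x\<bar>" for i
      proof (rule AE_I2)
        fix x
        have "\<bar>s i x\<bar> \<le> 2 * \<bar>f x\<bar>" using lim.hyps(3)[of x i] by simp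
        then show "norm \<bar>f x - s i x\<bar> \<le> 3 * \<bar>f x\<bar>" by simp
      qed
    qed measurable
    then have "(\<lambda>i. \<integral>x. \<bar>f x - s i x\<bar> \<partial>lborel) \<longlonglongrightarrow> 0" by simp
    from order_tendstoD(2)[OF this e] obtain i where i: "(\<integral>x. \<bar>f x - s i x\<bar> \<partial>lborel) < e / 2"
      unfolding eventually_sequentially by blast
    obtain \<phi> where \<phi>: "lcs \<phi>" "(\<integral>x. \<bar>s i x - \<phi> x\<bar> \<partial>lborel) < e / 2" using lim.IH e by blast
    have ii: "integrable lborel f" "integrable lborel (s i)" "integrable lborel \<phi>"
      using lim.hyps \<phi> by (auto intro: bcs_integrable lcs_bcs)
    have "(\<integral>x. \<bar>f x - \<phi> x\<bar> \<partial>lborel) \<le> (\<integral>x. \<bar>f x - s i x\<bar> + \<bar>s i x - \<phi> x\<bar> \<partial>lborel)"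
      using ii by (intro integral_mono) auto
    also have "\<dots> = (\<integral>x. \<bar>f x - s i x\<bar> \<partial>lborel) + (\<integral>x. \<bar>s i x - \<phi> x\<bar> \<partial>lborel)" using ii by simp
    also have "\<dots> < e" using i \<phi>(2) by simp
    finally show "\<exists>\<phi>. lcs \<phi> \<and> (\<integral>x. \<bar>f x - \<phi> x\<bar> \<partial>lborel) < e" using \<phi>(1) by blast
  qed
qed

text \<open>Cutting both the domain and the values gives a function in \<open>bcs\<close> that at
  each point eventually equals f, so that pointwise limits are trivial.\<close>

definition cut :: "nat \<Rightarrow> ('a::euclidean_space \<Rightarrow> real) \<Rightarrow> 'a \<Rightarrow> real" where
  "cut k f x = (if norm x \<le> real k \<and> \<bar>f x\<bar> \<le> real k then f x else 0)"

lemma cut_bcs: "f \<in> borel_measurable borel \<Longrightarrow> bcs (cut k f)"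
  by (rule bcsI[of _ "real k" "real k"]) (auto simp: cut_def[abs_def])

lemma cut_eventually: "\<forall>\<^sub>F k in sequentially. cut k f x = f x"
proof -
  obtain k0 :: nat where k0: "max (norm x) \<bar>f x\<bar> \<le> real k0" using real_arch_simple by blast
  have "cut k f x = f x" if "k \<ge> k0" for k
  proof -
    have "real k0 \<le> real k" using that by simp
    then show ?thesis using k0 by (simp add: cut_def)
  qed
  then show ?thesis unfolding eventually_sequentially by blast
qed

lemma l2norm_cut_lim:
  assumes f: "l2fun f"
  shows "(\<lambda>k. l2norm (\<lambda>x. f x - cut k f x)) \<longlonglongrightarrow> 0"
proof -
  have [measurable]: "f \<in> borel_measurable borel" "cut k f \<in> borel_measurable borel" for k
    using f cut_bcs by measurable
  have "(\<lambda>k. \<integral>x. (f x - cut k f x)\<^sup>2 \<partial>lborel) \<longlonglongrightarrow> (\<integral>x. 0 \<partial>(lborel :: 'a measure))"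
  proof (rule integral_dominated_convergence[where w="\<lambda>x. (f x)\<^sup>2"])
    show "integrable lborel (\<lambda>x. (f x)\<^sup>2)" using f by (simp add: l2fun_def)
    show "AE x in lborel. (\<lambda>k. (f x - cut k f x)\<^sup>2) \<longlonglongrightarrow> 0"
    proof (rule AE_I2)
      show "(\<lambda>k. (f x - cut k f x)\<^sup>2) \<longlonglongrightarrow> 0" for x
        by (rule tendsto_eventually, rule eventually_mono[OF cut_eventually[of f x]]) simp
    qed
    show "AE x in lborel. norm ((f x - cut k f x)\<^sup>2) \<le> (f x)\<^sup>2" for k
      by (rule AE_I2) (auto simp: cut_def)
  qed measurable
  then have "(\<lambda>k. sqrt (\<integral>x. (f x - cut k f x)\<^sup>2 \<partial>lborel)) \<longlonglongrightarrow> sqrt 0" by (intro tendsto_real_sqrt) simp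
  then show ?thesis by (simp add: l2norm_def)
qed

lemma l2norm_triangle3:
  assumes "l2fun f" "l2fun g" "l2fun h"
  shows "l2norm (\<lambda>x. f x - h x) \<le> l2norm (\<lambda>x. f x - g x) + l2norm (\<lambda>x. g x - h x)"
  using l2norm_triangle[OF l2fun_diff[OF assms(1,2)] l2fun_diff[OF assms(2,3)]] by simp

lemma l2norm_minus_commute: "l2norm (\<lambda>x. f x - g x) = l2norm (\<lambda>x. g x - f x)"
  unfolding l2norm_def by (simp add: power2_commute)

text \<open>Approximation in L^1 is turned into approximation in L^2: f is cut to values in [-M, M]
  and the approximant clamped to the same interval, so the squared error is at most 2 M times the
  error.\<close>

lemma l2fun_lcs_approx:
  assumes f: "l2fun f" and e: "e > 0"
  shows "\<exists>\<phi>. lcs \<phi> \<and> l2norm (\<lambda>x. f x - \<phi> x) < e"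
proof -
  have [measurable]: "f \<in> borel_measurable borel" using f by measurable
  obtain k where k: "l2norm (\<lambda>x. f x - cut k f x) < e / 2"
    using order_tendstoD(2)[OF l2norm_cut_lim[OF f], of "e / 2"] e unfolding eventually_sequentially by auto
  define M where "M = real k"
  define g where "g = cut k f"
  have g: "bcs g" unfolding g_def by (rule cut_bcs) simp
  have gM: "\<bar>g x\<bar> \<le> M" for x by (auto simp: g_def cut_def M_def)
  define e' where "e' = (e / 2)\<^sup>2 / (2 * M + 1)"
  have M0: "M \<ge> 0" by (simp add: M_def)
  have e': "e' > 0" using e M0 by (simp add: e'_def)
  obtain \<psi> where \<psi>: "lcs \<psi>" "(\<integral>x. \<bar>g x - \<psi> x\<bar> \<partial>lborel) < e'"
    using integrable_lcs_approx[OF bcs_integrable[OF g]] e' by blast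
  define \<phi> where "\<phi> x = max (- M) (min M (\<psi> x))" for x
  have \<phi>: "lcs \<phi>" unfolding \<phi>_def[abs_def] by (rule lcs_clamp[OF \<psi>(1) M0])
  have i: "integrable lborel g" "integrable lborel \<psi>" using g \<psi> by (auto intro: bcs_integrable lcs_bcs)
  have d2: "l2fun (\<lambda>x. g x - \<phi> x)" by (intro l2fun_diff bcs_l2fun lcs_bcs g \<phi>)
  have "(l2norm (\<lambda>x. g x - \<phi> x))\<^sup>2 \<le> (\<integral>x. (2 * M) * \<bar>g x - \<psi> x\<bar> \<partial>lborel)"
    unfolding l2norm_square
  proof (rule integral_mono)
    show "integrable lborel (\<lambda>x. (g x - \<phi> x)\<^sup>2)" using d2 by (simp add: l2fun_def)
    show "integrable lborel (\<lambda>x. (2 * M) * \<bar>g x - \<psi> x\<bar>)" using i by auto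
    fix x
    have 1: "\<bar>g x - \<phi> x\<bar> \<le> \<bar>g x - \<psi> x\<bar>" using gM[of x] unfolding \<phi>_def by (auto simp: max_def min_def)
    have 2: "\<bar>g x - \<phi> x\<bar> \<le> 2 * M" using gM[of x] M0 unfolding \<phi>_def by (auto simp: max_def min_def)
    have "\<bar>g x - \<phi> x\<bar> * \<bar>g x - \<phi> x\<bar> \<le> (2 * M) * \<bar>g x - \<psi> x\<bar>" using 1 2 M0 by (intro mult_mono) auto
    then show "(g x - \<phi> x)\<^sup>2 \<le> (2 * M) * \<bar>g x - \<psi> x\<bar>" by (simp add: power2_eq_square)
  qed
  also have "\<dots> \<le> (2 * M) * e'" using \<psi>(2) M0 by (simp add: mult_left_mono)
  also have "\<dots> < (2 * M + 1) * e'" using e' by simp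
  also have "\<dots> = (e / 2)\<^sup>2" using M0 by (simp add: e'_def)
  finally have "l2norm (\<lambda>x. g x - \<phi> x) < e / 2" using e by (intro power2_less_imp_less[of _ "e / 2"]) auto
  moreover have "l2norm (\<lambda>x. f x - \<phi> x) \<le> l2norm (\<lambda>x. f x - g x) + l2norm (\<lambda>x. g x - \<phi> x)"
    by (intro l2norm_triangle3 f bcs_l2fun g lcs_bcs \<phi>)
  ultimately show ?thesis using \<phi> k unfolding g_def by (intro exI[of _ \<phi>]) auto
qed

text \<open>The sum of 2^k (a k)^2 has a finite integral, so it is finite almost everywhere; there
  |a k| is at most (1/2)^k + 2^k (a k)^2, because z \<le> 1 + z^2 for z = 2^k |a k|.\<close>

lemma AE_summable_of_l2_bounds:
  fixes a :: "nat \<Rightarrow> 'a::euclidean_space \<Rightarrow> real"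
  assumes a: "\<And>k. l2fun (a k)" and b: "\<And>k. l2norm (a k) \<le> (1 / 4) ^ k"
  shows "AE x in lborel. summable (\<lambda>k. \<bar>a k x\<bar>)"
proof -
  have [measurable]: "a k \<in> borel_measurable borel" for k using a by measurable
  have nn: "(\<integral>\<^sup>+x. ennreal (2 ^ k * (a k x)\<^sup>2) \<partial>lborel) \<le> ennreal ((1 / 2) ^ k)" for k
  proof -
    have i: "integrable lborel (\<lambda>x. 2 ^ k * (a k x)\<^sup>2)" using a[of k] by (simp add: l2fun_def)
    have "(\<integral>\<^sup>+x. ennreal (2 ^ k * (a k x)\<^sup>2) \<partial>lborel) = ennreal (2 ^ k * (l2norm (a k))\<^sup>2)"
      unfolding l2norm_square using nn_integral_eq_integral[OF i] by simp
    also have "2 ^ k * (l2norm (a k))\<^sup>2 \<le> 2 ^ k * ((1 / 4) ^ k)\<^sup>2" using b[of k] by (intro mult_left_mono power_mono) auto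
    also have "\<dots> = (2 * (1 / 4) * (1 / 4)) ^ k" unfolding power2_eq_square power_mult_distrib by simp
    also have "\<dots> = (1 / 8) ^ k" by simp
    also have "\<dots> \<le> (1 / 2) ^ k" by (intro power_mono) auto
    finally show ?thesis by (simp add: ennreal_leI)
  qed
  have "(\<integral>\<^sup>+x. (\<Sum>k. ennreal (2 ^ k * (a k x)\<^sup>2)) \<partial>lborel) = (\<Sum>k. \<integral>\<^sup>+x. ennreal (2 ^ k * (a k x)\<^sup>2) \<partial>lborel)"
    by (rule nn_integral_suminf) simp
  also have "\<dots> \<le> (\<Sum>k. ennreal ((1 / 2) ^ k))" using nn by (intro suminf_le) auto
  also have "\<dots> < \<infinity>"
  proof -
    have "(\<Sum>k. ennreal ((1 / 2) ^ k)) = ennreal (\<Sum>k. (1 / 2) ^ k)"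
      by (rule suminf_ennreal2) (auto intro: summable_geometric)
    then show ?thesis by simp
  qed
  finally have "(\<integral>\<^sup>+x. (\<Sum>k. ennreal (2 ^ k * (a k x)\<^sup>2)) \<partial>lborel) \<noteq> \<infinity>" by simp
  then have "AE x in lborel. (\<Sum>k. ennreal (2 ^ k * (a k x)\<^sup>2)) \<noteq> \<infinity>"
    by (intro nn_integral_PInf_AE) auto
  then show ?thesis
  proof eventually_elim
    fix x assume "(\<Sum>k. ennreal (2 ^ k * (a k x)\<^sup>2)) \<noteq> \<infinity>"
    then have s: "summable (\<lambda>k. 2 ^ k * (a k x)\<^sup>2)"
      by (intro summable_suminf_not_top) (auto simp: infinity_ennreal_def)
    have "summable (\<lambda>k. (1 / 2) ^ k + 2 ^ k * (a k x)\<^sup>2)"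
      by (intro summable_add s summable_geometric) simp
    then show "summable (\<lambda>k. \<bar>a k x\<bar>)"
    proof (rule summable_comparison_test', simp)
      fix k :: nat
      define z where "z = 2 ^ k * \<bar>a k x\<bar>"
      have "0 \<le> z" "2 * z \<le> 1 + z\<^sup>2" using sum_squares_bound[of 1 z] by (simp_all add: z_def)
      then have "z \<le> 1 + z\<^sup>2" by linarith
      then have "2 ^ k * \<bar>a k x\<bar> \<le> 1 + (2 ^ k)\<^sup>2 * (a k x)\<^sup>2" unfolding z_def power_mult_distrib by simp
      also have "\<dots> = 2 ^ k * ((1 / 2) ^ k + 2 ^ k * (a k x)\<^sup>2)" by (simp add: distrib_left power_divide power2_eq_square)
      finally show "\<bar>a k x\<bar> \<le> (1 / 2) ^ k + 2 ^ k * (a k x)\<^sup>2" by simp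
    qed
  qed
qed

text \<open>Completeness in the form of Riesz and Fischer, for a family indexed by \<delta>
  \<rightarrow> 0. The limit is built along a fast sequence, and Fatou's lemma transfers the
  estimate to every small \<delta>.\<close>

lemma l2_complete:
  fixes F :: "real \<Rightarrow> 'a::euclidean_space \<Rightarrow> real"
  assumes F: "\<And>\<delta>. \<delta> > 0 \<Longrightarrow> l2fun (F \<delta>)"
    and C: "\<And>e. e > 0 \<Longrightarrow> \<exists>\<delta>0>0. \<forall>\<delta> \<delta>'. 0 < \<delta> \<longrightarrow> \<delta> < \<delta>0 \<longrightarrow> 0 < \<delta>' \<longrightarrow> \<delta>' < \<delta>0 \<longrightarrow> l2norm (\<lambda>x. F \<delta> x - F \<delta>' x) \<le> e"
  shows "\<exists>g. l2fun g \<and> (\<forall>e>0. \<exists>\<delta>0>0. \<forall>\<delta>. 0 < \<delta> \<longrightarrow> \<delta> < \<delta>0 \<longrightarrow> l2norm (\<lambda>x. F \<delta> x - g x) \<le> e)"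
proof -
  have "\<forall>k. \<exists>\<delta>0>0. \<forall>\<delta> \<delta>'. 0 < \<delta> \<longrightarrow> \<delta> < \<delta>0 \<longrightarrow> 0 < \<delta>' \<longrightarrow> \<delta>' < \<delta>0 \<longrightarrow> l2norm (\<lambda>x. F \<delta> x - F \<delta>' x) \<le> (1 / 4) ^ k"
    using C by simp
  then obtain s where s: "\<And>k. s k > 0" "\<And>k \<delta> \<delta>'. 0 < \<delta> \<Longrightarrow> \<delta> < s k \<Longrightarrow> 0 < \<delta>' \<Longrightarrow> \<delta>' < s k \<Longrightarrow> l2norm (\<lambda>x. F \<delta> x - F \<delta>' x) \<le> (1 / 4) ^ k"
    by metis
  \<comment> \<open>\<open>t k\<close> lies below all thresholds s i with i \<le> k; the divisor k +
    1 forces it to tend to zero even if the thresholds do not.\<close>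
  define t where "t k = Min (s ` {..k}) / 2 / real (Suc k)" for k
  have mpos: "Min (s ` {..k}) > 0" for k using Min_in[of "s ` {..k}"] s(1) by auto
  have t_pos: "t k > 0" for k unfolding t_def by (intro divide_pos_pos mpos) auto
  have t_le: "t k < s i" if "i \<le> k" for i k
  proof -
    have "m / 2 / real (Suc k) < m" if "m > 0" for m :: real
    proof -
      have "m / 2 / real (Suc k) \<le> m / 2 / 1" using that by (intro divide_left_mono) auto
      also have "m / 2 / 1 < m" using that by simp
      finally show ?thesis .
    qed
    from this[OF mpos[of k]] have "t k < Min (s ` {..k})" by (simp only: t_def)
    also have "\<dots> \<le> s i" using that by (intro Min_le) auto
    finally show ?thesis .
  qed
  have tc: "l2norm (\<lambda>x. F (t j) x - F (t k) x) \<le> (1 / 4) ^ i" if "i \<le> j" "i \<le> k" for i j k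
    using s(2)[of "t j" i "t k"] t_pos t_le that by auto
  have [measurable]: "F (t k) \<in> borel_measurable borel" for k using F[OF t_pos[of k]] by measurable
  define g where "g x = lim (\<lambda>k. F (t k) x)" for x
  have gm[measurable]: "g \<in> borel_measurable borel" unfolding g_def[abs_def] by measurable
  have "AE x in lborel. summable (\<lambda>k. \<bar>F (t (Suc k)) x - F (t k) x\<bar>)"
  proof (rule AE_summable_of_l2_bounds)
    show "l2fun (\<lambda>x. F (t (Suc k)) x - F (t k) x)" for k by (intro l2fun_diff F t_pos)
    show "l2norm (\<lambda>x. F (t (Suc k)) x - F (t k) x) \<le> (1 / 4) ^ k" for k by (rule tc) auto
  qed
  then have lim: "AE x in lborel. (\<lambda>k. F (t k) x) \<longlonglongrightarrow> g x"
  proof eventually_elim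
    fix x assume "summable (\<lambda>k. \<bar>F (t (Suc k)) x - F (t k) x\<bar>)"
    then have "summable (\<lambda>k. F (t (Suc k)) x - F (t k) x)" by (rule summable_rabs_cancel)
    then have "convergent (\<lambda>n. \<Sum>k<n. F (t (Suc k)) x - F (t k) x)" by (simp add: summable_iff_convergent)
    then have "convergent (\<lambda>n. F (t n) x - F (t 0) x)" unfolding sum_lessThan_telescope[of "\<lambda>k. F (t k) x"] .
    then obtain l where "(\<lambda>n. F (t n) x - F (t 0) x) \<longlonglongrightarrow> l" unfolding convergent_def by blast
    then have "(\<lambda>n. F (t n) x - F (t 0) x + F (t 0) x) \<longlonglongrightarrow> l + F (t 0) x" by (intro tendsto_add tendsto_const)
    then have "convergent (\<lambda>n. F (t n) x)" unfolding convergent_def by auto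
    then show "(\<lambda>k. F (t k) x) \<longlonglongrightarrow> g x" unfolding g_def by (rule convergent_LIMSEQ_iff[THEN iffD1])
  qed
  have t_lim: "t \<longlonglongrightarrow> 0"
  proof (rule tendsto_sandwich[where f="\<lambda>_. 0" and h="\<lambda>k. s 0 / 2 / real (Suc k)"])
    show "(\<lambda>k. s 0 / 2 / real (Suc k)) \<longlonglongrightarrow> 0" using LIMSEQ_Suc[OF lim_const_over_n[of "s 0 / 2"]] .
    show "\<forall>\<^sub>F k in sequentially. t k \<le> s 0 / 2 / real (Suc k)"
      unfolding t_def by (intro always_eventually allI divide_right_mono Min_le) auto
    show "\<forall>\<^sub>F k in sequentially. 0 \<le> t k" by (intro always_eventually allI less_imp_le t_pos)
  qed simp
  have key: "\<exists>\<delta>0>0. \<forall>\<delta>. 0 < \<delta> \<longrightarrow> \<delta> < \<delta>0 \<longrightarrow> l2fun (\<lambda>x. F \<delta> x - g x) \<and> l2norm (\<lambda>x. F \<delta> x - g x) \<le> e" if e: "e > 0" for e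
  proof -
    obtain \<delta>0 where d0: "\<delta>0 > 0" "\<And>\<delta> \<delta>'. 0 < \<delta> \<Longrightarrow> \<delta> < \<delta>0 \<Longrightarrow> 0 < \<delta>' \<Longrightarrow> \<delta>' < \<delta>0 \<Longrightarrow> l2norm (\<lambda>x. F \<delta> x - F \<delta>' x) \<le> e"
      using C[OF e] by blast
    obtain N where N: "\<And>k. k \<ge> N \<Longrightarrow> t k < \<delta>0"
      using order_tendstoD(2)[OF t_lim d0(1)] unfolding eventually_sequentially by blast
    have "l2fun (\<lambda>x. F \<delta> x - g x) \<and> l2norm (\<lambda>x. F \<delta> x - g x) \<le> e" if \<delta>: "0 < \<delta>" "\<delta> < \<delta>0" for \<delta>
    proof -
      have [measurable]: "F \<delta> \<in> borel_measurable borel" using F[OF \<delta>(1)] by measurable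
      have l: "AE x in lborel. (\<lambda>k. F \<delta> x - F (t (k + N)) x) \<longlonglongrightarrow> F \<delta> x - g x"
        using lim by eventually_elim (intro tendsto_diff tendsto_const LIMSEQ_ignore_initial_segment)
      have a: "l2fun (\<lambda>x. F \<delta> x - F (t (k + N)) x)" for k by (intro l2fun_diff F \<delta> t_pos)
      have b: "l2norm (\<lambda>x. F \<delta> x - F (t (k + N)) x) \<le> e" for k by (intro d0(2) \<delta> t_pos N) simp
      have m: "(\<lambda>x. F \<delta> x - g x) \<in> borel_measurable borel" by measurable
      show ?thesis using l2_fatou[OF a b l m] by blast
    qed
    then show ?thesis using d0(1) by blast
  qed
  have "l2fun g"
  proof -
    obtain \<delta>0 where d: "\<delta>0 > 0" "\<And>\<delta>. 0 < \<delta> \<Longrightarrow> \<delta> < \<delta>0 \<Longrightarrow> l2fun (\<lambda>x. F \<delta> x - g x)" using key[of 1] by auto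
    have h: "l2fun (F (\<delta>0 / 2))" "l2fun (\<lambda>x. F (\<delta>0 / 2) x - g x)" using d F by auto
    show ?thesis using l2fun_diff[OF h] by simp
  qed
  moreover have "\<exists>\<delta>0>0. \<forall>\<delta>. 0 < \<delta> \<longrightarrow> \<delta> < \<delta>0 \<longrightarrow> l2norm (\<lambda>x. F \<delta> x - g x) \<le> e" if "e > 0" for e
  proof -
    obtain \<delta>0 where "\<delta>0 > 0" "\<forall>\<delta>. 0 < \<delta> \<longrightarrow> \<delta> < \<delta>0 \<longrightarrow> l2fun (\<lambda>x. F \<delta> x - g x) \<and> l2norm (\<lambda>x. F \<delta> x - g x) \<le> e"
      using key[OF \<open>e > 0\<close>] by (elim exE conjE)
    then show ?thesis by (intro exI[of _ \<delta>0]) simp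
  qed
  ultimately show ?thesis by (intro exI[of _ g]) simp
qed

section \<open>The truncated kernels on L^2\<close>

context even_harmonic_poly
begin

definition kerd :: "real \<Rightarrow> real^'n \<Rightarrow> real" where
  "kerd \<delta> y = indicator {y. \<delta> < norm y} y * ker y"

lemma kerd_borel [measurable]: "kerd \<delta> \<in> borel_measurable borel"
  unfolding kerd_def[abs_def] by measurable

lemma kerd_even: "kerd \<delta> (- y) = kerd \<delta> y"
  by (simp add: kerd_def indicator_def ker_even[OF d_even])

lemma kerd_bound: "\<delta> > 0 \<Longrightarrow> \<bar>kerd \<delta> y\<bar> \<le> CP / \<delta> ^ CARD('n)"
  using ker_bound_away[of \<delta> y] CP(1) by (auto simp: kerd_def indicator_def)

text \<open>The kernel decays only like |y|^(-n) at infinity, so its square, not the kernel itself,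
  is the integrable quantity. Convolution with an L^2 function converges absolutely by the
  Cauchy--Schwarz inequality.\<close>

lemma kerd_l2:
  assumes \<delta>: "\<delta> > 0"
  shows "l2fun (kerd \<delta>)"
proof -
  let ?n = "CARD('n)"
  define g where "g r = indicator {\<delta><..} r * ennreal (CP\<^sup>2 / r ^ (2 * ?n))" for r
  have [measurable]: "g \<in> borel_measurable borel" unfolding g_def[abs_def] by measurable
  have "(\<integral>\<^sup>+y. ennreal (norm ((kerd \<delta> y)\<^sup>2)) \<partial>lborel) \<le> (\<integral>\<^sup>+y. g (norm (y::real^'n)) \<partial>lborel)"
  proof (rule nn_integral_mono)
    fix y :: "real^'n"
    have "\<bar>ker y\<bar>\<^sup>2 \<le> (CP / norm y ^ ?n)\<^sup>2" using ker_bound[of y] by (intro power_mono) auto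
    then have "(ker y)\<^sup>2 \<le> CP\<^sup>2 / norm y ^ (2 * ?n)" by (simp add: power_divide power_mult[symmetric] mult.commute)
    then show "ennreal (norm ((kerd \<delta> y)\<^sup>2)) \<le> g (norm y)"
      by (auto simp: kerd_def g_def indicator_def intro!: ennreal_leI)
  qed
  also have "\<dots> = emeasure lborel (ball (0::real^'n) 1) * (\<integral>\<^sup>+r. ennreal (polar_density TYPE(real^'n) r) * g r \<partial>lborel)"
    by (rule nn_integral_radial) simp
  also have "(\<integral>\<^sup>+r. ennreal (polar_density TYPE(real^'n) r) * g r \<partial>lborel) = (\<integral>\<^sup>+r. ennreal (CP\<^sup>2) * (indicator {\<delta><..} r * ennreal (real ?n / r ^ (?n + 1))) \<partial>lborel)"
  proof (rule nn_integral_cong)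
    fix r :: real
    show "ennreal (polar_density TYPE(real^'n) r) * g r = ennreal (CP\<^sup>2) * (indicator {\<delta><..} r * ennreal (real ?n / r ^ (?n + 1)))"
    proof (cases "r > \<delta>")
      case True
      then have r: "r > 0" using \<delta> by simp
      have "2 * ?n = (?n - 1) + (?n + 1)" using zero_less_card_finite[where 'a='n] by linarith
      then have "r ^ (2 * ?n) = r ^ (?n - 1) * r ^ (?n + 1)" by (simp only: power_add)
      then have "polar_density TYPE(real^'n) r * (CP\<^sup>2 / r ^ (2 * ?n)) = CP\<^sup>2 * (real ?n / r ^ (?n + 1))"
        using r by (simp add: polar_density_def)
      then show ?thesis using True r by (simp add: g_def ennreal_mult[symmetric])
    qed (simp add: g_def)
  qed
  also have "\<dots> = ennreal (CP\<^sup>2) * ennreal (1 / \<delta> ^ ?n)"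
    using \<delta> nn_integral_inverse_power_tail[of ?n \<delta>] by (subst nn_integral_cmult) auto
  also have "emeasure lborel (ball (0::real^'n) 1) * (ennreal (CP\<^sup>2) * ennreal (1 / \<delta> ^ ?n)) < \<infinity>"
    using emeasure_lborel_ball_finite[of "0::real^'n" 1] by (simp add: ennreal_mult_less_top)
  finally have "integrable lborel (\<lambda>y. (kerd \<delta> y)\<^sup>2)" by (intro integrableI_bounded) auto
  then show ?thesis by (simp add: l2fun_def)
qed

lemma conv_kerd_integrable:
  assumes "\<delta> > 0" "l2fun f"
  shows "integrable lborel (\<lambda>y. kerd \<delta> y * f (x - y))"
  by (intro l2fun_mult_integrable kerd_l2 l2fun_shift assms)

text \<open>A uniform bound of the truncated operators on \<open>L\<^sup>2\<close>.\<close>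
definition opB :: real where
  "opB = (SOME B. B > 0 \<and> (\<forall>\<delta> m f. \<delta> > 0 \<longrightarrow> bcs f \<longrightarrow>
    l2norm (conv (\<lambda>y. indicator {y. \<delta> < norm y \<and> norm y \<le> \<delta> * 2 ^ m} y * ker y) f) \<le> B * l2norm f))"

lemma opB: "opB > 0" "\<And>\<delta> m f. \<delta> > 0 \<Longrightarrow> bcs f \<Longrightarrow>
    l2norm (conv (\<lambda>y. indicator {y. \<delta> < norm y \<and> norm y \<le> \<delta> * 2 ^ m} y * ker y) f) \<le> opB * l2norm f"
proof -
  have "\<exists>B. B > 0 \<and> (\<forall>\<delta> m f. \<delta> > 0 \<longrightarrow> bcs f \<longrightarrow>
    l2norm (conv (\<lambda>y. indicator {y. \<delta> < norm y \<and> norm y \<le> \<delta> * 2 ^ m} y * ker y) f) \<le> B * l2norm f)"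
    by (rule truncated_l2_bound) blast
  from someI_ex[OF this] show "opB > 0" "\<And>\<delta> m f. \<delta> > 0 \<Longrightarrow> bcs f \<Longrightarrow>
    l2norm (conv (\<lambda>y. indicator {y. \<delta> < norm y \<and> norm y \<le> \<delta> * 2 ^ m} y * ker y) f) \<le> opB * l2norm f"
    unfolding opB_def by blast+
qed

text \<open>The kernel is cut at radius \<delta> 2^m and f by \<open>cut\<close>. The uniform bound
  for these approximants survives the limit m \<rightarrow> \<infinity> by Fatou's lemma.\<close>

lemma
  assumes \<delta>: "\<delta> > 0" and f: "l2fun f"
  shows conv_kerd_l2fun: "l2fun (conv (kerd \<delta>) f)" and conv_kerd_l2norm: "l2norm (conv (kerd \<delta>) f) \<le> opB * l2norm f"
proof -
  have [measurable]: "f \<in> borel_measurable borel" using f by measurable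
  define S where "S m y = indicator {y. \<delta> < norm y \<and> norm y \<le> \<delta> * 2 ^ m} y * ker y" for m :: nat and y
  have Sb: "bcs (S m)" for m unfolding S_def by (rule ker_annulus_bcs[OF \<delta>])
  have [measurable]: "S m \<in> borel_measurable borel" "cut m f \<in> borel_measurable borel" for m using Sb cut_bcs by measurable
  have l: "l2fun (conv (S m) (cut m f))" for m by (intro bcs_l2fun bcs_conv Sb cut_bcs) simp
  have b: "l2norm (conv (S m) (cut m f)) \<le> opB * l2norm f" for m
  proof -
    have "l2norm (conv (S m) (cut m f)) \<le> opB * l2norm (cut m f)"
      unfolding S_def[abs_def] by (intro opB(2) \<delta> cut_bcs) simp
    also have "l2norm (cut m f) \<le> l2norm f"
    proof -
      have "(\<integral>x. (cut m f x)\<^sup>2 \<partial>lborel) \<le> (\<integral>x. (f x)\<^sup>2 \<partial>lborel)"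
        using f bcs_l2fun[OF cut_bcs, of f m] by (intro integral_mono) (auto simp: l2fun_def cut_def)
      then show ?thesis unfolding l2norm_def by (rule real_sqrt_le_mono)
    qed
    finally show ?thesis using opB(1) by simp
  qed
  have lim: "AE x in lborel. (\<lambda>m. conv (S m) (cut m f) x) \<longlonglongrightarrow> conv (kerd \<delta>) f x"
  proof (rule AE_I2)
    fix x
    show "(\<lambda>m. conv (S m) (cut m f) x) \<longlonglongrightarrow> conv (kerd \<delta>) f x"
      unfolding conv_def
    proof (rule integral_dominated_convergence[where w="\<lambda>y. \<bar>kerd \<delta> y * f (x - y)\<bar>"])
      show "integrable lborel (\<lambda>y. \<bar>kerd \<delta> y * f (x - y)\<bar>)" using conv_kerd_integrable[OF \<delta> f] by (rule integrable_abs)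
      show "AE y in lborel. (\<lambda>m. S m y * cut m f (x - y)) \<longlonglongrightarrow> kerd \<delta> y * f (x - y)"
      proof (rule AE_I2, rule tendsto_eventually)
        fix y :: "real^'n"
        obtain m0 :: nat where m0: "norm y / \<delta> < 2 ^ m0" using real_arch_pow[of 2 "norm y / \<delta>"] by auto
        have "S m y = kerd \<delta> y" if "m \<ge> m0" for m
        proof -
          have "(2::real) ^ m0 \<le> 2 ^ m" using that by (intro power_increasing) auto
          then have "\<delta> * 2 ^ m0 \<le> \<delta> * 2 ^ m" using \<delta> by simp
          moreover have "norm y < \<delta> * 2 ^ m0" using m0 \<delta> by (simp add: pos_divide_less_eq mult.commute)
          ultimately have "norm y \<le> \<delta> * 2 ^ m" by simp
          then show ?thesis by (auto simp: S_def kerd_def indicator_def)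
        qed
        then have "\<forall>\<^sub>F m in sequentially. S m y = kerd \<delta> y" unfolding eventually_sequentially by blast
        then show "\<forall>\<^sub>F m in sequentially. S m y * cut m f (x - y) = kerd \<delta> y * f (x - y)"
          using cut_eventually[of f "x - y"] by eventually_elim simp
      qed
      show "AE y in lborel. norm (S m y * cut m f (x - y)) \<le> \<bar>kerd \<delta> y * f (x - y)\<bar>" for m
        by (rule AE_I2) (auto simp: S_def kerd_def cut_def indicator_def)
    qed measurable
  qed
  have m: "conv (kerd \<delta>) f \<in> borel_measurable borel" by measurable
  show "l2fun (conv (kerd \<delta>) f)" "l2norm (conv (kerd \<delta>) f) \<le> opB * l2norm f"
    using l2_fatou[OF l b lim m] by auto
qed

lemma conv_kerd_diff:
  assumes "\<delta> > 0" "l2fun f" "l2fun g"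
  shows "conv (kerd \<delta>) (\<lambda>x. f x - g x) x = conv (kerd \<delta>) f x - conv (kerd \<delta>) g x"
  unfolding conv_def using conv_kerd_integrable[of \<delta> f x] conv_kerd_integrable[of \<delta> g x] assms
  by (simp add: right_diff_distrib)

definition omega :: real where
  "omega = measure lborel (ball (0::real^'n) 1)"

lemma omega_pos: "omega > 0"
  unfolding omega_def using content_ball_pos[of 1 "0::real^'n"] by simp

lemma emeasure_unit_ball: "emeasure lborel (ball (0::real^'n) 1) = ennreal omega"
  unfolding omega_def using emeasure_lborel_ball_finite[of "0::real^'n" 1]
  by (intro emeasure_eq_ennreal_measure) auto

text \<open>The bound \<open>CP\<close> for P on the unit sphere times the area n
  \<open>omega\<close> of that sphere.\<close>

definition cN :: real where "cN = omega * (real CARD('n) * CP)"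

lemma cN_nonneg: "cN \<ge> 0"
  unfolding cN_def using omega_pos CP(1) by simp

lemma ker_annulus_integral_le:
  assumes s: "0 < s" and [measurable]: "\<phi> \<in> borel_measurable borel" and \<phi>: "\<And>r. s < r \<Longrightarrow> 0 \<le> \<phi> r"
    and c: "(\<integral>\<^sup>+r. indicator {s<..t} r * ennreal (\<phi> r / r) \<partial>lborel) \<le> ennreal c" "c \<ge> 0"
  shows "(\<integral>y. indicator {y. s < norm y \<and> norm y \<le> t} y * (\<phi> (norm y) * \<bar>ker y\<bar>) \<partial>lborel) \<le> cN * c"
proof -
  let ?n = "CARD('n)"
  define g where "g r = indicator {s<..t} r * ennreal (\<phi> r * (CP / r ^ ?n))" for r
  have [measurable]: "g \<in> borel_measurable borel" unfolding g_def[abs_def] by measurable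
  have "(\<integral>\<^sup>+y. ennreal (indicator {y. s < norm y \<and> norm y \<le> t} y * (\<phi> (norm y) * \<bar>ker y\<bar>)) \<partial>lborel) \<le> (\<integral>\<^sup>+y. g (norm (y::real^'n)) \<partial>lborel)"
  proof (rule nn_integral_mono)
    fix y :: "real^'n"
    show "ennreal (indicator {y. s < norm y \<and> norm y \<le> t} y * (\<phi> (norm y) * \<bar>ker y\<bar>)) \<le> g (norm y)"
      using mult_left_mono[OF ker_bound[of y], of "\<phi> (norm y)"] \<phi>[of "norm y"]
      by (auto simp: g_def indicator_def intro!: ennreal_leI)
  qed
  also have "\<dots> = ennreal omega * (\<integral>\<^sup>+r. ennreal (polar_density TYPE(real^'n) r) * g r \<partial>lborel)"
    unfolding emeasure_unit_ball[symmetric] by (rule nn_integral_radial) simp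
  also have "(\<integral>\<^sup>+r. ennreal (polar_density TYPE(real^'n) r) * g r \<partial>lborel) = (\<integral>\<^sup>+r. ennreal (real ?n * CP) * (indicator {s<..t} r * ennreal (\<phi> r / r)) \<partial>lborel)"
  proof (rule nn_integral_cong)
    fix r :: real
    show "ennreal (polar_density TYPE(real^'n) r) * g r = ennreal (real ?n * CP) * (indicator {s<..t} r * ennreal (\<phi> r / r))"
    proof (cases "s < r \<and> r \<le> t")
      case True
      then have r: "r > 0" using s by simp
      have "r ^ ?n = r ^ (?n - 1) * r" using power_minus_mult[of ?n r] by simp
      then have "polar_density TYPE(real^'n) r * (\<phi> r * (CP / r ^ ?n)) = real ?n * CP * (\<phi> r / r)"
        using r by (simp add: polar_density_def)
      then show ?thesis using True r \<phi>[of r] CP(1) by (simp add: g_def ennreal_mult[symmetric])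
    qed (auto simp: g_def)
  qed
  also have "\<dots> = ennreal (real ?n * CP) * (\<integral>\<^sup>+r. indicator {s<..t} r * ennreal (\<phi> r / r) \<partial>lborel)"
    by (rule nn_integral_cmult) simp
  also have "ennreal omega * (ennreal (real ?n * CP) * (\<integral>\<^sup>+r. indicator {s<..t} r * ennreal (\<phi> r / r) \<partial>lborel)) \<le> ennreal omega * (ennreal (real ?n * CP) * ennreal c)"
    by (intro mult_left_mono c) auto
  also have "\<dots> = ennreal (cN * c)"
    using omega_pos CP(1) c(2) by (simp add: cN_def ennreal_mult[symmetric] mult.assoc)
  finally have le: "(\<integral>\<^sup>+y. ennreal (indicator {y. s < norm y \<and> norm y \<le> t} y * (\<phi> (norm y) * \<bar>ker y\<bar>)) \<partial>lborel) \<le> ennreal (cN * c)" .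
  have "(\<integral>y. indicator {y. s < norm y \<and> norm y \<le> t} y * (\<phi> (norm y) * \<bar>ker y\<bar>) \<partial>lborel) = enn2real (\<integral>\<^sup>+y. ennreal (indicator {y. s < norm y \<and> norm y \<le> t} y * (\<phi> (norm y) * \<bar>ker y\<bar>)) \<partial>lborel)"
    by (rule integral_eq_nn_integral) (auto simp: indicator_def intro!: AE_I2 mult_nonneg_nonneg \<phi>)
  also have "\<dots> \<le> cN * c" using enn2real_mono[OF le] cN_nonneg c(2) by simp
  finally show ?thesis .
qed

lemma ker_annulus_norm_integral:
  assumes "0 < s" "s \<le> t"
  shows "(\<integral>y. indicator {y. s < norm y \<and> norm y \<le> t} y * (norm y * \<bar>ker y\<bar>) \<partial>lborel) \<le> cN * t"
proof (rule ker_annulus_integral_le[where \<phi>="\<lambda>r. r"])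
  have "(\<integral>\<^sup>+r. indicator {s<..t} r * ennreal (r / r) \<partial>lborel) = (\<integral>\<^sup>+r. indicator {s<..t} r \<partial>lborel)"
    using assms by (intro nn_integral_cong) (auto simp: indicator_def)
  also have "\<dots> = ennreal (t - s)" using assms by simp
  also have "\<dots> \<le> ennreal t" using assms by (intro ennreal_leI) simp
  finally show "(\<integral>\<^sup>+r. indicator {s<..t} r * ennreal (r / r) \<partial>lborel) \<le> ennreal t" .
qed (use assms in auto)

lemma ker_annulus_l1_integral:
  assumes "0 < s" "s \<le> t"
  shows "(\<integral>y. indicator {y. s < norm y \<and> norm y \<le> t} y * \<bar>ker y\<bar> \<partial>lborel) \<le> cN * (ln t - ln s)"
proof -
  have "(\<integral>y. indicator {y. s < norm y \<and> norm y \<le> t} y * (1 * \<bar>ker y\<bar>) \<partial>lborel) \<le> cN * (ln t - ln s)"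
  proof (rule ker_annulus_integral_le[where \<phi>="\<lambda>r. 1"])
    have "(\<integral>\<^sup>+r. indicator {s<..t} r * ennreal (1 / r) \<partial>lborel) \<le> (\<integral>\<^sup>+r. ennreal (1 / r) * indicator {s..t} r \<partial>lborel)"
      by (intro nn_integral_mono) (auto simp: indicator_def)
    also have "\<dots> = ennreal (ln t - ln s)"
      by (rule nn_integral_FTC_Icc) (use assms in \<open>auto intro!: derivative_eq_intros simp: divide_inverse\<close>)
    finally show "(\<integral>\<^sup>+r. indicator {s<..t} r * ennreal (1 / r) \<partial>lborel) \<le> ennreal (ln t - ln s)" .
  qed (use assms in auto)
  then show ?thesis by simp
qed

text \<open>The difference is convolution with the kernel on an annulus, which has integral zero.
  Subtracting \<phi> x gains a factor |y| from the Lipschitz condition, and the integral of |y| |K|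
  over the annulus is O(\<delta>). Since \<delta> \<le> 1, the result is supported within radius R +
  1.\<close>

lemma conv_kerd_lcs_cauchy:
  assumes \<phi>: "lcs \<phi>"
  obtains C where "C \<ge> 0" "\<And>\<delta> \<delta>'. 0 < \<delta>' \<Longrightarrow> \<delta>' \<le> \<delta> \<Longrightarrow> \<delta> \<le> 1 \<Longrightarrow> l2norm (\<lambda>x. conv (kerd \<delta>') \<phi> x - conv (kerd \<delta>) \<phi> x) \<le> C * \<delta>"
proof -
  obtain L R where L: "L \<ge> 0" "R \<ge> 0" "\<And>x y. \<bar>\<phi> x - \<phi> y\<bar> \<le> L * norm (x - y)" "\<And>x. norm x > R \<Longrightarrow> \<phi> x = 0"
    using lcsE[OF \<phi>] by metis
  define V where "V = measure lborel (cball (0::real^'n) (R + 1))"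
  define C where "C = L * cN * sqrt V"
  have C0: "C \<ge> 0" unfolding C_def V_def using L(1) cN_nonneg by simp
  have pb: "bcs \<phi>" by (rule lcs_bcs[OF \<phi>])
  have pl: "l2fun \<phi>" by (rule bcs_l2fun[OF pb])
  have "l2norm (\<lambda>x. conv (kerd \<delta>') \<phi> x - conv (kerd \<delta>) \<phi> x) \<le> C * \<delta>" if \<delta>: "0 < \<delta>'" "\<delta>' \<le> \<delta>" "\<delta> \<le> 1" for \<delta> \<delta>'
  proof -
    define A where "A y = indicator {y. \<delta>' < norm y \<and> norm y \<le> \<delta>} y * ker y" for y
    have Ab: "bcs A" unfolding A_def[abs_def] by (rule ker_annulus_bcs[OF \<delta>(1)])
    have dpos: "\<delta> > 0" using \<delta> by simp
    have D: "conv (kerd \<delta>') \<phi> x - conv (kerd \<delta>) \<phi> x = conv A \<phi> x" for x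
    proof -
      have "conv (kerd \<delta>') \<phi> x - conv (kerd \<delta>) \<phi> x = (\<integral>y. kerd \<delta>' y * \<phi> (x - y) - kerd \<delta> y * \<phi> (x - y) \<partial>lborel)"
        unfolding conv_def by (intro Bochner_Integration.integral_diff[symmetric] conv_kerd_integrable \<delta> dpos pl)
      also have "\<dots> = conv A \<phi> x"
        unfolding conv_def using \<delta> by (intro Bochner_Integration.integral_cong) (auto simp: A_def kerd_def indicator_def)
      finally show ?thesis .
    qed
    have pt: "\<bar>conv A \<phi> x\<bar> \<le> L * cN * \<delta> * indicator (cball 0 (R + 1)) x" for x
    proof (cases "norm x \<le> R + 1")
      case True
      have "(\<integral>y. A y * \<phi> x \<partial>lborel) = 0"
        using integral_ker_annulus[OF \<delta>(1), of \<delta>] by (simp add: A_def)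
      then have "conv A \<phi> x = (\<integral>y. A y * \<phi> (x - y) \<partial>lborel) - (\<integral>y. A y * \<phi> x \<partial>lborel)" by (simp add: conv_def)
      also have "\<dots> = (\<integral>y. A y * (\<phi> (x - y) - \<phi> x) \<partial>lborel)"
        using conv_integrable[OF Ab pb, of x] bcs_integrable[OF Ab]
        by (subst Bochner_Integration.integral_diff[symmetric]) (auto simp: right_diff_distrib)
      finally have "\<bar>conv A \<phi> x\<bar> \<le> (\<integral>y. \<bar>A y * (\<phi> (x - y) - \<phi> x)\<bar> \<partial>lborel)"
        using integral_abs_bound[of lborel "\<lambda>y. A y * (\<phi> (x - y) - \<phi> x)"] by simp
      also have "\<dots> \<le> (\<integral>y. L * (indicator {y. \<delta>' < norm y \<and> norm y \<le> \<delta>} y * (norm y * \<bar>ker y\<bar>)) \<partial>lborel)"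
      proof (rule integral_mono)
        have "integrable lborel (\<lambda>y. A y * \<phi> (x - y) - A y * \<phi> x)"
          using conv_integrable[OF Ab pb, of x] bcs_integrable[OF Ab] by (intro Bochner_Integration.integrable_diff) auto
        then show "integrable lborel (\<lambda>y. \<bar>A y * (\<phi> (x - y) - \<phi> x)\<bar>)" by (simp add: right_diff_distrib)
        have [measurable]: "A \<in> borel_measurable borel" using Ab by measurable
        have "bcs (\<lambda>y. indicator {y. norm y \<le> 1} y * norm y)" by (rule bcsI[of _ 1 1]) (auto simp: indicator_def)
        from bcs_integrable[OF bcs_mult[OF this bcs_abs[OF Ab]]]
        have "integrable lborel (\<lambda>y. indicator {y. norm y \<le> 1} y * norm y * \<bar>A y\<bar>)" .
        moreover have "(\<lambda>y. indicator {y. norm y \<le> 1} y * norm y * \<bar>A y\<bar>) = (\<lambda>y. indicator {y. \<delta>' < norm y \<and> norm y \<le> \<delta>} y * (norm y * \<bar>ker y\<bar>))"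
          using \<delta> by (auto simp: A_def indicator_def fun_eq_iff)
        ultimately show "integrable lborel (\<lambda>y. L * (indicator {y. \<delta>' < norm y \<and> norm y \<le> \<delta>} y * (norm y * \<bar>ker y\<bar>)))" by simp
        fix y
        have "\<bar>A y\<bar> * \<bar>\<phi> (x - y) - \<phi> x\<bar> \<le> \<bar>A y\<bar> * (L * norm y)"
          using L(3)[of "x - y" x] by (intro mult_left_mono) auto
        also have "\<dots> = L * (indicator {y. \<delta>' < norm y \<and> norm y \<le> \<delta>} y * (norm y * \<bar>ker y\<bar>))"
          by (auto simp: A_def indicator_def)
        finally show "\<bar>A y * (\<phi> (x - y) - \<phi> x)\<bar> \<le> L * (indicator {y. \<delta>' < norm y \<and> norm y \<le> \<delta>} y * (norm y * \<bar>ker y\<bar>))"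
          by (simp add: abs_mult)
      qed
      also have "\<dots> \<le> L * (cN * \<delta>)"
        using ker_annulus_norm_integral[OF \<delta>(1,2)] L(1) by (simp add: mult_left_mono)
      finally show ?thesis using True by simp
    next
      case False
      have "A y * \<phi> (x - y) = 0" for y
      proof (cases "norm y \<le> \<delta>")
        case True
        then have "norm (x - y) > R" using False \<delta> norm_triangle_ineq2[of x y] by simp
        then show ?thesis using L(4) by simp
      qed (simp add: A_def)
      then have z: "(\<lambda>y. A y * \<phi> (x - y)) = (\<lambda>_. 0)" by (rule ext)
      have "conv A \<phi> x = 0" unfolding conv_def z by simp
      then show ?thesis using False by simp
    qed
    have "(l2norm (conv A \<phi>))\<^sup>2 \<le> (\<integral>x. (L * cN * \<delta>)\<^sup>2 * indicator (cball (0::real^'n) (R + 1)) x \<partial>lborel)"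
      unfolding l2norm_square
    proof (rule integral_mono)
      show "integrable lborel (\<lambda>x. (conv A \<phi> x)\<^sup>2)" using bcs_l2fun[OF bcs_conv[OF Ab pb]] by (simp add: l2fun_def)
      show "integrable lborel (\<lambda>x. (L * cN * \<delta>)\<^sup>2 * indicator (cball (0::real^'n) (R + 1)) x)"
        using emeasure_lborel_cball_finite[of "0::real^'n" "R + 1"] by (intro integrable_mult_right) simp
      fix x
      have "\<bar>conv A \<phi> x\<bar>\<^sup>2 \<le> (L * cN * \<delta> * indicator (cball 0 (R + 1)) x)\<^sup>2" using pt[of x] by (intro power_mono) auto
      then show "(conv A \<phi> x)\<^sup>2 \<le> (L * cN * \<delta>)\<^sup>2 * indicator (cball (0::real^'n) (R + 1)) x"
        by (auto simp: indicator_def)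
    qed
    also have "\<dots> = (L * cN * \<delta>)\<^sup>2 * V" unfolding V_def by simp
    also have "\<dots> = (C * \<delta>)\<^sup>2" by (simp add: C_def V_def power_mult_distrib)
    finally have sq: "(l2norm (conv A \<phi>))\<^sup>2 \<le> (C * \<delta>)\<^sup>2" .
    have "l2norm (conv A \<phi>) \<le> C * \<delta>"
      by (rule power2_le_imp_le[OF sq]) (use C0 dpos in simp)
    then show ?thesis unfolding D .
  qed
  then show ?thesis by (rule that[OF C0])
qed

lemma conv_kerd_l2_limit:
  assumes f: "l2fun f"
  shows "\<exists>g. l2fun g \<and> (\<forall>e>0. \<exists>\<delta>0>0. \<forall>\<delta>. 0 < \<delta> \<longrightarrow> \<delta> < \<delta>0 \<longrightarrow> l2norm (\<lambda>x. conv (kerd \<delta>) f x - g x) \<le> e)"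
proof (rule l2_complete)
  show "l2fun (conv (kerd \<delta>) f)" if "\<delta> > 0" for \<delta> by (rule conv_kerd_l2fun[OF that f])
  fix e :: real assume e: "e > 0"
  \<comment> \<open>Replacing f by \<phi> costs at most e / 4 for each of the two truncations, by
    the uniform bound \<open>opB\<close>; the remaining e / 2 goes to \<phi>.\<close>
  define e' where "e' = e / (4 * opB)"
  have e': "e' > 0" using e opB(1) by (simp add: e'_def)
  obtain \<phi> where \<phi>: "lcs \<phi>" "l2norm (\<lambda>x. f x - \<phi> x) < e'" using l2fun_lcs_approx[OF f e'] by blast
  have pl: "l2fun \<phi>" by (intro bcs_l2fun lcs_bcs \<phi>)
  obtain C where C: "C \<ge> 0" "\<And>\<delta> \<delta>'. 0 < \<delta>' \<Longrightarrow> \<delta>' \<le> \<delta> \<Longrightarrow> \<delta> \<le> 1 \<Longrightarrow> l2norm (\<lambda>x. conv (kerd \<delta>') \<phi> x - conv (kerd \<delta>) \<phi> x) \<le> C * \<delta>"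
    using conv_kerd_lcs_cauchy[OF \<phi>(1)] by blast
  define \<delta>0 where "\<delta>0 = min 1 (e / (2 * (C + 1)))"
  have d0: "\<delta>0 > 0" using e C(1) by (simp add: \<delta>0_def)
  have near: "l2norm (\<lambda>x. conv (kerd \<delta>) f x - conv (kerd \<delta>) \<phi> x) \<le> e / 4" if "\<delta> > 0" for \<delta>
  proof -
    have "l2norm (\<lambda>x. conv (kerd \<delta>) f x - conv (kerd \<delta>) \<phi> x) = l2norm (conv (kerd \<delta>) (\<lambda>x. f x - \<phi> x))"
      using conv_kerd_diff[OF that f pl] by (intro arg_cong[where f=l2norm] ext) simp
    also have "\<dots> \<le> opB * l2norm (\<lambda>x. f x - \<phi> x)" by (rule conv_kerd_l2norm[OF that l2fun_diff[OF f pl]])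
    also have "\<dots> \<le> opB * e'" using \<phi>(2) opB(1) by simp
    also have "\<dots> = e / 4" using opB(1) by (simp add: e'_def)
    finally show ?thesis .
  qed
  have mid0: "l2norm (\<lambda>x. conv (kerd \<delta>') \<phi> x - conv (kerd \<delta>) \<phi> x) \<le> e / 2" if "0 < \<delta>'" "\<delta>' \<le> \<delta>" "\<delta> < \<delta>0" for \<delta> \<delta>'
  proof -
    have "l2norm (\<lambda>x. conv (kerd \<delta>') \<phi> x - conv (kerd \<delta>) \<phi> x) \<le> C * \<delta>" using C(2) that by (simp add: \<delta>0_def)
    also have "\<dots> \<le> (C + 1) * (e / (2 * (C + 1)))" using that C(1) by (intro mult_mono) (auto simp: \<delta>0_def)
    also have "\<dots> = e / 2"
    proof -
      have "C + 1 \<noteq> 0" using C(1) by linarith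
      then show ?thesis by (simp add: field_simps)
    qed
    finally show ?thesis .
  qed
  have mid: "l2norm (\<lambda>x. conv (kerd \<delta>) \<phi> x - conv (kerd \<delta>') \<phi> x) \<le> e / 2" if "0 < \<delta>" "\<delta> < \<delta>0" "0 < \<delta>'" "\<delta>' < \<delta>0" for \<delta> \<delta>'
  proof (cases "\<delta> \<le> \<delta>'")
    case True
    then show ?thesis using mid0[of \<delta> \<delta>'] that by simp
  next
    case False
    then show ?thesis using mid0[of \<delta>' \<delta>] that l2norm_minus_commute[of "conv (kerd \<delta>) \<phi>" "conv (kerd \<delta>') \<phi>"] by simp
  qed
  have "l2norm (\<lambda>x. conv (kerd \<delta>) f x - conv (kerd \<delta>') f x) \<le> e" if \<delta>: "0 < \<delta>" "\<delta> < \<delta>0" "0 < \<delta>'" "\<delta>' < \<delta>0" for \<delta> \<delta>'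
  proof -
    note l = conv_kerd_l2fun[OF \<delta>(1) f] conv_kerd_l2fun[OF \<delta>(3) f] conv_kerd_l2fun[OF \<delta>(1) pl] conv_kerd_l2fun[OF \<delta>(3) pl]
    have "l2norm (\<lambda>x. conv (kerd \<delta>) f x - conv (kerd \<delta>') f x)
      \<le> l2norm (\<lambda>x. conv (kerd \<delta>) f x - conv (kerd \<delta>) \<phi> x) + l2norm (\<lambda>x. conv (kerd \<delta>) \<phi> x - conv (kerd \<delta>') f x)"
      by (rule l2norm_triangle3[OF l(1,3,2)])
    moreover have "l2norm (\<lambda>x. conv (kerd \<delta>) \<phi> x - conv (kerd \<delta>') f x)
      \<le> l2norm (\<lambda>x. conv (kerd \<delta>) \<phi> x - conv (kerd \<delta>') \<phi> x) + l2norm (\<lambda>x. conv (kerd \<delta>') \<phi> x - conv (kerd \<delta>') f x)"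
      by (rule l2norm_triangle3[OF l(3,4,2)])
    ultimately show ?thesis
      using near[OF \<delta>(1)] near[OF \<delta>(3)] mid[OF \<delta>] l2norm_minus_commute[of "conv (kerd \<delta>') \<phi>" "conv (kerd \<delta>') f"] by linarith
  qed
  then show "\<exists>\<delta>0>0. \<forall>\<delta> \<delta>'. 0 < \<delta> \<longrightarrow> \<delta> < \<delta>0 \<longrightarrow> 0 < \<delta>' \<longrightarrow> \<delta>' < \<delta>0 \<longrightarrow> l2norm (\<lambda>x. conv (kerd \<delta>) f x - conv (kerd \<delta>') f x) \<le> e"
    using d0 by (intro exI[of _ \<delta>0]) simp
qed

section \<open>The potential and its truncated transforms\<close>

definition qpoly :: "real poly" where
  "qpoly = (SOME q. degree q < d div 2 \<and> (\<forall>i<d div 2. (\<integral>r. polar_density TYPE(real^'n) r * (indicator {..1} r * (r ^ (2 * i) * poly q (r\<^sup>2))) \<partial>lborel)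
     = (if i = 0 then 1 / measure lborel (ball (0::real^'n) 1) else 0)))"

lemma qpoly:
  "degree qpoly < d div 2"
  "i < d div 2 \<Longrightarrow> (\<integral>r. polar_density TYPE(real^'n) r * (indicator {..1} r * (r ^ (2 * i) * poly qpoly (r\<^sup>2))) \<partial>lborel)
     = (if i = 0 then 1 / measure lborel (ball (0::real^'n) 1) else 0)"
proof -
  have "d div 2 > 0" using d_even d_pos by (auto elim!: evenE)
  from exists_radial_moment_poly[OF this, of "1 / measure lborel (ball (0::real^'n) 1)", where 'a="real^'n"]
  have "degree qpoly < d div 2 \<and> (\<forall>i<d div 2. (\<integral>r. polar_density TYPE(real^'n) r * (indicator {..1} r * (r ^ (2 * i) * poly qpoly (r\<^sup>2))) \<partial>lborel)
     = (if i = 0 then 1 / measure lborel (ball (0::real^'n) 1) else 0))"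
    unfolding qpoly_def by (rule someI_ex)
  then show "degree qpoly < d div 2"
    "i < d div 2 \<Longrightarrow> (\<integral>r. polar_density TYPE(real^'n) r * (indicator {..1} r * (r ^ (2 * i) * poly qpoly (r\<^sup>2))) \<partial>lborel)
     = (if i = 0 then 1 / measure lborel (ball (0::real^'n) 1) else 0)" by auto
qed

text \<open>The radial function with \<open>T\<close>-image \<open>kerd 1\<close>.\<close>
definition bfun :: "real^'n \<Rightarrow> real" where
  "bfun y = indicator (cball 0 1) y * poly qpoly ((norm y)\<^sup>2)"

lemma bfun_borel [measurable]: "bfun \<in> borel_measurable borel"
  unfolding bfun_def[abs_def] by measurable

lemma bfun_out: "norm y > 1 \<Longrightarrow> bfun y = 0"
  by (simp add: bfun_def)

lemma bfun_bound: obtains M where "M \<ge> 0" "\<And>y. \<bar>bfun y\<bar> \<le> M"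
proof -
  obtain M where "M \<ge> 0" "\<And>y::real^'n. \<bar>indicator (cball 0 1) y * poly qpoly ((norm y)\<^sup>2)\<bar> \<le> M"
    using bounded_indicator_poly[of qpoly] by blast
  then show ?thesis using that[of M] by (simp add: bfun_def)
qed

lemma bfun_bcs: "bcs bfun"
proof -
  obtain M where "M \<ge> 0" "\<And>y. \<bar>bfun y\<bar> \<le> M" using bfun_bound by blast
  then show ?thesis by (intro bcsI[of _ M 1]) (auto simp: bfun_out)
qed

lemma half_d: "d = 2 * (d div 2)" "d div 2 > 0"
  using d_even d_pos by (auto elim!: evenE)

lemma conv_kerd_bfun_interior:
  assumes "0 < \<delta>" "norm x + \<delta> < 1"
  shows "conv (kerd \<delta>) bfun x = 0"
  using convolution_interior[OF half_d qpoly(1) assms] unfolding conv_def kerd_def bfun_def .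

lemma conv_kerd_bfun_exterior:
  assumes \<delta>: "0 < \<delta>" "norm x > 1 + \<delta>"
  shows "conv (kerd \<delta>) bfun x = ker x"
proof -
  have "conv (kerd \<delta>) bfun x = (\<integral>y. bfun y * kerd \<delta> (x - y) \<partial>lborel)"
    using conv_commute[of "kerd \<delta>" bfun x] by (simp add: conv_def)
  also have "\<dots> = (\<integral>y. indicator (cball 0 1) y * poly qpoly ((norm y)\<^sup>2) * pker (CARD('n) + d) (x - y) \<partial>lborel)"
  proof (rule Bochner_Integration.integral_cong[OF refl])
    fix y :: "real^'n"
    show "bfun y * kerd \<delta> (x - y) = indicator (cball 0 1) y * poly qpoly ((norm y)\<^sup>2) * pker (CARD('n) + d) (x - y)"
    proof (cases "norm y \<le> 1")
      case True
      then have "norm (x - y) > \<delta>" using \<delta> norm_triangle_ineq2[of x y] by linarith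
      then show ?thesis by (simp add: bfun_def kerd_def ker_def)
    qed (simp add: bfun_def)
  qed
  also have "\<dots> = pker (CARD('n) + d) x"
    by (rule convolution_exterior[OF half_d _ qpoly(2)]) (use \<delta> in auto)
  finally show ?thesis by (simp add: ker_def)
qed

text \<open>Only the boundedness of the potential is used, and the integral of |K| over an annulus
  gives the logarithm. The outer radius is 3 because |x| \<le> 2 and the potential lives in the unit
  ball.\<close>

lemma conv_kerd_bfun_bound:
  assumes M: "M \<ge> 0" "\<And>y. \<bar>bfun y\<bar> \<le> M" and \<delta>: "0 < \<delta>" "\<delta> \<le> 1" and x: "norm x \<le> 2"
  shows "\<bar>conv (kerd \<delta>) bfun x\<bar> \<le> M * (cN * (ln 3 - ln \<delta>))"
proof -
  have i: "integrable lborel (\<lambda>y. indicator {y. \<delta> < norm y \<and> norm y \<le> 3} y * \<bar>ker y\<bar>)"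
    using bcs_integrable[OF bcs_abs[OF ker_annulus_bcs[OF \<delta>(1), of 3]]] by (simp add: abs_mult)
  have "\<bar>conv (kerd \<delta>) bfun x\<bar> \<le> (\<integral>y. \<bar>kerd \<delta> y * bfun (x - y)\<bar> \<partial>lborel)"
    unfolding conv_def by (rule integral_abs_bound)
  also have "\<dots> \<le> (\<integral>y. M * (indicator {y. \<delta> < norm y \<and> norm y \<le> 3} y * \<bar>ker y\<bar>) \<partial>lborel)"
  proof (rule integral_mono)
    show "integrable lborel (\<lambda>y. \<bar>kerd \<delta> y * bfun (x - y)\<bar>)"
      by (intro integrable_abs conv_kerd_integrable \<delta> bcs_l2fun bfun_bcs)
    show "integrable lborel (\<lambda>y. M * (indicator {y. \<delta> < norm y \<and> norm y \<le> 3} y * \<bar>ker y\<bar>))" using i by simp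
    fix y
    show "\<bar>kerd \<delta> y * bfun (x - y)\<bar> \<le> M * (indicator {y. \<delta> < norm y \<and> norm y \<le> 3} y * \<bar>ker y\<bar>)"
    proof (cases "norm y \<le> 3")
      case True
      then show ?thesis using mult_right_mono[OF M(2)[of "x - y"], of "\<bar>ker y\<bar>"]
        by (auto simp: kerd_def abs_mult indicator_def mult.commute)
    next
      case False
      then have "norm (x - y) > 1" using x norm_triangle_ineq2[of y x] by (simp add: norm_minus_commute)
      then show ?thesis using M(1) by (simp add: bfun_out)
    qed
  qed
  also have "\<dots> = M * (\<integral>y. indicator {y. \<delta> < norm y \<and> norm y \<le> 3} y * \<bar>ker y\<bar> \<partial>lborel)" by simp
  also have "\<dots> \<le> M * (cN * (ln 3 - ln \<delta>))"
    using \<delta> M(1) by (intro mult_left_mono ker_annulus_l1_integral) auto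
  finally show ?thesis .
qed

text \<open>Inside radius 1 - \<delta> and outside radius 1 + \<delta> the truncated transform
  already equals \<open>kerd 1\<close>. In the shell between, the error is O(log (1/\<delta>)), and
  the shell has measure O(\<delta>).\<close>

lemma conv_kerd_bfun_limit:
  assumes e: "e > 0"
  shows "\<exists>\<delta>0>0. \<forall>\<delta>. 0 < \<delta> \<longrightarrow> \<delta> < \<delta>0 \<longrightarrow> l2norm (\<lambda>x. conv (kerd \<delta>) bfun x - kerd 1 x) \<le> e"
proof -
  obtain M where M: "M \<ge> 0" "\<And>y. \<bar>bfun y\<bar> \<le> M" using bfun_bound by blast
  obtain C where C: "C \<ge> 0" "\<And>a h. 0 \<le> h \<Longrightarrow> h \<le> 1 \<Longrightarrow> 1 \<le> a \<Longrightarrow> a \<le> 2 \<Longrightarrow> measure lborel {x::real^'n. \<bar>norm x - a\<bar> \<le> h} \<le> C * h"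
    using shell_measure by metis
  define G where "G = M * cN * 4 + CP"
  have G0: "G \<ge> 0" unfolding G_def using M(1) cN_nonneg CP(1) by simp
  define H where "H = G\<^sup>2 * C * sqrt 3 + 1"
  have H: "H > 0" unfolding H_def using C(1) by (simp add: add_nonneg_pos)
  have main: "(l2norm (\<lambda>x. conv (kerd \<delta>) bfun x - kerd 1 x))\<^sup>2 \<le> H * sqrt \<delta>" if \<delta>: "0 < \<delta>" "\<delta> < 1" for \<delta>
  proof -
    define D where "D x = conv (kerd \<delta>) bfun x - kerd 1 x" for x
    \<comment> \<open>The fourth root of 3 / \<delta> stands in for the logarithm: ln (3 / \<delta>)
      = 4 ln u \<le> 4 u, and u^2 times the measure of the shell is still of order sqrt
      \<delta>.\<close>
    define u where "u = sqrt (sqrt (3 / \<delta>))"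
    have u1: "u \<ge> 1" unfolding u_def using \<delta> by (simp add: real_sqrt_ge_1_iff)
    have u2: "u\<^sup>2 = sqrt (3 / \<delta>)" unfolding u_def using \<delta> by simp
    have "ln (3 / \<delta>) = 4 * ln u"
      unfolding u_def using \<delta> by (simp add: ln_sqrt)
    also have "\<dots> \<le> 4 * u" using ln_le_minus_one[of u] u1 by simp
    finally have ln: "ln 3 - ln \<delta> \<le> 4 * u" using \<delta> by (simp add: ln_div)
    let ?S = "{x::real^'n. \<bar>norm x - 1\<bar> \<le> \<delta>}"
    have Sm: "?S \<in> sets borel" by measurable
    have Sfin: "emeasure lborel ?S < \<infinity>"
    proof -
      have "emeasure lborel ?S \<le> emeasure lborel (cball (0::real^'n) (1 + \<delta>))" by (rule emeasure_mono) auto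
      then show ?thesis using emeasure_lborel_cball_finite[of "0::real^'n" "1 + \<delta>"] by (rule le_less_trans)
    qed
    have pt: "\<bar>D x\<bar> \<le> G * u * indicator ?S x" for x
    proof (cases "x \<in> ?S")
      case True
      then have x: "norm x \<le> 2" using \<delta> by simp
      have "\<bar>D x\<bar> \<le> \<bar>conv (kerd \<delta>) bfun x\<bar> + \<bar>kerd 1 x\<bar>" unfolding D_def by (rule abs_triangle_ineq4)
      also have "\<dots> \<le> M * (cN * (ln 3 - ln \<delta>)) + CP"
        using conv_kerd_bfun_bound[OF M \<delta>(1) _ x] kerd_bound[of 1 x] \<delta> by (intro add_mono) auto
      also have "\<dots> \<le> M * (cN * (4 * u)) + CP * u"
        using ln M(1) cN_nonneg CP(1) u1 by (intro add_mono mult_left_mono) (auto simp: mult_le_cancel_left1)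
      also have "\<dots> = G * u" by (simp add: G_def algebra_simps)
      finally show ?thesis using True by simp
    next
      case False
      then have "\<bar>norm x - 1\<bar> > \<delta>" by simp
      then consider "norm x + \<delta> < 1" | "norm x > 1 + \<delta>" by linarith
      then have "D x = 0"
      proof cases
        case 1
        then show ?thesis using conv_kerd_bfun_interior[OF \<delta>(1)] \<delta> by (simp add: D_def kerd_def)
      next
        case 2
        then show ?thesis using conv_kerd_bfun_exterior[OF \<delta>(1)] \<delta> by (simp add: D_def kerd_def)
      qed
      then show ?thesis using False by simp
    qed
    have "(l2norm D)\<^sup>2 \<le> (\<integral>x. (G * u)\<^sup>2 * indicator ?S x \<partial>lborel)"
      unfolding l2norm_square
    proof (rule integral_mono)
      show "integrable lborel (\<lambda>x. (D x)\<^sup>2)"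
        using l2fun_diff[OF conv_kerd_l2fun[OF \<delta>(1) bcs_l2fun[OF bfun_bcs]] kerd_l2[of 1]] by (simp add: l2fun_def D_def)
      show "integrable lborel (\<lambda>x. (G * u)\<^sup>2 * indicator ?S x)" using Sfin Sm by (intro integrable_mult_right) simp
      fix x
      have "\<bar>D x\<bar>\<^sup>2 \<le> (G * u * indicator ?S x)\<^sup>2" using pt[of x] by (intro power_mono) auto
      then show "(D x)\<^sup>2 \<le> (G * u)\<^sup>2 * indicator ?S x" by (auto simp: indicator_def)
    qed
    also have "\<dots> = (G * u)\<^sup>2 * measure lborel ?S" using Sm by simp
    also have "\<dots> \<le> (G * u)\<^sup>2 * (C * \<delta>)" using C(2)[of \<delta> 1] \<delta> by (intro mult_left_mono) auto
    also have "\<dots> = G\<^sup>2 * C * (sqrt (3 / \<delta>) * \<delta>)" by (simp add: power_mult_distrib u2)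
    also have "sqrt (3 / \<delta>) * \<delta> = sqrt 3 * sqrt \<delta>"
    proof -
      have cancel: "s / w * (w * w) = s * w" if "w \<noteq> 0" for s w :: real using that by simp
      have a: "sqrt \<delta> * sqrt \<delta> = \<delta>" using \<delta> by simp
      have "sqrt (3 / \<delta>) * \<delta> = sqrt 3 / sqrt \<delta> * (sqrt \<delta> * sqrt \<delta>)" unfolding a by (simp only: real_sqrt_divide)
      also have "\<dots> = sqrt 3 * sqrt \<delta>" by (rule cancel) (use \<delta> in simp)
      finally show ?thesis .
    qed
    also have "G\<^sup>2 * C * (sqrt 3 * sqrt \<delta>) \<le> H * sqrt \<delta>" unfolding H_def using \<delta> by (simp add: algebra_simps)
    finally show ?thesis unfolding D_def .
  qed
  define \<delta>0 where "\<delta>0 = min 1 ((e\<^sup>2 / H)\<^sup>2)"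
  have d0: "\<delta>0 > 0" using e H by (simp add: \<delta>0_def)
  have "l2norm (\<lambda>x. conv (kerd \<delta>) bfun x - kerd 1 x) \<le> e" if "0 < \<delta>" "\<delta> < \<delta>0" for \<delta>
  proof -
    have "sqrt \<delta> \<le> sqrt ((e\<^sup>2 / H)\<^sup>2)" using that by (intro real_sqrt_le_mono) (simp add: \<delta>0_def)
    also have "\<dots> = e\<^sup>2 / H" using H by simp
    finally have "H * sqrt \<delta> \<le> e\<^sup>2" using H by (simp add: pos_le_divide_eq mult.commute)
    moreover have "(l2norm (\<lambda>x. conv (kerd \<delta>) bfun x - kerd 1 x))\<^sup>2 \<le> H * sqrt \<delta>" using main that by (simp add: \<delta>0_def)
    ultimately have "(l2norm (\<lambda>x. conv (kerd \<delta>) bfun x - kerd 1 x))\<^sup>2 \<le> e\<^sup>2" by linarith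
    then show ?thesis by (rule power2_le_imp_le) (use e in simp)
  qed
  then show ?thesis using d0 by (intro exI[of _ \<delta>0]) simp
qed

end

section \<open>Truncations as averages\<close>

text \<open>Symmetry when k and F are merely square integrable. The inner integral of |k| |F| is
  bounded uniformly by the Cauchy--Schwarz inequality, and b is bounded of bounded support, so
  Fubini's theorem applies.\<close>

lemma inner_conv_even_l2:
  assumes k: "l2fun k" "\<And>x. k (- x) = k x" and b: "bcs b" and F: "l2fun F"
  shows "(\<integral>x. conv k b x * F x \<partial>lborel) = (\<integral>x. b x * conv k F x \<partial>lborel)"
proof -
  have [measurable]: "k \<in> borel_measurable borel" "b \<in> borel_measurable borel" "F \<in> borel_measurable borel"
    using k b F by measurable
  obtain M R where M: "\<And>x. \<bar>b x\<bar> \<le> M" "\<And>x. norm x > R \<Longrightarrow> b x = 0" using bcsE[OF b] by metis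
  have sh: "l2fun (\<lambda>v. k (v - y))" "l2norm (\<lambda>v. k (v - y)) = l2norm k" for y
  proof -
    have "k (v - y) = k (y - v)" for v using k(2)[of "v - y"] by simp
    then show "l2fun (\<lambda>v. k (v - y))" "l2norm (\<lambda>v. k (v - y)) = l2norm k"
      using l2fun_shift[OF k(1), of y] l2norm_shift[of k y] by simp_all
  qed
  have kF: "integrable lborel (\<lambda>v. k (v - y) * F v)" for y
    by (rule l2fun_mult_integrable[OF sh(1) F])
  define c where "c y = (\<integral>v. \<bar>k (v - y)\<bar> * \<bar>F v\<bar> \<partial>lborel)" for y
  have c: "\<bar>c y\<bar> \<le> l2norm k * l2norm F" for y
  proof -
    have "\<bar>\<integral>v. \<bar>k (v - y)\<bar> * \<bar>F v\<bar> \<partial>lborel\<bar> \<le> l2norm (\<lambda>v. \<bar>k (v - y)\<bar>) * l2norm (\<lambda>v. \<bar>F v\<bar>)"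
      by (intro l2norm_cauchy_schwarz l2fun_abs sh F)
    also have "l2norm (\<lambda>v. \<bar>k (v - y)\<bar>) = l2norm (\<lambda>v. k (v - y))" by (simp add: l2norm_def)
    also have "l2norm (\<lambda>v. \<bar>F v\<bar>) = l2norm F" by (simp add: l2norm_def)
    finally show ?thesis by (simp add: c_def sh(2))
  qed
  have cm [measurable]: "c \<in> borel_measurable borel" unfolding c_def[abs_def] by measurable
  have G: "integrable (lborel \<Otimes>\<^sub>M lborel) (\<lambda>(y, v). b y * (k (v - y) * F v))"
  proof (rule lborel_pair.Fubini_integrable)
    show "(\<lambda>(y, v). b y * (k (v - y) * F v)) \<in> borel_measurable (lborel \<Otimes>\<^sub>M lborel)" by measurable
    have "bcs (\<lambda>y. \<bar>b y\<bar> * c y)"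
    proof (rule bcsI[of _ "M * (l2norm k * l2norm F)" R])
      have "0 \<le> M" using M(1)[of 0] by linarith
      then show "\<bar>\<bar>b y\<bar> * c y\<bar> \<le> M * (l2norm k * l2norm F)" for y
        unfolding abs_mult using M(1)[of y] c[of y] by (intro mult_mono) auto
    qed (use M(2) in auto)
    then show "integrable lborel (\<lambda>y. \<integral>v. norm (case (y, v) of (y, v) \<Rightarrow> b y * (k (v - y) * F v)) \<partial>lborel)"
      using bcs_integrable by (simp add: abs_mult c_def)
    show "AE y in lborel. integrable lborel (\<lambda>v. case (y, v) of (y, v) \<Rightarrow> b y * (k (v - y) * F v))"
      using kF by (intro AE_I2) simp
  qed
  have "(\<integral>x. conv k b x * F x \<partial>lborel) = (\<integral>v. (\<integral>y. b y * (k (v - y) * F v) \<partial>lborel) \<partial>lborel)"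
  proof (rule Bochner_Integration.integral_cong[OF refl])
    fix v
    have "conv k b v * F v = (\<integral>y. b y * k (v - y) \<partial>lborel) * F v" unfolding conv_commute[of k b] by (simp add: conv_def)
    also have "\<dots> = (\<integral>y. b y * k (v - y) * F v \<partial>lborel)" by simp
    finally show "conv k b v * F v = (\<integral>y. b y * (k (v - y) * F v) \<partial>lborel)" by (simp only: mult.assoc)
  qed
  also have "\<dots> = (\<integral>y. (\<integral>v. b y * (k (v - y) * F v) \<partial>lborel) \<partial>lborel)"
    by (rule lborel_pair.Fubini_integral[OF G])
  also have "\<dots> = (\<integral>x. b x * conv k F x \<partial>lborel)"
  proof (rule Bochner_Integration.integral_cong[OF refl])
    fix y
    have "conv k F y = (\<integral>v. k (y - v) * F (y - (y - v)) \<partial>lborel)"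
      unfolding conv_def by (rule integral_lborel_reflect[symmetric])
    also have "\<dots> = (\<integral>v. k (v - y) * F v \<partial>lborel)"
    proof (rule Bochner_Integration.integral_cong[OF refl])
      fix v show "k (y - v) * F (y - (y - v)) = k (v - y) * F v" using k(2)[of "v - y"] by simp
    qed
    finally show "(\<integral>v. b y * (k (v - y) * F v) \<partial>lborel) = b y * conv k F y" by simp
  qed
  finally show ?thesis .
qed

lemma l2norm_affine:
  fixes f :: "'a::euclidean_space \<Rightarrow> real"
  assumes "c \<noteq> 0"
  shows "l2norm f = sqrt (\<bar>c\<bar> ^ DIM('a)) * l2norm (\<lambda>y. f (x + c *\<^sub>R y))"
  unfolding l2norm_def using integral_lborel_affine[OF assms, of "\<lambda>x. (f x)\<^sup>2" x] by (simp add: real_sqrt_mult)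

context even_harmonic_poly
begin

lemma kerd_scale: "\<epsilon> > 0 \<Longrightarrow> kerd (\<epsilon> * \<delta>) (\<epsilon> *\<^sub>R y) = kerd \<delta> y / \<epsilon> ^ CARD('n)"
  by (simp add: kerd_def ker_scale indicator_def)

text \<open>The kernel is homogeneous of degree - n, which cancels the Jacobian: truncations at
  different levels are dilations of one another.\<close>

lemma conv_kerd_dilate:
  assumes \<epsilon>: "\<epsilon> > 0"
  shows "conv (kerd (\<epsilon> * \<delta>)) f x = (\<integral>z. kerd \<delta> z * f (x - \<epsilon> *\<^sub>R z) \<partial>lborel)"
proof -
  have "conv (kerd (\<epsilon> * \<delta>)) f x = \<bar>\<epsilon>\<bar> ^ CARD('n) * (\<integral>z. kerd (\<epsilon> * \<delta>) (\<epsilon> *\<^sub>R z) * f (x - \<epsilon> *\<^sub>R z) \<partial>lborel)"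
    unfolding conv_def using integral_lborel_affine[of \<epsilon> "\<lambda>y. kerd (\<epsilon> * \<delta>) y * f (x - y)" 0] \<epsilon> by simp
  also have "\<dots> = (\<integral>z. \<epsilon> ^ CARD('n) * (kerd (\<epsilon> * \<delta>) (\<epsilon> *\<^sub>R z) * f (x - \<epsilon> *\<^sub>R z)) \<partial>lborel)" using \<epsilon> by simp
  also have "\<dots> = (\<integral>z. kerd \<delta> z * f (x - \<epsilon> *\<^sub>R z) \<partial>lborel)"
    using \<epsilon> by (intro Bochner_Integration.integral_cong) (auto simp: kerd_scale)
  finally show ?thesis .
qed

text \<open>Let F y = f (x - \<epsilon> y). The truncation of f at x pairs \<open>kerd 1\<close>
  with F. Replace \<open>kerd 1\<close> by the transform of \<open>bfun\<close> at level \<delta>,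
  move the transform to F by symmetry, and undo the dilation: what appears is the truncation of f at
  level \<epsilon> \<delta>, which tends to g. Both replacements are continuous for the L^2 pairing,
  so the equality holds at every x.\<close>

lemma truncation_eq_average:
  assumes f: "l2fun f" and g: "l2fun g"
    and lim: "\<And>e. e > 0 \<Longrightarrow> \<exists>\<delta>0>0. \<forall>\<delta>. 0 < \<delta> \<longrightarrow> \<delta> < \<delta>0 \<longrightarrow> l2norm (\<lambda>x. conv (kerd \<delta>) f x - g x) \<le> e"
    and \<epsilon>: "\<epsilon> > 0"
  shows "conv (kerd \<epsilon>) f x = (\<integral>y. bfun y * g (x - \<epsilon> *\<^sub>R y) \<partial>lborel)"
proof -
  define F where "F y = f (x - \<epsilon> *\<^sub>R y)" for y
  define G where "G y = g (x - \<epsilon> *\<^sub>R y)" for y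
  have Fl: "l2fun F" using l2fun_affine[OF f, of "-\<epsilon>" x] \<epsilon> by (simp add: F_def[abs_def])
  have Gl: "l2fun G" using l2fun_affine[OF g, of "-\<epsilon>" x] \<epsilon> by (simp add: G_def[abs_def])
  have bl: "l2fun bfun" by (rule bcs_l2fun[OF bfun_bcs])
  \<comment> \<open>The factor by which the dilation y \<mapsto> x - \<epsilon> y changes the L^2
    norm.\<close>
  define \<kappa> where "\<kappa> = sqrt (\<epsilon> ^ CARD('n))"
  have k: "\<kappa> > 0" using \<epsilon> by (simp add: \<kappa>_def)
  have A: "conv (kerd \<epsilon>) f x = (\<integral>z. kerd 1 z * F z \<partial>lborel)"
    using conv_kerd_dilate[OF \<epsilon>, of 1 f x] by (simp add: F_def)
  have B: "conv (kerd \<delta>) F y = conv (kerd (\<epsilon> * \<delta>)) f (x - \<epsilon> *\<^sub>R y)" for \<delta> y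
  proof -
    have "conv (kerd \<delta>) F y = (\<integral>z. kerd \<delta> (0 - z) * F (y - (0 - z)) \<partial>lborel)"
      unfolding conv_def by (rule integral_lborel_reflect[symmetric])
    also have "\<dots> = conv (kerd (\<epsilon> * \<delta>)) f (x - \<epsilon> *\<^sub>R y)"
      unfolding conv_kerd_dilate[OF \<epsilon>] by (simp add: F_def kerd_even algebra_simps)
    finally show ?thesis .
  qed
  let ?d = "(\<integral>z. kerd 1 z * F z \<partial>lborel) - (\<integral>y. bfun y * G y \<partial>lborel)"
  have est: "\<bar>?d\<bar> \<le> e * l2norm F + l2norm bfun * (e / \<kappa>)" if e: "e > 0" for e
  proof -
    obtain \<delta>1 where d1: "\<delta>1 > 0" "\<And>\<delta>. 0 < \<delta> \<Longrightarrow> \<delta> < \<delta>1 \<Longrightarrow> l2norm (\<lambda>x. conv (kerd \<delta>) bfun x - kerd 1 x) \<le> e"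
      using conv_kerd_bfun_limit[OF e] by auto
    obtain \<delta>2 where d2: "\<delta>2 > 0" "\<And>\<delta>. 0 < \<delta> \<Longrightarrow> \<delta> < \<delta>2 \<Longrightarrow> l2norm (\<lambda>x. conv (kerd \<delta>) f x - g x) \<le> e"
      using lim[OF e] by auto
    \<comment> \<open>Two thresholds are met at once: \<delta> for the transform of
      \<open>bfun\<close>, and \<epsilon> \<delta> for the truncations of f.\<close>
    define \<delta> where "\<delta> = min (\<delta>1 / 2) (\<delta>2 / (2 * \<epsilon>))"
    have d: "0 < \<delta>" "\<delta> < \<delta>1" using d1(1) d2(1) \<epsilon> by (auto simp: \<delta>_def)
    have "\<epsilon> * \<delta> \<le> \<epsilon> * (\<delta>2 / (2 * \<epsilon>))" using \<epsilon> by (intro mult_left_mono) (auto simp: \<delta>_def)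
    also have "\<dots> < \<delta>2" using \<epsilon> d2(1) by simp
    finally have ed: "0 < \<epsilon> * \<delta>" "\<epsilon> * \<delta> < \<delta>2" using \<epsilon> d by auto
    have cb: "l2fun (conv (kerd \<delta>) bfun)" by (rule conv_kerd_l2fun[OF d(1) bl])
    have cF: "l2fun (conv (kerd \<delta>) F)" by (rule conv_kerd_l2fun[OF d(1) Fl])
    have k1: "l2fun (kerd 1)" by (rule kerd_l2) simp
    note i = l2fun_mult_integrable
    have 1: "\<bar>(\<integral>z. conv (kerd \<delta>) bfun z * F z \<partial>lborel) - (\<integral>z. kerd 1 z * F z \<partial>lborel)\<bar> \<le> e * l2norm F"
    proof -
      have "(\<integral>z. conv (kerd \<delta>) bfun z * F z \<partial>lborel) - (\<integral>z. kerd 1 z * F z \<partial>lborel)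
        = (\<integral>z. (conv (kerd \<delta>) bfun z - kerd 1 z) * F z \<partial>lborel)"
        using i[OF cb Fl] i[OF k1 Fl] by (simp add: left_diff_distrib)
      also have "\<bar>\<dots>\<bar> \<le> l2norm (\<lambda>z. conv (kerd \<delta>) bfun z - kerd 1 z) * l2norm F"
        by (intro l2norm_cauchy_schwarz l2fun_diff cb k1 Fl)
      also have "\<dots> \<le> e * l2norm F" by (intro mult_right_mono d1(2) d) simp
      finally show ?thesis .
    qed
    have 2: "\<bar>(\<integral>y. bfun y * conv (kerd \<delta>) F y \<partial>lborel) - (\<integral>y. bfun y * G y \<partial>lborel)\<bar> \<le> l2norm bfun * (e / \<kappa>)"
    proof -
      have "(\<integral>y. bfun y * conv (kerd \<delta>) F y \<partial>lborel) - (\<integral>y. bfun y * G y \<partial>lborel)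
        = (\<integral>y. bfun y * (conv (kerd \<delta>) F y - G y) \<partial>lborel)"
        using i[OF bl cF] i[OF bl Gl] by (simp add: right_diff_distrib)
      also have "\<bar>\<dots>\<bar> \<le> l2norm bfun * l2norm (\<lambda>y. conv (kerd \<delta>) F y - G y)"
        by (intro l2norm_cauchy_schwarz l2fun_diff bl cF Gl)
      also have "l2norm (\<lambda>y. conv (kerd \<delta>) F y - G y) \<le> e / \<kappa>"
      proof -
        have "\<kappa> * l2norm (\<lambda>y. conv (kerd \<delta>) F y - G y) = l2norm (\<lambda>x. conv (kerd (\<epsilon> * \<delta>)) f x - g x)"
          using l2norm_affine[of "-\<epsilon>" "\<lambda>x. conv (kerd (\<epsilon> * \<delta>)) f x - g x" x] \<epsilon> by (simp add: B G_def \<kappa>_def)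
        also have "\<dots> \<le> e" by (rule d2(2)[OF ed])
        finally show ?thesis using k by (simp add: pos_le_divide_eq mult.commute)
      qed
      finally show ?thesis by (simp add: mult_left_mono)
    qed
    have "(\<integral>z. conv (kerd \<delta>) bfun z * F z \<partial>lborel) = (\<integral>y. bfun y * conv (kerd \<delta>) F y \<partial>lborel)"
      by (intro inner_conv_even_l2 kerd_l2 d kerd_even bfun_bcs Fl)
    then show ?thesis using 1 2 by linarith
  qed
  define D where "D = \<bar>?d\<bar>"
  have "D = 0"
  proof (rule ccontr)
    assume "D \<noteq> 0"
    then have a: "0 < D" by (simp add: D_def)
    define K where "K = l2norm F + l2norm bfun / \<kappa> + 1"
    have K: "K > 0" using k by (simp add: K_def add_nonneg_pos)
    have alg: "s * l2norm F + l2norm bfun * (s / \<kappa>) = s * (K - 1)" for s by (simp add: K_def algebra_simps)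
    have "D \<le> (D / (2 * K)) * l2norm F + l2norm bfun * ((D / (2 * K)) / \<kappa>)"
      unfolding D_def by (rule est) (use a K in \<open>simp add: D_def\<close>)
    also have "\<dots> = (D / (2 * K)) * (K - 1)" by (rule alg)
    also have "\<dots> \<le> (D / (2 * K)) * K" using K a by (intro mult_left_mono) auto
    also have "\<dots> = D / 2" using K by simp
    finally show False using a by linarith
  qed
  then show ?thesis by (simp add: A G_def D_def)
qed

lemma integral_bfun: "(\<integral>y. bfun y \<partial>lborel) = 1"
proof -
  define \<phi> where "\<phi> r = indicator {..1} r * poly qpoly (r\<^sup>2)" for r :: real
  have eq: "bfun y = \<phi> (norm y) * 1" for y by (auto simp: bfun_def \<phi>_def indicator_def)
  have "integrable lborel (\<lambda>y::real^'n. \<phi> (norm y) * 1)" using bcs_integrable[OF bfun_bcs] unfolding eq .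
  then have "(\<integral>y. \<phi> (norm (y::real^'n)) * 1 \<partial>lborel)
    = (\<integral>u. indicator (ball (0::real^'n) 1) u * 1 \<partial>lborel) * (\<integral>r. polar_density TYPE(real^'n) r * (\<phi> r * r ^ 0) \<partial>lborel)"
    by (rule integral_homogeneous_radial) auto
  also have "(\<integral>r. polar_density TYPE(real^'n) r * (\<phi> r * r ^ 0) \<partial>lborel) = 1 / omega"
    using qpoly(2)[of 0] half_d(2) by (simp add: \<phi>_def omega_def)
  also have "(\<integral>u. indicator (ball (0::real^'n) 1) u * 1 \<partial>lborel) = omega" by (simp add: omega_def)
  finally show ?thesis using omega_pos by (simp add: eq)
qed

end

section \<open>Pointwise convergence of averages\<close>

text \<open>Subadditivity as an integral over counting measure, so that the countable set of centres
  from the covering lemma serves as index set without being enumerated.\<close>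

lemma emeasure_UN_countable_le:
  assumes [measurable]: "\<And>i. i \<in> I \<Longrightarrow> X i \<in> sets M" and I: "countable I"
  shows "emeasure M (\<Union>i\<in>I. X i) \<le> (\<integral>\<^sup>+i. emeasure M (X i) \<partial>count_space I)"
proof -
  have U: "(\<Union>i\<in>I. X i) \<in> sets M" using I by (intro sets.countable_UN'') auto
  have "emeasure M (\<Union>i\<in>I. X i) = (\<integral>\<^sup>+x. indicator (\<Union>i\<in>I. X i) x \<partial>M)" using U by simp
  also have "\<dots> \<le> (\<integral>\<^sup>+x. (\<integral>\<^sup>+i. indicator (X i) x \<partial>count_space I) \<partial>M)"
  proof (rule nn_integral_mono)
    fix x
    show "indicator (\<Union>i\<in>I. X i) x \<le> (\<integral>\<^sup>+i. indicator (X i) x \<partial>count_space I)"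
    proof (cases "x \<in> (\<Union>i\<in>I. X i)")
      case True
      then obtain j where j: "j \<in> I" "x \<in> X j" by blast
      have "(1::ennreal) = (\<integral>\<^sup>+i. indicator {j} i \<partial>count_space I)" using j(1) by simp
      also have "\<dots> \<le> (\<integral>\<^sup>+i. indicator (X i) x \<partial>count_space I)"
        using j(2) by (intro nn_integral_mono) (auto simp: indicator_def)
      finally show ?thesis using True by simp
    qed simp
  qed
  also have "\<dots> = (\<integral>\<^sup>+i. (\<integral>\<^sup>+x. indicator (X i) x \<partial>M) \<partial>count_space I)"
    by (rule nn_integral_count_space_nn_integral[OF I]) simp
  also have "\<dots> = (\<integral>\<^sup>+i. emeasure M (X i) \<partial>count_space I)"
    by (rule nn_integral_cong) simp
  finally show ?thesis .
qed

text \<open>Vitali's lemma selects disjoint balls whose fivefold enlargements cover K; this is the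
  factor 5^n. The conclusion concerns a Borel cover because K is not known to be measurable.\<close>

lemma weak_type_covering:
  fixes u :: "'a::euclidean_space \<Rightarrow> ennreal"
  assumes [measurable]: "u \<in> borel_measurable borel" and \<mu>: "\<mu> > 0"
    and K: "\<And>x. x \<in> K \<Longrightarrow> \<exists>r>0. r \<le> 1 \<and> ennreal \<mu> * emeasure lborel (cball x r) \<le> (\<integral>\<^sup>+y\<in>cball x r. u y \<partial>lborel)"
  obtains W where "W \<in> sets borel" "K \<subseteq> W" "emeasure lborel W \<le> ennreal (5 ^ DIM('a) / \<mu>) * (\<integral>\<^sup>+y. u y \<partial>lborel)"
proof -
  from K have "\<forall>x\<in>K. \<exists>r. 0 < r \<and> r \<le> 1 \<and> ennreal \<mu> * emeasure lborel (cball x r) \<le> (\<integral>\<^sup>+y\<in>cball x r. u y \<partial>lborel)" by blast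
  from bchoice[OF this] obtain r where
    r: "\<And>x. x \<in> K \<Longrightarrow> 0 < r x \<and> r x \<le> 1"
       "\<And>x. x \<in> K \<Longrightarrow> ennreal \<mu> * emeasure lborel (cball x (r x)) \<le> (\<integral>\<^sup>+y\<in>cball x (r x). u y \<partial>lborel)" by blast
  obtain C where C: "countable C" "C \<subseteq> K" "pairwise (\<lambda>i j. disjnt (cball i (r i)) (cball j (r j))) C"
    "K \<subseteq> (\<Union>i\<in>C. cball i (5 * r i))"
  proof (rule Vitali_covering_lemma_cballs[where S=K and K=K and a="\<lambda>x. x" and r=r and B=1])
    show "K \<subseteq> (\<Union>i\<in>K. cball i (r i))"
    proof
      fix x assume "x \<in> K"
      then show "x \<in> (\<Union>i\<in>K. cball i (r i))" using r(1)[of x] by (intro UN_I[of x]) auto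
    qed
    show "\<And>i. i \<in> K \<Longrightarrow> 0 < r i \<and> r i \<le> 1" by (rule r(1))
  qed
  define W where "W = (\<Union>i\<in>C. cball i (5 * r i))"
  have W: "W \<in> sets borel" unfolding W_def using C(1) by (intro sets.countable_UN'') auto
  have "emeasure lborel W \<le> (\<integral>\<^sup>+i. emeasure lborel (cball i (5 * r i)) \<partial>count_space C)"
    unfolding W_def by (rule emeasure_UN_countable_le) (use C in auto)
  also have "\<dots> \<le> (\<integral>\<^sup>+i. ennreal (5 ^ DIM('a) / \<mu>) * emeasure (density lborel u) (cball i (r i)) \<partial>count_space C)"
  proof (rule nn_integral_mono)
    fix i assume "i \<in> space (count_space C)"
    then have i: "i \<in> K" using C(2) by auto
    have ri: "r i > 0" using r(1)[OF i] by simp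
    have "emeasure lborel (cball i (5 * r i)) = ennreal (5 ^ DIM('a)) * emeasure lborel (cball i (r i))"
      using ri by (simp add: emeasure_cball ennreal_mult[symmetric] power_mult_distrib mult_ac)
    also have "ennreal (5 ^ DIM('a)) = ennreal (5 ^ DIM('a) / \<mu>) * ennreal \<mu>" using \<mu> by (simp add: ennreal_mult[symmetric])
    also have "ennreal (5 ^ DIM('a) / \<mu>) * ennreal \<mu> * emeasure lborel (cball i (r i)) \<le> ennreal (5 ^ DIM('a) / \<mu>) * (\<integral>\<^sup>+y\<in>cball i (r i). u y \<partial>lborel)"
      unfolding mult.assoc by (intro mult_left_mono r(2) i) simp
    also have "(\<integral>\<^sup>+y\<in>cball i (r i). u y \<partial>lborel) = emeasure (density lborel u) (cball i (r i))"
      by (simp add: emeasure_density)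
    finally show "emeasure lborel (cball i (5 * r i)) \<le> ennreal (5 ^ DIM('a) / \<mu>) * emeasure (density lborel u) (cball i (r i))" .
  qed
  also have "\<dots> = ennreal (5 ^ DIM('a) / \<mu>) * (\<integral>\<^sup>+i. emeasure (density lborel u) (cball i (r i)) \<partial>count_space C)"
    by (rule nn_integral_cmult) simp
  also have "(\<integral>\<^sup>+i. emeasure (density lborel u) (cball i (r i)) \<partial>count_space C) = emeasure (density lborel u) (\<Union>i\<in>C. cball i (r i))"
    using C by (intro emeasure_UN_countable[symmetric]) (auto simp: disjoint_family_on_def pairwise_def disjnt_def)
  also have "\<dots> \<le> emeasure (density lborel u) UNIV" by (rule emeasure_mono) auto
  also have "\<dots> = (\<integral>\<^sup>+y. u y \<partial>lborel)" by (simp add: emeasure_density)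
  finally have "emeasure lborel W \<le> ennreal (5 ^ DIM('a) / \<mu>) * (\<integral>\<^sup>+y. u y \<partial>lborel)" by (simp add: mult_left_mono)
  then show ?thesis using that[OF W] C(4) unfolding W_def by simp
qed

lemma nn_integral_square_l2norm: "l2fun h \<Longrightarrow> (\<integral>\<^sup>+x. ennreal ((h x)\<^sup>2) \<partial>lborel) = ennreal ((l2norm h)\<^sup>2)"
  unfolding l2norm_square l2fun_def by (intro nn_integral_eq_integral) auto

lemma markov_l2:
  assumes h: "l2fun h" and a: "a > 0"
  shows "emeasure lborel {x. a < \<bar>h x\<bar>} \<le> ennreal (1 / a\<^sup>2) * ennreal ((l2norm h)\<^sup>2)"
proof -
  have [measurable]: "h \<in> borel_measurable borel" using h by measurable
  have "emeasure lborel {x. a < \<bar>h x\<bar>} = (\<integral>\<^sup>+x. indicator {x. a < \<bar>h x\<bar>} x \<partial>lborel)" by simp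
  also have "\<dots> \<le> (\<integral>\<^sup>+x. ennreal (1 / a\<^sup>2) * ennreal ((h x)\<^sup>2) \<partial>lborel)"
  proof (rule nn_integral_mono)
    fix x
    show "indicator {x. a < \<bar>h x\<bar>} x \<le> ennreal (1 / a\<^sup>2) * ennreal ((h x)\<^sup>2)"
    proof (cases "a < \<bar>h x\<bar>")
      case True
      then have "a\<^sup>2 \<le> \<bar>h x\<bar>\<^sup>2" using a by (intro power_mono) auto
      then have "1 \<le> 1 / a\<^sup>2 * (h x)\<^sup>2" using a by (simp add: pos_le_divide_eq)
      then have "ennreal 1 \<le> ennreal (1 / a\<^sup>2 * (h x)\<^sup>2)" by (rule ennreal_leI)
      also have "\<dots> = ennreal (1 / a\<^sup>2) * ennreal ((h x)\<^sup>2)" by (rule ennreal_mult) auto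
      finally show ?thesis using True by simp
    qed simp
  qed
  also have "\<dots> = ennreal (1 / a\<^sup>2) * ennreal ((l2norm h)\<^sup>2)"
    by (simp add: nn_integral_cmult nn_integral_square_l2norm[OF h])
  finally show ?thesis .
qed

definition avg :: "('a::euclidean_space \<Rightarrow> real) \<Rightarrow> ('a \<Rightarrow> real) \<Rightarrow> real \<Rightarrow> 'a \<Rightarrow> real" where
  "avg b g \<epsilon> x = (\<integral>y. b y * g (x - \<epsilon> *\<^sub>R y) \<partial>lborel)"

lemma l2fun_dilate: "l2fun g \<Longrightarrow> \<epsilon> > 0 \<Longrightarrow> l2fun (\<lambda>y. g (x - \<epsilon> *\<^sub>R y))"
  using l2fun_affine[of g "-\<epsilon>" x] by simp

text \<open>After the Cauchy--Schwarz inequality, averages of h are controlled by means of h^2 over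
  balls, so the weak type estimate is applied to the integrable function h^2.\<close>

lemma avg_square_le:
  fixes b :: "'a::euclidean_space \<Rightarrow> real"
  assumes b: "bcs b" and b1: "\<And>y. norm y > 1 \<Longrightarrow> b y = 0" and h: "l2fun h" and r: "r > 0"
  shows "ennreal ((avg b h r x)\<^sup>2 * r ^ DIM('a)) \<le> ennreal ((l2norm b)\<^sup>2) * (\<integral>\<^sup>+y\<in>cball x r. ennreal ((h y)\<^sup>2) \<partial>lborel)"
proof -
  have [measurable]: "h \<in> borel_measurable borel" using h by measurable
  define H where "H y = indicator (cball 0 1) y * h (x - r *\<^sub>R y)" for y
  have H: "l2fun H"
  proof -
    have "integrable lborel (\<lambda>y. indicator (cball 0 1) y *\<^sub>R (h (x - r *\<^sub>R y))\<^sup>2)"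
      using l2fun_dilate[OF h r, of x] by (intro integrable_mult_indicator) (auto simp: l2fun_def)
    moreover have "(H y)\<^sup>2 = indicator (cball 0 1) y *\<^sub>R (h (x - r *\<^sub>R y))\<^sup>2" for y
      by (simp add: H_def indicator_def)
    moreover have "H \<in> borel_measurable borel" unfolding H_def[abs_def] by measurable
    ultimately show ?thesis by (simp add: l2fun_def)
  qed
  have "avg b h r x = (\<integral>y. b y * H y \<partial>lborel)"
    unfolding avg_def H_def using b1 by (intro Bochner_Integration.integral_cong) (auto simp: indicator_def not_le)
  then have "\<bar>avg b h r x\<bar> \<le> l2norm b * l2norm H" using l2norm_cauchy_schwarz[OF bcs_l2fun[OF b] H] by simp
  then have "\<bar>avg b h r x\<bar>\<^sup>2 \<le> (l2norm b * l2norm H)\<^sup>2" by (intro power_mono) auto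
  then have "(avg b h r x)\<^sup>2 * r ^ DIM('a) \<le> (l2norm b)\<^sup>2 * (l2norm H)\<^sup>2 * r ^ DIM('a)"
    using r by (simp add: power_mult_distrib)
  then have "ennreal ((avg b h r x)\<^sup>2 * r ^ DIM('a)) \<le> ennreal ((l2norm b)\<^sup>2 * (l2norm H)\<^sup>2 * r ^ DIM('a))" by (rule ennreal_leI)
  also have "\<dots> = ennreal ((l2norm b)\<^sup>2) * (ennreal (r ^ DIM('a)) * ennreal ((l2norm H)\<^sup>2))"
    using r by (simp add: ennreal_mult[symmetric] mult_ac)
  also have "ennreal ((l2norm H)\<^sup>2) = (\<integral>\<^sup>+y. ennreal ((H y)\<^sup>2) \<partial>lborel)" by (rule nn_integral_square_l2norm[OF H, symmetric])
  also have "ennreal (r ^ DIM('a)) * (\<integral>\<^sup>+y. ennreal ((H y)\<^sup>2) \<partial>lborel) = (\<integral>\<^sup>+y\<in>cball x r. ennreal ((h y)\<^sup>2) \<partial>lborel)"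
  proof -
    have eq: "ennreal ((h (x + (- r) *\<^sub>R y))\<^sup>2) * indicator (cball x r) (x + (- r) *\<^sub>R y) = ennreal ((H y)\<^sup>2)" for y
      using r by (simp add: H_def indicator_def dist_norm)
    show ?thesis
      using nn_integral_lborel_affine[of "\<lambda>y. ennreal ((h y)\<^sup>2) * indicator (cball x r) y" "-r" x] r unfolding eq by simp
  qed
  finally show ?thesis .
qed

text \<open>As b has integral one, the error averages \<phi> (x - \<epsilon> y) - \<phi> x, which is
  at most L \<epsilon> on the support of b.\<close>

lemma avg_lcs_uniform:
  fixes b :: "'a::euclidean_space \<Rightarrow> real"
  assumes b: "bcs b" and b1: "\<And>y. norm y > 1 \<Longrightarrow> b y = 0" and int: "(\<integral>y. b y \<partial>lborel) = 1" and \<phi>: "lcs \<phi>"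
  obtains C where "C \<ge> 0" "\<And>\<epsilon> x. \<epsilon> > 0 \<Longrightarrow> \<bar>avg b \<phi> \<epsilon> x - \<phi> x\<bar> \<le> C * \<epsilon>"
proof -
  obtain L where L: "L \<ge> 0" "\<And>x y. \<bar>\<phi> x - \<phi> y\<bar> \<le> L * norm (x - y)" using lcsE[OF \<phi>] by metis
  have bi: "integrable lborel (\<lambda>y. \<bar>b y\<bar>)" using bcs_integrable[OF bcs_abs[OF b]] .
  have "\<bar>avg b \<phi> \<epsilon> x - \<phi> x\<bar> \<le> L * l1norm b * \<epsilon>" if \<epsilon>: "\<epsilon> > 0" for \<epsilon> x
  proof -
    have i1: "integrable lborel (\<lambda>y. b y * \<phi> (x - \<epsilon> *\<^sub>R y))"
      by (intro l2fun_mult_integrable bcs_l2fun b l2fun_dilate lcs_bcs \<phi> \<epsilon>)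
    have i2: "integrable lborel (\<lambda>y. b y * \<phi> x)" using bcs_integrable[OF b] by simp
    have "avg b \<phi> \<epsilon> x - \<phi> x = (\<integral>y. b y * \<phi> (x - \<epsilon> *\<^sub>R y) \<partial>lborel) - (\<integral>y. b y * \<phi> x \<partial>lborel)"
      using int by (simp add: avg_def)
    also have "\<dots> = (\<integral>y. b y * \<phi> (x - \<epsilon> *\<^sub>R y) - b y * \<phi> x \<partial>lborel)"
      by (rule Bochner_Integration.integral_diff[symmetric, OF i1 i2])
    finally have "\<bar>avg b \<phi> \<epsilon> x - \<phi> x\<bar> \<le> (\<integral>y. \<bar>b y * \<phi> (x - \<epsilon> *\<^sub>R y) - b y * \<phi> x\<bar> \<partial>lborel)"
      using integral_abs_bound[of lborel "\<lambda>y. b y * \<phi> (x - \<epsilon> *\<^sub>R y) - b y * \<phi> x"] by simp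
    also have "\<dots> \<le> (\<integral>y. L * \<epsilon> * \<bar>b y\<bar> \<partial>lborel)"
    proof (rule integral_mono)
      show "integrable lborel (\<lambda>y. \<bar>b y * \<phi> (x - \<epsilon> *\<^sub>R y) - b y * \<phi> x\<bar>)"
        by (intro integrable_abs Bochner_Integration.integrable_diff i1 i2)
      show "integrable lborel (\<lambda>y. L * \<epsilon> * \<bar>b y\<bar>)" using bi by simp
      fix y
      show "\<bar>b y * \<phi> (x - \<epsilon> *\<^sub>R y) - b y * \<phi> x\<bar> \<le> L * \<epsilon> * \<bar>b y\<bar>"
      proof (cases "norm y \<le> 1")
        case True
        have "\<bar>\<phi> (x - \<epsilon> *\<^sub>R y) - \<phi> x\<bar> \<le> L * norm (\<epsilon> *\<^sub>R y)" using L(2)[of "x - \<epsilon> *\<^sub>R y" x] by simp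
        also have "\<dots> \<le> L * \<epsilon>" using True \<epsilon> L(1) by (simp add: mult_left_le mult_left_mono)
        finally have "\<bar>b y\<bar> * \<bar>\<phi> (x - \<epsilon> *\<^sub>R y) - \<phi> x\<bar> \<le> \<bar>b y\<bar> * (L * \<epsilon>)" by (rule mult_left_mono) simp
        moreover have "b y * \<phi> (x - \<epsilon> *\<^sub>R y) - b y * \<phi> x = b y * (\<phi> (x - \<epsilon> *\<^sub>R y) - \<phi> x)" by (simp add: right_diff_distrib)
        ultimately show ?thesis by (simp add: abs_mult mult.commute)
      qed (use b1 in auto)
    qed
    also have "\<dots> = L * l1norm b * \<epsilon>" by (simp add: l1norm_def)
    finally show ?thesis .
  qed
  then show ?thesis by (intro that[of "L * l1norm b"]) (use L(1) in auto)
qed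

text \<open>Split g into a Lipschitz part \<phi> and a part h of small norm. The error is at most a
  from the averages of \<phi>, a from those of h and a from h itself, unless a maximal average of h
  or h itself exceeds a. Both exceptions have measure at most a constant times the squared norm of
  h.\<close>

lemma avg_bad_set:
  fixes b :: "'a::euclidean_space \<Rightarrow> real"
  assumes b: "bcs b" and b1: "\<And>y. norm y > 1 \<Longrightarrow> b y = 0" and int: "(\<integral>y. b y \<partial>lborel) = 1"
    and g: "l2fun g" and a: "a > 0" and \<eta>: "\<eta> > 0"
  obtains W where "W \<in> sets borel" "{x. \<not> (\<forall>\<^sub>F \<epsilon> in at_right 0. \<bar>avg b g \<epsilon> x - g x\<bar> \<le> 3 * a)} \<subseteq> W" "emeasure lborel W \<le> ennreal \<eta>"
proof -
  define v where "v = measure lborel (cball (0::'a) 1)"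
  have v: "v > 0" using content_cball_pos[of 1 "0::'a"] by (simp add: v_def)
  define B where "B = (l2norm b)\<^sup>2 + 1"
  have B: "B > 0" unfolding B_def by (simp add: add_nonneg_pos)
  \<comment> \<open>An average of h above a forces the mean of h^2 over the ball of radius r to be
    at least a^2 / (B v), where v r^n is its volume and B exceeds the squared norm of b.\<close>
  define \<mu> where "\<mu> = a\<^sup>2 / (B * v)"
  have \<mu>: "\<mu> > 0" using a B v by (simp add: \<mu>_def)
  define c where "c = 5 ^ DIM('a) / \<mu> + 1 / a\<^sup>2"
  have c: "c > 0" using \<mu> a by (simp add: c_def add_pos_pos)
  obtain \<phi> where \<phi>: "lcs \<phi>" "l2norm (\<lambda>x. g x - \<phi> x) < sqrt (\<eta> / c)"
    using l2fun_lcs_approx[OF g, of "sqrt (\<eta> / c)"] \<eta> c by auto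
  define h where "h x = g x - \<phi> x" for x
  have pl: "l2fun \<phi>" by (intro bcs_l2fun lcs_bcs \<phi>)
  have h: "l2fun h" unfolding h_def by (rule l2fun_diff[OF g pl])
  have [measurable]: "h \<in> borel_measurable borel" using h by measurable
  have "(l2norm h)\<^sup>2 \<le> (sqrt (\<eta> / c))\<^sup>2" using \<phi>(2) by (intro power_mono) (auto simp: h_def[abs_def])
  then have hn: "(l2norm h)\<^sup>2 \<le> \<eta> / c" using \<eta> c by simp
  \<comment> \<open>The covering lemma asks for bounded radii; r \<le> 1 is enough because only
    small \<epsilon> matter for the limit.\<close>
  define K where "K = {x. \<exists>r>0. r \<le> 1 \<and> a < \<bar>avg b h r x\<bar>}"
  have Kcov: "\<exists>r>0. r \<le> 1 \<and> ennreal \<mu> * emeasure lborel (cball x r) \<le> (\<integral>\<^sup>+y\<in>cball x r. ennreal ((h y)\<^sup>2) \<partial>lborel)" if x: "x \<in> K" for x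
  proof -
    obtain r where r: "r > 0" "r \<le> 1" "a < \<bar>avg b h r x\<bar>" using x by (auto simp: K_def)
    have sq: "a\<^sup>2 \<le> (avg b h r x)\<^sup>2" using power_mono[of a "\<bar>avg b h r x\<bar>" 2] r(3) a by simp
    have em: "emeasure lborel (cball x r) = ennreal (v * r ^ DIM('a))"
      unfolding v_def using r by (simp add: emeasure_cball content_cball)
    have "ennreal \<mu> * emeasure lborel (cball x r) = ennreal (1 / B) * ennreal (a\<^sup>2 * r ^ DIM('a))"
      unfolding em using r v B \<mu> by (simp add: ennreal_mult[symmetric] \<mu>_def)
    also have "\<dots> \<le> ennreal (1 / B) * ennreal ((avg b h r x)\<^sup>2 * r ^ DIM('a))"
      using sq r by (intro mult_left_mono ennreal_leI mult_right_mono) auto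
    also have "\<dots> \<le> ennreal (1 / B) * (ennreal ((l2norm b)\<^sup>2) * (\<integral>\<^sup>+y\<in>cball x r. ennreal ((h y)\<^sup>2) \<partial>lborel))"
      by (intro mult_left_mono avg_square_le b b1 h r) auto
    also have "\<dots> = ennreal (1 / B * (l2norm b)\<^sup>2) * (\<integral>\<^sup>+y\<in>cball x r. ennreal ((h y)\<^sup>2) \<partial>lborel)"
      using B by (subst ennreal_mult) (auto simp: mult.assoc)
    also have "\<dots> \<le> 1 * (\<integral>\<^sup>+y\<in>cball x r. ennreal ((h y)\<^sup>2) \<partial>lborel)"
    proof (rule mult_right_mono)
      have "1 / B * (l2norm b)\<^sup>2 \<le> 1" using B by (simp add: B_def)
      then show "ennreal (1 / B * (l2norm b)\<^sup>2) \<le> 1" using ennreal_leI by fastforce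
    qed simp
    finally show ?thesis using r by auto
  qed
  obtain W where W: "W \<in> sets borel" "K \<subseteq> W" "emeasure lborel W \<le> ennreal (5 ^ DIM('a) / \<mu>) * (\<integral>\<^sup>+y. ennreal ((h y)\<^sup>2) \<partial>lborel)"
    by (rule weak_type_covering[of "\<lambda>y. ennreal ((h y)\<^sup>2)" \<mu> K]) (use \<mu> Kcov in auto)
  have Ns: "{x. a < \<bar>h x\<bar>} \<in> sets borel" by measurable
  obtain C where C: "C \<ge> 0" "\<And>\<epsilon> x. \<epsilon> > 0 \<Longrightarrow> \<bar>avg b \<phi> \<epsilon> x - \<phi> x\<bar> \<le> C * \<epsilon>" using avg_lcs_uniform[OF b b1 int \<phi>(1)] by blast
  show ?thesis
  proof (rule that[of "W \<union> {x. a < \<bar>h x\<bar>}"])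
    show "W \<union> {x. a < \<bar>h x\<bar>} \<in> sets borel" using W(1) Ns by (rule sets.Un)
    show "{x. \<not> (\<forall>\<^sub>F \<epsilon> in at_right 0. \<bar>avg b g \<epsilon> x - g x\<bar> \<le> 3 * a)} \<subseteq> W \<union> {x. a < \<bar>h x\<bar>}"
    proof (rule subsetI, rule ccontr)
      fix x assume bad: "x \<in> {x. \<not> (\<forall>\<^sub>F \<epsilon> in at_right 0. \<bar>avg b g \<epsilon> x - g x\<bar> \<le> 3 * a)}" and "x \<notin> W \<union> {x. a < \<bar>h x\<bar>}"
      then have x: "x \<notin> K" "\<bar>h x\<bar> \<le> a" using W(2) by auto
      define t where "t = min 1 (a / (C + 1))"
      have t: "t > 0" using a C(1) by (simp add: t_def)
      have "\<bar>avg b g \<epsilon> x - g x\<bar> \<le> 3 * a" if \<epsilon>: "0 < \<epsilon>" "\<epsilon> < t" for \<epsilon>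
      proof -
        have "avg b g \<epsilon> x = avg b h \<epsilon> x + avg b \<phi> \<epsilon> x"
        proof -
          have i1: "integrable lborel (\<lambda>y. b y * h (x - \<epsilon> *\<^sub>R y))"
            by (intro l2fun_mult_integrable bcs_l2fun b l2fun_dilate h \<epsilon>)
          have i2: "integrable lborel (\<lambda>y. b y * \<phi> (x - \<epsilon> *\<^sub>R y))"
            by (intro l2fun_mult_integrable bcs_l2fun b l2fun_dilate lcs_bcs \<phi> \<epsilon>)
          show ?thesis unfolding avg_def Bochner_Integration.integral_add[OF i1 i2, symmetric]
            by (rule Bochner_Integration.integral_cong) (auto simp: h_def algebra_simps)
        qed
        moreover have "\<bar>avg b h \<epsilon> x\<bar> \<le> a"
        proof (rule ccontr)
          assume "\<not> \<bar>avg b h \<epsilon> x\<bar> \<le> a"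
          then have "x \<in> K" unfolding K_def using \<epsilon> by (auto simp: t_def intro!: exI[of _ \<epsilon>])
          then show False using x(1) by simp
        qed
        moreover have "\<bar>avg b \<phi> \<epsilon> x - \<phi> x\<bar> \<le> a"
        proof -
          have "\<bar>avg b \<phi> \<epsilon> x - \<phi> x\<bar> \<le> C * \<epsilon>" by (rule C(2)[OF \<epsilon>(1)])
          also have "\<dots> \<le> (C + 1) * (a / (C + 1))" using \<epsilon> C(1) a by (intro mult_mono) (auto simp: t_def)
          also have "\<dots> = a" using C(1) by simp
          finally show ?thesis .
        qed
        ultimately show ?thesis using x(2) unfolding h_def by linarith
      qed
      then have "\<forall>\<^sub>F \<epsilon> in at_right 0. \<bar>avg b g \<epsilon> x - g x\<bar> \<le> 3 * a"
        unfolding eventually_at_right_field using t by blast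
      then show False using bad by simp
    qed
    have "emeasure lborel (W \<union> {x. a < \<bar>h x\<bar>}) \<le> emeasure lborel W + emeasure lborel {x. a < \<bar>h x\<bar>}"
      using W(1) Ns by (intro emeasure_subadditive) auto
    also have "\<dots> \<le> ennreal (5 ^ DIM('a) / \<mu>) * ennreal ((l2norm h)\<^sup>2) + ennreal (1 / a\<^sup>2) * ennreal ((l2norm h)\<^sup>2)"
      using W(3) markov_l2[OF h a] unfolding nn_integral_square_l2norm[OF h] by (rule add_mono)
    also have "\<dots> = ennreal (c * (l2norm h)\<^sup>2)"
      unfolding c_def using \<mu> a by (simp add: ennreal_mult[symmetric] ennreal_plus[symmetric] distrib_right del: ennreal_plus)
    also have "\<dots> \<le> ennreal \<eta>" using hn c by (intro ennreal_leI) (simp add: pos_le_divide_eq mult.commute)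
    finally show "emeasure lborel (W \<union> {x. a < \<bar>h x\<bar>}) \<le> ennreal \<eta>" .
  qed
qed

text \<open>For each tolerance the bad set has Borel covers of arbitrarily small measure, so it is
  negligible without being shown measurable. Countably many tolerances give convergence.\<close>

lemma avg_tendsto_AE:
  fixes b :: "'a::euclidean_space \<Rightarrow> real"
  assumes b: "bcs b" and b1: "\<And>y. norm y > 1 \<Longrightarrow> b y = 0" and int: "(\<integral>y. b y \<partial>lborel) = 1" and g: "l2fun g"
  shows "AE x in lborel. ((\<lambda>\<epsilon>. avg b g \<epsilon> x) \<longlongrightarrow> g x) (at_right 0)"
proof -
  have one: "AE x in lborel. \<forall>\<^sub>F \<epsilon> in at_right 0. \<bar>avg b g \<epsilon> x - g x\<bar> \<le> 3 * a" if a: "a > 0" for a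
  proof -
    let ?S = "{x. \<not> (\<forall>\<^sub>F \<epsilon> in at_right 0. \<bar>avg b g \<epsilon> x - g x\<bar> \<le> 3 * a)}"
    have "\<forall>k::nat. \<exists>W. W \<in> sets borel \<and> ?S \<subseteq> W \<and> emeasure lborel W \<le> ennreal (1 / Suc k)"
    proof
      fix k :: nat
      obtain W where W: "W \<in> sets borel" "?S \<subseteq> W" "emeasure lborel W \<le> ennreal (1 / Suc k)"
        by (rule avg_bad_set[OF b b1 int g a, of "1 / Suc k"]) auto
      show "\<exists>W. W \<in> sets borel \<and> ?S \<subseteq> W \<and> emeasure lborel W \<le> ennreal (1 / Suc k)"
        by (intro exI[of _ W] conjI W)
    qed
    from choice[OF this] obtain W where "\<forall>k::nat. W k \<in> sets borel \<and> ?S \<subseteq> W k \<and> emeasure lborel (W k) \<le> ennreal (1 / Suc k)" ..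
    then have W: "\<And>k::nat. W k \<in> sets borel" "\<And>k. ?S \<subseteq> W k" "\<And>k. emeasure lborel (W k) \<le> ennreal (1 / Suc k)"
      by simp_all
    show ?thesis
    proof (rule AE_I[where N="\<Inter>k. W k"])
      show "{x \<in> space lborel. \<not> (\<forall>\<^sub>F \<epsilon> in at_right 0. \<bar>avg b g \<epsilon> x - g x\<bar> \<le> 3 * a)} \<subseteq> (\<Inter>k. W k)" using W(2) by auto
      show m: "(\<Inter>k. W k) \<in> sets lborel" using W(1) by auto
      have le: "emeasure lborel (\<Inter>k. W k) \<le> ennreal (1 / Suc k)" for k
        by (rule order_trans[OF emeasure_mono W(3)]) (use W(1) in auto)
      have "(\<lambda>k. ennreal (1 / real (Suc k))) \<longlonglongrightarrow> ennreal 0"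
        by (intro tendsto_ennrealI LIMSEQ_Suc lim_1_over_n)
      then have "emeasure lborel (\<Inter>k. W k) \<le> ennreal 0" by (rule LIMSEQ_le_const) (use le in auto)
      then show "emeasure lborel (\<Inter>k. W k) = 0" by simp
    qed
  qed
  have "AE x in lborel. \<forall>k::nat. \<forall>\<^sub>F \<epsilon> in at_right 0. \<bar>avg b g \<epsilon> x - g x\<bar> \<le> 3 * (1 / Suc k)"
    unfolding AE_all_countable by (intro allI one) simp
  then show ?thesis
  proof (rule AE_mp, intro AE_I2 impI)
    fix x assume ev: "\<forall>k::nat. \<forall>\<^sub>F \<epsilon> in at_right 0. \<bar>avg b g \<epsilon> x - g x\<bar> \<le> 3 * (1 / Suc k)"
    show "((\<lambda>\<epsilon>. avg b g \<epsilon> x) \<longlongrightarrow> g x) (at_right 0)"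
    proof (rule tendstoI)
      fix e :: real assume "e > 0"
      then obtain k :: nat where "1 / Suc k < e / 3" using nat_approx_posE[of "e/3"] by auto
      then have k: "3 * (1 / Suc k) < e" by simp
      from ev have "\<forall>\<^sub>F \<epsilon> in at_right 0. \<bar>avg b g \<epsilon> x - g x\<bar> \<le> 3 * (1 / Suc k)" by blast
      then show "\<forall>\<^sub>F \<epsilon> in at_right 0. dist (avg b g \<epsilon> x) (g x) < e"
        by eventually_elim (use k in \<open>simp add: dist_real_def\<close>)
    qed
  qed
qed

section \<open>Domination by the Hardy--Littlewood maximal function\<close>

lemma AE_lborel_reflect:
  fixes x :: "'a::euclidean_space"
  assumes "AE y in lborel. Q y"
  shows "AE y in lborel. Q (x - y)"
proof -
  obtain N where N: "{y \<in> space lborel. \<not> Q y} \<subseteq> N" "emeasure lborel N = 0" "N \<in> sets lborel"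
    using AE_E[OF assms] by blast
  have [measurable]: "N \<in> sets borel" using N(3) by simp
  show ?thesis
  proof (rule AE_I[where N="{y. x - y \<in> N}"])
    show "{y \<in> space lborel. \<not> Q (x - y)} \<subseteq> {y. x - y \<in> N}" using N(1) by auto
    have "emeasure lborel {y. x - y \<in> N} = (\<integral>\<^sup>+y. indicator {y. x - y \<in> N} y \<partial>lborel)" by simp
    also have "\<dots> = (\<integral>\<^sup>+y. indicator N (x - y) \<partial>lborel)" by (intro nn_integral_cong) (auto simp: indicator_def)
    also have "\<dots> = (\<integral>\<^sup>+y. indicator N y \<partial>lborel)" by (rule nn_integral_lborel_reflect) simp
    finally show "emeasure lborel {y. x - y \<in> N} = 0" using N by simp
    show "{y. x - y \<in> N} \<in> sets lborel" by simp
  qed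
qed

lemma lebesgue_measurable_reflect:
  fixes x :: "'a::euclidean_space"
  assumes "f \<in> borel_measurable lebesgue"
  shows "(\<lambda>y. f (x - y)) \<in> borel_measurable lebesgue"
proof -
  have "(\<lambda>y::'a. x + (\<Sum>j\<in>Basis. (- 1 * (y \<bullet> j)) *\<^sub>R j)) \<in> lebesgue \<rightarrow>\<^sub>M lebesgue"
    by (rule lebesgue_affine_measurable) simp
  moreover have "(\<lambda>y::'a. x + (\<Sum>j\<in>Basis. (- 1 * (y \<bullet> j)) *\<^sub>R j)) = (\<lambda>y. x - y)"
    by (simp add: sum_negf euclidean_representation)
  ultimately have "(\<lambda>y. x - y) \<in> lebesgue \<rightarrow>\<^sub>M lebesgue" by simp
  from measurable_compose[OF this assms] show ?thesis .
qed

lemma integral_complex_parts: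
  assumes "integrable M u" "integrable M v"
  shows "integrable M (\<lambda>y. complex_of_real (u y) + \<i> * complex_of_real (v y))"
    and "(\<integral>y. complex_of_real (u y) + \<i> * complex_of_real (v y) \<partial>M) = complex_of_real (\<integral>y. u y \<partial>M) + \<i> * complex_of_real (\<integral>y. v y \<partial>M)"
  using assms by auto

lemma l2fun_of_lebesgue:
  fixes u :: "'a::euclidean_space \<Rightarrow> real"
  assumes u: "u \<in> borel_measurable lebesgue" "integrable lebesgue (\<lambda>x. (u x)\<^sup>2)"
  obtains v where "l2fun v" "AE x in lborel. u x = v x"
proof -
  obtain v where v: "v \<in> borel_measurable lborel" "AE x in lborel. u x = v x"
    using completion_ex_borel_measurable_real[OF u(1)] by blast
  have [measurable]: "v \<in> borel_measurable borel" using v(1) by simp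
  have "integrable lebesgue (\<lambda>x. (v x)\<^sup>2)"
  proof (rule integrable_cong_AE_imp[OF u(2)])
    show "(\<lambda>x. (v x)\<^sup>2) \<in> borel_measurable lebesgue" by (rule measurable_completion) simp
    show "AE x in lebesgue. (u x)\<^sup>2 = (v x)\<^sup>2" using AE_completion[OF v(2)] by eventually_elim simp
  qed
  then have "integrable lborel (\<lambda>x. (v x)\<^sup>2)" by (subst (asm) integrable_completion) auto
  then have "l2fun v" by (simp add: l2fun_def)
  then show ?thesis using v(2) by (rule that)
qed

lemma L2_parts:
  fixes f :: "real^'n::finite \<Rightarrow> complex"
  assumes f: "L2 f"
  obtains u v where "l2fun u" "l2fun v" "AE x in lborel. f x = complex_of_real (u x) + \<i> * complex_of_real (v x)"
proof -
  have fm [measurable]: "f \<in> borel_measurable lebesgue" and fi: "integrable lebesgue (\<lambda>x. (norm (f x))\<^sup>2)" using f by (auto simp: L2_def)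
  have re: "integrable lebesgue (\<lambda>x. (Re (f x))\<^sup>2)"
    by (rule Bochner_Integration.integrable_bound[OF fi]) (auto simp: cmod_power2)
  have im: "integrable lebesgue (\<lambda>x. (Im (f x))\<^sup>2)"
    by (rule Bochner_Integration.integrable_bound[OF fi]) (auto simp: cmod_power2)
  obtain u where u: "l2fun u" "AE x in lborel. Re (f x) = u x"
    by (rule l2fun_of_lebesgue[OF _ re]) auto
  obtain v where v: "l2fun v" "AE x in lborel. Im (f x) = v x"
    by (rule l2fun_of_lebesgue[OF _ im]) auto
  have "AE x in lborel. f x = complex_of_real (u x) + \<i> * complex_of_real (v x)"
    using u(2) v(2) by eventually_elim (simp add: complex_eq_iff)
  then show ?thesis using that u(1) v(1) by blast
qed

context even_harmonic_poly
begin

text \<open>Passing to Borel representatives of the real and imaginary parts changes f on a null set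
  only. The truncation is an integral for each x, so the equality holds at every x.\<close>

lemma trunc_op_eq:
  assumes e: "e > 0" and f: "f \<in> borel_measurable lebesgue" and u: "l2fun u" and v: "l2fun v"
    and fuv: "AE x in lborel. f x = complex_of_real (u x) + \<i> * complex_of_real (v x)"
  shows "trunc_op (riesz_kernel d P) e f x = complex_of_real (conv (kerd e) u x) + \<i> * complex_of_real (conv (kerd e) v x)"
proof -
  have [measurable]: "u \<in> borel_measurable borel" "v \<in> borel_measurable borel" using u v by measurable
  have [measurable]: "(\<lambda>y. f (x - y)) \<in> borel_measurable lebesgue" by (rule lebesgue_measurable_reflect[OF f])
  have km [measurable]: "kerd e \<in> borel_measurable lebesgue" by (rule measurable_completion) simp
  define h where "h y = complex_of_real (kerd e y * u (x - y)) + \<i> * complex_of_real (kerd e y * v (x - y))" for y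
  have hm [measurable]: "h \<in> borel_measurable borel" unfolding h_def[abs_def] by measurable
  have "trunc_op (riesz_kernel d P) e f x = (\<integral>y. complex_of_real (kerd e y) * f (x - y) \<partial>lebesgue)"
    unfolding trunc_op_def set_lebesgue_integral_def
    by (intro Bochner_Integration.integral_cong) (auto simp: kerd_def ker_eq riesz_kernel_def indicator_def)
  also have "\<dots> = (\<integral>y. h y \<partial>lebesgue)"
  proof (rule integral_cong_AE)
    show "(\<lambda>y. complex_of_real (kerd e y) * f (x - y)) \<in> borel_measurable lebesgue" by measurable
    show "h \<in> borel_measurable lebesgue" by (rule measurable_completion) simp
    show "AE y in lebesgue. complex_of_real (kerd e y) * f (x - y) = h y"
      using AE_completion[OF AE_lborel_reflect[OF fuv, of x]] by eventually_elim (simp add: h_def algebra_simps)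
  qed
  also have "\<dots> = (\<integral>y. h y \<partial>lborel)" by (rule integral_completion) simp
  also have "\<dots> = complex_of_real (conv (kerd e) u x) + \<i> * complex_of_real (conv (kerd e) v x)"
    unfolding h_def conv_def by (intro integral_complex_parts conv_kerd_integrable e u v)
  finally show ?thesis .
qed

text \<open>The complex average is estimated as a whole and not by its two parts, so that |G| itself
  appears. A bounded kernel supported in the unit ball is at most M \<open>omega\<close> times the
  normalised indicator of that ball.\<close>

lemma average_le_HL_max:
  assumes M: "M \<ge> 0" "\<And>y. \<bar>bfun y\<bar> \<le> M" and u: "l2fun u" and v: "l2fun v" and e: "e > 0"
    and G: "AE x in lborel. G x = complex_of_real (u x) + \<i> * complex_of_real (v x)"
  shows "ennreal (norm (complex_of_real (avg bfun u e x) + \<i> * complex_of_real (avg bfun v e x))) \<le> ennreal (M * omega) * HL_max G x"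
proof -
  have [measurable]: "u \<in> borel_measurable borel" "v \<in> borel_measurable borel" using u v by measurable
  define H where "H y = complex_of_real (u y) + \<i> * complex_of_real (v y)" for y
  have [measurable]: "H \<in> borel_measurable borel" unfolding H_def[abs_def] by measurable
  let ?n = "CARD('n)" and ?I = "\<integral>\<^sup>+y\<in>ball x e. ennreal (norm (H y)) \<partial>lborel"
  let ?h = "\<lambda>y. complex_of_real (bfun y * u (x - e *\<^sub>R y)) + \<i> * complex_of_real (bfun y * v (x - e *\<^sub>R y))"
  note i = l2fun_mult_integrable[OF bcs_l2fun[OF bfun_bcs] l2fun_dilate[OF u e, of x]]
    l2fun_mult_integrable[OF bcs_l2fun[OF bfun_bcs] l2fun_dilate[OF v e, of x]]
  have em: "emeasure lborel (ball x e) = ennreal (omega * e ^ ?n)"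
    using e by (simp add: emeasure_ball omega_def content_ball)
  have "complex_of_real (avg bfun u e x) + \<i> * complex_of_real (avg bfun v e x) = (\<integral>y. ?h y \<partial>lborel)"
    unfolding avg_def by (rule integral_complex_parts(2)[OF i, symmetric])
  then have "ennreal (norm (complex_of_real (avg bfun u e x) + \<i> * complex_of_real (avg bfun v e x))) = ennreal (norm (\<integral>y. ?h y \<partial>lborel))"
    by simp
  also have "\<dots> \<le> (\<integral>\<^sup>+y. ennreal (norm (?h y)) \<partial>lborel)"
    by (rule integral_norm_bound_ennreal[OF integral_complex_parts(1)[OF i]])
  also have "\<dots> \<le> (\<integral>\<^sup>+y. ennreal M * (ennreal (norm (H (x + (- e) *\<^sub>R y))) * indicator (ball x e) (x + (- e) *\<^sub>R y)) \<partial>lborel)"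
  proof (rule nn_integral_mono_AE)
    show "AE y in lborel. ennreal (norm (?h y)) \<le> ennreal M * (ennreal (norm (H (x + (- e) *\<^sub>R y))) * indicator (ball x e) (x + (- e) *\<^sub>R y))"
      \<comment> \<open>The potential may be nonzero on the unit sphere, while the maximal function
        uses open balls; the sphere is a null set.\<close>
      using AE_lborel_norm_neq[of 1]
    proof eventually_elim
      fix y :: "real^'n" assume y: "norm y \<noteq> 1"
      have h: "?h y = complex_of_real (bfun y) * H (x - e *\<^sub>R y)" by (simp add: H_def algebra_simps)
      show "ennreal (norm (?h y)) \<le> ennreal M * (ennreal (norm (H (x + (- e) *\<^sub>R y))) * indicator (ball x e) (x + (- e) *\<^sub>R y))"
      proof (cases "norm y < 1")
        case True
        then have "indicator (ball x e) (x + (- e) *\<^sub>R y) = (1::ennreal)" using e by (simp add: dist_norm)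
        moreover have "ennreal (norm (?h y)) \<le> ennreal (M * norm (H (x - e *\<^sub>R y)))"
          unfolding h norm_mult using M(2)[of y] by (intro ennreal_leI mult_right_mono) auto
        ultimately show ?thesis using M(1) by (simp add: ennreal_mult)
      next
        case False
        then have "bfun y = 0" using y by (intro bfun_out) simp
        then show ?thesis by simp
      qed
    qed
  qed
  also have "\<dots> = ennreal M * (\<integral>\<^sup>+y. ennreal (norm (H (x + (- e) *\<^sub>R y))) * indicator (ball x e) (x + (- e) *\<^sub>R y) \<partial>lborel)"
    by (rule nn_integral_cmult) measurable
  also have "(\<integral>\<^sup>+y. ennreal (norm (H (x + (- e) *\<^sub>R y))) * indicator (ball x e) (x + (- e) *\<^sub>R y) \<partial>lborel) = ennreal (1 / e ^ ?n) * ?I"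
  proof -
    have "?I = ennreal (e ^ ?n) * (\<integral>\<^sup>+y. ennreal (norm (H (x + (- e) *\<^sub>R y))) * indicator (ball x e) (x + (- e) *\<^sub>R y) \<partial>lborel)"
      using nn_integral_lborel_affine[of "\<lambda>y. ennreal (norm (H y)) * indicator (ball x e) y" "-e" x] e by simp
    moreover have "ennreal (1 / e ^ ?n) * ennreal (e ^ ?n) = 1" using e by (simp add: ennreal_mult[symmetric])
    ultimately show ?thesis by (simp add: mult.assoc[symmetric])
  qed
  \<comment> \<open>The factor \<open>omega\<close> turns division by e^n into division by the
    volume of the ball.\<close>
  also have "ennreal M * (ennreal (1 / e ^ ?n) * ?I) = ennreal (M * omega) * (?I / emeasure lborel (ball x e))"
  proof -
    have "?I / emeasure lborel (ball x e) = ennreal (1 / (omega * e ^ ?n)) * ?I"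
      unfolding em using e omega_pos by (simp add: divide_ennreal_def inverse_ennreal divide_inverse mult.commute)
    moreover have "ennreal (M * omega) * ennreal (1 / (omega * e ^ ?n)) = ennreal M * ennreal (1 / e ^ ?n)"
      using e omega_pos M(1) by (simp add: ennreal_mult[symmetric])
    ultimately show ?thesis by (simp add: mult.assoc[symmetric])
  qed
  also have "?I / emeasure lborel (ball x e) = (\<integral>\<^sup>+y\<in>ball x e. ennreal (norm (G y)) \<partial>lebesgue) / emeasure lebesgue (ball x e)"
  proof -
    have "?I = (\<integral>\<^sup>+y\<in>ball x e. ennreal (norm (G y)) \<partial>lborel)"
    proof (rule nn_integral_cong_AE)
      show "AE y in lborel. ennreal (norm (H y)) * indicator (ball x e) y = ennreal (norm (G y)) * indicator (ball x e) y"
        using G by eventually_elim (simp add: H_def)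
    qed
    then show ?thesis by (simp add: nn_integral_completion)
  qed
  also have "\<dots> \<le> HL_max G x"
    unfolding HL_max_def using e by (intro SUP_upper) auto
  finally show ?thesis by (simp add: mult_left_mono)
qed

text \<open>The averages play two roles: letting the truncation level tend to zero they identify the
  singular integral almost everywhere, and at each fixed level they are dominated by its maximal
  function.\<close>

lemma max_sing_op_le:
  assumes M: "M \<ge> 0" "\<And>y. \<bar>bfun y\<bar> \<le> M" and f: "L2 f"
  shows "max_sing_op (riesz_kernel d P) f x \<le> ennreal (M * omega) * HL_max (sing_op (riesz_kernel d P) f) x"
proof -
  let ?K = "riesz_kernel d P"
  have fm: "f \<in> borel_measurable lebesgue" using f by (simp add: L2_def)
  obtain u v where uv: "l2fun u" "l2fun v" and fuv: "AE x in lborel. f x = complex_of_real (u x) + \<i> * complex_of_real (v x)"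
    by (rule L2_parts[OF f])
  obtain u' where u': "l2fun u'" "\<And>e. e > 0 \<Longrightarrow> \<exists>\<delta>0>0. \<forall>\<delta>. 0 < \<delta> \<longrightarrow> \<delta> < \<delta>0 \<longrightarrow> l2norm (\<lambda>x. conv (kerd \<delta>) u x - u' x) \<le> e"
    using conv_kerd_l2_limit[OF uv(1)] by auto
  obtain v' where v': "l2fun v'" "\<And>e. e > 0 \<Longrightarrow> \<exists>\<delta>0>0. \<forall>\<delta>. 0 < \<delta> \<longrightarrow> \<delta> < \<delta>0 \<longrightarrow> l2norm (\<lambda>x. conv (kerd \<delta>) v x - v' x) \<le> e"
    using conv_kerd_l2_limit[OF uv(2)] by auto
  have T: "trunc_op ?K e f x = complex_of_real (avg bfun u' e x) + \<i> * complex_of_real (avg bfun v' e x)" if e: "e > 0" for e x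
  proof -
    have "conv (kerd e) u x = avg bfun u' e x"
      unfolding avg_def by (rule truncation_eq_average[OF uv(1) u'(1) _ e]) (rule u'(2))
    moreover have "conv (kerd e) v x = avg bfun v' e x"
      unfolding avg_def by (rule truncation_eq_average[OF uv(2) v'(1) _ e]) (rule v'(2))
    ultimately show ?thesis unfolding trunc_op_eq[OF e fm uv fuv] by simp
  qed
  have lim: "AE x in lborel. ((\<lambda>e. avg bfun h e x) \<longlongrightarrow> h x) (at_right 0)" if "l2fun h" for h
    by (rule avg_tendsto_AE[OF bfun_bcs _ integral_bfun that]) (rule bfun_out)
  \<comment> \<open>Where the limit does not exist, \<open>Lim\<close> has an unspecified value.
    This can happen only on a null set, which the integrals in \<open>HL_max\<close> do not
    see.\<close>
  have S: "AE x in lborel. sing_op ?K f x = complex_of_real (u' x) + \<i> * complex_of_real (v' x)"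
    using lim[OF u'(1)] lim[OF v'(1)]
  proof eventually_elim
    fix x assume l: "((\<lambda>e. avg bfun u' e x) \<longlongrightarrow> u' x) (at_right 0)" "((\<lambda>e. avg bfun v' e x) \<longlongrightarrow> v' x) (at_right 0)"
    have "((\<lambda>e. complex_of_real (avg bfun u' e x) + \<i> * complex_of_real (avg bfun v' e x)) \<longlongrightarrow> complex_of_real (u' x) + \<i> * complex_of_real (v' x)) (at_right 0)"
      by (intro tendsto_intros l)
    moreover have "\<forall>\<^sub>F e in at_right 0. complex_of_real (avg bfun u' e x) + \<i> * complex_of_real (avg bfun v' e x) = trunc_op ?K e f x"
      using eventually_at_right_less[of "0::real"] by eventually_elim (simp add: T)
    ultimately have "((\<lambda>e. trunc_op ?K e f x) \<longlongrightarrow> complex_of_real (u' x) + \<i> * complex_of_real (v' x)) (at_right 0)"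
      by (rule Lim_transform_eventually)
    then show "sing_op ?K f x = complex_of_real (u' x) + \<i> * complex_of_real (v' x)"
      unfolding sing_op_def by (intro tendsto_Lim) auto
  qed
  show ?thesis
    unfolding max_sing_op_def
  proof (rule SUP_least)
    fix e :: real assume "e \<in> {0<..}"
    then have e: "e > 0" by simp
    show "ennreal (norm (trunc_op ?K e f x)) \<le> ennreal (M * omega) * HL_max (sing_op ?K f) x"
      unfolding T[OF e] by (rule average_le_HL_max[OF M u'(1) v'(1) e S])
  qed
qed

end

theorem theorem1:
  fixes P :: "real^'n::finite \<Rightarrow> real" and d :: nat
  assumes "even d" and "d \<ge> 2"
    and "homogeneous_harmonic_poly d P"
    and "\<exists>x. P x \<noteq> 0"
  shows "\<exists>C::real. C \<ge> 0 \<and> (\<forall>f x. L2 f \<longrightarrow>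
           max_sing_op (riesz_kernel d P) f x
             \<le> ennreal C * HL_max (sing_op (riesz_kernel d P) f) x)"
proof -
  interpret even_harmonic_poly P d by unfold_locales (use assms in auto)
  obtain M where M: "M \<ge> 0" "\<And>y. \<bar>bfun y\<bar> \<le> M" using bfun_bound by blast
  \<comment> \<open>M bounds the potential, whose polynomial is determined by conditions on n and d
    alone, so the constant does not depend on f or x.\<close>
  show ?thesis using max_sing_op_le[OF M] M(1) omega_pos by (intro exI[of _ "M * omega"]) auto
qed

end
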